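(* Let $d\ge2$ and let $G_n$ be finite vertex-transitive graphs converging locally to the $d$-regular tree $\mathbb T_d$, each equipped with a random environment matrix satisfying the assumptions in the context with a constant $c_1$ not depending on $n$. Let $s(x)=x^2$ and $\tilde T_{G_n}(f)=T_{G_n}(f\circ s)$, and let $\rho=\rho_d=4(d-1)/d^2$. Then jointly for all real $f\in\mathcal X$ (in the sense of finite-dimensional distributions) $\tilde T_{G_n}(f)\to\tilde T(f)$ in distribution, where the $\tilde T(f)$ are jointly normal with mean $0$. Moreover, for all real $f,g\in\mathcal X$: if $d>2$, then $$\mathbf E[\tilde T(f)\tilde T(g)]=\int_0^\rho\int_0^\rho f'(x)g'(y)\,\beta_d(x,y)\,dx\,dy,$$ $$\beta_d(x,y)=\frac{2d^4}{\pi^2}\,\frac{(d-2)\,\kappa(x)\kappa(y)}{16(2d-3)(x-y)^2+(d-2)^2A(d,x,y)},$$ where $\kappa(x)=2d\sqrt{x(\rho-x)}$ and $A(d,x,y)=\rho\,\kappa\big(\tfrac{x+y}2\big)^2+4(d+3)(x-y)^2+\rho^2(d-2)^2$; if $d=2$, then $$\mathbf E[\tilde T(f)\tilde T(g)]=\frac{32}{\pi}\int_0^1f'(x)g'(x)\sqrt{x(1-x)}\,dx.$$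
   Context: Setting. Graphs are simple, undirected and of finite degree. For a finite vertex-transitive graph $G$, $M$ is the transition matrix of nearest-neighbor simple random walk on $G$. The random environment $B=(B_{u,v})_{u,v\in G}$ is a random real matrix such that: (i) for every edge $uv$, $B_{u,v}$ has mean $0$ and variance $1$; (ii) the rows $(B_{u,v})_{v}$ for different $u$ are independent; (iii) for a constant $c_1$, $|B_{u,v}|\le c_1M_{u,v}$ for all $u,v$ (so $B_{u,v}=0$ if $uv$ is not an edge); (iv) for all $u,v$, $\sum_{g\in \mathrm{Stab}(u)}B_{u,gv}=0$, where $\mathrm{Stab}(u)$ is the stabilizer of $u$ in the automorphism group of $G$. Local convergence $G_n\to \mathbb T_d$: for every $r$, for all large $n$ the $r$-ball around a fixed vertex of $G_n$ is isomorphic (as a rooted graph) to the $r$-ball around a vertex of $\mathbb T_d$. $\mathcal X$ is the space of complex functions analytic in a neighborhood of the closed unit disk; $f\in\mathcal X$ is real if its power series at $0$ has real coefficients. For finite $G$, $\mu_\varepsilon$ is the empirical probability measure of the eigenvalues (with multiplicity) of $M+\varepsilon B$, $m_\varepsilon=|G|^{1/2}(\mu_\varepsilon-\mu_0)/\varepsilon^2$, and $T_G(f)=\lim_{\varepsilon\to0}\int f\,dm_\varepsilon$ for $f\in\mathcal X$ (this limit exists). *)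

theory Defs
  imports
    "HOL-Probability.Probability"
    "HOL-Complex_Analysis.Complex_Analysis"
    "Graph_Theory.Pair_Digraph"
    "Jordan_Normal_Form.Char_Poly"
begin

text \<open>
  Finite simple undirected graphs are the instances of the locale \<^locale>\<open>pair_graph\<close>:
  the arcs form a symmetric irreflexive relation on a finite vertex set.
\<close>

definition nbrs :: "'a pair_pre_digraph \<Rightarrow> 'a \<Rightarrow> 'a set" where
  "nbrs G u = {v. (u, v) \<in> parcs G}"

text \<open>Automorphisms are extended by the identity outside the vertex set, so that a finite graph
  has finitely many of them.\<close>

definition auts :: "'a pair_pre_digraph \<Rightarrow> ('a \<Rightarrow> 'a) set" where
  "auts G = {g. g permutes pverts G \<and>
     (\<forall>u\<in>pverts G. \<forall>v\<in>pverts G. (g u, g v) \<in> parcs G \<longleftrightarrow> (u, v) \<in> parcs G)}"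

definition Stab :: "'a pair_pre_digraph \<Rightarrow> 'a \<Rightarrow> ('a \<Rightarrow> 'a) set" where
  "Stab G u = {g \<in> auts G. g u = u}"

definition vertex_transitive :: "'a pair_pre_digraph \<Rightarrow> bool" where
  "vertex_transitive G \<longleftrightarrow> (\<forall>u\<in>pverts G. \<forall>v\<in>pverts G. \<exists>g\<in>auts G. g u = v)"

definition gball :: "'a pair_pre_digraph \<Rightarrow> 'a \<Rightarrow> nat \<Rightarrow> 'a set" where
  "gball G u r = {v. \<exists>k\<le>r. (u, v) \<in> parcs G ^^ k}"

definition ball_iso ::
  "'a pair_pre_digraph \<Rightarrow> 'a \<Rightarrow> 'b pair_pre_digraph \<Rightarrow> 'b \<Rightarrow> nat \<Rightarrow> bool" where
  "ball_iso G u H w r \<longleftrightarrow> (\<exists>\<phi>. bij_betw \<phi> (gball G u r) (gball H w r) \<and> \<phi> u = w \<and>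
     (\<forall>x\<in>gball G u r. \<forall>y\<in>gball G u r. (\<phi> x, \<phi> y) \<in> parcs H \<longleftrightarrow> (x, y) \<in> parcs G))"

text \<open>
  The \<open>d\<close>-regular tree, as the Cayley graph of the free product of \<open>d\<close> copies of the group of
  order 2: vertices are words over \<open>d\<close> letters without two equal consecutive letters, and
  adjacent words differ by adding or deleting the first letter.
\<close>

definition reg_tree :: "nat \<Rightarrow> nat list pair_pre_digraph" where
  "reg_tree d = (let W = {xs. set xs \<subseteq> {..<d} \<and> distinct_adj xs} in
     \<lparr>pverts = W,
      parcs = {(xs, ys). xs \<in> W \<and> ys \<in> W \<and> ((\<exists>a. ys = a # xs) \<or> (\<exists>a. xs = a # ys))}\<rparr>)"

lemma card_nbrs_reg_tree:
  assumes "xs \<in> pverts (reg_tree d)"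
  shows "card (nbrs (reg_tree d) xs) = d"
proof (cases xs)
  case Nil
  have "nbrs (reg_tree d) xs = (\<lambda>a. [a]) ` {..<d}"
    by (auto simp: Nil nbrs_def reg_tree_def Let_def)
  then show ?thesis by (simp add: card_image inj_on_def)
next
  case (Cons b ys)
  have b: "b < d" "set ys \<subseteq> {..<d}" "distinct_adj (b # ys)"
    using assms by (auto simp: Cons reg_tree_def Let_def)
  have "nbrs (reg_tree d) xs = insert ys ((\<lambda>a. a # xs) ` ({..<d} - {b}))"
    using b by (auto simp: Cons nbrs_def reg_tree_def Let_def dest: distinct_adj_ConsD)
  moreover have "ys \<notin> (\<lambda>a. a # xs) ` ({..<d} - {b})"
    by (auto simp: Cons dest: arg_cong[where f = length])
  ultimately show ?thesis
    using b by (simp add: card_image inj_on_def)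
qed

text \<open>The tree is vertex-transitive, so its root may be taken to be the empty word.\<close>

definition converges_locally_to_tree :: "(nat \<Rightarrow> 'a pair_pre_digraph) \<Rightarrow> nat \<Rightarrow> bool" where
  "converges_locally_to_tree G d \<longleftrightarrow>
     (\<exists>root. (\<forall>n. root n \<in> pverts (G n)) \<and>
       (\<forall>r. \<forall>\<^sub>F n in sequentially. ball_iso (G n) (root n) (reg_tree d) [] r))"

definition walk_matrix :: "'a pair_pre_digraph \<Rightarrow> 'a \<Rightarrow> 'a \<Rightarrow> real" where
  "walk_matrix G u v = (if (u, v) \<in> parcs G then 1 / real (card (nbrs G u)) else 0)"

definition random_environment ::
  "'a pair_pre_digraph \<Rightarrow> real \<Rightarrow> 'w measure \<Rightarrow> ('w \<Rightarrow> 'a \<Rightarrow> 'a \<Rightarrow> real) \<Rightarrow> bool" where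
  "random_environment G c P B \<longleftrightarrow>
     (\<forall>u\<in>pverts G. \<forall>v\<in>pverts G. (\<lambda>\<omega>. B \<omega> u v) \<in> borel_measurable P) \<and>
     (\<forall>(u, v)\<in>parcs G. prob_space.expectation P (\<lambda>\<omega>. B \<omega> u v) = 0 \<and>
                        prob_space.variance P (\<lambda>\<omega>. B \<omega> u v) = 1) \<and>
     prob_space.indep_vars P (\<lambda>_. PiM (pverts G) (\<lambda>_. borel))
       (\<lambda>u \<omega>. restrict (B \<omega> u) (pverts G)) (pverts G) \<and>
     (AE \<omega> in P. \<forall>u\<in>pverts G. \<forall>v\<in>pverts G. \<bar>B \<omega> u v\<bar> \<le> c * walk_matrix G u v) \<and>
     (AE \<omega> in P. \<forall>u\<in>pverts G. \<forall>v\<in>pverts G. (\<Sum>g\<in>Stab G u. B \<omega> u (g v)) = 0)"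

text \<open>
  A matrix indexed by a finite vertex set becomes a matrix in the sense of \<^typ>\<open>complex mat\<close>
  through an arbitrary enumeration of that set, on which the characteristic polynomial does
  not depend. \<^term>\<open>proots\<close> counts roots with multiplicity.
\<close>

definition vertex_enum :: "'a set \<Rightarrow> nat \<Rightarrow> 'a" where
  "vertex_enum V = (SOME e. bij_betw e {0..<card V} V)"

definition mat_of :: "'a set \<Rightarrow> ('a \<Rightarrow> 'a \<Rightarrow> real) \<Rightarrow> complex mat" where
  "mat_of V A = mat (card V) (card V)
     (\<lambda>(i, j). complex_of_real (A (vertex_enum V i) (vertex_enum V j)))"

definition empirical_eigs :: "'a set \<Rightarrow> ('a \<Rightarrow> 'a \<Rightarrow> real) \<Rightarrow> complex pmf" where
  "empirical_eigs V A = pmf_of_multiset (proots (char_poly (mat_of V A)))"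

definition eig_measure ::
  "'a pair_pre_digraph \<Rightarrow> ('a \<Rightarrow> 'a \<Rightarrow> real) \<Rightarrow> real \<Rightarrow> complex pmf" where
  "eig_measure G B \<epsilon> = empirical_eigs (pverts G) (\<lambda>u v. walk_matrix G u v + \<epsilon> * B u v)"

text \<open>The integral of \<open>f\<close> against the signed measure \<open>|G|\<^sup>1\<^sup>/\<^sup>2 (\<mu>\<^sub>\<epsilon> - \<mu>\<^sub>0) / \<epsilon>\<^sup>2\<close>.\<close>

definition m_integral ::
  "'a pair_pre_digraph \<Rightarrow> ('a \<Rightarrow> 'a \<Rightarrow> real) \<Rightarrow> real \<Rightarrow> (complex \<Rightarrow> complex) \<Rightarrow> complex" where
  "m_integral G B \<epsilon> f =
     of_real (sqrt (real (card (pverts G)))) *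
     (measure_pmf.expectation (eig_measure G B \<epsilon>) f - measure_pmf.expectation (eig_measure G B 0) f)
     / of_real (\<epsilon>\<^sup>2)"

definition T_stat ::
  "'a pair_pre_digraph \<Rightarrow> ('a \<Rightarrow> 'a \<Rightarrow> real) \<Rightarrow> (complex \<Rightarrow> complex) \<Rightarrow> complex" where
  "T_stat G B f = Lim (at 0) (\<lambda>\<epsilon>. m_integral G B \<epsilon> f)"

definition T_tilde ::
  "'a pair_pre_digraph \<Rightarrow> ('a \<Rightarrow> 'a \<Rightarrow> real) \<Rightarrow> (complex \<Rightarrow> complex) \<Rightarrow> complex" where
  "T_tilde G B f = T_stat G B (f \<circ> (\<lambda>z. z\<^sup>2))"

definition test_functions :: "(complex \<Rightarrow> complex) set" where
  "test_functions = {f. f analytic_on cball 0 1}"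

definition real_test_functions :: "(complex \<Rightarrow> complex) set" where
  "real_test_functions =
     {f \<in> test_functions. \<forall>k. (deriv ^^ k) f 0 / fact k \<in> \<real>}"

text \<open>For real \<open>f\<close> the derivative is real on \<open>[0, 1]\<close>, so taking the real part loses nothing.\<close>

definition real_deriv :: "(complex \<Rightarrow> complex) \<Rightarrow> real \<Rightarrow> real" where
  "real_deriv f x = Re (deriv f (complex_of_real x))"

text \<open>Point masses count as normal distributions of variance 0.\<close>

definition normal_rv :: "'w measure \<Rightarrow> ('w \<Rightarrow> real) \<Rightarrow> bool" where
  "normal_rv P X \<longleftrightarrow> X \<in> borel_measurable P \<and>
     (\<exists>\<mu>. (AE \<omega> in P. X \<omega> = \<mu>) \<or> (\<exists>\<sigma>>0. distributed P lborel X (normal_density \<mu> \<sigma>)))"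

definition jointly_normal :: "'w measure \<Rightarrow> 'i set \<Rightarrow> ('i \<Rightarrow> 'w \<Rightarrow> real) \<Rightarrow> bool" where
  "jointly_normal P I X \<longleftrightarrow>
     (\<forall>J a. finite J \<longrightarrow> J \<subseteq> I \<longrightarrow> normal_rv P (\<lambda>\<omega>. \<Sum>j\<in>J. a j * X j \<omega>))"

definition converges_in_distribution ::
  "(nat \<Rightarrow> 'w measure) \<Rightarrow> (nat \<Rightarrow> 'w \<Rightarrow> 'b::topological_space) \<Rightarrow> 'v measure \<Rightarrow> ('v \<Rightarrow> 'b) \<Rightarrow> bool"
where
  "converges_in_distribution P X Q Y \<longleftrightarrow>
     (\<forall>n. X n \<in> borel_measurable (P n)) \<and> Y \<in> borel_measurable Q \<and>
     (\<forall>h :: 'b \<Rightarrow> real. continuous_on UNIV h \<longrightarrow> bounded (range h) \<longrightarrow>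
        (\<lambda>n. \<integral>\<omega>. h (X n \<omega>) \<partial>P n) \<longlonglongrightarrow> (\<integral>\<omega>. h (Y \<omega>) \<partial>Q))"

text \<open>
  A vector of length \<open>k\<close> is embedded into the sequence space by padding with zeros; this is a
  homeomorphism onto a closed retract, so it does not affect convergence in distribution.
\<close>

definition pad :: "nat \<Rightarrow> (nat \<Rightarrow> 'b::zero) \<Rightarrow> nat \<Rightarrow> 'b" where
  "pad k x = (\<lambda>i. if i < k then x i else 0)"

definition converges_fdd ::
  "(nat \<Rightarrow> 'w measure) \<Rightarrow> (nat \<Rightarrow> 'i \<Rightarrow> 'w \<Rightarrow> 'b::{topological_space, zero}) \<Rightarrow>
   'v measure \<Rightarrow> ('i \<Rightarrow> 'v \<Rightarrow> 'b) \<Rightarrow> 'i set \<Rightarrow> bool"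
where
  "converges_fdd P X Q Y I \<longleftrightarrow>
     (\<forall>k (t :: nat \<Rightarrow> 'i). (\<forall>i<k. t i \<in> I) \<longrightarrow>
        converges_in_distribution P (\<lambda>n \<omega>. pad k (\<lambda>i. X n (t i) \<omega>)) Q (\<lambda>\<omega>. pad k (\<lambda>i. Y (t i) \<omega>)))"

definition rho :: "nat \<Rightarrow> real" where
  "rho d = 4 * (real d - 1) / (real d)\<^sup>2"

definition kappa :: "nat \<Rightarrow> real \<Rightarrow> real" where
  "kappa d x = 2 * real d * sqrt (x * (rho d - x))"

definition A_fun :: "nat \<Rightarrow> real \<Rightarrow> real \<Rightarrow> real" where
  "A_fun d x y = rho d * (kappa d ((x + y) / 2))\<^sup>2 + 4 * (real d + 3) * (x - y)\<^sup>2
     + (rho d)\<^sup>2 * (real d - 2)\<^sup>2"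

definition beta :: "nat \<Rightarrow> real \<Rightarrow> real \<Rightarrow> real" where
  "beta d x y = 2 * real d ^ 4 / pi\<^sup>2 *
     ((real d - 2) * kappa d x * kappa d y /
      (16 * (2 * real d - 3) * (x - y)\<^sup>2 + (real d - 2)\<^sup>2 * A_fun d x y))"

end

theory Submission
  imports Defs "Jordan_Normal_Form.Schur_Decomposition"
begin

text \<open>
  Expanding traces to second order, \<open>T\<^sub>G(f)\<close> becomes a linear combination of
  \<open>|G|\<^sup>-\<^sup>1\<^sup>/\<^sup>2 tr (M\<^sup>a B M\<^sup>b B) = |G|\<^sup>-\<^sup>1\<^sup>/\<^sup>2 \<Sum>\<^sub>u\<^sub>z (B M\<^sup>a)\<^sub>u\<^sub>z (B M\<^sup>b)\<^sub>z\<^sub>u\<close>; the first-order term vanishes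
  because \<open>B\<close> averages to zero over stabilizers. The summands are uncorrelated for distinct unordered
  pairs \<open>{u, z}\<close> and depend only on the rows of \<open>B\<close> near \<open>u\<close>, so a central limit theorem for local
  dependence applies to polynomials, and an \<open>L\<^sup>1\<close> estimate uniform in \<open>n\<close> extends it to power series.

  On a tree-like ball, \<open>(B M\<^sup>b)\<^sub>u\<^sub>z\<close> is the entry of \<open>B\<close> pointing from \<open>u\<close> towards \<open>z\<close> times a difference of
  walk probabilities. Convolving these differences gives the limiting variance as a sum of squares over the
  distance \<open>l\<close>. With \<open>x = \<rho> cos\<^sup>2 (t / 2)\<close> the same coefficients are the sine coefficients of
  \<open>f'(x) sin t\<close>, and \<open>\<beta>\<^sub>d\<close> is the kernel \<open>\<Sum>\<^sub>l (d - 1)\<^sup>-\<^sup>l sin (l t) sin (l s)\<close> in closed form. Hence the limit can be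
  realized as a series in independent standard normal variables indexed by \<open>l\<close>.
\<close>

subsection \<open>Second-order perturbation of traces\<close>

text \<open>Composition with the square leaves only even traces, and exponents a + b = 2m - 2
  contribute the product of two walk differences at the same distance l. The generating function of
  these differences is geometric in the distance, so the convolution over a + b collapses to one
  difference at distance 2l; this collapse is what produces the sine coefficients. For a polynomial
  of degree K the variance is then exact, and equal to its limit, as soon as balls of some radius
  above 2K + 1 are trees. Only the normal approximation is asymptotic: |G|^(-1/2) beats a constant
  that depends on K.

  Two difficulties shape the rest. The conditions on B hold almost surely, whereas T is defined by
  \<open>Lim\<close> at every point: the estimates use a pointwise version of B, and measurability
  of T is shown on the exceptional set as well, where the limit may fail to exist. Joint convergence
  is tested against all bounded continuous functions; it is obtained from characteristic functions
  of linear combinations by a Stone-Weierstrass argument, with the L1 bound supplying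
  tightness.\<close>

definition mm :: "'a set \<Rightarrow> ('a \<Rightarrow> 'a \<Rightarrow> real) \<Rightarrow> ('a \<Rightarrow> 'a \<Rightarrow> real) \<Rightarrow> 'a \<Rightarrow> 'a \<Rightarrow> real" where
  "mm V A B u v = (\<Sum>w\<in>V. A u w * B w v)"

fun mpow :: "'a set \<Rightarrow> ('a \<Rightarrow> 'a \<Rightarrow> real) \<Rightarrow> nat \<Rightarrow> 'a \<Rightarrow> 'a \<Rightarrow> real" where
  "mpow V A 0 = (\<lambda>u v. if u = v then 1 else 0)"
| "mpow V A (Suc k) = mm V (mpow V A k) A"

definition tr :: "'a set \<Rightarrow> ('a \<Rightarrow> 'a \<Rightarrow> real) \<Rightarrow> real" where
  "tr V A = (\<Sum>u\<in>V. A u u)"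

lemma mm_assoc: "mm V (mm V A B) C = mm V A (mm V B C)"
proof (intro ext)
  fix u v
  have "mm V (mm V A B) C u v = (\<Sum>w\<in>V. \<Sum>x\<in>V. A u x * B x w * C w v)"
    by (simp add: mm_def sum_distrib_right)
  also have "\<dots> = (\<Sum>x\<in>V. \<Sum>w\<in>V. A u x * B x w * C w v)"
    by (rule sum.swap)
  also have "\<dots> = mm V A (mm V B C) u v"
    by (simp add: mm_def sum_distrib_left mult.assoc)
  finally show "mm V (mm V A B) C u v = mm V A (mm V B C) u v" .
qed

lemma mm_add_left: "mm V (\<lambda>u v. A u v + B u v) C = (\<lambda>u v. mm V A C u v + mm V B C u v)"
  by (simp add: mm_def fun_eq_iff distrib_right sum.distrib)

lemma mm_add_right: "mm V C (\<lambda>u v. A u v + B u v) = (\<lambda>u v. mm V C A u v + mm V C B u v)"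
  by (simp add: mm_def fun_eq_iff distrib_left sum.distrib)

lemma mm_scale_left: "mm V (\<lambda>u v. c * A u v) C = (\<lambda>u v. c * mm V A C u v)"
  by (simp add: mm_def fun_eq_iff sum_distrib_left mult.assoc)

lemma mm_scale_right: "mm V C (\<lambda>u v. c * A u v) = (\<lambda>u v. c * mm V C A u v)"
  by (simp add: mm_def fun_eq_iff sum_distrib_left mult_ac)

lemma mm_sum_left: "mm V (\<lambda>u v. \<Sum>j\<in>J. A j u v) C = (\<lambda>u v. \<Sum>j\<in>J. mm V (A j) C u v)"
  by (simp add: mm_def fun_eq_iff sum_distrib_right sum.swap[of _ J])

lemma tr_mm_commute: "tr V (mm V A B) = tr V (mm V B A)"
  unfolding tr_def mm_def by (subst sum.swap) (simp add: mult.commute)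

lemma tr_add: "tr V (\<lambda>u v. A u v + B u v) = tr V A + tr V B"
  by (simp add: tr_def sum.distrib)

lemma tr_scale: "tr V (\<lambda>u v. c * A u v) = c * tr V A"
  by (simp add: tr_def sum_distrib_left)

lemma tr_sum: "tr V (\<lambda>u v. \<Sum>j\<in>J. A j u v) = (\<Sum>j\<in>J. tr V (A j))"
  unfolding tr_def by (rule sum.swap)

lemma mm_one_left: "finite V \<Longrightarrow> u \<in> V \<Longrightarrow> mm V (\<lambda>u v. if u = v then 1 else 0) A u v = A u v"
  by (simp add: mm_def if_distrib[of "\<lambda>x. x * _"] cong: if_cong)

text \<open>Membership of \<open>v\<close> in \<open>V\<close> serves the base case: the product
  with the identity is a sum over \<open>V\<close>, which returns the entry only for a column in
  \<open>V\<close>.\<close>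

lemma mpow_add:
  assumes "finite V" "v \<in> V"
  shows "mm V (mpow V A j) (mpow V A k) u v = mpow V A (j + k) u v"
  using assms(2)
proof (induction k arbitrary: v)
  case 0
  then show ?case using assms(1) by (simp add: mm_def if_distrib[of "(*) _"] cong: if_cong)
next
  case (Suc k)
  have "mm V (mpow V A j) (mpow V A (Suc k)) u v = mm V (mm V (mpow V A j) (mpow V A k)) A u v"
    by (simp add: mm_assoc)
  also have "\<dots> = mm V (mpow V A (j + k)) A u v"
    unfolding mm_def[of V _ A] using Suc by simp
  finally show ?case by simp
qed

text \<open>The operator norm for the supremum norm. It is at most 1 for the walk matrix, asks for
  no symmetry of \<open>B\<close>, and controls products, traces and the spectral radius at
  once.\<close>

definition row_bound :: "'a set \<Rightarrow> ('a \<Rightarrow> 'a \<Rightarrow> real) \<Rightarrow> real \<Rightarrow> bool" where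
  "row_bound V A c \<longleftrightarrow> (\<forall>u\<in>V. (\<Sum>v\<in>V. \<bar>A u v\<bar>) \<le> c)"

lemma row_bound_mm:
  assumes "row_bound V A a" "row_bound V B b" "0 \<le> b"
  shows "row_bound V (mm V A B) (a * b)"
  unfolding row_bound_def
proof
  fix u assume u: "u \<in> V"
  have "(\<Sum>v\<in>V. \<bar>mm V A B u v\<bar>) \<le> (\<Sum>v\<in>V. \<Sum>w\<in>V. \<bar>A u w\<bar> * \<bar>B w v\<bar>)"
    unfolding mm_def by (intro sum_mono order.trans[OF sum_abs]) (simp add: abs_mult)
  also have "\<dots> = (\<Sum>w\<in>V. \<bar>A u w\<bar> * (\<Sum>v\<in>V. \<bar>B w v\<bar>))"
    by (subst sum.swap) (simp add: sum_distrib_left)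
  also have "\<dots> \<le> (\<Sum>w\<in>V. \<bar>A u w\<bar> * b)"
    using assms(2) by (intro sum_mono mult_left_mono) (auto simp: row_bound_def)
  also have "\<dots> \<le> a * b"
    using assms(1,3) u by (simp add: sum_distrib_right[symmetric] row_bound_def mult_right_mono)
  finally show "(\<Sum>v\<in>V. \<bar>mm V A B u v\<bar>) \<le> a * b" .
qed

lemma row_bound_add:
  assumes "row_bound V A a" "row_bound V B b"
  shows "row_bound V (\<lambda>u v. A u v + B u v) (a + b)"
  unfolding row_bound_def
proof
  fix u assume u: "u \<in> V"
  have "(\<Sum>v\<in>V. \<bar>A u v + B u v\<bar>) \<le> (\<Sum>v\<in>V. \<bar>A u v\<bar>) + (\<Sum>v\<in>V. \<bar>B u v\<bar>)"
    unfolding sum.distrib[symmetric] by (intro sum_mono abs_triangle_ineq)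
  also have "\<dots> \<le> a + b" using assms u by (intro add_mono) (auto simp: row_bound_def)
  finally show "(\<Sum>v\<in>V. \<bar>A u v + B u v\<bar>) \<le> a + b" .
qed

lemma row_bound_scale: "row_bound V A a \<Longrightarrow> row_bound V (\<lambda>u v. c * A u v) (\<bar>c\<bar> * a)"
  by (auto simp: row_bound_def abs_mult sum_distrib_left[symmetric] intro!: mult_left_mono)

lemma row_bound_mono: "row_bound V A a \<Longrightarrow> a \<le> b \<Longrightarrow> row_bound V A b"
  by (auto simp: row_bound_def)

lemma row_bound_one: "finite V \<Longrightarrow> row_bound V (\<lambda>u v. if u = v then 1 else 0) 1"
  by (auto simp: row_bound_def if_distrib[of abs] cong: if_cong)

lemma row_bound_mpow:
  assumes "finite V" "row_bound V A a" "0 \<le> a"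
  shows "row_bound V (mpow V A k) (a ^ k)"
proof (induction k)
  case 0
  then show ?case using row_bound_one[OF assms(1)] by simp
next
  case (Suc k)
  from row_bound_mm[OF this assms(2,3)] show ?case by (simp add: mult.commute)
qed

lemma abs_tr_le:
  fixes a :: real
  assumes "finite V" "row_bound V A a"
  shows "\<bar>tr V A\<bar> \<le> card V * a"
proof -
  have "\<bar>tr V A\<bar> \<le> (\<Sum>u\<in>V. \<bar>A u u\<bar>)" unfolding tr_def by (rule sum_abs)
  also have "\<dots> \<le> (\<Sum>u\<in>V. a)"
  proof (rule sum_mono)
    fix u assume u: "u \<in> V"
    have "\<bar>A u u\<bar> \<le> (\<Sum>v\<in>V. \<bar>A u v\<bar>)" using u assms(1) by (intro member_le_sum) auto
    then show "\<bar>A u u\<bar> \<le> a" using assms(2) u by (force simp: row_bound_def)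
  qed
  finally show ?thesis by simp
qed

text \<open>The coefficients of \<open>\<epsilon>\<close> and \<open>\<epsilon>\<^sup>2\<close> in \<open>(M + \<epsilon> B)\<^sup>k\<close>, and the remainder divided by \<open>\<epsilon>\<^sup>3\<close>.\<close>

fun pert1 :: "'a set \<Rightarrow> ('a \<Rightarrow> 'a \<Rightarrow> real) \<Rightarrow> ('a \<Rightarrow> 'a \<Rightarrow> real) \<Rightarrow> nat \<Rightarrow> 'a \<Rightarrow> 'a \<Rightarrow> real" where
  "pert1 V M B 0 = (\<lambda>u v. 0)"
| "pert1 V M B (Suc k) = (\<lambda>u v. mm V (pert1 V M B k) M u v + mm V (mpow V M k) B u v)"

fun pert2 :: "'a set \<Rightarrow> ('a \<Rightarrow> 'a \<Rightarrow> real) \<Rightarrow> ('a \<Rightarrow> 'a \<Rightarrow> real) \<Rightarrow> nat \<Rightarrow> 'a \<Rightarrow> 'a \<Rightarrow> real" where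
  "pert2 V M B 0 = (\<lambda>u v. 0)"
| "pert2 V M B (Suc k) = (\<lambda>u v. mm V (pert2 V M B k) M u v + mm V (pert1 V M B k) B u v)"

fun pert3 :: "'a set \<Rightarrow> ('a \<Rightarrow> 'a \<Rightarrow> real) \<Rightarrow> ('a \<Rightarrow> 'a \<Rightarrow> real) \<Rightarrow> real \<Rightarrow> nat \<Rightarrow> 'a \<Rightarrow> 'a \<Rightarrow> real" where
  "pert3 V M B e 0 = (\<lambda>u v. 0)"
| "pert3 V M B e (Suc k) =
    (\<lambda>u v. mm V (pert3 V M B e k) (\<lambda>u v. M u v + e * B u v) u v + mm V (pert2 V M B k) B u v)"

lemma mpow_perturb:
  "mpow V (\<lambda>u v. M u v + e * B u v) k =
    (\<lambda>u v. mpow V M k u v + e * pert1 V M B k u v + e\<^sup>2 * pert2 V M B k u v + e ^ 3 * pert3 V M B e k u v)"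
proof (induction k)
  case (Suc k)
  show ?case
    unfolding mpow.simps Suc.IH pert1.simps pert2.simps pert3.simps
    by (simp add: mm_add_left mm_add_right mm_scale_left mm_scale_right fun_eq_iff algebra_simps power2_eq_square power3_eq_cube)
qed simp

text \<open>The growth in \<open>k\<close> is polynomial up to the factor (1 + |e| c)^k, and for
  small \<open>e\<close> the base of that factor stays below the radius of convergence of the test
  function.\<close>

lemma pert_bounds:
  assumes V: "finite V" and M: "row_bound V M 1" and B: "row_bound V B c" "0 \<le> c"
  shows "row_bound V (pert1 V M B k) (real k * c)" "row_bound V (pert2 V M B k) ((real k)\<^sup>2 * c\<^sup>2)"
    "row_bound V (pert3 V M B e k) (real k ^ 3 * c ^ 3 * (1 + \<bar>e\<bar> * c) ^ k)"
proof -
  have 1: "row_bound V (pert1 V M B k) (real k * c)" for k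
  proof (induction k)
    case (Suc k)
    have "row_bound V (pert1 V M B (Suc k)) (real k * c * 1 + 1 ^ k * c)"
      unfolding pert1.simps
      by (intro row_bound_add row_bound_mm Suc M B row_bound_mpow V) auto
    then show ?case by (simp add: algebra_simps)
  qed (simp add: row_bound_def)
  have 2: "row_bound V (pert2 V M B k) ((real k)\<^sup>2 * c\<^sup>2)" for k
  proof (induction k)
    case (Suc k)
    have "row_bound V (pert2 V M B (Suc k)) ((real k)\<^sup>2 * c\<^sup>2 * 1 + real k * c * c)"
      unfolding pert2.simps using Suc
      by (intro row_bound_add row_bound_mm 1 M B) auto
    then show ?case
    proof (rule row_bound_mono)
      have "(real k)\<^sup>2 * c\<^sup>2 * 1 + real k * c * c = ((real k)\<^sup>2 + real k) * c\<^sup>2"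
        by (simp add: power2_eq_square algebra_simps)
      also have "\<dots> \<le> (real (Suc k))\<^sup>2 * c\<^sup>2"
        by (intro mult_right_mono) (auto simp: power2_eq_square algebra_simps)
      finally show "(real k)\<^sup>2 * c\<^sup>2 * 1 + real k * c * c \<le> (real (Suc k))\<^sup>2 * c\<^sup>2" by simp
    qed
  qed (simp add: row_bound_def)
  show "row_bound V (pert1 V M B k) (real k * c)" "row_bound V (pert2 V M B k) ((real k)\<^sup>2 * c\<^sup>2)"
    by (rule 1, rule 2)
  define b where "b = 1 + \<bar>e\<bar> * c"
  have b: "b \<ge> 1" using B by (simp add: b_def)
  have "row_bound V (pert3 V M B e k) (real k ^ 3 * c ^ 3 * b ^ k)" for k
  proof (induction k)
    case (Suc k)
    have Mb: "row_bound V (\<lambda>u v. M u v + e * B u v) b"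
      unfolding b_def by (intro row_bound_add row_bound_scale M B)
    have "row_bound V (pert3 V M B e (Suc k)) (real k ^ 3 * c ^ 3 * b ^ k * b + (real k)\<^sup>2 * c\<^sup>2 * c)"
      unfolding pert3.simps using Suc 2[of k] b B
      by (intro row_bound_add row_bound_mm Mb) auto
    then show ?case
    proof (rule row_bound_mono)
      have "(real k)\<^sup>2 * c\<^sup>2 * c \<le> (real k)\<^sup>2 * c\<^sup>2 * c * b ^ Suc k"
        using mult_left_mono[OF one_le_power[OF b, of "Suc k"], of "(real k)\<^sup>2 * c\<^sup>2 * c"] B by simp
      then have "real k ^ 3 * c ^ 3 * b ^ k * b + (real k)\<^sup>2 * c\<^sup>2 * c \<le> (real k ^ 3 + (real k)\<^sup>2) * c ^ 3 * b ^ Suc k"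
        by (simp add: power2_eq_square power3_eq_cube algebra_simps)
      also have "\<dots> \<le> real (Suc k) ^ 3 * c ^ 3 * b ^ Suc k"
        using b B by (intro mult_right_mono) (auto simp: power2_eq_square power3_eq_cube algebra_simps)
      finally show "real k ^ 3 * c ^ 3 * b ^ k * b + (real k)\<^sup>2 * c\<^sup>2 * c \<le> real (Suc k) ^ 3 * c ^ 3 * b ^ Suc k" by simp
    qed
  qed (simp add: row_bound_def)
  then show "row_bound V (pert3 V M B e k) (real k ^ 3 * c ^ 3 * (1 + \<bar>e\<bar> * c) ^ k)"
    by (simp add: b_def)
qed

section \<open>Traces of powers and the empirical eigenvalue measure\<close>

definition mtrace :: "complex mat \<Rightarrow> complex" where
  "mtrace A = (\<Sum>i<dim_row A. A $$ (i, i))"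

lemma mtrace_mult_commute:
  assumes "A \<in> carrier_mat n m" "B \<in> carrier_mat m n"
  shows "mtrace (A * B) = mtrace (B * A)"
proof -
  have "mtrace (A * B) = (\<Sum>i<n. \<Sum>j<m. A $$ (i, j) * B $$ (j, i))"
    using assms by (auto simp: mtrace_def scalar_prod_def atLeast0LessThan intro!: sum.cong)
  also have "\<dots> = (\<Sum>j<m. \<Sum>i<n. A $$ (i, j) * B $$ (j, i))"
    by (rule sum.swap)
  also have "\<dots> = mtrace (B * A)"
    using assms by (auto simp: mtrace_def scalar_prod_def atLeast0LessThan mult.commute intro!: sum.cong)
  finally show ?thesis .
qed

lemma upper_triangular_pow:
  assumes A: "(A :: complex mat) \<in> carrier_mat n n" and ut: "upper_triangular A"
  shows "upper_triangular (A ^\<^sub>m k)" "\<And>i. i < n \<Longrightarrow> (A ^\<^sub>m k) $$ (i, i) = (A $$ (i, i)) ^ k"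
proof -
  have "(\<forall>i<n. \<forall>j<i. (A ^\<^sub>m k) $$ (i, j) = 0) \<and> (\<forall>i<n. (A ^\<^sub>m k) $$ (i, i) = (A $$ (i, i)) ^ k)"
  proof (induction k)
    case 0
    then show ?case using A by auto
  next
    case (Suc k)
    have Ak: "A ^\<^sub>m k \<in> carrier_mat n n" using A by simp
    have entry: "(A ^\<^sub>m Suc k) $$ (i, j) = (\<Sum>l<n. (A ^\<^sub>m k) $$ (i, l) * A $$ (l, j))" if "i < n" "j < n" for i j
      using A Ak that by (simp add: scalar_prod_def atLeast0LessThan)
    have low: "A $$ (i, j) = 0" if "i < n" "j < i" for i j
      using ut A that by (auto simp: upper_triangular_def)
    show ?case
    proof (intro conjI allI impI)
      fix i j assume ij: "i < n" "j < i"
      then have "(A ^\<^sub>m k) $$ (i, l) * A $$ (l, j) = 0" if "l < n" for l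
        using Suc low[of l j] that by (cases "l < i") auto
      then show "(A ^\<^sub>m Suc k) $$ (i, j) = 0"
        unfolding entry[OF ij(1) less_trans[OF ij(2,1)]] by (intro sum.neutral) auto
    next
      fix i assume i: "i < n"
      have "(\<Sum>l<n. (A ^\<^sub>m k) $$ (i, l) * A $$ (l, i)) = (\<Sum>l\<in>{i}. (A ^\<^sub>m k) $$ (i, l) * A $$ (l, i))"
      proof (rule sum.mono_neutral_right)
        show "\<forall>l\<in>{..<n} - {i}. (A ^\<^sub>m k) $$ (i, l) * A $$ (l, i) = 0"
        proof
          fix l assume l: "l \<in> {..<n} - {i}"
          then show "(A ^\<^sub>m k) $$ (i, l) * A $$ (l, i) = 0"
            using Suc low[of l i] i by (cases "l < i") auto
        qed
      qed (use i in auto)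
      then show "(A ^\<^sub>m Suc k) $$ (i, i) = (A $$ (i, i)) ^ Suc k"
        using i Suc by (subst entry) auto
    qed
  qed
  then show "upper_triangular (A ^\<^sub>m k)" "\<And>i. i < n \<Longrightarrow> (A ^\<^sub>m k) $$ (i, i) = (A $$ (i, i)) ^ k"
    using A by (auto simp: upper_triangular_def)
qed

text \<open>By Schur decomposition \<open>A\<close> is similar to an upper triangular matrix whose
  diagonal lists the roots with multiplicity; the diagonal of its \<open>k\<close>-th power consists
  of their \<open>k\<close>-th powers, and the trace is invariant under similarity.\<close>

lemma char_poly_proots:
  assumes A: "A \<in> carrier_mat n n"
  shows "size (proots (char_poly A)) = n" "\<And>z. z \<in># proots (char_poly A) \<Longrightarrow> eigenvalue A z"
    "mtrace (A ^\<^sub>m k) = (\<Sum>z\<in>#proots (char_poly A). z ^ k)"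
proof -
  have deg: "degree (char_poly A) = n" "coeff (char_poly A) n = 1"
    using degree_monic_char_poly[OF A] by auto
  then have nz: "char_poly A \<noteq> 0" by auto
  show "size (proots (char_poly A)) = n" using deg by (simp add: size_proots_complex)
  show "eigenvalue A z" if "z \<in># proots (char_poly A)" for z
    using that nz by (simp add: eigenvalue_root_char_poly[OF A])
  obtain es where es: "mset es = proots (char_poly A)" using ex_mset by blast
  have "char_poly A = Polynomial.smult (lead_coeff (char_poly A)) (\<Prod>x\<in>#proots (char_poly A). [:-x, 1:])"
    by (rule complex_poly_decompose_multiset[symmetric])
  also have "\<dots> = (\<Prod>x\<leftarrow>es. [:-x, 1:])"
    using deg unfolding es[symmetric] by (simp add: prod_mset_prod_list[symmetric])
  finally have cp: "char_poly A = (\<Prod>x\<leftarrow>es. [:-x, 1:])" .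
  obtain B P Q where BPQ: "schur_decomposition A es = (B, P, Q)"
    by (cases "schur_decomposition A es") auto
  from schur_decomposition[OF A cp this] have
    sim: "similar_mat_wit A B P Q" and ut: "upper_triangular B" and diag: "diag_mat B = es" by auto
  from sim A have c: "B \<in> carrier_mat n n" "P \<in> carrier_mat n n" "Q \<in> carrier_mat n n" "Q * P = 1\<^sub>m n"
    by (auto simp: similar_mat_wit_def Let_def)
  have Bk: "B ^\<^sub>m k \<in> carrier_mat n n" using c by simp
  have "mtrace (A ^\<^sub>m k) = mtrace (P * (B ^\<^sub>m k * Q))"
    using similar_mat_wit_pow_id[OF sim] assoc_mult_mat[OF c(2) Bk c(3)] by simp
  also have "\<dots> = mtrace (B ^\<^sub>m k * Q * P)"
    using c Bk by (intro mtrace_mult_commute[of _ n n]) auto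
  also have "B ^\<^sub>m k * Q * P = B ^\<^sub>m k"
    using c Bk assoc_mult_mat[OF Bk c(3) c(2)] by simp
  also have "mtrace (B ^\<^sub>m k) = (\<Sum>i<n. (B $$ (i, i)) ^ k)"
    using upper_triangular_pow(2)[OF c(1) ut] c(1) by (simp add: mtrace_def)
  also have "\<dots> = (\<Sum>z\<leftarrow>es. z ^ k)"
    unfolding diag[symmetric] diag_mat_def using c by (simp add: sum_list_sum_nth atLeast0LessThan)
  also have "\<dots> = (\<Sum>z\<in>#proots (char_poly A). z ^ k)"
    unfolding es[symmetric] by (simp add: sum_mset_sum_list[symmetric])
  finally show "mtrace (A ^\<^sub>m k) = (\<Sum>z\<in>#proots (char_poly A). z ^ k)" .
qed

lemma vertex_enum_bij: "finite V \<Longrightarrow> bij_betw (vertex_enum V) {0..<card V} V"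
  unfolding vertex_enum_def using ex_bij_betw_nat_finite[of V] by (rule someI_ex)

lemma sum_vertex_enum: "finite V \<Longrightarrow> (\<Sum>i<card V. f (vertex_enum V i)) = (\<Sum>v\<in>V. f v)"
  using sum.reindex_bij_betw[OF vertex_enum_bij, of V f] by (simp add: atLeast0LessThan)

lemma mat_of_carrier [simp]: "mat_of V A \<in> carrier_mat (card V) (card V)"
  by (simp add: mat_of_def)

lemma mat_of_mm:
  assumes "finite V"
  shows "mat_of V (mm V A B) = mat_of V A * mat_of V B"
proof (rule eq_matI)
  fix i j assume "i < dim_row (mat_of V A * mat_of V B)" "j < dim_col (mat_of V A * mat_of V B)"
  then show "mat_of V (mm V A B) $$ (i, j) = (mat_of V A * mat_of V B) $$ (i, j)"
    using sum_vertex_enum[OF assms, of "\<lambda>w. complex_of_real (A (vertex_enum V i) w * B w (vertex_enum V j))"]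
    by (simp add: mat_of_def mm_def scalar_prod_def atLeast0LessThan)
qed (simp_all add: mat_of_def)

lemma mat_of_mpow:
  assumes "finite V"
  shows "mat_of V (mpow V A k) = mat_of V A ^\<^sub>m k"
proof (induction k)
  case 0
  have "inj_on (vertex_enum V) {0..<card V}" using vertex_enum_bij[OF assms] by (simp add: bij_betw_def)
  then show ?case
    by (intro eq_matI) (auto simp: mat_of_def dest: inj_onD)
next
  case (Suc k)
  then show ?case by (simp add: mat_of_mm[OF assms])
qed

lemma mtrace_mat_of: "finite V \<Longrightarrow> mtrace (mat_of V A) = complex_of_real (tr V A)"
  using sum_vertex_enum[of V "\<lambda>u. complex_of_real (A u u)"]
  by (simp add: mtrace_def mat_of_def tr_def)

text \<open>Compare both sides of the eigenvector equation at a coordinate of largest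
  modulus.\<close>

lemma eigenvalue_norm_le:
  assumes V: "finite V" and A: "row_bound V A a" and ev: "eigenvalue (mat_of V A) z"
  shows "norm z \<le> a"
proof -
  let ?n = "card V" and ?A = "mat_of V A"
  obtain x where x: "x \<in> carrier_vec ?n" "x \<noteq> 0\<^sub>v ?n" "?A *\<^sub>v x = z \<cdot>\<^sub>v x"
    using ev by (auto simp: eigenvalue_def eigenvector_def mat_of_def)
  have "\<exists>j<?n. vec_index x j \<noteq> 0"
    using x(1,2) by (metis carrier_vecD dim_vec eq_vecI index_zero_vec)
  then obtain j where j: "j < ?n" "vec_index x j \<noteq> 0" by blast
  define m where "m = Max ((\<lambda>i. norm (vec_index x i)) ` {..<?n})"
  have le: "norm (vec_index x i) \<le> m" if "i < ?n" for i
    unfolding m_def using that by (intro Max_ge) auto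
  have "m \<in> (\<lambda>i. norm (vec_index x i)) ` {..<?n}"
    unfolding m_def using j by (intro Max_in) auto
  then obtain i where i: "i < ?n" "norm (vec_index x i) = m" by auto
  have m: "m > 0" using le[OF j(1)] j(2) by (meson less_le_trans zero_less_norm_iff)
  have "z * vec_index x i = vec_index (?A *\<^sub>v x) i" using x i by simp
  also have "\<dots> = (\<Sum>k<?n. ?A $$ (i, k) * vec_index x k)"
    using x(1) i by (simp add: mat_of_def scalar_prod_def atLeast0LessThan)
  finally have "norm z * m = norm (\<Sum>k<?n. ?A $$ (i, k) * vec_index x k)"
    using i(2) by (metis norm_mult)
  also have "\<dots> \<le> (\<Sum>k<?n. \<bar>A (vertex_enum V i) (vertex_enum V k)\<bar> * m)"
    using i le by (intro order.trans[OF norm_sum] sum_mono)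
      (auto simp: norm_mult mat_of_def intro!: mult_left_mono)
  also have "\<dots> = (\<Sum>v\<in>V. \<bar>A (vertex_enum V i) v\<bar>) * m"
    using sum_vertex_enum[OF V, of "\<lambda>v. \<bar>A (vertex_enum V i) v\<bar> * m"] by (simp add: sum_distrib_right)
  also have "\<dots> \<le> a * m"
  proof (rule mult_right_mono)
    have "vertex_enum V i \<in> V"
      using bij_betwE[OF vertex_enum_bij[OF V]] i by auto
    then show "(\<Sum>v\<in>V. \<bar>A (vertex_enum V i) v\<bar>) \<le> a" using A by (auto simp: row_bound_def)
  qed (use m in simp)
  finally show ?thesis using m by simp
qed

lemma sum_mset_count:
  fixes f :: "'b \<Rightarrow> 'c::comm_semiring_1"
  assumes "finite S" "set_mset M \<subseteq> S"
  shows "(\<Sum>z\<in>#M. f z) = (\<Sum>z\<in>S. of_nat (count M z) * f z)"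
  using assms(2)
proof (induction M)
  case (add x M)
  have "(\<Sum>z\<in>S. of_nat (count (add_mset x M) z) * f z) =
      (\<Sum>z\<in>S. of_nat (count M z) * f z + (if z = x then f z else 0))"
    by (intro sum.cong) (auto simp: algebra_simps)
  also have "\<dots> = (\<Sum>z\<in>S. of_nat (count M z) * f z) + f x"
    using add.prems assms(1) by (simp add: sum.distrib)
  finally show ?case using add by (simp add: add.commute)
qed simp

lemma expectation_pmf_of_multiset:
  fixes f :: "'b \<Rightarrow> complex"
  assumes "M \<noteq> {#}"
  shows "measure_pmf.expectation (pmf_of_multiset M) f = (\<Sum>z\<in>#M. f z) / size M"
proof -
  have "measure_pmf.expectation (pmf_of_multiset M) f = (\<Sum>z\<in>set_mset M. pmf (pmf_of_multiset M) z *\<^sub>R f z)"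
    using assms by (intro integral_measure_pmf) auto
  also have "\<dots> = (\<Sum>z\<in>set_mset M. of_nat (count M z) * f z) / size M"
    using assms by (simp add: scaleR_conv_of_real sum_divide_distrib)
  also have "(\<Sum>z\<in>set_mset M. of_nat (count M z) * f z) = (\<Sum>z\<in>#M. f z)"
    by (rule sum_mset_count[symmetric]) auto
  finally show ?thesis .
qed

text \<open>The perturbed matrices need not be symmetric, so the eigenvalues are complex; the row
  bound keeps them in a disc where the power series of \<open>f\<close> converges. They are finitely
  many, so the series may be summed term by term.\<close>

lemma expectation_empirical_eigs:
  fixes f :: "complex \<Rightarrow> complex"
  assumes V: "finite V" "V \<noteq> {}" and A: "row_bound V A r"
    and f: "\<And>z. norm z \<le> r \<Longrightarrow> (\<lambda>k. a k * z ^ k) sums f z"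
  shows "(\<lambda>k. a k * tr V (mpow V A k)) sums (card V * measure_pmf.expectation (empirical_eigs V A) f)"
proof -
  let ?M = "proots (char_poly (mat_of V A))"
  note * = char_poly_proots[OF mat_of_carrier[of V A]]
  have ne: "?M \<noteq> {#}"
  proof
    assume "?M = {#}"
    then show False using *(1) V by simp
  qed
  have le: "norm z \<le> r" if "z \<in># ?M" for z
    using eigenvalue_norm_le[OF V(1) A *(2)[OF that]] .
  have "(\<lambda>k. \<Sum>z\<in>set_mset ?M. of_nat (count ?M z) * (a k * z ^ k)) sums (\<Sum>z\<in>set_mset ?M. of_nat (count ?M z) * f z)"
    by (intro sums_sum sums_mult f le) auto
  also have "(\<Sum>z\<in>set_mset ?M. of_nat (count ?M z) * f z) = card V * measure_pmf.expectation (empirical_eigs V A) f"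
    unfolding empirical_eigs_def expectation_pmf_of_multiset[OF ne] *(1)
    using V by (simp add: sum_mset_count[of "set_mset ?M" ?M f])
  also have "(\<lambda>k. \<Sum>z\<in>set_mset ?M. of_nat (count ?M z) * (a k * z ^ k)) = (\<lambda>k. a k * tr V (mpow V A k))"
  proof
    fix k
    have "(\<Sum>z\<in>set_mset ?M. of_nat (count ?M z) * (a k * z ^ k)) = a k * (\<Sum>z\<in>#?M. z ^ k)"
      by (simp add: sum_mset_count[of "set_mset ?M" ?M] sum_distrib_left mult_ac)
    also have "(\<Sum>z\<in>#?M. z ^ k) = tr V (mpow V A k)"
      by (simp add: *(3)[symmetric] mat_of_mpow[OF V(1), symmetric] mtrace_mat_of[OF V(1)])
    finally show "(\<Sum>z\<in>set_mset ?M. of_nat (count ?M z) * (a k * z ^ k)) = a k * tr V (mpow V A k)" by simp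
  qed
  finally show ?thesis .
qed

lemma mm_cong:
  "(\<And>w. w \<in> V \<Longrightarrow> A u w = A' u w) \<Longrightarrow> (\<And>w. w \<in> V \<Longrightarrow> B w v = B' w v) \<Longrightarrow> mm V A B u v = mm V A' B' u v"
  unfolding mm_def by (intro sum.cong) auto

lemma tr_cong: "(\<And>u. u \<in> V \<Longrightarrow> A u u = A' u u) \<Longrightarrow> tr V A = tr V A'"
  unfolding tr_def by (rule sum.cong) auto

text \<open>Discrete variation of constants: each source \<open>Y j\<close> is transported by the
  remaining \<open>k - 1 - j\<close> multiplications.\<close>

lemma unroll_recurrence:
  assumes V: "finite V" "v \<in> V" and X: "X 0 = (\<lambda>u v. 0)" "\<And>k. X (Suc k) = (\<lambda>u v. mm V (X k) M u v + Y k u v)"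
  shows "X k u v = (\<Sum>j<k. mm V (Y j) (mpow V M (k - 1 - j)) u v)"
  using V(2)
proof (induction k arbitrary: v)
  case (Suc k)
  have "X (Suc k) u v = mm V (\<lambda>u v. \<Sum>j<k. mm V (Y j) (mpow V M (k - 1 - j)) u v) M u v + Y k u v"
    unfolding X(2) by (intro arg_cong2[where f = "(+)"] refl mm_cong Suc.IH)
  also have "mm V (\<lambda>u v. \<Sum>j<k. mm V (Y j) (mpow V M (k - 1 - j)) u v) M u v
      = (\<Sum>j<k. mm V (Y j) (mpow V M (Suc k - 1 - j)) u v)"
    unfolding mm_sum_left
  proof (rule sum.cong[OF refl])
    fix j assume "j \<in> {..<k}"
    then have "Suc k - 1 - j = Suc (k - 1 - j)" by auto
    then show "mm V (mm V (Y j) (mpow V M (k - 1 - j))) M u v = mm V (Y j) (mpow V M (Suc k - 1 - j)) u v"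
      by (simp add: mm_assoc)
  qed
  also have "Y k u v = mm V (Y k) (mpow V M (Suc k - 1 - k)) u v"
    using V(1) Suc.prems by (simp add: mm_def if_distrib[of "(*) _"] cong: if_cong)
  finally show ?case by simp
qed (simp add: X)

lemma tr_unroll:
  assumes V: "finite V" and X: "X 0 = (\<lambda>u v. 0)" "\<And>k. X (Suc k) = (\<lambda>u v. mm V (X k) M u v + Y k u v)"
  shows "tr V (X k) = (\<Sum>j<k. tr V (mm V (mpow V M (k - 1 - j)) (Y j)))"
proof -
  have "tr V (X k) = tr V (\<lambda>u v. \<Sum>j<k. mm V (Y j) (mpow V M (k - 1 - j)) u v)"
    by (intro tr_cong unroll_recurrence[OF V _ X])
  also have "\<dots> = (\<Sum>j<k. tr V (mm V (Y j) (mpow V M (k - 1 - j))))"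
    by (rule tr_sum)
  also have "\<dots> = (\<Sum>j<k. tr V (mm V (mpow V M (k - 1 - j)) (Y j)))"
    by (intro sum.cong refl tr_mm_commute)
  finally show ?thesis .
qed

text \<open>The \<open>k\<close> possible places of \<open>B\<close> in a product of length
  \<open>k\<close> give the same trace by cyclicity.\<close>

lemma tr_pert1:
  assumes "finite V"
  shows "tr V (pert1 V M B k) = real k * tr V (mm V (mpow V M (k - 1)) B)"
proof -
  have "tr V (mm V (mpow V M (k - 1 - j)) (mm V (mpow V M j) B)) = tr V (mm V (mpow V M (k - 1)) B)" if "j < k" for j
    unfolding mm_assoc[symmetric] using that mpow_add[OF assms, of _ M "k - 1 - j" j]
    by (intro tr_cong mm_cong) auto
  then show ?thesis
    using tr_unroll[OF assms, of "pert1 V M B" M "\<lambda>k. mm V (mpow V M k) B" k] by simp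
qed

lemma sum_triangle: "(\<Sum>j<n. \<Sum>b<j. g b) = (\<Sum>b<n. real (n - 1 - b) * g b)"
proof (induction n)
  case (Suc n)
  have "(\<Sum>b<Suc n. real (Suc n - 1 - b) * g b) = (\<Sum>b<n. real (n - 1 - b) * g b + g b)"
  proof -
    have "(\<Sum>b<Suc n. real (Suc n - 1 - b) * g b) = (\<Sum>b<n. real (Suc n - 1 - b) * g b)" by simp
    also have "\<dots> = (\<Sum>b<n. real (n - 1 - b) * g b + g b)"
    proof (rule sum.cong[OF refl])
      fix b assume "b \<in> {..<n}"
      then have "Suc n - 1 - b = Suc (n - 1 - b)" by auto
      then show "real (Suc n - 1 - b) * g b = real (n - 1 - b) * g b + g b"
        by (simp only: of_nat_Suc distrib_right mult_1)
    qed
    finally show ?thesis .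
  qed
  then show ?case using Suc by (simp add: sum.distrib)
qed simp

definition pair_tr :: "'a set \<Rightarrow> ('a \<Rightarrow> 'a \<Rightarrow> real) \<Rightarrow> ('a \<Rightarrow> 'a \<Rightarrow> real) \<Rightarrow> nat \<Rightarrow> nat \<Rightarrow> real" where
  "pair_tr V M B a b = tr V (mm V (mm V (mpow V M a) B) (mm V (mpow V M b) B))"

lemma pair_tr_commute: "pair_tr V M B a b = pair_tr V M B b a"
  unfolding pair_tr_def by (rule tr_mm_commute)

text \<open>In a cyclic word of length \<open>k\<close>, two letters \<open>B\<close> separate runs
  of \<open>M\<close> of lengths a and b with a + b = k - 2. An ordered pair (a, b) has
  \<open>k\<close> rotations, and every placement of the two letters arises from two ordered pairs;
  hence the weight \<open>k\<close> against the factor 2.\<close>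

lemma tr_pert2:
  assumes V: "finite V"
  shows "2 * tr V (pert2 V M B k) = real k * (\<Sum>b<k - 1. pair_tr V M B (k - 2 - b) b)"
proof -
  \<comment> \<open>Here \<open>i\<close> counts the factors \<open>M\<close> after the second
    \<open>B\<close>; cyclicity moves them to the front, where they join the factors before the
    first \<open>B\<close>.\<close>
  have *: "tr V (mm V (mpow V M i) (mm V (pert1 V M B j) B)) = (\<Sum>b<j. pair_tr V M B (i + (j - 1 - b)) b)" for i j
  proof -
    have "tr V (mm V (mpow V M i) (mm V (pert1 V M B j) B))
      = tr V (mm V (pert1 V M B j) (mm V B (mpow V M i)))"
      by (subst tr_mm_commute) (simp add: mm_assoc)
    also have "\<dots> = tr V (mm V (\<lambda>u v. \<Sum>a<j. mm V (mm V (mpow V M a) B) (mpow V M (j - 1 - a)) u v) (mm V B (mpow V M i)))"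
      by (intro tr_cong mm_cong unroll_recurrence[OF V, where Y = "\<lambda>k. mm V (mpow V M k) B"]) auto
    also have "\<dots> = (\<Sum>a<j. tr V (mm V (mm V (mm V (mpow V M a) B) (mpow V M (j - 1 - a))) (mm V B (mpow V M i))))"
      unfolding mm_sum_left by (rule tr_sum)
    also have "\<dots> = (\<Sum>a<j. pair_tr V M B (i + a) (j - 1 - a))"
    proof (rule sum.cong[OF refl])
      fix a
      have "tr V (mm V (mm V (mm V (mpow V M a) B) (mpow V M (j - 1 - a))) (mm V B (mpow V M i)))
        = tr V (mm V (mpow V M i) (mm V (mm V (mm V (mpow V M a) B) (mpow V M (j - 1 - a))) B))"
        by (subst tr_mm_commute[of V "mpow V M i"]) (simp add: mm_assoc)
      also have "\<dots> = tr V (mm V (mm V (mpow V M i) (mpow V M a)) (mm V B (mm V (mpow V M (j - 1 - a)) B)))"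
        by (simp add: mm_assoc)
      also have "\<dots> = tr V (mm V (mpow V M (i + a)) (mm V B (mm V (mpow V M (j - 1 - a)) B)))"
        by (intro tr_cong mm_cong mpow_add V) auto
      finally show "tr V (mm V (mm V (mm V (mpow V M a) B) (mpow V M (j - 1 - a))) (mm V B (mpow V M i)))
        = pair_tr V M B (i + a) (j - 1 - a)"
        by (simp add: pair_tr_def mm_assoc)
    qed
    also have "\<dots> = (\<Sum>b<j. pair_tr V M B (i + (j - 1 - b)) b)"
    proof -
      have "(\<Sum>a<j. pair_tr V M B (i + a) (j - 1 - a)) = (\<Sum>a<j. pair_tr V M B (i + (j - 1 - (j - Suc a))) (j - Suc a))"
      proof (rule sum.cong[OF refl])
        fix a assume "a \<in> {..<j}"
        then have "j - 1 - (j - Suc a) = a" "j - 1 - a = j - Suc a" by auto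
        then show "pair_tr V M B (i + a) (j - 1 - a) = pair_tr V M B (i + (j - 1 - (j - Suc a))) (j - Suc a)"
          by (simp only:)
      qed
      also have "\<dots> = (\<Sum>b<j. pair_tr V M B (i + (j - 1 - b)) b)"
        by (rule sum.nat_diff_reindex)
      finally show ?thesis .
    qed
    finally show ?thesis .
  qed
  let ?g = "\<lambda>b. pair_tr V M B (k - 2 - b) b"
  have "tr V (pert2 V M B k) = (\<Sum>j<k. \<Sum>b<j. pair_tr V M B (k - 1 - j + (j - 1 - b)) b)"
    using tr_unroll[OF V, of "pert2 V M B" M "\<lambda>k. mm V (pert1 V M B k) B" k] by (simp add: *)
  also have "\<dots> = (\<Sum>j<k. \<Sum>b<j. ?g b)"
    by (intro sum.cong refl arg_cong2[where f = "pair_tr V M B"]) auto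
  also have "\<dots> = (\<Sum>b<k. real (k - 1 - b) * ?g b)"
    by (rule sum_triangle)
  also have "\<dots> = (\<Sum>b<k - 1. real (k - 1 - b) * ?g b)"
    by (cases k) auto
  finally have t: "tr V (pert2 V M B k) = (\<Sum>b<k - 1. real (k - 1 - b) * ?g b)" .
  \<comment> \<open>Reversing the order of summation and exchanging the two exponents replaces the
    weight \<open>k - 1 - b\<close> by \<open>Suc b\<close>; the two weights add up to
    \<open>k\<close>.\<close>
  have t2: "(\<Sum>b<k - 1. real (k - 1 - b) * ?g b) = (\<Sum>b<k - 1. real (Suc b) * ?g b)"
  proof -
    have "(\<Sum>b<k - 1. real (k - 1 - b) * ?g b) = (\<Sum>b<k - 1. real (k - 1 - (k - 1 - Suc b)) * ?g (k - 1 - Suc b))"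
      using sum.nat_diff_reindex[of "\<lambda>b. real (k - 1 - b) * ?g b" "k - 1"] by (simp only:)
    also have "\<dots> = (\<Sum>b<k - 1. real (Suc b) * ?g b)"
    proof (rule sum.cong[OF refl])
      fix b assume b: "b \<in> {..<k - 1}"
      then have "k - 1 - (k - 1 - Suc b) = Suc b" "k - 2 - (k - 1 - Suc b) = b" "k - 1 - Suc b = k - 2 - b" by auto
      then show "real (k - 1 - (k - 1 - Suc b)) * ?g (k - 1 - Suc b) = real (Suc b) * ?g b"
        using pair_tr_commute[of V M B b] by simp
    qed
    finally show ?thesis .
  qed
  have "2 * tr V (pert2 V M B k) = tr V (pert2 V M B k) + tr V (pert2 V M B k)" by simp
  also have "\<dots> = (\<Sum>b<k - 1. real (k - 1 - b) * ?g b) + (\<Sum>b<k - 1. real (Suc b) * ?g b)"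
    by (rule arg_cong2[where f = "(+)", OF t t[unfolded t2]])
  also have "\<dots> = (\<Sum>b<k - 1. real k * ?g b)"
    unfolding sum.distrib[symmetric] distrib_right[symmetric]
  proof (rule sum.cong[OF refl])
    fix b assume "b \<in> {..<k - 1}"
    then have "k - 1 - b + Suc b = k" by auto
    then show "(real (k - 1 - b) + real (Suc b)) * ?g b = real k * ?g b"
      by (simp only: of_nat_add[symmetric])
  qed
  finally show ?thesis by (simp only: sum_distrib_left)
qed

text \<open>The row sum is 1 except at an isolated vertex, whose row is zero.\<close>

lemma row_bound_walk_matrix:
  assumes "pair_graph G"
  shows "row_bound (pverts G) (walk_matrix G) 1"
proof -
  interpret pair_graph G by fact
  show ?thesis
    unfolding row_bound_def
  proof
    fix u assume u: "u \<in> pverts G"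
    have sub: "nbrs G u \<subseteq> pverts G"
      using in_arcsD2 by (auto simp: nbrs_def)
    have "(\<Sum>v\<in>pverts G. \<bar>walk_matrix G u v\<bar>) = (\<Sum>v\<in>nbrs G u. 1 / real (card (nbrs G u)))"
      using sub by (intro sum.mono_neutral_cong_right) (auto simp: walk_matrix_def nbrs_def)
    also have "\<dots> \<le> 1" by simp
    finally show "(\<Sum>v\<in>pverts G. \<bar>walk_matrix G u v\<bar>) \<le> 1" .
  qed
qed

text \<open>The second-order coefficient of \<open>\<integral> f d\<mu>\<^sub>\<epsilon>\<close>; when the first-order one does not vanish, the limit defining
  \<open>T_stat\<close> does not exist and \<open>Lim\<close> is an arbitrary constant.\<close>

lemma T_stat_eq:
  assumes G: "pair_graph G" "pverts G \<noteq> {}" and r: "r > 1"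
    and a: "summable (\<lambda>k. \<bar>a k\<bar> * r ^ k)"
    and f: "\<And>z. norm z \<le> r \<Longrightarrow> (\<lambda>k. complex_of_real (a k) * z ^ k) sums f z"
  shows "T_stat G B f =
    (if (\<Sum>k. a k * tr (pverts G) (pert1 (pverts G) (walk_matrix G) B k)) = 0
     then complex_of_real ((\<Sum>k. a k * tr (pverts G) (pert2 (pverts G) (walk_matrix G) B k)) / sqrt (card (pverts G)))
     else (THE l. False))"
proof -
  interpret pair_graph G by fact
  define V where "V = pverts G"
  define M where "M = walk_matrix G"
  define n where "n = real (card V)"
  have V: "finite V" "V \<noteq> {}" using G(2) by (auto simp: V_def)
  have n: "n > 0" using V by (simp add: n_def card_gt_0_iff)
  have M: "row_bound V M 1" unfolding M_def V_def by (rule row_bound_walk_matrix[OF G(1)])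
  \<comment> \<open>Any finite bound on the row sums of \<open>B\<close> serves, since the graph and
    the matrix are fixed while \<open>e\<close> tends to 0.\<close>
  define c where "c = (\<Sum>u\<in>V. \<Sum>v\<in>V. \<bar>B u v\<bar>)"
  have c: "c \<ge> 0" by (simp add: c_def sum_nonneg)
  have B: "row_bound V B c"
    unfolding row_bound_def c_def using V(1) by (auto intro!: member_le_sum sum_nonneg)
  \<comment> \<open>The gap between \<open>r'\<close> and \<open>r\<close> absorbs the factor
    \<open>k ^ 3\<close>; the gap between 1 and \<open>r'\<close> leaves room for the
    perturbation.\<close>
  obtain r' where r': "1 < r'" "r' < r" using dense[OF r] by auto
  have poly: "summable (\<lambda>k. \<bar>a k\<bar> * (real k ^ 3 * r' ^ k))"
  proof -
    \<comment> \<open>The cube root makes \<open>k ^ 3 * (r' / r) ^ k\<close> the cube of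
      \<open>k * s ^ k\<close>, which tends to 0.\<close>
    define s where "s = root 3 (r' / r)"
    have s3: "s ^ 3 = r' / r" using r r' by (simp add: s_def odd_real_root_pow)
    have "s < 1" "s \<ge> 0" using r r' by (simp_all add: s_def)
    then have "(\<lambda>k. (real k * s ^ k) ^ 3) \<longlonglongrightarrow> 0 ^ 3"
      by (intro tendsto_power powser_times_n_limit_0) auto
    also have "(\<lambda>k. (real k * s ^ k) ^ 3) = (\<lambda>k. real k ^ 3 * (r' / r) ^ k)"
      by (simp add: power_mult_distrib s3[symmetric] power_mult[symmetric] mult.commute)
    finally have "Bseq (\<lambda>k. real k ^ 3 * (r' / r) ^ k)"
      by (rule convergent_imp_Bseq[OF convergentI])
    then obtain K where K: "\<And>k. \<bar>real k ^ 3 * (r' / r) ^ k\<bar> \<le> K"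
      unfolding Bseq_def real_norm_def by blast
    show ?thesis
    proof (rule summable_comparison_test[OF _ summable_mult[OF a, of K]], intro exI allI impI)
      fix k
      have "\<bar>a k\<bar> * (real k ^ 3 * r' ^ k) = (\<bar>a k\<bar> * r ^ k) * (real k ^ 3 * (r' / r) ^ k)"
        using r by (simp add: power_divide)
      also have "\<dots> \<le> (\<bar>a k\<bar> * r ^ k) * K"
        using K[of k] r by (intro mult_left_mono) auto
      finally show "norm (\<bar>a k\<bar> * (real k ^ 3 * r' ^ k)) \<le> K * (\<bar>a k\<bar> * r ^ k)"
        using r' by (simp add: mult_ac)
    qed
  qed
  have sum_tr: "summable (\<lambda>k. a k * tr V (A k))" "\<bar>\<Sum>k. a k * tr V (A k)\<bar> \<le> n * b * (\<Sum>k. \<bar>a k\<bar> * (real k ^ 3 * r' ^ k))"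
    if A: "\<And>k. row_bound V (A k) (b * (real k ^ 3 * r' ^ k))" for A b
  proof -
    have le: "\<bar>a k * tr V (A k)\<bar> \<le> n * b * (\<bar>a k\<bar> * (real k ^ 3 * r' ^ k))" for k
      using mult_left_mono[OF abs_tr_le[OF V(1) A, of k], of "\<bar>a k\<bar>"] by (simp add: abs_mult n_def mult_ac)
    have s: "summable (\<lambda>k. \<bar>a k * tr V (A k)\<bar>)"
      by (rule summable_comparison_test[OF _ summable_mult[OF poly, of "n * b"]]) (use le in auto)
    show "summable (\<lambda>k. a k * tr V (A k))" using s by (rule summable_rabs_cancel)
    have "\<bar>\<Sum>k. a k * tr V (A k)\<bar> \<le> (\<Sum>k. \<bar>a k * tr V (A k)\<bar>)" using s by (rule summable_rabs)
    also have "\<dots> \<le> (\<Sum>k. n * b * (\<bar>a k\<bar> * (real k ^ 3 * r' ^ k)))"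
      by (intro suminf_le le s summable_mult poly)
    also have "\<dots> = n * b * (\<Sum>k. \<bar>a k\<bar> * (real k ^ 3 * r' ^ k))"
      using poly by (rule suminf_mult)
    finally show "\<bar>\<Sum>k. a k * tr V (A k)\<bar> \<le> n * b * (\<Sum>k. \<bar>a k\<bar> * (real k ^ 3 * r' ^ k))" .
  qed
  have k3: "real k \<le> real k ^ 3" "(real k)\<^sup>2 \<le> real k ^ 3" for k
    by (cases "k = 0"; auto intro: self_le_power power_increasing)+
  have rk: "1 \<le> r' ^ k" for k using r' by (intro one_le_power) simp
  have k3r: "real k ^ 3 \<le> real k ^ 3 * r' ^ k" for k
    using mult_left_mono[OF rk[of k], of "real k ^ 3"] by simp
  define S1 where "S1 = (\<Sum>k. a k * tr V (pert1 V M B k))"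
  define S2 where "S2 = (\<Sum>k. a k * tr V (pert2 V M B k))"
  define S3 where "S3 e = (\<Sum>k. a k * tr V (pert3 V M B e k))" for e
  have s1: "summable (\<lambda>k. a k * tr V (pert1 V M B k))"
  proof (rule sum_tr(1)[of _ c])
    fix k show "row_bound V (pert1 V M B k) (c * (real k ^ 3 * r' ^ k))"
      using mult_left_mono[OF order.trans[OF k3(1) k3r], of c k] c
      by (intro row_bound_mono[OF pert_bounds(1)[OF V(1) M B c]]) (simp add: mult.commute)
  qed
  have s2: "summable (\<lambda>k. a k * tr V (pert2 V M B k))"
  proof (rule sum_tr(1)[of _ "c\<^sup>2"])
    fix k show "row_bound V (pert2 V M B k) (c\<^sup>2 * (real k ^ 3 * r' ^ k))"
      using mult_left_mono[OF order.trans[OF k3(2) k3r], of "c\<^sup>2" k] c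
      by (intro row_bound_mono[OF pert_bounds(2)[OF V(1) M B c]]) (simp add: mult.commute)
  qed
  \<comment> \<open>Chosen so that 1 + |e| c stays below \<open>r'\<close>; the denominator
    \<open>c + 1\<close> covers the case c = 0.\<close>
  define e0 where "e0 = (r' - 1) / (c + 1)"
  have e0: "e0 > 0" using r' c by (simp add: e0_def)
  have small: "1 + \<bar>e\<bar> * c \<le> r'" if "\<bar>e\<bar> < e0" for e
  proof -
    have "\<bar>e\<bar> * c \<le> e0 * (c + 1)" using that c by (intro mult_mono) auto
    also have "\<dots> = r' - 1" using c by (simp add: e0_def)
    finally show ?thesis by simp
  qed
  have b3: "row_bound V (pert3 V M B e k) (c ^ 3 * (real k ^ 3 * r' ^ k))" if "\<bar>e\<bar> < e0" for e k
  proof (rule row_bound_mono[OF pert_bounds(3)[OF V(1) M B c]])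
    have "(1 + \<bar>e\<bar> * c) ^ k \<le> r' ^ k"
      using small[OF that] c by (intro power_mono) auto
    then have "real k ^ 3 * c ^ 3 * (1 + \<bar>e\<bar> * c) ^ k \<le> real k ^ 3 * c ^ 3 * r' ^ k"
      using c by (intro mult_left_mono) auto
    then show "real k ^ 3 * c ^ 3 * (1 + \<bar>e\<bar> * c) ^ k \<le> c ^ 3 * (real k ^ 3 * r' ^ k)"
      by (simp add: mult_ac)
  qed
  define C3 where "C3 = n * c ^ 3 * (\<Sum>k. \<bar>a k\<bar> * (real k ^ 3 * r' ^ k))"
  have S3_le: "\<bar>S3 e\<bar> \<le> C3" if "\<bar>e\<bar> < e0" for e
    unfolding S3_def C3_def by (rule sum_tr(2)[OF b3[OF that]])
  have exp_sums: "(\<lambda>k. complex_of_real (a k * tr V (mpow V (\<lambda>u v. M u v + e * B u v) k)))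
      sums (n * measure_pmf.expectation (eig_measure G B e) f)" if e: "\<bar>e\<bar> < e0" for e
  proof -
    have "row_bound V (\<lambda>u v. M u v + e * B u v) r"
      using small[OF e] r' by (intro row_bound_mono[OF row_bound_add[OF M row_bound_scale[OF B]]]) simp
    from expectation_empirical_eigs[OF V this f] show ?thesis
      by (simp add: eig_measure_def V_def M_def n_def)
  qed
  have diff: "measure_pmf.expectation (eig_measure G B e) f - measure_pmf.expectation (eig_measure G B 0) f
     = complex_of_real ((e * S1 + e\<^sup>2 * S2 + e ^ 3 * S3 e) / n)" if e: "\<bar>e\<bar> < e0" for e
  proof -
    have s3: "summable (\<lambda>k. a k * tr V (pert3 V M B e k))" using sum_tr(1) b3[OF e] by blast
    have "(\<lambda>k. complex_of_real (a k * tr V (mpow V (\<lambda>u v. M u v + e * B u v) k)) - complex_of_real (a k * tr V (mpow V (\<lambda>u v. M u v + 0 * B u v) k)))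
      sums (n * measure_pmf.expectation (eig_measure G B e) f - n * measure_pmf.expectation (eig_measure G B 0) f)"
      using exp_sums[OF e] exp_sums[of 0] e0 by (intro sums_diff) auto
    moreover have "complex_of_real (a k * tr V (mpow V (\<lambda>u v. M u v + e * B u v) k)) - complex_of_real (a k * tr V (mpow V (\<lambda>u v. M u v + 0 * B u v) k))
      = complex_of_real (e * (a k * tr V (pert1 V M B k)) + e\<^sup>2 * (a k * tr V (pert2 V M B k)) + e ^ 3 * (a k * tr V (pert3 V M B e k)))" for k
      unfolding mpow_perturb[of V M e B k] by (simp add: tr_add tr_scale algebra_simps)
    moreover have "(\<lambda>k. complex_of_real (e * (a k * tr V (pert1 V M B k)) + e\<^sup>2 * (a k * tr V (pert2 V M B k)) + e ^ 3 * (a k * tr V (pert3 V M B e k))))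
      sums complex_of_real (e * S1 + e\<^sup>2 * S2 + e ^ 3 * S3 e)"
      unfolding S1_def S2_def S3_def by (intro sums_of_real sums_add sums_mult summable_sums s1 s2 s3)
    ultimately have "n * measure_pmf.expectation (eig_measure G B e) f - n * measure_pmf.expectation (eig_measure G B 0) f
      = complex_of_real (e * S1 + e\<^sup>2 * S2 + e ^ 3 * S3 e)"
      by (simp add: sums_iff)
    then show ?thesis using n by (simp add: field_simps)
  qed
  have sq: "sqrt n / n = 1 / sqrt n" using n by (simp add: real_div_sqrt field_simps)
  have m_eq: "m_integral G B e f = complex_of_real ((S1 / e + S2 + e * S3 e) / sqrt n)" if "\<bar>e\<bar> < e0" "e \<noteq> 0" for e
  proof -
    have "m_integral G B e f = complex_of_real (sqrt n * ((e * S1 + e\<^sup>2 * S2 + e ^ 3 * S3 e) / n) / e\<^sup>2)"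
      unfolding m_integral_def diff[OF that(1)] by (simp add: n_def V_def)
    also have "sqrt n * ((e * S1 + e\<^sup>2 * S2 + e ^ 3 * S3 e) / n) / e\<^sup>2 = (sqrt n / n) * (S1 / e + S2 + e * S3 e)"
      using that(2) n by (simp add: field_simps power2_eq_square power3_eq_cube)
    finally show ?thesis unfolding sq by simp
  qed
  have ev: "\<forall>\<^sub>F e in at 0. \<bar>e\<bar> < e0 \<and> e \<noteq> 0"
    unfolding eventually_at using e0 by (auto simp: dist_real_def)
  have eS3: "((\<lambda>e. e * S3 e) \<longlongrightarrow> 0) (at 0)"
  proof (rule Lim_null_comparison)
    show "\<forall>\<^sub>F e in at 0. norm (e * S3 e) \<le> \<bar>e\<bar> * C3"
      using ev by eventually_elim (auto simp: abs_mult intro!: mult_left_mono S3_le)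
    show "((\<lambda>e. \<bar>e\<bar> * C3) \<longlongrightarrow> 0) (at 0)" by (auto intro!: tendsto_eq_intros)
  qed
  show ?thesis
  proof (cases "S1 = 0")
    case True
    have "((\<lambda>e. complex_of_real ((S1 / e + S2 + e * S3 e) / sqrt n)) \<longlongrightarrow> complex_of_real ((0 + S2 + 0) / sqrt n)) (at 0)"
      using n True by (intro tendsto_intros eS3) auto
    then have "((\<lambda>e. complex_of_real ((S1 / e + S2 + e * S3 e) / sqrt n)) \<longlongrightarrow> complex_of_real (S2 / sqrt n)) (at 0)"
      by simp
    then have "((\<lambda>e. m_integral G B e f) \<longlongrightarrow> complex_of_real (S2 / sqrt n)) (at 0)"
      by (rule Lim_transform_eventually) (use ev in \<open>auto elim!: eventually_mono simp: m_eq\<close>)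
    then have "T_stat G B f = complex_of_real (S2 / sqrt n)"
      unfolding T_stat_def by (intro tendsto_Lim) auto
    then show ?thesis using True by (simp add: S1_def S2_def V_def M_def n_def)
  next
    case False
    \<comment> \<open>A limit would become 0 after multiplication by \<open>e\<close> and the square
      root of \<open>n\<close>, whereas that product tends to \<open>S1\<close>. The predicate that
      defines \<open>Lim\<close> is therefore false for every candidate, and \<open>Lim\<close> is
      \<open>THE l. False\<close>.\<close>
    have "\<not> ((\<lambda>e. m_integral G B e f) \<longlongrightarrow> l) (at 0)" for l
    proof
      assume l: "((\<lambda>e. m_integral G B e f) \<longlongrightarrow> l) (at 0)"
      have "((\<lambda>e. complex_of_real e * complex_of_real (sqrt n) * m_integral G B e f) \<longlongrightarrow> complex_of_real 0 * complex_of_real (sqrt n) * l) (at 0)"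
        by (intro tendsto_intros l)
      moreover have "((\<lambda>e. complex_of_real e * complex_of_real (sqrt n) * m_integral G B e f) \<longlongrightarrow> complex_of_real (S1 + 0 * S2 + 0 * 0)) (at 0)"
      proof (rule Lim_transform_eventually)
        show "((\<lambda>e. complex_of_real (S1 + e * S2 + e * (e * S3 e))) \<longlongrightarrow> complex_of_real (S1 + 0 * S2 + 0 * 0)) (at 0)"
          by (intro tendsto_intros eS3)
        show "\<forall>\<^sub>F e in at 0. complex_of_real (S1 + e * S2 + e * (e * S3 e)) = complex_of_real e * complex_of_real (sqrt n) * m_integral G B e f"
          using ev
        proof eventually_elim
          case (elim e)
          have "S1 + e * S2 + e * (e * S3 e) = e * sqrt n * ((S1 / e + S2 + e * S3 e) / sqrt n)"
            using elim n by (simp add: field_simps)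
          moreover have "m_integral G B e f = complex_of_real ((S1 / e + S2 + e * S3 e) / sqrt n)"
            using elim by (intro m_eq) auto
          ultimately show ?case by (simp only: of_real_mult)
        qed
      qed
      ultimately have "complex_of_real (S1 + 0 * S2 + 0 * 0) = complex_of_real 0 * complex_of_real (sqrt n) * l"
        by (rule tendsto_unique[OF at_neq_bot, rotated])
      then show False using False by simp
    qed
    then have "T_stat G B f = (THE l. False)"
      by (simp add: T_stat_def Topological_Spaces.Lim_def)
    then show ?thesis using False by (simp add: S1_def V_def M_def)
  qed
qed

subsection \<open>A central limit theorem under local dependence\<close>

locale indep_rows = prob_space M for M :: "'w measure" +
  fixes N :: "'i \<Rightarrow> 'b measure" and R :: "'i \<Rightarrow> 'w \<Rightarrow> 'b" and V :: "'i set"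
  assumes fin_V: "finite V" and indep: "indep_vars N R V"
begin

text \<open>An explicit factorization through the rows in \<open>S\<close>, at every point of the
  space, in place of measurability for a generated sigma-algebra. Closure under sums, products and
  composition then only means composing functions.\<close>

definition dep :: "'i set \<Rightarrow> ('w \<Rightarrow> 'c::topological_space) \<Rightarrow> bool" where
  "dep S X \<longleftrightarrow> S \<subseteq> V \<and>
     (\<exists>g\<in>borel_measurable (PiM S N). \<forall>\<omega>\<in>space M. X \<omega> = g (\<lambda>i\<in>S. R i \<omega>))"

lemma depI:
  assumes "S \<subseteq> V" "g \<in> borel_measurable (PiM S N)"
    "\<And>\<omega>. \<omega> \<in> space M \<Longrightarrow> X \<omega> = g (\<lambda>i\<in>S. R i \<omega>)"
  shows "dep S X"
  using assms unfolding dep_def by auto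

lemma dep_subset: "dep S X \<Longrightarrow> S \<subseteq> V"
  by (simp add: dep_def)

lemma dep_mono:
  assumes "dep S X" "S \<subseteq> S'" "S' \<subseteq> V"
  shows "dep S' X"
proof -
  obtain g where g: "g \<in> borel_measurable (PiM S N)" "\<forall>\<omega>\<in>space M. X \<omega> = g (\<lambda>i\<in>S. R i \<omega>)"
    using assms(1) by (auto simp: dep_def)
  have "(\<lambda>x. g (restrict x S)) \<in> borel_measurable (PiM S' N)"
    using measurable_restrict_subset[OF assms(2)] g(1) by (rule measurable_compose)
  moreover have "X \<omega> = g (restrict (\<lambda>i\<in>S'. R i \<omega>) S)" if "\<omega> \<in> space M" for \<omega>
    using g(2) that assms(2) by (simp add: Int_absorb1)
  ultimately show ?thesis
    by (rule depI[OF assms(3)])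
qed

lemma dep_const: "S \<subseteq> V \<Longrightarrow> dep S (\<lambda>_. c)"
  by (auto simp: dep_def intro!: bexI[of _ "\<lambda>_. c"])

lemma dep_compose:
  assumes "dep S X" "h \<in> borel_measurable borel"
  shows "dep S (\<lambda>\<omega>. h (X \<omega>))"
proof -
  obtain g where g: "g \<in> borel_measurable (PiM S N)" "\<forall>\<omega>\<in>space M. X \<omega> = g (\<lambda>i\<in>S. R i \<omega>)"
    using assms(1) by (auto simp: dep_def)
  have "(\<lambda>x. h (g x)) \<in> borel_measurable (PiM S N)"
    using g(1) assms(2) by (rule measurable_compose)
  then show ?thesis
    by (rule depI[OF dep_subset[OF assms(1)]]) (use g(2) in auto)
qed

lemma dep_row:
  assumes "u \<in> V" "h \<in> borel_measurable (N u)"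
  shows "dep {u} (\<lambda>\<omega>. h (R u \<omega>))"
  using assms unfolding dep_def
  by (auto intro!: bexI[of _ "\<lambda>x. h (x u)"])

lemma dep_add:
  fixes X Y :: "'w \<Rightarrow> real"
  assumes "dep S X" "dep S Y"
  shows "dep S (\<lambda>\<omega>. X \<omega> + Y \<omega>)"
proof -
  obtain g where g: "g \<in> borel_measurable (PiM S N)" "\<forall>\<omega>\<in>space M. X \<omega> = g (\<lambda>i\<in>S. R i \<omega>)"
    using assms(1) by (auto simp: dep_def)
  obtain h where h: "h \<in> borel_measurable (PiM S N)" "\<forall>\<omega>\<in>space M. Y \<omega> = h (\<lambda>i\<in>S. R i \<omega>)"
    using assms(2) by (auto simp: dep_def)
  have "(\<lambda>x. g x + h x) \<in> borel_measurable (PiM S N)"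
    using g(1) h(1) by simp
  then show ?thesis
    by (rule depI[OF dep_subset[OF assms(1)]]) (use g(2) h(2) in auto)
qed

lemma dep_mult:
  fixes X Y :: "'w \<Rightarrow> real"
  assumes "dep S X" "dep S Y"
  shows "dep S (\<lambda>\<omega>. X \<omega> * Y \<omega>)"
proof -
  obtain g where g: "g \<in> borel_measurable (PiM S N)" "\<forall>\<omega>\<in>space M. X \<omega> = g (\<lambda>i\<in>S. R i \<omega>)"
    using assms(1) by (auto simp: dep_def)
  obtain h where h: "h \<in> borel_measurable (PiM S N)" "\<forall>\<omega>\<in>space M. Y \<omega> = h (\<lambda>i\<in>S. R i \<omega>)"
    using assms(2) by (auto simp: dep_def)
  have "(\<lambda>x. g x * h x) \<in> borel_measurable (PiM S N)"
    using g(1) h(1) by simp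
  then show ?thesis
    by (rule depI[OF dep_subset[OF assms(1)]]) (use g(2) h(2) in auto)
qed

lemma dep_sum:
  fixes X :: "'j \<Rightarrow> 'w \<Rightarrow> real"
  assumes "\<And>j. j \<in> J \<Longrightarrow> dep S (X j)" "S \<subseteq> V"
  shows "dep S (\<lambda>\<omega>. \<Sum>j\<in>J. X j \<omega>)"
  using assms by (induction J rule: infinite_finite_induct) (auto intro: dep_add dep_const)

lemma dep_measurable [measurable_dest]: "dep S X \<Longrightarrow> X \<in> borel_measurable M"
proof -
  assume d: "dep S X"
  then obtain g where g: "g \<in> borel_measurable (PiM S N)" "\<And>\<omega>. \<omega>\<in>space M \<Longrightarrow> X \<omega> = g (\<lambda>i\<in>S. R i \<omega>)"
    by (auto simp: dep_def)
  have "(\<lambda>\<omega>. \<lambda>i\<in>S. R i \<omega>) \<in> measurable M (PiM S N)"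
    using indep dep_subset[OF d] by (auto simp: indep_vars_def intro!: measurable_restrict)
  from measurable_compose[OF this g(1)] show "X \<in> borel_measurable M"
    using g(2) by (subst measurable_cong[of M X "\<lambda>\<omega>. g (\<lambda>i\<in>S. R i \<omega>)"]) auto
qed

text \<open>Disjoint families of rows are independent as tuples, and so are functions of them. The
  value type covers real factors and complex exponentials alike.\<close>

lemma expectation_dep_mult:
  fixes X Y :: "'w \<Rightarrow> 'c::{real_normed_field, banach, second_countable_topology}"
  assumes "dep S X" "dep S' Y" "S \<inter> S' = {}" "integrable M X" "integrable M Y"
  shows "expectation (\<lambda>\<omega>. X \<omega> * Y \<omega>) = expectation X * expectation Y"
proof -
  obtain g where g: "g \<in> borel_measurable (PiM S N)" "\<And>\<omega>. \<omega>\<in>space M \<Longrightarrow> X \<omega> = g (\<lambda>i\<in>S. R i \<omega>)"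
    using assms(1) by (auto simp: dep_def)
  obtain h where h: "h \<in> borel_measurable (PiM S' N)" "\<And>\<omega>. \<omega>\<in>space M \<Longrightarrow> Y \<omega> = h (\<lambda>i\<in>S'. R i \<omega>)"
    using assms(2) by (auto simp: dep_def)
  let ?X = "g \<circ> (\<lambda>\<omega>. \<lambda>i\<in>S. R i \<omega>)" and ?Y = "h \<circ> (\<lambda>\<omega>. \<lambda>i\<in>S'. R i \<omega>)"
  have eqs: "X \<omega> = ?X \<omega>" "Y \<omega> = ?Y \<omega>" if "\<omega> \<in> space M" for \<omega>
    using g(2) h(2) that by auto
  have "indep_var borel ?X borel ?Y"
    by (rule indep_var_compose[OF indep_var_restrict[OF indep assms(3)] g(1) h(1)])
       (use assms in \<open>auto dest: dep_subset\<close>)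
  moreover have "integrable M ?X" "integrable M ?Y"
    using assms(4,5) eqs by (metis (no_types, lifting) Bochner_Integration.integrable_cong)+
  ultimately have "expectation (\<lambda>\<omega>. ?X \<omega> * ?Y \<omega>) = expectation ?X * expectation ?Y"
    by (rule indep_var_lebesgue_integral)
  moreover have "expectation (\<lambda>\<omega>. ?X \<omega> * ?Y \<omega>) = expectation (\<lambda>\<omega>. X \<omega> * Y \<omega>)"
    "expectation ?X = expectation X" "expectation ?Y = expectation Y"
    by (intro Bochner_Integration.integral_cong refl; simp only: eqs)+
  ultimately show ?thesis
    by simp
qed

lemma integrable_bounded:
  fixes X :: "'w \<Rightarrow> 'c::{banach, second_countable_topology}"
  assumes "X \<in> borel_measurable M" "\<And>\<omega>. \<omega> \<in> space M \<Longrightarrow> norm (X \<omega>) \<le> C"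
  shows "integrable M X"
  using assms by (intro integrable_const_bound[of _ C]) auto

lemma expectation_norm_le:
  fixes X :: "'w \<Rightarrow> 'c::{banach, second_countable_topology}"
  assumes "X \<in> borel_measurable M" "\<And>\<omega>. \<omega> \<in> space M \<Longrightarrow> norm (X \<omega>) \<le> C"
  shows "norm (expectation X) \<le> C"
proof -
  have i: "integrable M X"
    by (rule integrable_bounded[OF assms])
  have "norm (expectation X) \<le> expectation (\<lambda>\<omega>. norm (X \<omega>))"
    by (rule integral_norm_bound)
  also have "\<dots> \<le> expectation (\<lambda>_. C)"
    using i assms(2) by (intro integral_mono) auto
  finally show ?thesis by (simp add: prob_space)
qed

text \<open>Products of terms with disjoint sets of rows have expectation 0, so each index
  contributes at most \<open>D\<close> products, each of size at most C^2.\<close>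

lemma second_moment_local_sum:
  fixes X :: "'j \<Rightarrow> 'w \<Rightarrow> real" and C D :: real
  assumes "finite J" and dep: "\<And>j. j \<in> J \<Longrightarrow> dep (nb j) (X j)"
    and bound: "\<And>j \<omega>. j \<in> J \<Longrightarrow> \<omega> \<in> space M \<Longrightarrow> \<bar>X j \<omega>\<bar> \<le> C"
    and mean: "\<And>j. j \<in> J \<Longrightarrow> expectation (X j) = 0"
    and deg: "\<And>j. j \<in> J \<Longrightarrow> real (card {k\<in>J. nb j \<inter> nb k \<noteq> {}}) \<le> D"
  shows "expectation (\<lambda>\<omega>. (\<Sum>j\<in>J. X j \<omega>)\<^sup>2) \<le> card J * D * C\<^sup>2"
proof -
  note [measurable] = dep[THEN dep_measurable]
  have int: "integrable M (\<lambda>\<omega>. X j \<omega> * X k \<omega>)" if "j \<in> J" "k \<in> J" for j k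
  proof (rule integrable_bounded)
    show "norm (X j \<omega> * X k \<omega>) \<le> C * C" if "\<omega> \<in> space M" for \<omega>
      using bound[OF \<open>j \<in> J\<close> that] bound[OF \<open>k \<in> J\<close> that] by (auto simp: abs_mult intro!: mult_mono)
  qed (use that in auto)
  have "expectation (\<lambda>\<omega>. (\<Sum>j\<in>J. X j \<omega>)\<^sup>2) = expectation (\<lambda>\<omega>. \<Sum>j\<in>J. \<Sum>k\<in>J. X j \<omega> * X k \<omega>)"
    by (simp add: power2_eq_square sum_product)
  also have "\<dots> = (\<Sum>j\<in>J. \<Sum>k\<in>J. expectation (\<lambda>\<omega>. X j \<omega> * X k \<omega>))"
    using int by (subst Bochner_Integration.integral_sum, auto)+
  also have "\<dots> \<le> (\<Sum>j\<in>J. \<Sum>k\<in>J. if nb j \<inter> nb k \<noteq> {} then C\<^sup>2 else 0)"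
  proof (intro sum_mono)
    fix j k assume jk: "j \<in> J" "k \<in> J"
    show "expectation (\<lambda>\<omega>. X j \<omega> * X k \<omega>) \<le> (if nb j \<inter> nb k \<noteq> {} then C\<^sup>2 else 0)"
    proof (cases "nb j \<inter> nb k = {}")
      case True
      have "integrable M (X j)" "integrable M (X k)"
        using jk bound by (auto intro!: integrable_bounded[where C = C])
      then show ?thesis
        using expectation_dep_mult[OF dep[OF jk(1)] dep[OF jk(2)] True] mean jk True by simp
    next
      case False
      have "norm (expectation (\<lambda>\<omega>. X j \<omega> * X k \<omega>)) \<le> C * C"
      proof (rule expectation_norm_le)
        show "norm (X j \<omega> * X k \<omega>) \<le> C * C" if "\<omega> \<in> space M" for \<omega>
          using bound[OF \<open>j \<in> J\<close> that] bound[OF \<open>k \<in> J\<close> that] by (auto simp: abs_mult intro!: mult_mono)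
      qed (use jk in auto)
      then show ?thesis
        using False by (simp add: power2_eq_square)
    qed
  qed
  also have "\<dots> = (\<Sum>j\<in>J. real (card {k\<in>J. nb j \<inter> nb k \<noteq> {}}) * C\<^sup>2)"
    using assms(1) by (simp add: sum.If_cases Int_def)
  also have "\<dots> \<le> (\<Sum>j\<in>J. D * C\<^sup>2)"
    by (intro sum_mono mult_right_mono deg) auto
  finally show ?thesis by simp
qed

text \<open>Cauchy-Schwarz, in the form that the variance of |X| is nonnegative.\<close>

lemma abs_expectation_le_sqrt:
  fixes X :: "'w \<Rightarrow> real"
  assumes "integrable M X" "integrable M (\<lambda>\<omega>. (X \<omega>)\<^sup>2)"
  shows "expectation (\<lambda>\<omega>. \<bar>X \<omega>\<bar>) \<le> sqrt (expectation (\<lambda>\<omega>. (X \<omega>)\<^sup>2))"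
proof -
  have "0 \<le> variance (\<lambda>\<omega>. \<bar>X \<omega>\<bar>)"
    by (rule variance_positive)
  also have "\<dots> = expectation (\<lambda>\<omega>. (X \<omega>)\<^sup>2) - (expectation (\<lambda>\<omega>. \<bar>X \<omega>\<bar>))\<^sup>2"
    using assms by (subst variance_eq) auto
  finally show ?thesis
    by (intro real_le_rsqrt) simp
qed

text \<open>Stein's method on the Fourier side: local dependence turns the characteristic function
  into an approximate solution of \<open>\<phi>' = - s \<sigma>\<^sup>2 \<phi>\<close>.\<close>

theorem local_clt:
  fixes X :: "'j \<Rightarrow> 'w \<Rightarrow> real" and C :: real
  assumes J: "finite J" "J \<noteq> {}" and dep: "\<And>j. j \<in> J \<Longrightarrow> dep (nb j) (X j)"
    and bound: "\<And>j \<omega>. j \<in> J \<Longrightarrow> \<omega> \<in> space M \<Longrightarrow> \<bar>X j \<omega>\<bar> \<le> C"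
    and mean: "\<And>j. j \<in> J \<Longrightarrow> expectation (X j) = 0"
    and deg: "\<And>j. j \<in> J \<Longrightarrow> card {k\<in>J. nb j \<inter> nb k \<noteq> {}} \<le> D"
  defines "Y \<equiv> \<lambda>\<omega>. (\<Sum>j\<in>J. X j \<omega>) / sqrt (card J)"
  shows "norm (expectation (\<lambda>\<omega>. iexp (Y \<omega>)) - complex_of_real (exp (- expectation (\<lambda>\<omega>. (Y \<omega>)\<^sup>2) / 2)))
    \<le> (4 * D\<^sup>2 * C\<^sup>2 + D\<^sup>2 * C ^ 3) / sqrt (card J)"
proof -
  define n where "n = real (card J)"
  have n: "n > 0"
    using J by (auto simp: n_def card_gt_0_iff)
  define a where "a = 1 / sqrt n"
  have a: "a > 0" "a\<^sup>2 = 1 / n" "a * a * n = 1"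
    using n by (auto simp: a_def power_divide)
  obtain j0 where j0: "j0 \<in> J" using J by auto
  obtain \<omega>0 where \<omega>0: "\<omega>0 \<in> space M" using not_empty by auto
  have C0: "C \<ge> 0" using bound[OF j0 \<omega>0] by linarith
  note [measurable] = dep[THEN dep_measurable]
  have Y_eq: "Y \<omega> = a * (\<Sum>j\<in>J. X j \<omega>)" for \<omega>
    by (simp add: Y_def a_def n_def)
  have [measurable]: "Y \<in> borel_measurable M"
    unfolding Y_def by measurable
  define near where "near j = {k\<in>J. nb j \<inter> nb k \<noteq> {}}" for j
  have near: "finite (near j)" "near j \<subseteq> J" for j
    using J by (auto simp: near_def)
  have nearD: "k \<in> J" if "k \<in> near j" for j k
    using that by (auto simp: near_def)
  have near_sym: "j \<in> near k \<longleftrightarrow> k \<in> near j" if "j \<in> J" "k \<in> J" for j k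
    using that by (auto simp: near_def)
  have card_near: "real (card (near j)) \<le> real D" if "j \<in> J" for j
    using deg[OF that] by (simp add: near_def)
  \<comment> \<open>The part of \<open>Y\<close> that may depend on \<open>X j\<close>; the
    remainder \<open>Y - L j\<close> is independent of \<open>X j\<close>.\<close>
  define L where "L j \<omega> = a * (\<Sum>k\<in>near j. X k \<omega>)" for j \<omega>
  have L_meas [measurable]: "L j \<in> borel_measurable M" for j
  proof -
    have "\<And>k. k \<in> near j \<Longrightarrow> X k \<in> borel_measurable M"
      using near(2)[of j] by auto
    then show ?thesis unfolding L_def by measurable
  qed
  have L_bound: "\<bar>L j \<omega>\<bar> \<le> a * (real D * C)" if "j \<in> J" "\<omega> \<in> space M" for j \<omega>
  proof -
    have "\<bar>\<Sum>k\<in>near j. X k \<omega>\<bar> \<le> (\<Sum>k\<in>near j. C)"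
      using near(2) that by (intro order.trans[OF sum_abs] sum_mono bound) auto
    also have "\<dots> \<le> real D * C"
      using card_near[OF that(1)] C0 by (auto intro!: mult_right_mono)
    finally show ?thesis
      using a(1) by (simp add: L_def abs_mult)
  qed
  have X_bound: "norm (X j \<omega>) \<le> C" if "j \<in> J" "\<omega> \<in> space M" for j \<omega>
    using bound that by simp
  have int_X: "integrable M (X j)" if "j \<in> J" for j
    using that X_bound[OF that] by (intro integrable_bounded[where C = C]) auto
  have Y_bound: "\<bar>Y \<omega>\<bar> \<le> a * (n * C)" if "\<omega> \<in> space M" for \<omega>
  proof -
    have "\<bar>\<Sum>k\<in>J. X k \<omega>\<bar> \<le> (\<Sum>k\<in>J. C)"
      using that by (intro order.trans[OF sum_abs] sum_mono bound) auto
    then show ?thesis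
      using a(1) by (simp add: Y_eq abs_mult n_def)
  qed
  define K where "K = a * (n * C)"
  have K0: "K \<ge> 0" using a n C0 by (simp add: K_def)
  have half_sq: "\<bar>x\<bar> ^ Suc 1 / fact (Suc 1) \<le> \<bar>x\<bar>\<^sup>2" for x :: real
    using zero_le_power2[of x] by (simp add: power2_eq_square)
  have norm_iexp: "norm (iexp x) = 1" for x :: real
    by simp
  have int1: "integrable M (\<lambda>\<omega>. complex_of_real (Z \<omega>) * iexp (s * Y \<omega>))"
    if [measurable]: "Z \<in> borel_measurable M" and "\<And>\<omega>. \<omega> \<in> space M \<Longrightarrow> \<bar>Z \<omega>\<bar> \<le> K'" for Z K' s
    by (rule integrable_bounded[where C = K']) (use that in \<open>auto simp: norm_mult\<close>)
  \<comment> \<open>\<open>X j\<close> is centred and independent of the far part, so the term of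
    order zero disappears.\<close>
  have far: "expectation (\<lambda>\<omega>. complex_of_real (X j \<omega>) * iexp (s * (Y \<omega> - L j \<omega>))) = 0"
    if j: "j \<in> J" for j s
  proof -
    let ?S = "\<Union>k\<in>J - near j. nb k"
    have S: "?S \<subseteq> V" using dep dep_subset by blast
    have "Y \<omega> - L j \<omega> = (\<Sum>k\<in>J - near j. a * X k \<omega>)" for \<omega>
      using near[of j] J
      by (simp add: Y_eq L_def sum_diff algebra_simps sum_distrib_left)
    moreover have "dep ?S (\<lambda>\<omega>. \<Sum>k\<in>J - near j. a * X k \<omega>)"
    proof (intro dep_sum S)
      fix k assume k: "k \<in> J - near j"
      then show "dep ?S (\<lambda>\<omega>. a * X k \<omega>)"
        using dep[of k] S by (intro dep_mult dep_const dep_mono[of "nb k" _ ?S]) auto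
    qed
    ultimately have "dep ?S (\<lambda>\<omega>. Y \<omega> - L j \<omega>)" by simp
    from dep_compose[OF this, of "\<lambda>y. iexp (s * y)"]
    have 1: "dep ?S (\<lambda>\<omega>. iexp (s * (Y \<omega> - L j \<omega>)))" by simp
    have 2: "dep (nb j) (\<lambda>\<omega>. complex_of_real (X j \<omega>))"
      using dep_compose[OF dep[OF j], of complex_of_real] by simp
    have "expectation (\<lambda>\<omega>. complex_of_real (X j \<omega>) * iexp (s * (Y \<omega> - L j \<omega>))) =
      expectation (\<lambda>\<omega>. complex_of_real (X j \<omega>)) * expectation (\<lambda>\<omega>. iexp (s * (Y \<omega> - L j \<omega>)))"
    proof (rule expectation_dep_mult[OF 2 1])
      show "nb j \<inter> ?S = {}" by (auto simp: near_def)
      show "integrable M (\<lambda>\<omega>. complex_of_real (X j \<omega>))" using int_X[OF j] by simp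
      show "integrable M (\<lambda>\<omega>. iexp (s * (Y \<omega> - L j \<omega>)))"
        by (rule integrable_bounded[where C = 1]) auto
    qed
    then show ?thesis using mean[OF j] by simp
  qed
  \<comment> \<open>Writing \<open>Y - L j\<close> as a perturbation of \<open>Y\<close> and
    expanding the exponential to first order in \<open>s * L j\<close> leaves a remainder quadratic
    in \<open>L j\<close>. By \<open>far\<close> the left-hand exponential itself has zero
    correlation with \<open>X j\<close>.\<close>
  have near1: "norm (expectation (\<lambda>\<omega>. complex_of_real (X j \<omega>) * iexp (s * Y \<omega>))
      - \<i> * s * expectation (\<lambda>\<omega>. complex_of_real (X j \<omega> * L j \<omega>) * iexp (s * Y \<omega>)))
      \<le> C * (a * (D * C))\<^sup>2" if j: "j \<in> J" and s: "0 \<le> s" "s \<le> 1" for j and s :: real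
  proof -
    have iL: "integrable M (\<lambda>\<omega>. complex_of_real (X j \<omega> * L j \<omega>) * iexp (s * Y \<omega>))"
      by (rule int1[of _ "C * (a * (real D * C))"])
         (use j in \<open>auto simp: abs_mult intro!: mult_mono bound L_bound C0\<close>)
    have iX: "integrable M (\<lambda>\<omega>. complex_of_real (X j \<omega>) * iexp (s * Y \<omega>))"
      by (rule int1[of _ C]) (use j bound in auto)
    have iF: "integrable M (\<lambda>\<omega>. complex_of_real (X j \<omega>) * iexp (s * (Y \<omega> - L j \<omega>)))"
      by (rule integrable_bounded[where C = C]) (use j bound in \<open>auto simp: norm_mult\<close>)
    have "expectation (\<lambda>\<omega>. complex_of_real (X j \<omega>) * iexp (s * Y \<omega>))
      - \<i> * s * expectation (\<lambda>\<omega>. complex_of_real (X j \<omega> * L j \<omega>) * iexp (s * Y \<omega>))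
      = expectation (\<lambda>\<omega>. complex_of_real (X j \<omega>) * iexp (s * Y \<omega>)
          - \<i> * s * (complex_of_real (X j \<omega> * L j \<omega>) * iexp (s * Y \<omega>))
          - complex_of_real (X j \<omega>) * iexp (s * (Y \<omega> - L j \<omega>)))"
      using iL iX iF far[OF j, of s]
      by (subst Bochner_Integration.integral_diff, force, force)
         (subst Bochner_Integration.integral_diff, auto)
    also have "norm \<dots> \<le> C * (a * (D * C))\<^sup>2"
    proof (rule expectation_norm_le)
      fix \<omega> assume \<omega>: "\<omega> \<in> space M"
      let ?x = "- (s * L j \<omega>)"
      have "iexp (s * (Y \<omega> - L j \<omega>)) = iexp (s * Y \<omega>) * iexp ?x"
        by (simp add: exp_add [symmetric] algebra_simps)
      then have "complex_of_real (X j \<omega>) * iexp (s * Y \<omega>)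
          - \<i> * s * (complex_of_real (X j \<omega> * L j \<omega>) * iexp (s * Y \<omega>))
          - complex_of_real (X j \<omega>) * iexp (s * (Y \<omega> - L j \<omega>))
        = - (complex_of_real (X j \<omega>) * iexp (s * Y \<omega>) * (iexp ?x - (\<Sum>k\<le>1. (\<i> * ?x) ^ k / fact k)))"
        by (simp add: algebra_simps)
      also have "norm \<dots> = \<bar>X j \<omega>\<bar> * norm (iexp ?x - (\<Sum>k\<le>1. (\<i> * ?x) ^ k / fact k))"
        by (simp only: norm_minus_cancel norm_mult norm_iexp norm_of_real mult_1_right)
      also have "\<dots> \<le> C * (\<bar>?x\<bar> ^ Suc 1 / fact (Suc 1))"
        using iexp_approx1[of ?x 1] bound[OF j \<omega>] C0 by (intro mult_mono) auto
        also have "\<dots> \<le> C * (a * (D * C))\<^sup>2"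
        proof (rule mult_left_mono[OF _ C0])
          have "\<bar>?x\<bar> \<le> a * (D * C)"
            using mult_mono[OF s(2) L_bound[OF j \<omega>]] s by (auto simp: abs_mult)
          then show "\<bar>?x\<bar> ^ Suc 1 / fact (Suc 1) \<le> (a * (D * C))\<^sup>2"
            by (intro order.trans[OF half_sq] power_mono) auto
        qed
        finally show "norm (complex_of_real (X j \<omega>) * iexp (s * Y \<omega>)
          - \<i> * s * (complex_of_real (X j \<omega> * L j \<omega>) * iexp (s * Y \<omega>))
          - complex_of_real (X j \<omega>) * iexp (s * (Y \<omega> - L j \<omega>))) \<le> C * (a * (D * C))\<^sup>2" .
    qed (use j in measurable)
    finally show ?thesis .
  qed
  define v where "v = expectation (\<lambda>\<omega>. (Y \<omega>)\<^sup>2)"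
  \<comment> \<open>A random counterpart of the variance of \<open>Y\<close>: its mean is
    \<open>v\<close>, and its fluctuations are small because the products \<open>X j * X k\<close>
    are again locally dependent.\<close>
  define W where "W \<omega> = a * (\<Sum>j\<in>J. X j \<omega> * L j \<omega>)" for \<omega>
  have [measurable]: "W \<in> borel_measurable M"
    unfolding W_def by measurable
  define I where "I = Sigma J near"
  have finI: "finite I" using J near by (auto simp: I_def)
  have cardI: "real (card I) \<le> n * D"
    using card_near J sum_mono[of J "\<lambda>j. real (card (near j))" "\<lambda>_. real D"]
    by (simp add: I_def card_SigmaI near n_def)
  have W_eq: "W \<omega> = a\<^sup>2 * (\<Sum>(j,k)\<in>I. X j \<omega> * X k \<omega>)" for \<omega>
    using J near
    by (simp add: W_def L_def I_def sum.Sigma[symmetric] power2_eq_square sum_distrib_left algebra_simps)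
  have int_XX: "integrable M (\<lambda>\<omega>. X j \<omega> * X k \<omega>)" if "j \<in> J" "k \<in> J" for j k
    by (rule integrable_bounded[where C = "C * C"])
       (use that bound C0 in \<open>auto simp: abs_mult intro!: mult_mono\<close>)
  have EI: "expectation (\<lambda>\<omega>. \<Sum>(j,k)\<in>I. X j \<omega> * X k \<omega>) = (\<Sum>(j,k)\<in>I. expectation (\<lambda>\<omega>. X j \<omega> * X k \<omega>))"
    unfolding case_prod_unfold
    by (rule Bochner_Integration.integral_sum) (auto simp: I_def intro!: int_XX dest: nearD)
  have W_mean: "expectation W = v"
  proof -
    have "v = expectation (\<lambda>\<omega>. a\<^sup>2 * (\<Sum>j\<in>J. \<Sum>k\<in>J. X j \<omega> * X k \<omega>))"
      unfolding v_def Y_eq power_mult_distrib power2_eq_square[of "sum _ _"] sum_product ..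
    also have "\<dots> = a\<^sup>2 * (\<Sum>j\<in>J. \<Sum>k\<in>J. expectation (\<lambda>\<omega>. X j \<omega> * X k \<omega>))"
      using int_XX by (simp add: Bochner_Integration.integral_sum Bochner_Integration.integrable_sum)
    also have "\<dots> = a\<^sup>2 * (\<Sum>j\<in>J. \<Sum>k\<in>near j. expectation (\<lambda>\<omega>. X j \<omega> * X k \<omega>))"
    proof (rule arg_cong2[where f = "(*)", OF refl], rule sum.cong[OF refl], rule sum.mono_neutral_right)
      fix j assume j: "j \<in> J"
      show "\<forall>k\<in>J - near j. expectation (\<lambda>\<omega>. X j \<omega> * X k \<omega>) = 0"
      proof
        fix k assume k: "k \<in> J - near j"
        then have "nb j \<inter> nb k = {}" by (auto simp: near_def)
        then show "expectation (\<lambda>\<omega>. X j \<omega> * X k \<omega>) = 0"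
          using expectation_dep_mult[OF dep[OF j] dep[of k]] k j mean int_X by simp
      qed
    qed (use J near in auto)
    also have "\<dots> = a\<^sup>2 * (\<Sum>(j,k)\<in>I. expectation (\<lambda>\<omega>. X j \<omega> * X k \<omega>))"
      using J near by (simp add: I_def sum.Sigma)
    also have "\<dots> = expectation (\<lambda>\<omega>. a\<^sup>2 * (\<Sum>(j,k)\<in>I. X j \<omega> * X k \<omega>))"
      by (simp add: EI)
    also have "\<dots> = expectation W"
      by (simp add: W_eq[abs_def])
    finally show ?thesis by simp
  qed
  have W_var: "expectation (\<lambda>\<omega>. (W \<omega> - v)\<^sup>2) \<le> 16 * real D ^ 3 * C ^ 4 / n"
  proof -
    define Z where "Z = (\<lambda>(j, k) \<omega>. X j \<omega> * X k \<omega> - expectation (\<lambda>\<omega>. X j \<omega> * X k \<omega>))"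
    have "W \<omega> - v = a\<^sup>2 * (\<Sum>p\<in>I. Z p \<omega>)" for \<omega>
    proof -
      have "v = a\<^sup>2 * (\<Sum>(j,k)\<in>I. expectation (\<lambda>\<omega>. X j \<omega> * X k \<omega>))"
        unfolding W_mean[symmetric] W_eq[abs_def] by (simp add: EI)
      then show ?thesis
        by (simp add: W_eq Z_def case_prod_unfold sum_subtractf right_diff_distrib)
    qed
    then have "expectation (\<lambda>\<omega>. (W \<omega> - v)\<^sup>2) = (a\<^sup>2)\<^sup>2 * expectation (\<lambda>\<omega>. (\<Sum>p\<in>I. Z p \<omega>)\<^sup>2)"
      by (simp add: power_mult_distrib)
    also have "expectation (\<lambda>\<omega>. (\<Sum>p\<in>I. Z p \<omega>)\<^sup>2) \<le> real (card I) * (4 * (real D)\<^sup>2) * (2 * C\<^sup>2)\<^sup>2"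
    proof (rule second_moment_local_sum[where nb = "\<lambda>(j, k). nb j \<union> nb k"])
      show "finite I" by fact
      fix p assume p: "p \<in> I"
      obtain j k where jk: "p = (j, k)" "j \<in> J" "k \<in> near j" "k \<in> J"
        using p by (auto simp: I_def dest: nearD)
      have XX: "norm (X j \<omega> * X k \<omega>) \<le> C\<^sup>2" if "\<omega> \<in> space M" for \<omega>
        using bound[OF jk(2) that] bound[OF jk(4) that] C0
        by (auto simp: abs_mult power2_eq_square intro!: mult_mono)
      have E: "norm (expectation (\<lambda>\<omega>. X j \<omega> * X k \<omega>)) \<le> C\<^sup>2"
        by (rule expectation_norm_le[OF _ XX]) (use jk in measurable)
      have sub: "nb j \<union> nb k \<subseteq> V"
        using dep_subset dep jk by blast
      have "dep (nb j \<union> nb k) (\<lambda>\<omega>. X j \<omega> * X k \<omega> + - expectation (\<lambda>\<omega>. X j \<omega> * X k \<omega>))"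
        by (intro dep_add dep_mult dep_const sub dep_mono[OF dep[OF jk(2)]] dep_mono[OF dep[OF jk(4)]]) auto
      then show "dep (case p of (j, k) \<Rightarrow> nb j \<union> nb k) (Z p)"
        by (simp add: jk Z_def)
      show "\<bar>Z p \<omega>\<bar> \<le> 2 * C\<^sup>2" if "\<omega> \<in> space M" for \<omega>
        using XX[OF that] E by (simp add: Z_def jk)
      show "expectation (Z p) = 0"
        using int_XX[OF jk(2,4)] by (simp add: Z_def jk prob_space)
      \<comment> \<open>A pair sharing a row with (j, k) has one endpoint among at most 2 D indices
        near \<open>j\<close> or \<open>k\<close>, and the other among at most \<open>D\<close>
        indices near that endpoint. The swap records which of the two it is, whence the bound 4
        D^2.\<close>
      have "{q \<in> I. (case p of (j, k) \<Rightarrow> nb j \<union> nb k) \<inter> (case q of (j, k) \<Rightarrow> nb j \<union> nb k) \<noteq> {}}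
        \<subseteq> Sigma (near j \<union> near k) near \<union> prod.swap ` Sigma (near j \<union> near k) near"
      proof
        fix q assume "q \<in> {q \<in> I. (case p of (j, k) \<Rightarrow> nb j \<union> nb k) \<inter> (case q of (j, k) \<Rightarrow> nb j \<union> nb k) \<noteq> {}}"
        then obtain j' k' where q: "q = (j', k')" "j' \<in> J" "k' \<in> near j'" "k' \<in> J" and
            ne: "(nb j \<union> nb k) \<inter> (nb j' \<union> nb k') \<noteq> {}"
          using jk by (auto simp: I_def dest: nearD)
        have "j' \<in> near j \<union> near k \<or> k' \<in> near j \<union> near k"
          using ne q unfolding near_def by blast
        then show "q \<in> Sigma (near j \<union> near k) near \<union> prod.swap ` Sigma (near j \<union> near k) near"
          using q near_sym[of j' k'] by (auto simp: image_iff)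
      qed
      then have "card {q \<in> I. (case p of (j, k) \<Rightarrow> nb j \<union> nb k) \<inter> (case q of (j, k) \<Rightarrow> nb j \<union> nb k) \<noteq> {}}
        \<le> card (Sigma (near j \<union> near k) near \<union> prod.swap ` Sigma (near j \<union> near k) near)"
        by (intro card_mono) (auto simp: near)
      also have "\<dots> \<le> card (Sigma (near j \<union> near k) near) + card (Sigma (near j \<union> near k) near)"
        by (intro order.trans[OF card_Un_le] add_left_mono card_image_le) (auto simp: near)
      finally have "real (card {q \<in> I. (case p of (j, k) \<Rightarrow> nb j \<union> nb k) \<inter> (case q of (j, k) \<Rightarrow> nb j \<union> nb k) \<noteq> {}})
        \<le> 2 * real (card (Sigma (near j \<union> near k) near))"
        by linarith
      also have "real (card (Sigma (near j \<union> near k) near)) \<le> 2 * real D * real D"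
      proof -
        have "real (card (Sigma (near j \<union> near k) near)) = (\<Sum>i\<in>near j \<union> near k. real (card (near i)))"
          by (simp add: near)
        also have "\<dots> \<le> (\<Sum>i\<in>near j \<union> near k. real D)"
          using near by (intro sum_mono card_near) auto
        also have "\<dots> = card (near j \<union> near k) * real D" by simp
        also have "\<dots> \<le> (2 * D) * real D"
          using card_Un_le[of "near j" "near k"] card_near[OF jk(2)] card_near[OF jk(4)]
          by (intro mult_right_mono) auto
        finally show ?thesis by simp
      qed
      finally show "real (card {q \<in> I. (case p of (j, k) \<Rightarrow> nb j \<union> nb k) \<inter> (case q of (j, k) \<Rightarrow> nb j \<union> nb k) \<noteq> {}})
          \<le> 4 * (real D)\<^sup>2"
        by (simp add: power2_eq_square)
    qed
    also have "real (card I) * (4 * (real D)\<^sup>2) * (2 * C\<^sup>2)\<^sup>2 \<le> (n * real D) * (4 * (real D)\<^sup>2) * (2 * C\<^sup>2)\<^sup>2"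
      by (intro mult_right_mono cardI) auto
    also have "(a\<^sup>2)\<^sup>2 * ((n * real D) * (4 * (real D)\<^sup>2) * (2 * C\<^sup>2)\<^sup>2) = 16 * real D ^ 3 * C ^ 4 / n"
      using n unfolding a(2) by (simp add: power2_eq_square power3_eq_cube power4_eq_xxxx field_simps)
    finally show ?thesis using a by (simp add: mult_left_mono)
  qed
  have W_bound: "\<bar>W \<omega>\<bar> \<le> a * (n * (C * (a * (D * C))))" if "\<omega> \<in> space M" for \<omega>
  proof -
    have "\<bar>\<Sum>j\<in>J. X j \<omega> * L j \<omega>\<bar> \<le> (\<Sum>j\<in>J. C * (a * (D * C)))"
      using that by (intro order.trans[OF sum_abs] sum_mono) (auto simp: abs_mult intro!: mult_mono bound L_bound C0)
    then show ?thesis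
      using a(1) by (simp add: W_def abs_mult n_def)
  qed
  have iW: "integrable M W"
    by (rule integrable_bounded[where C = "a * (n * (C * (a * (D * C))))"]) (use W_bound in auto)
  have iW2: "integrable M (\<lambda>\<omega>. (W \<omega> - v)\<^sup>2)"
  proof (rule integrable_bounded[where C = "(a * (n * (C * (a * (D * C)))) + \<bar>v\<bar>)\<^sup>2"])
    fix \<omega> assume "\<omega> \<in> space M"
    from W_bound[OF this] have "\<bar>W \<omega> - v\<bar> \<le> \<bar>a * (n * (C * (a * (D * C)))) + \<bar>v\<bar>\<bar>" by linarith
    then show "norm ((W \<omega> - v)\<^sup>2) \<le> (a * (n * (C * (a * (D * C)))) + \<bar>v\<bar>)\<^sup>2"
      by (simp add: abs_le_square_iff)
  qed measurable
  define e where "e = 4 * (real D)\<^sup>2 * C\<^sup>2 * a + (real D)\<^sup>2 * C ^ 3 * a"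
  have W_L1: "expectation (\<lambda>\<omega>. \<bar>W \<omega> - v\<bar>) \<le> 4 * (real D)\<^sup>2 * C\<^sup>2 * a"
  proof -
    have "expectation (\<lambda>\<omega>. \<bar>W \<omega> - v\<bar>) \<le> sqrt (expectation (\<lambda>\<omega>. (W \<omega> - v)\<^sup>2))"
      using iW iW2 by (intro abs_expectation_le_sqrt) auto
    also have "\<dots> \<le> sqrt (16 * real D ^ 3 * C ^ 4 / n)"
      using W_var by (rule real_sqrt_le_mono)
    \<comment> \<open>The cube of \<open>D\<close> is enlarged to a fourth power in order to have a
      perfect square.\<close>
    also have "\<dots> \<le> sqrt ((4 * (real D)\<^sup>2 * C\<^sup>2 * a)\<^sup>2)"
    proof (intro real_sqrt_le_mono)
      have "real D ^ 3 \<le> real D ^ 4"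
        by (cases "D = 0") (auto intro!: power_increasing)
      then have "16 * real D ^ 3 * C ^ 4 / n \<le> 16 * real D ^ 4 * C ^ 4 / n"
        using n by (intro divide_right_mono mult_right_mono mult_left_mono) auto
      also have "\<dots> = (4 * (real D)\<^sup>2 * C\<^sup>2 * a)\<^sup>2"
        using a(2) by (simp add: divide_inverse power_mult_distrib flip: power_mult)
      finally show "16 * real D ^ 3 * C ^ 4 / n \<le> (4 * (real D)\<^sup>2 * C\<^sup>2 * a)\<^sup>2" .
    qed
    also have "\<dots> = 4 * (real D)\<^sup>2 * C\<^sup>2 * a"
      using a by simp
    finally show ?thesis .
  qed
  define \<phi> where "\<phi> s = expectation (\<lambda>\<omega>. iexp (s * Y \<omega>))" for s :: real
  define \<phi>' where "\<phi>' s = \<i> * expectation (\<lambda>\<omega>. complex_of_real (Y \<omega>) * iexp (s * Y \<omega>))" for s :: real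
  have i0: "integrable M (\<lambda>\<omega>. iexp (s * Y \<omega>))" for s
    by (rule integrable_bounded[where C = 1]) auto
  have i1: "integrable M (\<lambda>\<omega>. complex_of_real (Y \<omega>) * iexp (s * Y \<omega>))" for s
    by (rule int1[of _ K]) (use Y_bound in \<open>auto simp: K_def\<close>)
  have deriv: "(\<phi> has_vector_derivative \<phi>' s) (at s within T)" for s T
  proof -
    \<comment> \<open>A quadratic bound on the increment yields the derivative directly and replaces
      differentiation under the integral.\<close>
    have linear_stat: "norm (\<phi> t - \<phi> s - (t - s) *\<^sub>R \<phi>' s) \<le> K\<^sup>2 * (t - s)\<^sup>2" for t
    proof -
      have "\<phi> t - \<phi> s - (t - s) *\<^sub>R \<phi>' s = expectation (\<lambda>\<omega>. iexp (t * Y \<omega>) - iexp (s * Y \<omega>)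
          - (\<i> * (t - s)) * (complex_of_real (Y \<omega>) * iexp (s * Y \<omega>)))"
        unfolding \<phi>_def \<phi>'_def using i0 i1[of s]
        by (subst Bochner_Integration.integral_diff, force, force)
           (subst Bochner_Integration.integral_diff, auto simp: scaleR_conv_of_real algebra_simps)
      also have "norm \<dots> \<le> K\<^sup>2 * (t - s)\<^sup>2"
      proof (rule expectation_norm_le)
        fix \<omega> assume \<omega>: "\<omega> \<in> space M"
        let ?x = "(t - s) * Y \<omega>"
        have "iexp (t * Y \<omega>) = iexp (s * Y \<omega>) * iexp ?x"
          by (simp add: exp_add [symmetric] algebra_simps)
        then have "iexp (t * Y \<omega>) - iexp (s * Y \<omega>) - (\<i> * (t - s)) * (complex_of_real (Y \<omega>) * iexp (s * Y \<omega>))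
          = iexp (s * Y \<omega>) * (iexp ?x - (\<Sum>k\<le>1. (\<i> * ?x) ^ k / fact k))"
          by (simp add: algebra_simps)
        also have "norm \<dots> = norm (iexp ?x - (\<Sum>k\<le>1. (\<i> * ?x) ^ k / fact k))"
          by (simp only: norm_mult norm_iexp mult_1_left)
        also have "\<dots> \<le> \<bar>?x\<bar> ^ Suc 1 / fact (Suc 1)"
          by (rule iexp_approx1)
        also have "\<dots> \<le> \<bar>?x\<bar>\<^sup>2" by (rule half_sq)
        also have "\<dots> = \<bar>Y \<omega>\<bar>\<^sup>2 * (t - s)\<^sup>2" by (simp add: power_mult_distrib)
        also have "\<dots> \<le> K\<^sup>2 * (t - s)\<^sup>2"
          using Y_bound[OF \<omega>] by (intro mult_right_mono power_mono) (auto simp: K_def)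
        finally show "norm (iexp (t * Y \<omega>) - iexp (s * Y \<omega>)
          - (\<i> * (t - s)) * (complex_of_real (Y \<omega>) * iexp (s * Y \<omega>))) \<le> K\<^sup>2 * (t - s)\<^sup>2" .
      qed measurable
      finally show ?thesis .
    qed
    have "((\<lambda>t. norm (\<phi> t - \<phi> s - (t - s) *\<^sub>R \<phi>' s) / norm (t - s)) \<longlongrightarrow> 0) (at s within T)"
    proof (rule Lim_null_comparison)
      show "\<forall>\<^sub>F t in at s within T. norm (norm (\<phi> t - \<phi> s - (t - s) *\<^sub>R \<phi>' s) / norm (t - s)) \<le> K\<^sup>2 * \<bar>t - s\<bar>"
      proof (rule always_eventually, rule allI)
        fix t
        show "norm (norm (\<phi> t - \<phi> s - (t - s) *\<^sub>R \<phi>' s) / norm (t - s)) \<le> K\<^sup>2 * \<bar>t - s\<bar>"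
        proof (cases "t = s")
          case False
          then have "\<bar>t - s\<bar> > 0" by simp
          moreover have "(t - s)\<^sup>2 = \<bar>t - s\<bar> * \<bar>t - s\<bar>" by (simp add: power2_eq_square)
          ultimately show ?thesis
            using linear_stat[of t] by (simp add: pos_divide_le_eq mult.assoc del: abs_mult_self_eq)
        qed simp
      qed
      show "((\<lambda>t. K\<^sup>2 * \<bar>t - s\<bar>) \<longlongrightarrow> 0) (at s within T)"
        by (auto intro!: tendsto_eq_intros)
    qed
    then show ?thesis
      unfolding has_vector_derivative_def has_derivative_iff_norm
      by (auto intro: bounded_linear_intros)
  qed
  have ode: "norm (\<phi>' s + s * v * \<phi> s) \<le> e" if s: "0 \<le> s" "s \<le> 1" for s :: real
  proof -
    have iXL: "integrable M (\<lambda>\<omega>. complex_of_real (X j \<omega> * L j \<omega>) * iexp (s * Y \<omega>))" if "j \<in> J" for j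
      by (rule int1[of _ "C * (a * (real D * C))"])
         (use that in \<open>auto simp: abs_mult intro!: mult_mono bound L_bound C0\<close>)
    have iX: "integrable M (\<lambda>\<omega>. complex_of_real (X j \<omega>) * iexp (s * Y \<omega>))" if "j \<in> J" for j
      by (rule int1[of _ C]) (use that bound in auto)
    have iWe: "integrable M (\<lambda>\<omega>. complex_of_real (W \<omega>) * iexp (s * Y \<omega>))"
      by (rule int1[OF _ W_bound]) auto
    have 1: "\<phi>' s = \<i> * a * (\<Sum>j\<in>J. expectation (\<lambda>\<omega>. complex_of_real (X j \<omega>) * iexp (s * Y \<omega>)))"
    proof -
      have "(\<lambda>\<omega>. complex_of_real (Y \<omega>) * iexp (s * Y \<omega>))
        = (\<lambda>\<omega>. a * (\<Sum>j\<in>J. complex_of_real (X j \<omega>) * iexp (s * Y \<omega>)))"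
        by (simp add: Y_eq sum_distrib_right sum_distrib_left mult_ac)
      then show ?thesis
        unfolding \<phi>'_def using iX by (simp add: Bochner_Integration.integral_sum)
    qed
    have 2: "expectation (\<lambda>\<omega>. complex_of_real (W \<omega>) * iexp (s * Y \<omega>))
       = a * (\<Sum>j\<in>J. expectation (\<lambda>\<omega>. complex_of_real (X j \<omega> * L j \<omega>) * iexp (s * Y \<omega>)))"
    proof -
      have "(\<lambda>\<omega>. complex_of_real (W \<omega>) * iexp (s * Y \<omega>))
        = (\<lambda>\<omega>. a * (\<Sum>j\<in>J. complex_of_real (X j \<omega> * L j \<omega>) * iexp (s * Y \<omega>)))"
        by (simp add: W_def sum_distrib_right sum_distrib_left mult_ac)
      then show ?thesis
        using iXL by (simp add: Bochner_Integration.integral_sum)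
    qed
    have "norm (\<phi>' s + s * expectation (\<lambda>\<omega>. complex_of_real (W \<omega>) * iexp (s * Y \<omega>)))
       = norm (\<i> * a * (\<Sum>j\<in>J. expectation (\<lambda>\<omega>. complex_of_real (X j \<omega>) * iexp (s * Y \<omega>))
      - \<i> * s * expectation (\<lambda>\<omega>. complex_of_real (X j \<omega> * L j \<omega>) * iexp (s * Y \<omega>))))"
      unfolding 1 2 sum_subtractf sum_distrib_left[symmetric]
      by (rule arg_cong[where f = norm]) (simp add: algebra_simps)
    also have "\<dots> \<le> a * (\<Sum>j\<in>J. C * (a * (D * C))\<^sup>2)"
    proof -
      have "norm (\<Sum>j\<in>J. expectation (\<lambda>\<omega>. complex_of_real (X j \<omega>) * iexp (s * Y \<omega>))
        - \<i> * s * expectation (\<lambda>\<omega>. complex_of_real (X j \<omega> * L j \<omega>) * iexp (s * Y \<omega>)))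
        \<le> (\<Sum>j\<in>J. C * (a * (D * C))\<^sup>2)"
        by (intro order.trans[OF norm_sum] sum_mono near1 s)
      moreover have "norm (\<i> * complex_of_real a) = a"
        using a(1) by (simp add: norm_mult)
      ultimately show ?thesis
        using a(1) by (simp only: norm_mult mult_left_mono)
    qed
    also have "\<dots> = (a * a * n) * (a * (C ^ 3 * (real D)\<^sup>2))"
      by (simp add: n_def power2_eq_square power3_eq_cube)
    also have "\<dots> = (real D)\<^sup>2 * C ^ 3 * a"
      by (simp only: a(3)) simp
    finally have A: "norm (\<phi>' s + s * expectation (\<lambda>\<omega>. complex_of_real (W \<omega>) * iexp (s * Y \<omega>)))
      \<le> (real D)\<^sup>2 * C ^ 3 * a" .
    have "v * \<phi> s - expectation (\<lambda>\<omega>. complex_of_real (W \<omega>) * iexp (s * Y \<omega>))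
      = expectation (\<lambda>\<omega>. complex_of_real (v - W \<omega>) * iexp (s * Y \<omega>))"
      unfolding \<phi>_def using i0[of s] iWe by (simp add: left_diff_distrib)
    also have "norm \<dots> \<le> expectation (\<lambda>\<omega>. norm (complex_of_real (v - W \<omega>) * iexp (s * Y \<omega>)))"
      by (rule integral_norm_bound)
    also have "\<dots> = expectation (\<lambda>\<omega>. \<bar>W \<omega> - v\<bar>)"
      by (simp only: norm_mult norm_iexp norm_of_real mult_1_right abs_minus_commute)
    finally have "norm (v * \<phi> s - expectation (\<lambda>\<omega>. complex_of_real (W \<omega>) * iexp (s * Y \<omega>)))
      \<le> 4 * (real D)\<^sup>2 * C\<^sup>2 * a" using W_L1 by linarith
    then have B: "norm (s * (v * \<phi> s - expectation (\<lambda>\<omega>. complex_of_real (W \<omega>) * iexp (s * Y \<omega>))))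
      \<le> 4 * (real D)\<^sup>2 * C\<^sup>2 * a"
      using s mult_mono[of s 1 "norm (v * \<phi> s - expectation (\<lambda>\<omega>. complex_of_real (W \<omega>) * iexp (s * Y \<omega>)))" "4 * (real D)\<^sup>2 * C\<^sup>2 * a"]
      by (simp add: norm_mult)
    have "\<phi>' s + s * v * \<phi> s = (\<phi>' s + s * expectation (\<lambda>\<omega>. complex_of_real (W \<omega>) * iexp (s * Y \<omega>)))
      + s * (v * \<phi> s - expectation (\<lambda>\<omega>. complex_of_real (W \<omega>) * iexp (s * Y \<omega>)))"
      by (simp add: algebra_simps)
    then have "norm (\<phi>' s + s * v * \<phi> s) \<le> (real D)\<^sup>2 * C ^ 3 * a + 4 * (real D)\<^sup>2 * C\<^sup>2 * a"
      using norm_triangle_mono[OF A B] by (simp only:)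
    then show ?thesis by (simp only: e_def add.commute)
  qed
  have v0: "v \<ge> 0" by (auto simp: v_def)
  \<comment> \<open>Integrating factor: the derivative of \<open>\<psi>\<close> is the defect of the
    differential equation times exp (s^2 v / 2), which on [0, 1] is at most exp (v / 2) times
    \<open>e\<close>. The increment over [0, 1] carries the same factor exp (v / 2), which
    cancels.\<close>
  define \<psi> where "\<psi> s = exp (s\<^sup>2 * v / 2) *\<^sub>R \<phi> s" for s
  have d\<psi>: "(\<psi> has_vector_derivative exp (s\<^sup>2 * v / 2) *\<^sub>R (\<phi>' s + s * v * \<phi> s)) (at s within {0..1})" for s
    unfolding \<psi>_def
    by (rule derivative_eq_intros deriv refl has_vector_derivative_scaleR[OF _ deriv] | simp)+
       (simp add: scaleR_conv_of_real algebra_simps)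
  have "norm (\<psi> 1 - \<psi> 0) \<le> (exp (v / 2) * e) * norm (1 - 0 :: real)"
  proof (rule differentiable_bound[of "{0..1::real}" \<psi> "\<lambda>s h. h *\<^sub>R (exp (s\<^sup>2 * v / 2) *\<^sub>R (\<phi>' s + s * v * \<phi> s))"])
    fix s :: real assume s: "s \<in> {0..1}"
    show "(\<psi> has_derivative (\<lambda>h. h *\<^sub>R (exp (s\<^sup>2 * v / 2) *\<^sub>R (\<phi>' s + s * v * \<phi> s)))) (at s within {0..1})"
      using d\<psi> unfolding has_vector_derivative_def .
    have "s\<^sup>2 \<le> 1" using s by (simp add: power_le_one)
    then have "exp (s\<^sup>2 * v / 2) \<le> exp (v / 2)"
      using v0 mult_right_mono[of "s\<^sup>2" 1 v] by simp
    then have "norm (exp (s\<^sup>2 * v / 2) *\<^sub>R (\<phi>' s + s * v * \<phi> s)) \<le> exp (v / 2) * e"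
      using ode[of s] s by (auto intro!: mult_mono)
    then show "onorm (\<lambda>h. h *\<^sub>R (exp (s\<^sup>2 * v / 2) *\<^sub>R (\<phi>' s + s * v * \<phi> s))) \<le> exp (v / 2) * e"
      by (intro onorm_le) (simp only: norm_scaleR[of _ "_ *\<^sub>R _"] mult.commute[of "\<bar>_\<bar>"] real_norm_def mult_right_mono abs_ge_zero)
  qed auto
  moreover have "\<psi> 0 = 1" by (simp add: \<psi>_def \<phi>_def prob_space)
  moreover have "\<psi> 1 - 1 = exp (v / 2) *\<^sub>R (\<phi> 1 - exp (- v / 2))"
    by (simp add: right_diff_distrib \<psi>_def scaleR_diff_right scaleR_conv_of_real exp_of_real [symmetric] exp_minus del: exp_of_real)
  ultimately have "norm (\<phi> 1 - exp (- v / 2)) \<le> e"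
    by simp
  moreover have "e = (4 * D\<^sup>2 * C\<^sup>2 + D\<^sup>2 * C ^ 3) / sqrt (card J)"
    by (simp add: e_def a_def n_def add_divide_distrib)
  ultimately show ?thesis
    by (simp add: \<phi>_def v_def)
qed

end

subsection \<open>Joint convergence and Gaussian series\<close>

text \<open>The algebra spanned by the characters of the first \<open>k\<close> coordinates.
  Induction over it transfers convergence of characteristic functions to all its members.\<close>

inductive trig_sum :: "nat \<Rightarrow> ((nat \<Rightarrow> real) \<Rightarrow> complex) \<Rightarrow> bool" for k where
  iexp: "trig_sum k (\<lambda>x. c * iexp (\<Sum>i<k. t i * x i))"
| add: "trig_sum k f \<Longrightarrow> trig_sum k g \<Longrightarrow> trig_sum k (\<lambda>x. f x + g x)"

lemma trig_sum_mult_iexp: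
  assumes "trig_sum k f"
  shows "trig_sum k (\<lambda>x. c * iexp (\<Sum>i<k. t i * x i) * f x)"
  using assms
proof induction
  case (iexp c' t')
  have "(\<lambda>x. c * iexp (\<Sum>i<k. t i * x i) * (c' * iexp (\<Sum>i<k. t' i * x i)))
    = (\<lambda>x. c * c' * iexp (\<Sum>i<k. (t i + t' i) * x i))"
    by (simp add: exp_add sum.distrib algebra_simps)
  then show ?case by (simp only: trig_sum.iexp)
next
  case (add f g)
  then show ?case
    using trig_sum.add[OF add.IH] by (simp add: algebra_simps)
qed

lemma trig_sum_mult:
  assumes "trig_sum k f" "trig_sum k g"
  shows "trig_sum k (\<lambda>x. f x * g x)"
  using assms(1)
proof induction
  case (iexp c t)
  then show ?case using trig_sum_mult_iexp[OF assms(2)] by simp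
next
  case (add f f')
  then show ?case
    using trig_sum.add[OF add.IH] by (simp add: algebra_simps)
qed

lemma trig_sum_const: "trig_sum k (\<lambda>x. c)"
  using trig_sum.iexp[of k c "\<lambda>_. 0"] by simp

lemma trig_sum_sin:
  assumes "i < k"
  shows "trig_sum k (\<lambda>x. complex_of_real (sin (x i / L)))"
proof -
  have sum_single: "(\<Sum>j<k. (if j = i then s else 0) * x j) = s * x i" for s :: real and x
    using assms by (simp add: if_distrib[of "\<lambda>t. t * _"] if_distribR cong: if_cong)
  have "complex_of_real (sin y) = 1 / (2 * \<i>) * iexp y + - 1 / (2 * \<i>) * iexp (- y)" for y
    by (simp add: sin_of_real [symmetric] sin_exp_eq field_simps exp_minus)
  then have "complex_of_real (sin (x i / L)) = 1 / (2 * \<i>) * iexp (\<Sum>j<k. (if j = i then 1 / L else 0) * x j)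
     + - 1 / (2 * \<i>) * iexp (\<Sum>j<k. (if j = i then - 1 / L else 0) * x j)" for x :: "nat \<Rightarrow> real"
    unfolding sum_single by simp
  then show ?thesis
    using trig_sum.add[OF trig_sum.iexp trig_sum.iexp] by presburger
qed

lemma (in prob_space) trig_sum_integrable:
  assumes "trig_sum k f" "\<And>i. i < k \<Longrightarrow> Z i \<in> borel_measurable M"
  shows "integrable M (\<lambda>\<omega>. f (\<lambda>i. Z i \<omega>))"
  using assms(1)
proof induction
  case (iexp c t)
  have [measurable]: "(\<lambda>\<omega>. \<Sum>i<k. t i * Z i \<omega>) \<in> borel_measurable M"
    using assms(2) by auto
  show ?case
    by (rule integrable_const_bound[of _ "norm c"]) (auto simp: norm_mult simp del: of_real_sum)
next
  case (add f g)
  then show ?case by simp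
qed

lemma abs_expectation_diff_le:
  assumes "prob_space M" "integrable M X" "integrable M Y" "integrable M Z"
    and "\<And>\<omega>. \<omega> \<in> space M \<Longrightarrow> \<bar>X \<omega> - Y \<omega>\<bar> \<le> Z \<omega>"
  shows "\<bar>integral\<^sup>L M X - integral\<^sup>L M Y\<bar> \<le> (integral\<^sup>L M Z :: real)"
proof -
  have "\<bar>integral\<^sup>L M X - integral\<^sup>L M Y\<bar> = \<bar>\<integral>\<omega>. X \<omega> - Y \<omega> \<partial>M\<bar>"
    using assms by simp
  also have "\<dots> \<le> (\<integral>\<omega>. \<bar>X \<omega> - Y \<omega>\<bar> \<partial>M)"
    by (rule integral_abs_bound)
  also have "\<dots> \<le> integral\<^sup>L M Z"
    using assms by (intro integral_mono) auto
  finally show ?thesis .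
qed

text \<open>The substitution \<open>y\<^sub>i = sin (x\<^sub>i / \<lambda>)\<close> maps the whole space into a compact cube, where
  polynomials are dense; pulled back, they are trigonometric sums.\<close>

lemma trig_approx:
  fixes h :: "(nat \<Rightarrow> real) \<Rightarrow> real"
  assumes h: "continuous_on UNIV h" and H: "\<And>x. \<bar>h x\<bar> \<le> H" and e: "e > 0" and L: "L > 0"
  obtains g where "trig_sum k (\<lambda>x. complex_of_real (g x))"
    "\<And>x. \<bar>h (pad k x) - g x\<bar> \<le> e + 2 * H * (\<Sum>i<k. \<bar>x i\<bar>) / L"
proof -
  \<comment> \<open>The coordinates from \<open>k\<close> on are pinned to 0, so that the first
    \<open>k\<close> coordinates already separate the points of this compact cube.\<close>
  define S where "S = PiE UNIV (\<lambda>i. if i < k then {-1..1::real} else {0})"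
  define \<sigma> where "\<sigma> x = (\<lambda>i. if i < k then sin (x i / L) else 0)" for x :: "nat \<Rightarrow> real"
  define R where "R = {f :: (nat \<Rightarrow> real) \<Rightarrow> real. continuous_on S f \<and> trig_sum k (\<lambda>x. complex_of_real (f (\<sigma> x)))}"
  \<comment> \<open>On the cube \<open>arcsin\<close> undoes the substitution, so \<open>h'\<close>
    is \<open>h\<close> carried over to the compact side, up to the effect of arguments beyond the
    range of \<open>arcsin\<close>.\<close>
  define h' where "h' y = h (\<lambda>i. if i < k then L * arcsin (y i) else 0)" for y
  have mem_S: "x \<in> S \<longleftrightarrow> (\<forall>i. x i \<in> (if i < k then {-1..1} else {0}))" for x
    by (simp only: S_def PiE_UNIV_domain Pi_iff ball_UNIV)
  have coord: "continuous_on S (\<lambda>x. x i)" for i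
    by (rule continuous_on_subset[OF continuous_on_product_coordinates subset_UNIV])
  interpret function_ring_on R S
  proof
    have "compactin (product_topology (\<lambda>i. euclidean) UNIV) S"
      unfolding S_def compactin_PiE by simp
    then show "compact S" by (simp only: euclidean_product_topology compactin_euclidean_iff)
  next
    fix x y :: "nat \<Rightarrow> real"
    assume xy: "x \<in> S" "y \<in> S" "x \<noteq> y"
    obtain i where i: "x i \<noteq> y i" using xy(3) by (metis ext)
    have "i < k"
    proof (rule ccontr)
      assume "\<not> i < k"
      then have "x i \<in> {0}" "y i \<in> {0}"
        using xy(1)[unfolded mem_S, rule_format, of i] xy(2)[unfolded mem_S, rule_format, of i] by simp_all
      then show False using i by simp
    qed
    then have "(\<lambda>x. x i) \<in> R"
      using trig_sum_sin[of i k L] coord[of i] by (simp add: R_def \<sigma>_def)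
    then show "\<exists>f\<in>R. f x \<noteq> f y"
      using i by (rule bexI[of "\<lambda>f. f x \<noteq> f y" "\<lambda>x. x i" R, rotated])
  next
    fix f g assume "f \<in> R" "g \<in> R"
    then have f: "continuous_on S f" "trig_sum k (\<lambda>x. complex_of_real (f (\<sigma> x)))"
      and g: "continuous_on S g" "trig_sum k (\<lambda>x. complex_of_real (g (\<sigma> x)))"
      by (simp_all add: R_def)
    show "(\<lambda>x. f x + g x) \<in> R"
      using continuous_on_add[OF f(1) g(1)] trig_sum.add[OF f(2) g(2)] by (simp add: R_def)
    show "(\<lambda>x. f x * g x) \<in> R"
      using continuous_on_mult[OF f(1) g(1)] trig_sum_mult[OF f(2) g(2)] by (simp add: R_def)
  qed (simp_all add: R_def trig_sum_const)
  have "continuous_on S h'"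
    unfolding h'_def
  proof (rule continuous_on_compose2[OF h])
    show "continuous_on S (\<lambda>y i. if i < k then L * arcsin (y i) else 0)"
    proof (rule continuous_on_coordinatewise_then_product)
      fix i
      show "continuous_on S (\<lambda>y. if i < k then L * arcsin (y i) else 0)"
      proof (cases "i < k")
        case True
        have "-1 \<le> y i \<and> y i \<le> 1" if "y \<in> S" for y
          using that[unfolded mem_S, rule_format, of i] True by simp
        then have "continuous_on S (\<lambda>y. L * arcsin (y i))"
          by (intro continuous_intros coord) auto
        then show ?thesis using True by simp
      qed simp
    qed
  qed simp
  from Stone_Weierstrass_basic[OF this e] obtain g where
    g: "g \<in> R" "\<And>y. y \<in> S \<Longrightarrow> \<bar>h' y - g y\<bar> < e" by auto
  have H0: "H \<ge> 0" using H[of undefined] by linarith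
  have "\<bar>h (pad k x) - g (\<sigma> x)\<bar> \<le> e + 2 * H * (\<Sum>i<k. \<bar>x i\<bar>) / L" for x
  proof -
    have "\<sigma> x \<in> S" by (simp add: \<sigma>_def mem_S)
    then have 1: "\<bar>h' (\<sigma> x) - g (\<sigma> x)\<bar> \<le> e" using g(2) by force
    \<comment> \<open>If all coordinates are at most \<open>L\<close> in modulus, the sine is
      inverted exactly because 1 is below pi / 2. Otherwise the crude bound \<open>2 * H\<close> is
      paid for by a coordinate exceeding \<open>L\<close>, as in Markov's inequality.\<close>
    have "\<bar>h (pad k x) - h' (\<sigma> x)\<bar> \<le> 2 * H * (\<Sum>i<k. \<bar>x i\<bar>) / L"
    proof (cases "\<forall>i<k. \<bar>x i\<bar> \<le> L")
      case True
      have "L * arcsin (sin (x i / L)) = x i" if "i < k" for i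
      proof -
        have "\<bar>x i / L\<bar> \<le> 1" using True that L by (simp add: abs_divide)
        then have "\<bar>x i / L\<bar> \<le> pi / 2" using pi_ge_two by linarith
        then have "arcsin (sin (x i / L)) = x i / L"
          by (intro arcsin_sin) linarith+
        then show ?thesis using L by simp
      qed
      then have "h' (\<sigma> x) = h (pad k x)"
        unfolding h'_def \<sigma>_def pad_def by (intro arg_cong[where f = h]) auto
      then show ?thesis using H0 L by (simp add: sum_nonneg)
    next
      case False
      then obtain i where i: "i < k" "\<bar>x i\<bar> > L" by auto
      have "\<bar>x i\<bar> \<le> (\<Sum>i<k. \<bar>x i\<bar>)" using i by (intro member_le_sum) auto
      then have "1 \<le> (\<Sum>i<k. \<bar>x i\<bar>) / L" using L i by simp
      then have "2 * H * 1 \<le> 2 * H * ((\<Sum>i<k. \<bar>x i\<bar>) / L)"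
        using H0 by (intro mult_left_mono) auto
      moreover have "\<bar>h (pad k x) - h' (\<sigma> x)\<bar> \<le> 2 * H"
        using H[of "pad k x"] H[of "\<lambda>i. if i < k then L * arcsin (\<sigma> x i) else 0"]
        unfolding h'_def by linarith
      ultimately show ?thesis by simp
    qed
    with 1 show ?thesis by linarith
  qed
  moreover have "trig_sum k (\<lambda>x. complex_of_real (g (\<sigma> x)))"
    using g(1) by (simp add: R_def)
  ultimately show thesis using that[of "\<lambda>x. g (\<sigma> x)"] by blast
qed

lemma pad_measurable:
  fixes Z :: "nat \<Rightarrow> 'w \<Rightarrow> 'b::{second_countable_topology, zero}"
  assumes "\<And>i. i < k \<Longrightarrow> Z i \<in> borel_measurable M"
  shows "(\<lambda>\<omega>. pad k (\<lambda>i. Z i \<omega>)) \<in> borel_measurable M"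
proof (rule measurable_coordinatewise_then_product)
  fix i show "(\<lambda>\<omega>. pad k (\<lambda>i. Z i \<omega>) i) \<in> borel_measurable M"
    using assms[of i] by (cases "i < k") (auto simp: pad_def)
qed

text \<open>A multivariate continuity theorem. The common bound \<open>C\<close> on first moments
  takes the place of tightness: after integration, the error term of \<open>trig_approx\<close> is
  small once \<open>L\<close> is large.\<close>

theorem tendsto_integral_pad_of_char:
  fixes Z :: "nat \<Rightarrow> nat \<Rightarrow> 'w \<Rightarrow> real" and Y :: "nat \<Rightarrow> 'v \<Rightarrow> real"
  assumes P: "\<And>n. prob_space (P n)" and Q: "prob_space Q"
    and Zm: "\<And>n i. i < k \<Longrightarrow> Z n i \<in> borel_measurable (P n)"
    and Ym: "\<And>i. i < k \<Longrightarrow> Y i \<in> borel_measurable Q"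
    and Z1: "\<And>n i. i < k \<Longrightarrow> integrable (P n) (\<lambda>\<omega>. \<bar>Z n i \<omega>\<bar>)"
      "\<And>n i. i < k \<Longrightarrow> (\<integral>\<omega>. \<bar>Z n i \<omega>\<bar> \<partial>P n) \<le> C"
    and Y1: "\<And>i. i < k \<Longrightarrow> integrable Q (\<lambda>\<omega>. \<bar>Y i \<omega>\<bar>)"
      "\<And>i. i < k \<Longrightarrow> (\<integral>\<omega>. \<bar>Y i \<omega>\<bar> \<partial>Q) \<le> C"
    and conv: "\<And>t. (\<lambda>n. \<integral>\<omega>. iexp (\<Sum>i<k. t i * Z n i \<omega>) \<partial>P n) \<longlonglongrightarrow> (\<integral>\<omega>. iexp (\<Sum>i<k. t i * Y i \<omega>) \<partial>Q)"
    and h: "continuous_on UNIV (h :: (nat \<Rightarrow> real) \<Rightarrow> real)" "bounded (range h)"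
  shows "(\<lambda>n. \<integral>\<omega>. h (pad k (\<lambda>i. Z n i \<omega>)) \<partial>P n) \<longlonglongrightarrow> (\<integral>\<omega>. h (pad k (\<lambda>i. Y i \<omega>)) \<partial>Q)"
proof (rule LIMSEQ_I)
  fix r :: real assume r: "r > 0"
  obtain H where H: "\<And>x. \<bar>h x\<bar> \<le> H" using h(2) by (auto simp: bounded_iff)
  have H0: "H \<ge> 0" using H[of undefined] by linarith
  \<comment> \<open>Each passage from \<open>h\<close> to \<open>g\<close> costs
    \<open>2 * e\<close> and the convergence for \<open>g\<close> costs \<open>e\<close>, in total
    less than \<open>r\<close>.\<close>
  define e where "e = r / 6"
  have e: "e > 0" using r by (simp add: e_def)
  define K where "K = 2 * H * (real k * \<bar>C\<bar>)"
  have K0: "K \<ge> 0" using H0 by (simp add: K_def)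
  define L where "L = K / e + 1"
  have "K / e \<ge> 0" using K0 e by simp
  then have L: "L > 0" by (simp add: L_def)
  have "K / L \<le> e"
  proof -
    have "K \<le> e * L" unfolding L_def using e by (simp add: field_simps)
    then show ?thesis using L by (simp add: divide_le_eq)
  qed
  obtain g where g: "trig_sum k (\<lambda>x. complex_of_real (g x))"
    "\<And>x. \<bar>h (pad k x) - g x\<bar> \<le> e + 2 * H * (\<Sum>i<k. \<bar>x i\<bar>) / L"
    using trig_approx[OF h(1) H e L] by blast
  have h_meas: "h \<in> borel_measurable borel"
    using h(1) by (rule borel_measurable_continuous_onI)
  have close: "\<bar>(\<integral>\<omega>. h (pad k (\<lambda>i. W i \<omega>)) \<partial>M) - (\<integral>\<omega>. g (\<lambda>i. W i \<omega>) \<partial>M)\<bar> \<le> 2 * e"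
    if M: "prob_space M" and W: "\<And>i. i < k \<Longrightarrow> W i \<in> borel_measurable M"
      and W1: "\<And>i. i < k \<Longrightarrow> integrable M (\<lambda>\<omega>. \<bar>W i \<omega>\<bar>)"
       "\<And>i. i < k \<Longrightarrow> (\<integral>\<omega>. \<bar>W i \<omega>\<bar> \<partial>M) \<le> C" for M :: "'x measure" and W
  proof -
    interpret prob_space M by fact
    have i1: "integrable M (\<lambda>\<omega>. h (pad k (\<lambda>i. W i \<omega>)))"
      by (rule integrable_const_bound[of _ H])
         (use H measurable_compose[OF pad_measurable[OF W] h_meas] in auto)
    have i2: "integrable M (\<lambda>\<omega>. g (\<lambda>i. W i \<omega>))"
      using integrable_Re[OF trig_sum_integrable[OF g(1) W]] by simp
    have i3: "integrable M (\<lambda>\<omega>. (\<Sum>i<k. \<bar>W i \<omega>\<bar>))"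
      using W1(1) by auto
    have "\<bar>(\<integral>\<omega>. h (pad k (\<lambda>i. W i \<omega>)) \<partial>M) - (\<integral>\<omega>. g (\<lambda>i. W i \<omega>) \<partial>M)\<bar>
      \<le> (\<integral>\<omega>. e + 2 * H * (\<Sum>i<k. \<bar>W i \<omega>\<bar>) / L \<partial>M)"
      using g(2) i3 by (intro abs_expectation_diff_le M i1 i2) (auto simp: prob_space)
    also have "\<dots> = e + 2 * H * (\<Sum>i<k. (\<integral>\<omega>. \<bar>W i \<omega>\<bar> \<partial>M)) / L"
      using i3 W1(1) by (simp add: prob_space)
    also have "\<dots> \<le> e + 2 * H * (real k * \<bar>C\<bar>) / L"
    proof -
      have "(\<Sum>i<k. (\<integral>\<omega>. \<bar>W i \<omega>\<bar> \<partial>M)) \<le> (\<Sum>i<k. \<bar>C\<bar>)"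
        using W1(2) by (intro sum_mono) (metis abs_ge_self lessThan_iff order.trans)
      then show ?thesis
        using H0 L by (intro add_left_mono divide_right_mono mult_left_mono) auto
    qed
    also have "\<dots> \<le> 2 * e" using \<open>K / L \<le> e\<close> by (simp add: K_def)
    finally show ?thesis .
  qed
  have "(\<lambda>n. \<integral>\<omega>. f (\<lambda>i. Z n i \<omega>) \<partial>P n) \<longlonglongrightarrow> (\<integral>\<omega>. f (\<lambda>i. Y i \<omega>) \<partial>Q)" if "trig_sum k f" for f
    using that
  proof induction
    case (iexp c t)
    then show ?case using tendsto_mult_left[OF conv[of t], of c] by simp
  next
    case (add f f')
    have "(\<lambda>n. \<integral>\<omega>. f (\<lambda>i. Z n i \<omega>) + f' (\<lambda>i. Z n i \<omega>) \<partial>P n)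
      = (\<lambda>n. (\<integral>\<omega>. f (\<lambda>i. Z n i \<omega>) \<partial>P n) + (\<integral>\<omega>. f' (\<lambda>i. Z n i \<omega>) \<partial>P n))"
      by (intro ext Bochner_Integration.integral_add prob_space.trig_sum_integrable[OF P, where k = k]) (simp_all add: add.hyps Zm)
    moreover have "(\<integral>\<omega>. f (\<lambda>i. Y i \<omega>) + f' (\<lambda>i. Y i \<omega>) \<partial>Q)
      = (\<integral>\<omega>. f (\<lambda>i. Y i \<omega>) \<partial>Q) + (\<integral>\<omega>. f' (\<lambda>i. Y i \<omega>) \<partial>Q)"
      by (intro Bochner_Integration.integral_add prob_space.trig_sum_integrable[OF Q, where k = k]) (simp_all add: add.hyps Ym)
    ultimately show ?case
      using tendsto_add[OF add.IH] by simp
  qed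
  from tendsto_Re[OF this[OF g(1)]]
  have "(\<lambda>n. \<integral>\<omega>. g (\<lambda>i. Z n i \<omega>) \<partial>P n) \<longlonglongrightarrow> (\<integral>\<omega>. g (\<lambda>i. Y i \<omega>) \<partial>Q)"
    by (simp add: integral_complex_of_real)
  from LIMSEQ_D[OF this e] obtain n0 where
    n0: "\<And>n. n \<ge> n0 \<Longrightarrow> \<bar>(\<integral>\<omega>. g (\<lambda>i. Z n i \<omega>) \<partial>P n) - (\<integral>\<omega>. g (\<lambda>i. Y i \<omega>) \<partial>Q)\<bar> < e"
    by auto
  show "\<exists>n0. \<forall>n\<ge>n0. norm ((\<integral>\<omega>. h (pad k (\<lambda>i. Z n i \<omega>)) \<partial>P n) - (\<integral>\<omega>. h (pad k (\<lambda>i. Y i \<omega>)) \<partial>Q)) < r"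
  proof (intro exI[of _ n0] allI impI)
    fix n assume "n \<ge> n0"
    note n0[OF this]
    moreover have "\<bar>(\<integral>\<omega>. h (pad k (\<lambda>i. Z n i \<omega>)) \<partial>P n) - (\<integral>\<omega>. g (\<lambda>i. Z n i \<omega>) \<partial>P n)\<bar> \<le> 2 * e"
      by (rule close[OF P Zm Z1])
    moreover have "\<bar>(\<integral>\<omega>. h (pad k (\<lambda>i. Y i \<omega>)) \<partial>Q) - (\<integral>\<omega>. g (\<lambda>i. Y i \<omega>) \<partial>Q)\<bar> \<le> 2 * e"
      by (rule close[OF Q Ym Y1])
    moreover have "5 * e < r" using r by (simp add: e_def)
    ultimately show "norm ((\<integral>\<omega>. h (pad k (\<lambda>i. Z n i \<omega>)) \<partial>P n) - (\<integral>\<omega>. h (pad k (\<lambda>i. Y i \<omega>)) \<partial>Q)) < r"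
      unfolding real_norm_def by linarith
  qed
qed

section \<open>Series in independent standard normal coordinates\<close>

abbreviation std_normal_seq :: "(nat \<Rightarrow> real) measure" where
  "std_normal_seq \<equiv> PiM UNIV (\<lambda>_. std_normal_distribution)"

lemma prob_space_std_normal: "prob_space std_normal_distribution"
  using real_dist_normal_dist by (simp add: real_distribution_def)

interpretation gauss: product_prob_space "\<lambda>_::nat. std_normal_distribution" UNIV
  by (rule product_prob_spaceI) (rule prob_space_std_normal)

lemma coord_measurable [measurable]: "(\<lambda>\<omega>. \<omega> l) \<in> borel_measurable std_normal_seq"
  using measurable_component_singleton[of l UNIV "\<lambda>_. std_normal_distribution"] by simp

lemma distr_coord: "distr std_normal_seq borel (\<lambda>\<omega>. \<omega> l) = std_normal_distribution"
proof -
  have "distr std_normal_seq borel (\<lambda>\<omega>. \<omega> l) = distr std_normal_seq std_normal_distribution (\<lambda>\<omega>. \<omega> l)"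
    by (rule distr_cong) auto
  also have "\<dots> = std_normal_distribution"
    by (rule distr_PiM_component) (auto simp: prob_space_std_normal)
  finally show ?thesis .
qed

text \<open>Independence is read off from the law of the whole sequence, which is the product of its
  marginals by construction.\<close>

lemma indep_coord: "gauss.indep_vars (\<lambda>_. borel) (\<lambda>l \<omega>. \<omega> l) UNIV"
proof -
  have "distr std_normal_seq (PiM UNIV (\<lambda>_. borel)) (\<lambda>\<omega>. \<lambda>l\<in>UNIV. \<omega> l) = distr std_normal_seq std_normal_seq (\<lambda>\<omega>. \<omega>)"
    by (rule distr_cong) (auto intro!: sets_PiM_cong)
  also have "\<dots> = std_normal_seq" by (rule distr_id)
  also have "\<dots> = PiM UNIV (\<lambda>l. distr std_normal_seq borel (\<lambda>\<omega>. \<omega> l))"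
    by (simp add: distr_coord)
  finally show ?thesis
    by (subst gauss.indep_vars_iff_distr_eq_PiM') auto
qed

lemma distributed_coord: "distributed std_normal_seq lborel (\<lambda>\<omega>. \<omega> l) std_normal_density"
proof -
  have "distr std_normal_seq lborel (\<lambda>\<omega>. \<omega> l) = distr std_normal_seq borel (\<lambda>\<omega>. \<omega> l)"
    by (rule distr_cong) auto
  then show ?thesis
    by (auto simp: distributed_def distr_coord)
qed

text \<open>For absolutely summable coefficients the series converges almost surely. Where it does
  not, \<open>suminf\<close> still returns some value, and so the linear identities below hold
  almost everywhere only.\<close>

definition gauss_series :: "(nat \<Rightarrow> real) \<Rightarrow> (nat \<Rightarrow> real) \<Rightarrow> real" where
  "gauss_series a \<omega> = (\<Sum>l. a l * \<omega> l)"

lemma gauss_series_measurable [measurable]: "gauss_series a \<in> borel_measurable std_normal_seq"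
  unfolding gauss_series_def by measurable

lemma coord_abs_integrable:
  "integrable std_normal_seq (\<lambda>\<omega>. \<bar>\<omega> l\<bar>)" "gauss.expectation (\<lambda>\<omega>. \<bar>\<omega> l\<bar>) \<le> 1"
proof -
  have "integrable (distr std_normal_seq borel (\<lambda>\<omega>. \<omega> l)) (\<lambda>x. x)"
    "integrable (distr std_normal_seq borel (\<lambda>\<omega>. \<omega> l)) (\<lambda>x. x\<^sup>2)"
    unfolding distr_coord
    using integrable_std_normal_distribution_moment[of 1] integrable_std_normal_distribution_moment[of 2] by auto
  then have i: "integrable std_normal_seq (\<lambda>\<omega>. \<omega> l)" "integrable std_normal_seq (\<lambda>\<omega>. (\<omega> l)\<^sup>2)"
    by (auto simp: integrable_distr_eq)
  then show "integrable std_normal_seq (\<lambda>\<omega>. \<bar>\<omega> l\<bar>)" by simp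
  have "gauss.variance (\<lambda>\<omega>. \<omega> l) = 1"
    by (rule gauss.standard_normal_distributed_variance[OF distributed_coord])
  moreover have "gauss.expectation (\<lambda>\<omega>. \<omega> l) = 0"
    by (rule gauss.standard_normal_distributed_expectation[OF distributed_coord])
  ultimately have v: "gauss.expectation (\<lambda>\<omega>. (\<omega> l)\<^sup>2) = 1"
    by simp
  have "0 \<le> gauss.variance (\<lambda>\<omega>. \<bar>\<omega> l\<bar>)" by (rule gauss.variance_positive)
  also have "\<dots> = 1 - (gauss.expectation (\<lambda>\<omega>. \<bar>\<omega> l\<bar>))\<^sup>2"
    using i v by (subst gauss.variance_eq) auto
  finally show "gauss.expectation (\<lambda>\<omega>. \<bar>\<omega> l\<bar>) \<le> 1"
    by (simp add: power_le_one_iff abs_square_le_1)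
qed

text \<open>The expected sum of the absolute terms is at most the sum of the |a l|, because a
  standard normal variable has first absolute moment at most 1. A nonnegative series with finite
  expectation is finite almost surely.\<close>

lemma AE_summable_gauss:
  assumes a: "summable (\<lambda>l. \<bar>a l\<bar>)"
  shows "AE \<omega> in std_normal_seq. summable (\<lambda>l. a l * \<omega> l)"
proof -
  have "(\<integral>\<^sup>+\<omega>. (\<Sum>l. ennreal \<bar>a l * \<omega> l\<bar>) \<partial>std_normal_seq) = (\<Sum>l. \<integral>\<^sup>+\<omega>. ennreal \<bar>a l * \<omega> l\<bar> \<partial>std_normal_seq)"
    by (rule nn_integral_suminf) measurable
  also have "\<dots> \<le> (\<Sum>l. ennreal \<bar>a l\<bar>)"
  proof (rule suminf_le)
    fix l
    have "(\<integral>\<^sup>+\<omega>. ennreal \<bar>a l * \<omega> l\<bar> \<partial>std_normal_seq) = ennreal (gauss.expectation (\<lambda>\<omega>. \<bar>a l * \<omega> l\<bar>))"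
      using coord_abs_integrable(1)[of l] by (intro nn_integral_eq_integral) (auto simp: abs_mult)
    also have "\<dots> \<le> ennreal \<bar>a l\<bar>"
      using coord_abs_integrable(2)[of l] by (intro ennreal_leI) (auto simp: abs_mult mult_left_le)
    finally show "(\<integral>\<^sup>+\<omega>. ennreal \<bar>a l * \<omega> l\<bar> \<partial>std_normal_seq) \<le> ennreal \<bar>a l\<bar>" .
  qed auto
  also have "\<dots> = ennreal (\<Sum>l. \<bar>a l\<bar>)"
    using a by (intro suminf_ennreal2) auto
  also have "\<dots> < \<infinity>" by simp
  finally have "AE \<omega> in std_normal_seq. (\<Sum>l. ennreal \<bar>a l * \<omega> l\<bar>) \<noteq> \<infinity>"
    by (intro nn_integral_noteq_infinite) auto
  then show ?thesis
  proof eventually_elim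
    case (elim \<omega>)
    then have "summable (\<lambda>l. \<bar>a l * \<omega> l\<bar>)"
      by (intro summable_suminf_not_top) auto
    then show ?case by (rule summable_rabs_cancel)
  qed
qed

lemma summable_square:
  fixes a :: "nat \<Rightarrow> real"
  assumes a: "summable (\<lambda>l. \<bar>a l\<bar>)"
  shows "summable (\<lambda>l. (a l)\<^sup>2)"
proof (rule summable_comparison_test_ev[OF _ a])
  have "(\<lambda>l. \<bar>a l\<bar>) \<longlonglongrightarrow> 0" using a by (rule summable_LIMSEQ_zero)
  then have "\<forall>\<^sub>F l in sequentially. \<bar>a l\<bar> < 1" by (rule order_tendstoD) simp
  then show "\<forall>\<^sub>F l in sequentially. norm ((a l)\<^sup>2) \<le> \<bar>a l\<bar>"
  proof eventually_elim
    case (elim l)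
    then show ?case
      using mult_left_le[of "\<bar>a l\<bar>" "\<bar>a l\<bar>"] by (simp add: power2_eq_square abs_mult)
  qed
qed

text \<open>Characteristic functions of partial sums factor by independence, and dominated
  convergence passes to the series.\<close>

lemma char_gauss_series:
  assumes a: "summable (\<lambda>l. \<bar>a l\<bar>)"
  shows "gauss.expectation (\<lambda>\<omega>. iexp (gauss_series a \<omega>)) = complex_of_real (exp (- (\<Sum>l. (a l)\<^sup>2) / 2))"
proof (rule LIMSEQ_unique)
  show "(\<lambda>n. gauss.expectation (\<lambda>\<omega>. iexp (\<Sum>l<n. a l * \<omega> l))) \<longlonglongrightarrow> gauss.expectation (\<lambda>\<omega>. iexp (gauss_series a \<omega>))"
  proof (rule integral_dominated_convergence[where w = "\<lambda>_. 1"])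
    show "AE \<omega> in std_normal_seq. (\<lambda>n. iexp (\<Sum>l<n. a l * \<omega> l)) \<longlonglongrightarrow> iexp (gauss_series a \<omega>)"
      using AE_summable_gauss[OF a]
    proof eventually_elim
      case (elim \<omega>)
      then have "(\<lambda>n. \<Sum>l<n. a l * \<omega> l) \<longlonglongrightarrow> gauss_series a \<omega>"
        unfolding gauss_series_def by (rule summable_LIMSEQ)
      then show ?case by (intro tendsto_intros)
    qed
  qed (auto simp del: of_real_sum)
  have "gauss.expectation (\<lambda>\<omega>. iexp (\<Sum>l<n. a l * \<omega> l)) = complex_of_real (exp (- (\<Sum>l<n. (a l)\<^sup>2) / 2))" for n
  proof -
    have "gauss.indep_vars (\<lambda>_. borel) (\<lambda>l \<omega>. a l * \<omega> l) {..<n}"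
      by (rule gauss.indep_vars_compose2[OF gauss.indep_vars_subset[OF indep_coord]]) auto
    from gauss.char_distr_sum[OF this, of 1]
    have "gauss.expectation (\<lambda>\<omega>. iexp (\<Sum>l<n. a l * \<omega> l)) = (\<Prod>l<n. gauss.expectation (\<lambda>\<omega>. iexp (a l * \<omega> l)))"
      by (simp add: char_def integral_distr del: of_real_sum)
    also have "\<dots> = (\<Prod>l<n. complex_of_real (exp (- ((a l)\<^sup>2) / 2)))"
    proof (rule prod.cong[OF refl])
      fix l
      have "gauss.expectation (\<lambda>\<omega>. iexp (a l * \<omega> l)) = char (distr std_normal_seq borel (\<lambda>\<omega>. \<omega> l)) (a l)"
        by (simp add: char_def integral_distr)
      then show "gauss.expectation (\<lambda>\<omega>. iexp (a l * \<omega> l)) = complex_of_real (exp (- ((a l)\<^sup>2) / 2))"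
        by (simp add: distr_coord char_std_normal_distribution)
    qed
    also have "\<dots> = complex_of_real (exp (- (\<Sum>l<n. (a l)\<^sup>2) / 2))"
      by (simp add: exp_sum sum_negf[symmetric] sum_divide_distrib flip: of_real_prod del: of_real_exp)
    finally show ?thesis .
  qed
  moreover have "(\<lambda>n. complex_of_real (exp (- (\<Sum>l<n. (a l)\<^sup>2) / 2))) \<longlonglongrightarrow> complex_of_real (exp (- (\<Sum>l. (a l)\<^sup>2) / 2))"
  proof -
    show ?thesis by (intro tendsto_intros summable_LIMSEQ summable_square a) simp
  qed
  ultimately show "(\<lambda>n. gauss.expectation (\<lambda>\<omega>. iexp (\<Sum>l<n. a l * \<omega> l))) \<longlonglongrightarrow> complex_of_real (exp (- (\<Sum>l. (a l)\<^sup>2) / 2))"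
    by simp
qed

lemma AE_gauss_series_add:
  assumes "summable (\<lambda>l. \<bar>a l\<bar>)" "summable (\<lambda>l. \<bar>b l\<bar>)"
  shows "AE \<omega> in std_normal_seq. gauss_series (\<lambda>l. a l + b l) \<omega> = gauss_series a \<omega> + gauss_series b \<omega>"
  using AE_summable_gauss[OF assms(1)] AE_summable_gauss[OF assms(2)]
  by eventually_elim (simp add: gauss_series_def suminf_add distrib_right)

lemma AE_gauss_series_cmult:
  assumes "summable (\<lambda>l. \<bar>a l\<bar>)"
  shows "AE \<omega> in std_normal_seq. gauss_series (\<lambda>l. c * a l) \<omega> = c * gauss_series a \<omega>"
  using AE_summable_gauss[OF assms]
  by eventually_elim (simp add: gauss_series_def suminf_mult mult.assoc)

lemma AE_gauss_series_sum:
  assumes "finite J" "\<And>j. j \<in> J \<Longrightarrow> summable (\<lambda>l. \<bar>a j l\<bar>)"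
  shows "summable (\<lambda>l. \<bar>\<Sum>j\<in>J. c j * a j l\<bar>)"
    "AE \<omega> in std_normal_seq. gauss_series (\<lambda>l. \<Sum>j\<in>J. c j * a j l) \<omega> = (\<Sum>j\<in>J. c j * gauss_series (a j) \<omega>)"
proof -
  have "summable (\<lambda>l. \<bar>\<Sum>j\<in>J. c j * a j l\<bar>) \<and>
    (AE \<omega> in std_normal_seq. gauss_series (\<lambda>l. \<Sum>j\<in>J. c j * a j l) \<omega> = (\<Sum>j\<in>J. c j * gauss_series (a j) \<omega>))"
    using assms
  proof (induction J rule: finite_induct)
    case empty
    then show ?case by (simp add: gauss_series_def)
  next
    case (insert j J)
    have sj: "summable (\<lambda>l. \<bar>c j * a j l\<bar>)"
      using insert.prems[of j, OF insertI1] by (simp add: abs_mult summable_mult)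
    have sJ: "summable (\<lambda>l. \<bar>\<Sum>j\<in>J. c j * a j l\<bar>)" using insert.IH insert.prems by simp
    have "summable (\<lambda>l. \<bar>c j * a j l + (\<Sum>j\<in>J. c j * a j l)\<bar>)"
      by (rule summable_rabs_comparison_test[OF _ summable_add[OF sj sJ]]) (auto intro: exI[of _ 0])
    have "AE \<omega> in std_normal_seq. gauss_series (\<lambda>l. \<Sum>j\<in>J. c j * a j l) \<omega> = (\<Sum>j\<in>J. c j * gauss_series (a j) \<omega>)"
      using insert.IH insert.prems by simp
    from this AE_gauss_series_add[OF sj sJ] AE_gauss_series_cmult[OF insert.prems[of j, OF insertI1], of "c j"]
    have "AE \<omega> in std_normal_seq. gauss_series (\<lambda>l. c j * a j l + (\<Sum>j\<in>J. c j * a j l)) \<omega>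
      = c j * gauss_series (a j) \<omega> + (\<Sum>j\<in>J. c j * gauss_series (a j) \<omega>)"
      by eventually_elim simp
    with \<open>summable (\<lambda>l. \<bar>c j * a j l + (\<Sum>j\<in>J. c j * a j l)\<bar>)\<close> show ?case
      using insert.hyps by simp
  qed
  then show "summable (\<lambda>l. \<bar>\<Sum>j\<in>J. c j * a j l\<bar>)"
    "AE \<omega> in std_normal_seq. gauss_series (\<lambda>l. \<Sum>j\<in>J. c j * a j l) \<omega> = (\<Sum>j\<in>J. c j * gauss_series (a j) \<omega>)"
    by auto
qed

text \<open>Equality in law with a multiple of a single coordinate, from equality of characteristic
  functions. Moments and normality are then read off from one standard normal variable.\<close>

lemma distr_gauss_series:
  assumes a: "summable (\<lambda>l. \<bar>a l\<bar>)"
  shows "distr std_normal_seq borel (gauss_series a) =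
    distr std_normal_seq borel (\<lambda>\<omega>. sqrt (\<Sum>l. (a l)\<^sup>2) * \<omega> 0)"
proof (rule Levy_uniqueness)
  show "real_distribution (distr std_normal_seq borel (gauss_series a))"
    "real_distribution (distr std_normal_seq borel (\<lambda>\<omega>. sqrt (\<Sum>l. (a l)\<^sup>2) * \<omega> 0))"
    by (auto intro!: gauss.real_distribution_distr)
  show "char (distr std_normal_seq borel (gauss_series a)) =
    char (distr std_normal_seq borel (\<lambda>\<omega>. sqrt (\<Sum>l. (a l)\<^sup>2) * \<omega> 0))"
  proof
    fix t
    have ta: "summable (\<lambda>l. \<bar>t * a l\<bar>)" using a by (simp add: abs_mult summable_mult)
    have "char (distr std_normal_seq borel (gauss_series a)) t = gauss.expectation (\<lambda>\<omega>. iexp (t * gauss_series a \<omega>))"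
      by (simp add: char_def integral_distr)
    also have "\<dots> = gauss.expectation (\<lambda>\<omega>. iexp (gauss_series (\<lambda>l. t * a l) \<omega>))"
      using AE_gauss_series_cmult[OF a, of t] by (intro integral_cong_AE) auto
    also have "\<dots> = complex_of_real (exp (- (t\<^sup>2 * (\<Sum>l. (a l)\<^sup>2)) / 2))"
      unfolding char_gauss_series[OF ta] using summable_square[OF a]
      by (simp add: power_mult_distrib suminf_mult)
    also have "\<dots> = char std_normal_distribution (t * sqrt (\<Sum>l. (a l)\<^sup>2))"
      using suminf_nonneg[OF summable_square[OF a]]
      by (simp add: char_std_normal_distribution power_mult_distrib)
    also have "\<dots> = char (distr std_normal_seq borel (\<lambda>\<omega>. sqrt (\<Sum>l. (a l)\<^sup>2) * \<omega> 0)) t"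
    proof -
      have "char (distr std_normal_seq borel (\<lambda>\<omega>. \<omega> 0)) (t * sqrt (\<Sum>l. (a l)\<^sup>2)) =
        char (distr std_normal_seq borel (\<lambda>\<omega>. sqrt (\<Sum>l. (a l)\<^sup>2) * \<omega> 0)) t"
        by (simp add: char_def integral_distr mult.assoc)
      then show ?thesis by (simp only: distr_coord)
    qed
    finally show "char (distr std_normal_seq borel (gauss_series a)) t =
      char (distr std_normal_seq borel (\<lambda>\<omega>. sqrt (\<Sum>l. (a l)\<^sup>2) * \<omega> 0)) t" .
  qed
qed

lemma gauss_coord_moments:
  "integrable std_normal_seq (\<lambda>\<omega>. \<omega> l)" "integrable std_normal_seq (\<lambda>\<omega>. (\<omega> l)\<^sup>2)"
  "gauss.expectation (\<lambda>\<omega>. \<omega> l) = 0" "gauss.expectation (\<lambda>\<omega>. (\<omega> l)\<^sup>2) = 1"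
proof -
  have "integrable (distr std_normal_seq borel (\<lambda>\<omega>. \<omega> l)) (\<lambda>x. x)"
    "integrable (distr std_normal_seq borel (\<lambda>\<omega>. \<omega> l)) (\<lambda>x. x\<^sup>2)"
    unfolding distr_coord
    using integrable_std_normal_distribution_moment[of 1] integrable_std_normal_distribution_moment[of 2] by auto
  then show i: "integrable std_normal_seq (\<lambda>\<omega>. \<omega> l)" "integrable std_normal_seq (\<lambda>\<omega>. (\<omega> l)\<^sup>2)"
    by (auto simp: integrable_distr_eq)
  show e: "gauss.expectation (\<lambda>\<omega>. \<omega> l) = 0"
    by (rule gauss.standard_normal_distributed_expectation[OF distributed_coord])
  have "gauss.variance (\<lambda>\<omega>. \<omega> l) = 1"
    by (rule gauss.standard_normal_distributed_variance[OF distributed_coord])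
  then show "gauss.expectation (\<lambda>\<omega>. (\<omega> l)\<^sup>2) = 1" using e by simp
qed

lemma gauss_series_moments:
  assumes a: "summable (\<lambda>l. \<bar>a l\<bar>)"
  shows "integrable std_normal_seq (gauss_series a)"
    "integrable std_normal_seq (\<lambda>\<omega>. (gauss_series a \<omega>)\<^sup>2)"
    "gauss.expectation (gauss_series a) = 0"
    "gauss.expectation (\<lambda>\<omega>. (gauss_series a \<omega>)\<^sup>2) = (\<Sum>l. (a l)\<^sup>2)"
proof -
  let ?s = "sqrt (\<Sum>l. (a l)\<^sup>2)"
  have int: "integrable std_normal_seq (\<lambda>\<omega>. f (gauss_series a \<omega>)) \<longleftrightarrow> integrable std_normal_seq (\<lambda>\<omega>. f (?s * \<omega> 0))"
    and ex: "gauss.expectation (\<lambda>\<omega>. f (gauss_series a \<omega>)) = gauss.expectation (\<lambda>\<omega>. f (?s * \<omega> 0))"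
    if "f \<in> borel_measurable borel" for f :: "real \<Rightarrow> real"
  proof -
    have m: "(\<lambda>\<omega>. ?s * \<omega> 0) \<in> borel_measurable std_normal_seq" by measurable
    show "integrable std_normal_seq (\<lambda>\<omega>. f (gauss_series a \<omega>)) \<longleftrightarrow> integrable std_normal_seq (\<lambda>\<omega>. f (?s * \<omega> 0))"
      using integrable_distr_eq[OF gauss_series_measurable that, of a] integrable_distr_eq[OF m that]
      by (simp only: distr_gauss_series[OF a])
    show "gauss.expectation (\<lambda>\<omega>. f (gauss_series a \<omega>)) = gauss.expectation (\<lambda>\<omega>. f (?s * \<omega> 0))"
      using integral_distr[OF gauss_series_measurable that, of a] integral_distr[OF m that]
      by (simp only: distr_gauss_series[OF a])
  qed
  show "integrable std_normal_seq (gauss_series a)"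
    using int[of "\<lambda>x. x"] gauss_coord_moments by auto
  show "integrable std_normal_seq (\<lambda>\<omega>. (gauss_series a \<omega>)\<^sup>2)"
    using int[of "\<lambda>x. x\<^sup>2"] gauss_coord_moments by (auto simp: power_mult_distrib)
  show "gauss.expectation (gauss_series a) = 0"
    using ex[of "\<lambda>x. x"] gauss_coord_moments by auto
  show "gauss.expectation (\<lambda>\<omega>. (gauss_series a \<omega>)\<^sup>2) = (\<Sum>l. (a l)\<^sup>2)"
    using ex[of "\<lambda>x. x\<^sup>2"] gauss_coord_moments suminf_nonneg[OF summable_square[OF a]]
    by (auto simp: power_mult_distrib)
qed

text \<open>Polarization of the variance formula.\<close>

lemma gauss_series_covariance:
  assumes a: "summable (\<lambda>l. \<bar>a l\<bar>)" and b: "summable (\<lambda>l. \<bar>b l\<bar>)"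
  shows "gauss.expectation (\<lambda>\<omega>. gauss_series a \<omega> * gauss_series b \<omega>) = (\<Sum>l. a l * b l)"
proof -
  have ab: "summable (\<lambda>l. \<bar>a l + b l\<bar>)"
    by (rule summable_rabs_comparison_test[OF _ summable_add[OF a b]]) (auto intro: exI[of _ 0])
  have "gauss.expectation (\<lambda>\<omega>. gauss_series a \<omega> * gauss_series b \<omega>) =
    gauss.expectation (\<lambda>\<omega>. ((gauss_series (\<lambda>l. a l + b l) \<omega>)\<^sup>2 - (gauss_series a \<omega>)\<^sup>2 - (gauss_series b \<omega>)\<^sup>2) / 2)"
    using AE_gauss_series_add[OF a b]
    by (intro integral_cong_AE) (auto elim!: eventually_mono simp: power2_eq_square algebra_simps)
  also have "\<dots> = ((\<Sum>l. (a l + b l)\<^sup>2) - (\<Sum>l. (a l)\<^sup>2) - (\<Sum>l. (b l)\<^sup>2)) / 2"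
    using gauss_series_moments[OF a] gauss_series_moments[OF b] gauss_series_moments[OF ab] by simp
  also have "\<dots> = (\<Sum>l. ((a l + b l)\<^sup>2 - (a l)\<^sup>2 - (b l)\<^sup>2) / 2)"
    using summable_square[OF a] summable_square[OF b] summable_square[OF ab]
    by (simp add: suminf_diff suminf_divide summable_diff)
  also have "\<dots> = (\<Sum>l. a l * b l)"
    by (intro suminf_cong) (simp add: power2_eq_square algebra_simps)
  finally show ?thesis .
qed

text \<open>A vanishing sum of squares forces all coefficients to vanish, which gives the point mass
  at 0; otherwise the standard deviation is positive and a density exists.\<close>

lemma normal_rv_gauss_series:
  assumes a: "summable (\<lambda>l. \<bar>a l\<bar>)" and X: "X \<in> borel_measurable std_normal_seq"
    and eq: "AE \<omega> in std_normal_seq. X \<omega> = gauss_series a \<omega>"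
  shows "normal_rv std_normal_seq X"
proof (cases "(\<Sum>l. (a l)\<^sup>2) = 0")
  case True
  then have "\<forall>l. (a l)\<^sup>2 = 0"
    using suminf_eq_zero_iff[OF summable_square[OF a]] by simp
  then have "gauss_series a \<omega> = 0" for \<omega> by (simp add: gauss_series_def)
  then show ?thesis using X eq by (auto simp: normal_rv_def)
next
  case False
  let ?s = "sqrt (\<Sum>l. (a l)\<^sup>2)"
  have s: "?s > 0" using False suminf_nonneg[OF summable_square[OF a]] by simp
  have "distributed std_normal_seq lborel (\<lambda>\<omega>. 0 + ?s * \<omega> 0) (normal_density (0 + ?s * 0) (\<bar>?s\<bar> * 1))"
    by (rule gauss.normal_density_affine[OF distributed_coord]) (use s in auto)
  then have D: "distributed std_normal_seq lborel (\<lambda>\<omega>. ?s * \<omega> 0) (normal_density 0 ?s)"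
    using s by simp
  have "distr std_normal_seq lborel X = distr std_normal_seq borel (gauss_series a)"
    using X eq by (intro distr_cong_AE) auto
  also have "\<dots> = distr std_normal_seq lborel (\<lambda>\<omega>. ?s * \<omega> 0)"
    unfolding distr_gauss_series[OF a] by (rule distr_cong) auto
  finally have "distributed std_normal_seq lborel X (normal_density 0 ?s)"
    using D X by (simp add: distributed_def)
  then show ?thesis using X s unfolding normal_rv_def by blast
qed

subsection \<open>Walks on the tree and the covariance kernel\<close>

text \<open>The probability that simple random walk on the tree is at the root after \<open>a\<close> steps, as a function of the
  starting distance, at \<open>l - 1\<close> minus at \<open>l + 1\<close>.\<close>

fun tree_diff :: "real \<Rightarrow> nat \<Rightarrow> nat \<Rightarrow> real" where
  "tree_diff d 0 l = (if l = 1 then 1 else 0)"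
| "tree_diff d (Suc a) l = (if l = 0 then 0 else (tree_diff d a (l - 1) + (d - 1) * tree_diff d a (l + 1)) / d)"

lemma tree_diff_0 [simp]: "tree_diff d a 0 = 0"
  by (cases a) auto

lemma tree_diff_eq_0: "a + 1 < l \<Longrightarrow> tree_diff d a l = 0"
  by (induction a arbitrary: l) auto

text \<open>For l > 0 the generating function of \<open>tree_diff d a l\<close> in \<open>a\<close>
  is (d / x) lam^l, where lam is the small root of lam = (x / d) (1 + (d - 1) lam^2). Hence the
  product for \<open>l\<close> and \<open>m\<close> is d / x times the one for \<open>l + m\<close>.
  The induction proves this identity of coefficients without power series.\<close>

lemma tree_diff_convolution:
  assumes "d \<noteq> 0" "l > 0" "m > 0"
  shows "(\<Sum>a\<le>k. tree_diff d a l * tree_diff d (k - a) m) = d * tree_diff d (Suc k) (l + m)"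
  using assms(2)
proof (induction k arbitrary: l)
  case 0
  then show ?case using assms by auto
next
  case (Suc k)
  have "(\<Sum>a\<le>Suc k. tree_diff d a l * tree_diff d (Suc k - a) m)
      = tree_diff d 0 l * tree_diff d (Suc k) m + (\<Sum>a\<le>k. tree_diff d (Suc a) l * tree_diff d (k - a) m)"
    by (subst sum.atMost_Suc_shift) simp
  also have "(\<Sum>a\<le>k. tree_diff d (Suc a) l * tree_diff d (k - a) m)
      = ((\<Sum>a\<le>k. tree_diff d a (l - 1) * tree_diff d (k - a) m)
          + (d - 1) * (\<Sum>a\<le>k. tree_diff d a (l + 1) * tree_diff d (k - a) m)) / d"
    using Suc.prems assms by (simp add: sum_distrib_left sum.distrib[symmetric] sum_divide_distrib field_simps)
  also have "(\<Sum>a\<le>k. tree_diff d a (l + 1) * tree_diff d (k - a) m) = d * tree_diff d (Suc k) (l + 1 + m)"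
    by (rule Suc.IH) simp
  also have "tree_diff d 0 l * tree_diff d (Suc k) m + ((\<Sum>a\<le>k. tree_diff d a (l - 1) * tree_diff d (k - a) m)
          + (d - 1) * (d * tree_diff d (Suc k) (l + 1 + m))) / d = d * tree_diff d (Suc (Suc k)) (l + m)"
  proof (cases "l = 1")
    case True
    then show ?thesis using assms by (simp add: field_simps del: tree_diff.simps(2)) (simp add: tree_diff.simps(2)[of d "Suc k"] field_simps del: tree_diff.simps(2))
  next
    case False
    then have l: "l - 1 > 0" using Suc.prems by simp
    show ?thesis
      unfolding Suc.IH[OF l] using False l assms
      by (simp add: tree_diff.simps(2)[of d "Suc k"] field_simps del: tree_diff.simps)
         (simp add: algebra_simps)
  qed
  finally show ?case .
qed

text \<open>The weight \<open>(d - 1) ^ (l - 1) * d\<close> symmetrizes the two-step recurrence of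
  \<open>tree_diff\<close>: moves up and down get equal coefficients, as for multiplication by
  \<open>cos t\<close> in the sine basis. Odd time and even distance are what the convolution of two
  differences at the same distance \<open>l\<close> produces.\<close>

definition sine_coeff :: "real \<Rightarrow> nat \<Rightarrow> nat \<Rightarrow> real" where
  "sine_coeff d j l = (d - 1) ^ (l - 1) * d * tree_diff d (2 * j + 1) (2 * l)"

lemma sine_coeff_0 [simp]: "sine_coeff d j 0 = 0"
  by (simp add: sine_coeff_def)

lemma sine_coeff_eq_0: "j + 1 < l \<Longrightarrow> sine_coeff d j l = 0"
  by (simp add: sine_coeff_def tree_diff_eq_0)

lemma sine_coeff_base:
  assumes "d \<noteq> 0"
  shows "sine_coeff d 0 l = (if l = 1 then 1 else 0)"
  using assms by (auto simp: sine_coeff_def)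

lemma sine_coeff_Suc:
  assumes "d > 1" "l > 0"
  shows "sine_coeff d (Suc j) l = (d - 1) / d\<^sup>2 *
    (2 * sine_coeff d j l + sine_coeff d j (l + 1) + sine_coeff d j (l - 1))"
proof -
  let ?D = "tree_diff d (2 * j + 1)"
  have eq: "tree_diff d (2 * Suc j + 1) (2 * l) =
    (?D (2 * (l - 1)) + 2 * (d - 1) * ?D (2 * l) + (d - 1)\<^sup>2 * ?D (2 * (l + 1))) / d\<^sup>2"
  proof -
    have s: "2 * Suc j + 1 = Suc (Suc (2 * j + 1))" "2 * l - 1 - 1 = 2 * (l - 1)" "2 * l - 1 + 1 = 2 * l"
      "2 * l + 1 - 1 = 2 * l" "2 * l + 1 + 1 = 2 * (l + 1)"
      using assms by auto
    show ?thesis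
      unfolding s(1) tree_diff.simps(2)[of d "Suc (2 * j + 1)"] tree_diff.simps(2)[of d "2 * j + 1"] s(2-)
      using assms by (simp add: field_simps power2_eq_square del: tree_diff.simps)
  qed
  define A B C p r where "A = ?D (2 * (l - 1))" and "B = ?D (2 * l)" and "C = ?D (2 * (l + 1))"
    and "p = (d - 1) ^ (l - 1)" and "r = (d - 1) ^ (l - 1 - 1) * A"
  \<comment> \<open>At l = 1 the truncated exponent \<open>l - 1 - 1\<close> is off by one, but
    \<open>A\<close> is then 0.\<close>
  have pA: "p * A = (d - 1) * r"
  proof (cases "l = 1")
    case False
    then have "l - 1 = Suc (l - 1 - 1)" using assms by simp
    then have "p = (d - 1) * (d - 1) ^ (l - 1 - 1)"
      unfolding p_def by (metis power_Suc)
    then show ?thesis by (simp add: r_def)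
  qed (simp add: A_def r_def)
  have pl: "(d - 1) ^ (l + 1 - 1) = p * (d - 1)"
    using assms power_minus_mult[of l "d - 1"] by (simp add: p_def)
  have "sine_coeff d (Suc j) l = d * ((d - 1) * r + p * (2 * (d - 1) * B + (d - 1)\<^sup>2 * C)) / d\<^sup>2"
    unfolding sine_coeff_def eq A_def[symmetric] B_def[symmetric] C_def[symmetric] p_def[symmetric] pA[symmetric]
    by (simp add: algebra_simps)
  moreover have "sine_coeff d j l = p * d * B" "sine_coeff d j (l + 1) = p * (d - 1) * d * C" "sine_coeff d j (l - 1) = d * r"
    unfolding sine_coeff_def pl A_def[symmetric] B_def[symmetric] C_def[symmetric] p_def[symmetric] r_def
    by (simp_all add: algebra_simps)
  moreover have "d * ((d - 1) * r + p * (2 * (d - 1) * B + (d - 1)\<^sup>2 * C)) =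
      (d - 1) * (2 * (p * d * B) + p * (d - 1) * d * C + d * r)"
    by (simp add: power2_eq_square algebra_simps)
  ultimately show ?thesis
    by (simp only: times_divide_eq_left)
qed

text \<open>The coefficients of the recurrence add up to 4 (d - 1) / d^2, which is at most
  1.\<close>

lemma sine_coeff_bound:
  assumes "d \<ge> 2"
  shows "\<bar>sine_coeff d j l\<bar> \<le> 1"
proof (induction j arbitrary: l)
  case 0
  then show ?case using assms by (simp add: sine_coeff_base)
next
  case (Suc j)
  show ?case
  proof (cases "l = 0")
    case False
    have "\<bar>2 * sine_coeff d j l + sine_coeff d j (l + 1) + sine_coeff d j (l - 1)\<bar> \<le> 4"
      using Suc[of l] Suc[of "l + 1"] Suc[of "l - 1"] by linarith
    moreover have "(d - 1) / d\<^sup>2 * 4 \<le> 1"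
    proof -
      have "0 \<le> (d - 2)\<^sup>2" by simp
      then have "(d - 1) * 4 \<le> d\<^sup>2" by (simp add: power2_eq_square algebra_simps)
      then show ?thesis using assms by (simp add: field_simps)
    qed
    moreover have "0 \<le> (d - 1) / d\<^sup>2" using assms by simp
    ultimately have "(d - 1) / d\<^sup>2 * \<bar>2 * sine_coeff d j l + sine_coeff d j (l + 1) + sine_coeff d j (l - 1)\<bar> \<le> 1"
      by (meson mult_left_mono order_trans)
    then show ?thesis
      using False assms by (simp add: sine_coeff_Suc abs_mult)
  qed simp
qed

definition cos_param :: "real \<Rightarrow> real \<Rightarrow> real" where
  "cos_param d t = 2 * (d - 1) / d\<^sup>2 * (1 + cos t)"

text \<open>A step in \<open>j\<close> multiplies by (d - 1) / d^2 times 2 + 2 cos t, and 2 cos t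
  sin (l t) = sin ((l + 1) t) + sin ((l - 1) t) is the shift that appears in
  \<open>sine_coeff_Suc\<close>.\<close>

lemma sine_expansion:
  assumes "d > 1" "j + 1 \<le> N"
  shows "cos_param d t ^ j * sin t = (\<Sum>l\<le>N. sine_coeff d j l * sin (l * t))"
  using assms(2)
proof (induction j arbitrary: N)
  case 0
  then have "(\<Sum>l\<le>N. sine_coeff d 0 l * sin (l * t)) = (\<Sum>l\<in>{1}. sine_coeff d 0 l * sin (l * t))"
    using assms by (intro sum.mono_neutral_right) (auto simp: sine_coeff_base)
  then show ?case using assms by (simp add: sine_coeff_base)
next
  case (Suc j)
  then obtain M where N: "N = Suc M" and M: "j + 1 \<le> M" by (cases N) auto
  let ?b = "sine_coeff d j"
  \<comment> \<open>Both shifts of the index are free of boundary terms: the coefficient at 0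
    vanishes, and so do those beyond \<open>j + 1\<close>, which is less than
    \<open>N\<close>.\<close>
  have up: "(\<Sum>l\<le>N. ?b (l - 1) * sin (l * t)) = (\<Sum>l\<le>N. ?b l * sin (real l * t + t))"
  proof -
    have "(\<Sum>l\<le>N. ?b (l - 1) * sin (l * t)) = (\<Sum>l\<le>M. ?b l * sin (real l * t + t))"
      unfolding N by (subst sum.atMost_Suc_shift) (simp add: algebra_simps)
    also have "\<dots> = (\<Sum>l\<le>N. ?b l * sin (real l * t + t))"
      unfolding N using M by (simp add: sine_coeff_eq_0)
    finally show ?thesis .
  qed
  have down: "(\<Sum>l\<le>N. ?b (l + 1) * sin (l * t)) = (\<Sum>l\<le>N. ?b l * sin (real l * t - t))"
  proof -
    have "(\<Sum>l\<le>N. ?b (l + 1) * sin (l * t)) = (\<Sum>l\<le>M. ?b (l + 1) * sin (l * t))"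
      unfolding N using M by (simp add: sine_coeff_eq_0)
    also have "\<dots> = (\<Sum>l\<le>N. ?b l * sin (real l * t - t))"
      unfolding N by (subst sum.atMost_Suc_shift) (simp add: algebra_simps)
    finally show ?thesis .
  qed
  have "cos_param d t ^ Suc j * sin t = cos_param d t * (\<Sum>l\<le>N. ?b l * sin (l * t))"
    using Suc.IH[of N] N M by simp
  also have "\<dots> = (d - 1) / d\<^sup>2 * (\<Sum>l\<le>N. ?b l * (2 * sin (l * t) + 2 * cos t * sin (l * t)))"
  proof -
    have "cos_param d t = (d - 1) / d\<^sup>2 * (2 + 2 * cos t)"
      by (simp add: cos_param_def field_simps)
    moreover have "(2 + 2 * cos t) * (\<Sum>l\<le>N. ?b l * sin (l * t)) = (\<Sum>l\<le>N. ?b l * (2 * sin (l * t) + 2 * cos t * sin (l * t)))"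
      unfolding sum_distrib_left by (intro sum.cong) (simp_all add: algebra_simps)
    ultimately show ?thesis by (simp only: mult.assoc)
  qed
  also have "\<dots> = (d - 1) / d\<^sup>2 * (\<Sum>l\<le>N. ?b l * (2 * sin (l * t)) + ?b l * sin (real l * t + t) + ?b l * sin (real l * t - t))"
    by (simp add: sin_add sin_diff algebra_simps)
  also have "\<dots> = (d - 1) / d\<^sup>2 * (\<Sum>l\<le>N. (2 * ?b l + ?b (l + 1) + ?b (l - 1)) * sin (l * t))"
    unfolding sum.distrib up[symmetric] down[symmetric] by (simp add: sum.distrib algebra_simps)
  also have "\<dots> = (\<Sum>l\<le>N. sine_coeff d (Suc j) l * sin (l * t))"
    unfolding sum_distrib_left
  proof (rule sum.cong[OF refl])
    fix l assume "l \<in> {..N}"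
    show "(d - 1) / d\<^sup>2 * ((2 * ?b l + ?b (l + 1) + ?b (l - 1)) * sin (real l * t)) = sine_coeff d (Suc j) l * sin (real l * t)"
      using assms by (cases "l = 0") (simp_all add: sine_coeff_Suc)
  qed
  finally show ?case .
qed

section \<open>Orthogonality of sines, the Poisson kernel and the closed form of the
  covariance\<close>

lemma integral_sin_sin:
  fixes l m :: nat
  assumes "l > 0" "m > 0"
  shows "((\<lambda>t. sin (l * t) * sin (m * t)) has_integral (if l = m then pi / 2 else 0)) {0..pi}"
proof (cases "l = m")
  case True
  have "((\<lambda>t. sin (l * t) * sin (l * t)) has_integral
      (pi / 2 - sin (2 * real l * pi) / (4 * real l)) - (0 / 2 - sin (2 * real l * 0) / (4 * real l))) {0..pi}"
  proof (rule fundamental_theorem_of_calculus)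
    fix t assume "t \<in> {0..pi}"
    have *: "1 / 2 - cos (2 * real l * t) * (2 * real l) / (4 * real l) = sin (l * t) * sin (l * t)"
      using assms cos_double_sin[of "l * t"] by (simp add: power2_eq_square field_simps)
    have "((\<lambda>t. t / 2 - sin (2 * real l * t) / (4 * real l)) has_real_derivative
       1 / 2 - cos (2 * real l * t) * (2 * real l) / (4 * real l)) (at t within {0..pi})"
      using assms by (auto intro!: derivative_eq_intros)
    then show "((\<lambda>t. t / 2 - sin (2 * real l * t) / (4 * real l)) has_vector_derivative
       sin (l * t) * sin (l * t)) (at t within {0..pi})"
      by (simp only: * has_real_derivative_iff_has_vector_derivative)
  qed simp
  moreover have "sin (2 * real l * pi) = 0"
    using sin_npi[of "2 * l"] by simp
  ultimately show ?thesis using True by simp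
next
  case False
  define p q where "p = real l - real m" and "q = real l + real m"
  have pq: "p \<noteq> 0" "q \<noteq> 0" using False assms by (auto simp: p_def q_def)
  have "((\<lambda>t. sin (l * t) * sin (m * t)) has_integral
      (sin (p * pi) / (2 * p) - sin (q * pi) / (2 * q)) - (sin (p * 0) / (2 * p) - sin (q * 0) / (2 * q))) {0..pi}"
  proof (rule fundamental_theorem_of_calculus)
    fix t assume "t \<in> {0..pi}"
    have *: "cos (p * t) * p / (2 * p) - cos (q * t) * q / (2 * q) = sin (l * t) * sin (m * t)"
      using pq sin_times_sin[of "l * t" "m * t"] by (simp add: p_def[symmetric] q_def[symmetric] field_simps)
         (simp add: p_def q_def algebra_simps)
    have "((\<lambda>t. sin (p * t) / (2 * p) - sin (q * t) / (2 * q)) has_real_derivative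
       cos (p * t) * p / (2 * p) - cos (q * t) * q / (2 * q)) (at t within {0..pi})"
      using pq by (auto intro!: derivative_eq_intros)
    then show "((\<lambda>t. sin (p * t) / (2 * p) - sin (q * t) / (2 * q)) has_vector_derivative
       sin (l * t) * sin (m * t)) (at t within {0..pi})"
      by (simp only: * has_real_derivative_iff_has_vector_derivative)
  qed simp
  moreover have "sin (p * pi) = 0" "sin (q * pi) = 0"
    using sin_integer_2pi sin_zero_iff_int2[of "p * pi"] sin_zero_iff_int2[of "q * pi"]
    by (auto simp: p_def q_def intro: exI[of _ "int l - int m"] exI[of _ "int l + int m"])
  ultimately show ?thesis using False by simp
qed

lemma iterated_integral_uniform_limit:
  fixes h :: "nat \<Rightarrow> real \<times> real \<Rightarrow> real"
  assumes r: "0 \<le> r" and c: "\<And>n. continuous_on ({0..r} \<times> {0..r}) (h n)"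
    and u: "uniform_limit ({0..r} \<times> {0..r}) h g sequentially"
  shows "(\<lambda>n. integral {0..r} (\<lambda>y. integral {0..r} (\<lambda>x. h n (y, x))))
    \<longlonglongrightarrow> integral {0..r} (\<lambda>y. integral {0..r} (\<lambda>x. g (y, x)))"
proof -
  have cg: "continuous_on ({0..r} \<times> {0..r}) g"
    by (rule uniform_limit_theorem[OF _ u]) (use c in auto)
  have sect: "continuous_on {0..r} (\<lambda>x. k (y, x))" if "continuous_on ({0..r} \<times> {0..r}) k" "y \<in> {0..r}"
    for k :: "real \<times> real \<Rightarrow> real" and y
    by (rule continuous_on_compose2[OF that(1)]) (use that(2) in \<open>auto intro!: continuous_intros\<close>)
  have inner: "continuous_on {0..r} (\<lambda>y. integral {0..r} (\<lambda>x. h n (y, x)))" for n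
    using integral_continuous_on_param[of "{0..r}" 0 r "\<lambda>y x. h n (y, x)"] c[of n] by simp
  have "uniform_limit {0..r} (\<lambda>n y. integral {0..r} (\<lambda>x. h n (y, x))) (\<lambda>y. integral {0..r} (\<lambda>x. g (y, x))) sequentially"
  proof (rule uniform_limitI)
    fix e :: real assume e: "e > 0"
    define e' where "e' = e / (2 * (r + 1))"
    have e': "e' > 0" using e r by (simp add: e'_def)
    have "e' * r < e' * (2 * (r + 1))" using e' r by (intro mult_strict_left_mono) auto
    also have "\<dots> = e" using r by (simp add: e'_def)
    finally have e'r: "e' * r < e" .
    from uniform_limitD[OF u e']
    show "\<forall>\<^sub>F n in sequentially. \<forall>y\<in>{0..r}. dist (integral {0..r} (\<lambda>x. h n (y, x))) (integral {0..r} (\<lambda>x. g (y, x))) < e"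
    proof eventually_elim
      case (elim n)
      show ?case
      proof
        fix y assume y: "y \<in> {0..r}"
        have "norm (integral {0..r} (\<lambda>x. h n (y, x) - g (y, x))) \<le> e' * (r - 0)"
          using elim y r by (intro integral_bound continuous_intros sect c cg) (force simp: dist_real_def)+
        also have "integral {0..r} (\<lambda>x. h n (y, x) - g (y, x)) = integral {0..r} (\<lambda>x. h n (y, x)) - integral {0..r} (\<lambda>x. g (y, x))"
          by (intro Henstock_Kurzweil_Integration.integral_diff integrable_continuous_real sect c cg y)
        finally show "dist (integral {0..r} (\<lambda>x. h n (y, x))) (integral {0..r} (\<lambda>x. g (y, x))) < e"
          using e'r by (simp add: dist_norm)
      qed
    qed
  qed
  from uniform_limit_integral[OF this inner] obtain I J where IJ:
    "\<And>n. ((\<lambda>y. integral {0..r} (\<lambda>x. h n (y, x))) has_integral I n) {0..r}"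
    "((\<lambda>y. integral {0..r} (\<lambda>x. g (y, x))) has_integral J) {0..r}" "I \<longlonglongrightarrow> J"
    by auto
  have "I = (\<lambda>n. integral {0..r} (\<lambda>y. integral {0..r} (\<lambda>x. h n (y, x))))"
    by (rule ext) (rule integral_unique[OF IJ(1), symmetric])
  with IJ(2,3) show ?thesis by (simp add: integral_unique)
qed

lemma set_lebesgue_eq_integral:
  fixes f :: "real \<Rightarrow> real"
  assumes "continuous_on {a..b} f"
  shows "(LBINT x:{a..b}. f x) = integral {a..b} f"
  by (rule set_borel_integral_eq_integral(2)[OF borel_integrable_atLeastAtMost'[OF assms]])

lemma rho_bounds:
  assumes "d \<ge> 2"
  shows "0 < rho d" "rho d \<le> 1"
proof -
  have d: "real d \<ge> 2" using assms by simp
  show "0 < rho d" using d by (simp add: rho_def)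
  have "0 \<le> (real d - 2)\<^sup>2" by simp
  then have "(real d - 1) * 4 \<le> (real d)\<^sup>2" by (simp add: power2_eq_square algebra_simps)
  then show "rho d \<le> 1" using d by (simp add: rho_def field_simps)
qed

lemma integral_cos_param:
  assumes d: "d \<ge> 2" and f: "continuous_on {0..rho d} f"
  shows "integral {0..rho d} f = integral {0..pi} (\<lambda>t. f (cos_param d t) * (rho d / 2 * sin t))"
    "cos_param d t \<in> {0..rho d}"
proof -
  have cp: "cos_param d t = rho d / 2 * (1 + cos t)" for t
    using d by (simp add: cos_param_def rho_def field_simps)
  have r: "0 < rho d" using rho_bounds d by simp
  have range: "cos_param d t \<in> {0..rho d}" for t
  proof -
    have "0 \<le> 1 + cos t" "1 + cos t \<le> 2"
      using cos_ge_minus_one[of t] cos_le_one[of t] by linarith+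
    then have "0 \<le> rho d / 2 * (1 + cos t)" "rho d / 2 * (1 + cos t) \<le> rho d / 2 * 2"
      using r by (auto intro!: mult_left_mono)
    then show ?thesis by (simp add: cp)
  qed
  show "cos_param d t \<in> {0..rho d}" by fact
  \<comment> \<open>\<open>cos_param\<close> decreases from \<open>rho d\<close> to 0, hence the
    minus sign and the difference of two oriented integrals, the first of which is over an empty
    interval.\<close>
  have "((\<lambda>t. (- (rho d / 2 * sin t)) *\<^sub>R f (cos_param d t)) has_integral
      integral {cos_param d 0..cos_param d pi} f - integral {cos_param d pi..cos_param d 0} f) {0..pi}"
  proof (rule has_integral_substitution_general[where s = "{}"])
    show "(cos_param d has_field_derivative - (rho d / 2 * sin t)) (at t within {0..pi})" for t
      unfolding cp[abs_def] by (auto intro!: derivative_eq_intros)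
    show "continuous_on {0..pi} (cos_param d)"
      unfolding cp[abs_def] by (intro continuous_intros)
    show "cos_param d ` {0..pi} \<subseteq> {0..rho d}" using range by auto
  qed (use f in auto)
  then have "((\<lambda>t. (- (rho d / 2 * sin t)) *\<^sub>R f (cos_param d t)) has_integral - integral {0..rho d} f) {0..pi}"
    using r by (simp add: cp)
  from has_integral_neg[OF this]
  have "((\<lambda>t. f (cos_param d t) * (rho d / 2 * sin t)) has_integral integral {0..rho d} f) {0..pi}"
    by (simp add: mult_ac)
  then show "integral {0..rho d} f = integral {0..pi} (\<lambda>t. f (cos_param d t) * (rho d / 2 * sin t))"
    by (rule integral_unique[symmetric])
qed

text \<open>The real part of the geometric series with ratio q exp (i t).\<close>

lemma geometric_cos_sums:
  fixes q t :: real
  assumes "\<bar>q\<bar> < 1"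
  shows "(\<lambda>k. q ^ k * cos (k * t)) sums ((1 - q * cos t) / (1 - 2 * q * cos t + q\<^sup>2))"
proof -
  let ?z = "of_real q * cis t"
  have n: "norm ?z < 1" using assms by (simp add: norm_mult)
  from sums_Re[OF geometric_sums[OF n]]
  have "(\<lambda>k. Re (?z ^ k)) sums Re (1 / (1 - ?z))" .
  moreover have "Re (?z ^ k) = q ^ k * cos (k * t)" for k
    by (simp add: power_mult_distrib Complex.DeMoivre flip: of_real_power)
  moreover have "Re (1 / (1 - ?z)) = (1 - q * cos t) / (1 - 2 * q * cos t + q\<^sup>2)"
  proof -
    have "(q * sin t)\<^sup>2 = q\<^sup>2 - (q * cos t)\<^sup>2"
      by (simp add: power_mult_distrib sin_squared_eq right_diff_distrib)
    then have "(1 - q * cos t)\<^sup>2 + (q * sin t)\<^sup>2 = 1 - 2 * q * cos t + q\<^sup>2"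
      by (simp add: power2_diff)
    then show ?thesis by (simp add: Re_divide power_mult_distrib)
  qed
  ultimately show ?thesis by simp
qed

text \<open>The squared modulus of 1 - q exp (i t), that is, the denominator of the Poisson
  kernel.\<close>

definition poisson_den :: "real \<Rightarrow> real \<Rightarrow> real" where
  "poisson_den q t = 1 - 2 * q * cos t + q\<^sup>2"

lemma poisson_den_pos:
  assumes "\<bar>q\<bar> < 1"
  shows "poisson_den q t > 0"
proof -
  have "poisson_den q t = (q - cos t)\<^sup>2 + (sin t)\<^sup>2"
    by (simp add: poisson_den_def sin_squared_eq power2_diff)
  moreover have "(q - cos t)\<^sup>2 + (sin t)\<^sup>2 \<noteq> 0"
  proof
    assume "(q - cos t)\<^sup>2 + (sin t)\<^sup>2 = 0"
    then have "sin t = 0" "cos t = q" by (simp_all add: sum_power2_eq_zero_iff)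
    then have "q\<^sup>2 = 1" using sin_cos_squared_add[of t] by simp
    then show False using assms by (simp add: power2_eq_1_iff abs_if split: if_splits)
  qed
  ultimately show ?thesis by (metis add_nonneg_nonneg less_eq_real_def zero_le_power2)
qed

definition sine_kernel :: "real \<Rightarrow> real \<Rightarrow> real \<Rightarrow> real" where
  "sine_kernel q t s = q * (1 - q\<^sup>2) * (sin t * sin s) / (poisson_den q (t - s) * poisson_den q (t + s))"

text \<open>A product of sines is half the difference of the cosines at t - s and t + s; the two
  Poisson sums, put over a common denominator, give the closed form.\<close>

lemma sine_kernel_sums:
  fixes q t s :: real
  assumes "\<bar>q\<bar> < 1"
  shows "(\<lambda>k. q ^ k * (sin (k * t) * sin (k * s))) sums sine_kernel q t s"
proof -
  let ?a = "cos (t - s)" and ?b = "cos (t + s)"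
  let ?N1 = "poisson_den q (t - s)" and ?N2 = "poisson_den q (t + s)"
  have pos: "?N1 > 0" "?N2 > 0" using poisson_den_pos[OF assms] by auto
  have "(\<lambda>k. (q ^ k * cos (k * (t - s)) - q ^ k * cos (k * (t + s))) / 2) sums
    (((1 - q * ?a) / ?N1 - (1 - q * ?b) / ?N2) / 2)"
    using geometric_cos_sums[OF assms, of "t - s"] geometric_cos_sums[OF assms, of "t + s"]
    by (intro sums_divide sums_diff) (simp_all add: poisson_den_def)
  moreover have "(q ^ k * cos (k * (t - s)) - q ^ k * cos (k * (t + s))) / 2 = q ^ k * (sin (k * t) * sin (k * s))" for k :: nat
  proof -
    have "sin (k * t) * sin (k * s) = (cos (k * (t - s)) - cos (k * (t + s))) / 2"
      by (simp add: sin_times_sin right_diff_distrib distrib_left)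
    then show ?thesis by (simp only: right_diff_distrib diff_divide_distrib times_divide_eq_right)
  qed
  moreover have "((1 - q * ?a) / ?N1 - (1 - q * ?b) / ?N2) / 2 = sine_kernel q t s"
  proof -
    have alg: "((N1 + u) / 2 / N1 - (N2 + u) / 2 / N2) / 2 = u * (N2 - N1) / (4 * (N1 * N2))"
      if "N1 > 0" "N2 > 0" for N1 N2 u :: real
      using that by (simp add: field_simps)
    have "1 - q * ?a = (?N1 + (1 - q\<^sup>2)) / 2" "1 - q * ?b = (?N2 + (1 - q\<^sup>2)) / 2"
      by (simp_all add: poisson_den_def)
    then have "((1 - q * ?a) / ?N1 - (1 - q * ?b) / ?N2) / 2 = (1 - q\<^sup>2) * (?N2 - ?N1) / (4 * (?N1 * ?N2))"
      using alg[OF pos, of "1 - q\<^sup>2"] by (simp only:)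
    also have "?N2 - ?N1 = 4 * q * (sin t * sin s)"
      by (simp add: poisson_den_def cos_add cos_diff algebra_simps)
    finally show ?thesis by (simp add: sine_kernel_def)
  qed
  ultimately show ?thesis by simp
qed

text \<open>Each sine is an eigenfunction of the kernel, with eigenvalue
  \<open>pi / 2 * q ^ l\<close>: the series of the kernel converges uniformly since q < 1, and
  orthogonality leaves one term.\<close>

lemma sine_kernel_integral:
  fixes q s :: real
  assumes q: "0 \<le> q" "q < 1" and l: "l > 0"
  shows "((\<lambda>t. sin (real l * t) * sine_kernel q t s) has_integral (pi / 2 * q ^ l * sin (l * s))) {0..pi}"
proof -
  have aq: "\<bar>q\<bar> < 1" using q by simp
  define f where "f n t = sin (real l * t) * (\<Sum>k<n. q ^ k * (sin (k * t) * sin (k * s)))" for n t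
  have "uniform_limit {0..pi} (\<lambda>n t. \<Sum>k<n. q ^ k * (sin (real k * t) * sin (real k * s)))
      (\<lambda>t. \<Sum>k. q ^ k * (sin (real k * t) * sin (real k * s))) sequentially"
  proof (rule Weierstrass_m_test)
    show "norm (q ^ k * (sin (real k * t) * sin (real k * s))) \<le> q ^ k" for k t
    proof -
      have "\<bar>sin (real k * t)\<bar> * \<bar>sin (real k * s)\<bar> \<le> 1 * 1"
        by (intro mult_mono) auto
      then have "q ^ k * (\<bar>sin (real k * t)\<bar> * \<bar>sin (real k * s)\<bar>) \<le> q ^ k"
        using q by (intro mult_left_le) auto
      then show ?thesis using q by (simp add: abs_mult)
    qed
    show "summable (\<lambda>k. q ^ k)" using aq by (simp add: summable_geometric)
  qed
  also have "(\<lambda>t. \<Sum>k. q ^ k * (sin (real k * t) * sin (real k * s))) = (\<lambda>t. sine_kernel q t s)"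
    using sine_kernel_sums[OF aq] by (simp add: sums_iff)
  finally have u: "uniform_limit {0..pi} (\<lambda>n t. \<Sum>k<n. q ^ k * (sin (real k * t) * sin (real k * s)))
      (\<lambda>t. sine_kernel q t s) sequentially" .
  have ck: "continuous_on {0..pi} (\<lambda>t. sine_kernel q t s)"
    by (rule uniform_limit_theorem[OF _ u]) (intro always_eventually allI continuous_intros, simp)
  have uf: "uniform_limit {0..pi} f (\<lambda>t. sin (real l * t) * sine_kernel q t s) sequentially"
    unfolding f_def
  proof (rule uniform_lim_mult[OF uniform_limit_const u])
    show "bounded ((\<lambda>t. sin (real l * t)) ` {0..pi})"
      by (intro compact_imp_bounded compact_continuous_image continuous_intros) auto
    show "bounded ((\<lambda>t. sine_kernel q t s) ` {0..pi})"
      by (intro compact_imp_bounded compact_continuous_image ck) auto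
  qed
  have cf: "continuous_on {0..pi} (f n)" for n
    unfolding f_def by (intro continuous_intros)
  from uniform_limit_integral[OF uf cf] obtain I J where IJ: "\<And>n. (f n has_integral I n) {0..pi}"
    "((\<lambda>t. sin (real l * t) * sine_kernel q t s) has_integral J) {0..pi}" "I \<longlonglongrightarrow> J"
    by auto
  have "I n = pi / 2 * q ^ l * sin (l * s)" if "n > l" for n
  proof -
    have "((\<lambda>t. \<Sum>k<n. (q ^ k * sin (k * s)) * (sin (real l * t) * sin (real k * t))) has_integral
       (\<Sum>k<n. (q ^ k * sin (k * s)) * (if k = l then pi / 2 else 0))) {0..pi}"
    proof (intro has_integral_sum has_integral_mult_right)
      fix k show "((\<lambda>t. sin (real l * t) * sin (real k * t)) has_integral (if k = l then pi / 2 else 0)) {0..pi}"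
      proof (cases "k = 0")
        case False
        then show ?thesis using integral_sin_sin[OF l, of k] by (auto split: if_splits)
      qed (use l in auto)
    qed auto
    also have "(\<lambda>t. \<Sum>k<n. (q ^ k * sin (k * s)) * (sin (real l * t) * sin (real k * t))) = f n"
      by (rule ext) (simp add: f_def sum_distrib_left mult_ac)
    also have "(\<Sum>k<n. (q ^ k * sin (k * s)) * (if k = l then pi / 2 else 0)) = pi / 2 * q ^ l * sin (l * s)"
      using that by (simp add: if_distrib[of "(*) _"] cong: if_cong)
    finally show ?thesis using IJ(1) has_integral_unique by blast
  qed
  then have "\<forall>\<^sub>F n in sequentially. I n = pi / 2 * q ^ l * sin (l * s)"
    by (rule eventually_sequentiallyI[of "Suc l"]) auto
  then have "I \<longlonglongrightarrow> pi / 2 * q ^ l * sin (l * s)" by (rule tendsto_eventually)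
  then have "J = pi / 2 * q ^ l * sin (l * s)"
    using IJ(3) LIMSEQ_unique by blast
  then show ?thesis using IJ(2) by (simp only:)
qed

lemma kappa_cos_param:
  assumes "d \<ge> 2" "t \<in> {0..pi}"
  shows "kappa d (cos_param d t) = real d * rho d * sin t"
proof -
  have cp: "cos_param d t = rho d / 2 * (1 + cos t)"
    using assms by (simp add: cos_param_def rho_def field_simps)
  have "cos_param d t * (rho d - cos_param d t) = (rho d / 2)\<^sup>2 * (1 - (cos t)\<^sup>2)"
    unfolding cp by (simp add: power2_eq_square field_simps)
  also have "\<dots> = (rho d / 2 * sin t)\<^sup>2"
    by (simp only: power_mult_distrib sin_squared_eq)
  finally have "sqrt (cos_param d t * (rho d - cos_param d t)) = \<bar>rho d / 2 * sin t\<bar>"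
    by (simp only: real_sqrt_abs)
  also have "\<dots> = rho d / 2 * sin t"
    using rho_bounds[OF assms(1)] assms(2) sin_ge_zero[of t] by (intro abs_of_nonneg) auto
  finally show ?thesis by (simp add: kappa_def)
qed

definition beta_den :: "nat \<Rightarrow> real \<Rightarrow> real \<Rightarrow> real" where
  "beta_den d x y = 16 * (2 * real d - 3) * (x - y)\<^sup>2 + (real d - 2)\<^sup>2 * A_fun d x y"

lemma beta_den_pos:
  assumes "d > 2"
  shows "beta_den d x y > 0"
proof -
  have "(rho d)\<^sup>2 * (real d - 2)\<^sup>2 > 0"
    using rho_bounds[of d] assms by simp
  moreover have "rho d * (kappa d ((x + y) / 2))\<^sup>2 \<ge> 0" "4 * (real d + 3) * (x - y)\<^sup>2 \<ge> 0"
    using rho_bounds[of d] assms by auto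
  ultimately have "A_fun d x y > 0" unfolding A_fun_def by linarith
  then have "(real d - 2)\<^sup>2 * A_fun d x y > 0" using assms by simp
  moreover have "16 * (2 * real d - 3) * (x - y)\<^sup>2 \<ge> 0" using assms by auto
  ultimately show ?thesis unfolding beta_den_def by linarith
qed

text \<open>With p = d - 1 and q = 1 / p, the denominator of \<open>beta\<close> at the substituted
  points is r^2 p^4 times the product of the two Poisson denominators, which identifies
  \<open>beta\<close> as a sine kernel. The factor \<open>rho d / 2\<close> is the Jacobian of the
  substitution without its \<open>sin t\<close>.\<close>

lemma beta_cos_param:
  assumes d: "d > 2" and ts: "t \<in> {0..pi}" "s \<in> {0..pi}"
  shows "beta d (cos_param d t) (cos_param d s) * (rho d / 2) =
    16 * real d * (real d - 1) / (pi\<^sup>2 * rho d) * sine_kernel (1 / (real d - 1)) t s"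
proof -
  define p where "p = real d - 1"
  define q where "q = 1 / p"
  define r where "r = rho d"
  have p: "p > 1" and dp: "real d = p + 1" using d by (auto simp: p_def)
  have q: "\<bar>q\<bar> < 1" "q * p = 1" using p by (auto simp: q_def)
  have r: "r > 0" and rp: "r * (p + 1)\<^sup>2 = 4 * p"
    using rho_bounds[of d] d p by (auto simp: r_def rho_def dp)
  let ?c = "cos t" and ?e = "cos s"
  define x y where "x = cos_param d t" and "y = cos_param d s"
  have cp: "x = r / 2 * (1 + ?c)" "y = r / 2 * (1 + ?e)"
    using p by (simp_all add: x_def y_def cos_param_def r_def rho_def dp field_simps)
  have k: "kappa d x = (p + 1) * r * sin t" "kappa d y = (p + 1) * r * sin s"
    using kappa_cos_param[of d] d ts by (simp_all add: x_def y_def r_def dp)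
  let ?N = "poisson_den q (t - s) * poisson_den q (t + s)"
  have Npos: "?N > 0" using poisson_den_pos[OF q(1)] by simp
  \<comment> \<open>The product over t - s and t + s depends on \<open>cos t\<close> and
    \<open>cos s\<close> only, and so becomes comparable with the polynomial
    \<open>beta_den\<close>.\<close>
  have N: "p ^ 4 * ?N = (p\<^sup>2 + 1 - 2 * p * ?c * ?e)\<^sup>2 - 4 * p\<^sup>2 * (1 - ?c\<^sup>2) * (1 - ?e\<^sup>2)"
  proof -
    have "p\<^sup>2 * poisson_den q u = p\<^sup>2 + 1 - 2 * p * cos u" for u
    proof -
      have "p\<^sup>2 * poisson_den q u = p\<^sup>2 - 2 * (q * p) * p * cos u + (q * p)\<^sup>2"
        by (simp add: poisson_den_def power2_eq_square algebra_simps)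
      then show ?thesis by (simp add: q(2))
    qed
    then have "p ^ 4 * ?N = (p\<^sup>2 + 1 - 2 * p * cos (t - s)) * (p\<^sup>2 + 1 - 2 * p * cos (t + s))"
      by (metis (no_types, lifting) mult.assoc mult.left_commute power2_eq_square power4_eq_xxxx)
    also have "\<dots> = (p\<^sup>2 + 1 - 2 * p * ?c * ?e)\<^sup>2 - 4 * p\<^sup>2 * (sin t)\<^sup>2 * (sin s)\<^sup>2"
      by (simp add: cos_add cos_diff power2_eq_square algebra_simps)
    finally show ?thesis by (simp add: sin_squared_eq)
  qed
  have m: "((x + y) / 2) * (r - (x + y) / 2) = (r / 2)\<^sup>2 * (1 - ((?c + ?e) / 2)\<^sup>2)"
    unfolding cp by (simp add: power2_eq_square field_simps)
  have "\<bar>(?c + ?e) / 2\<bar> \<le> 1"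
  proof -
    have "\<bar>?c + ?e\<bar> \<le> 2"
      using abs_cos_le_one[of t] abs_cos_le_one[of s] abs_triangle_ineq[of ?c ?e] by linarith
    then show ?thesis by simp
  qed
  then have "0 \<le> (r / 2)\<^sup>2 * (1 - ((?c + ?e) / 2)\<^sup>2)"
    by (simp add: abs_square_le_1)
  then have "(kappa d ((x + y) / 2))\<^sup>2 = (2 * real d)\<^sup>2 * ((r / 2)\<^sup>2 * (1 - ((?c + ?e) / 2)\<^sup>2))"
    by (simp only: kappa_def power_mult_distrib[of "_ * real d"] r_def[symmetric] m real_sqrt_pow2)
  also have "(2 * real d)\<^sup>2 = 4 * (p + 1)\<^sup>2" by (simp add: dp power2_eq_square algebra_simps)
  finally have km: "(kappa d ((x + y) / 2))\<^sup>2 = 4 * (p + 1)\<^sup>2 * ((r / 2)\<^sup>2 * (1 - ((?c + ?e) / 2)\<^sup>2))" .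
  have xy: "(x - y)\<^sup>2 = r\<^sup>2 * ((?c - ?e)\<^sup>2 / 4)"
    unfolding cp by (simp add: power2_eq_square field_simps)
  have "rho d * (kappa d ((x + y) / 2))\<^sup>2 = r\<^sup>2 * ((r * (p + 1)\<^sup>2) * (1 - ((?c + ?e) / 2)\<^sup>2))"
    unfolding km r_def[symmetric] by (simp add: power2_eq_square algebra_simps)
  then have A: "A_fun d x y = r\<^sup>2 * (4 * p * (1 - ((?c + ?e) / 2)\<^sup>2) + (p + 4) * (?c - ?e)\<^sup>2 + (p - 1)\<^sup>2)"
    unfolding A_fun_def xy r_def[symmetric] rp dp by (simp add: algebra_simps add_divide_distrib)
  have "beta_den d x y = r\<^sup>2 * (p ^ 4 * ?N)"
    unfolding beta_den_def A xy N dp by (simp add: power2_eq_square field_simps) 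
  then have "beta d x y = 2 * (p + 1) ^ 4 / pi\<^sup>2 * ((p - 1) * ((p + 1) * r * sin t) * ((p + 1) * r * sin s) / (r\<^sup>2 * (p ^ 4 * ?N)))"
    unfolding beta_def beta_den_def k dp by simp
  also have "\<dots> = 2 * (p + 1) ^ 6 * (p - 1) / (pi\<^sup>2 * p ^ 4) * (sin t * sin s / ?N)"
  proof -
    have alg: "2 * w ^ 4 / Q * (u * (w * r * a) * (w * r * b) / (r\<^sup>2 * (P * N))) = 2 * w ^ 6 * u / (Q * P) * (a * b / N)"
      if "N > 0" "P > 0" "Q > 0" for w u a b P Q N :: real
      using that r by (simp add: divide_simps) (simp add: eval_nat_numeral algebra_simps)
    show ?thesis by (rule alg[OF Npos]) (use p in auto)
  qed
  finally have b: "beta d x y = 2 * (p + 1) ^ 6 * (p - 1) / (pi\<^sup>2 * p ^ 4) * (sin t * sin s / ?N)" .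
  have r_eq: "r = 4 * p / (p + 1)\<^sup>2" using rp p by (simp add: field_simps)
  have alg: "16 * w * ((w * u) / p\<^sup>2) / (pi\<^sup>2 * (4 * p / w\<^sup>2)) = 2 * w ^ 6 * u / (pi\<^sup>2 * p ^ 4) * (4 * p / w\<^sup>2 / 2)"
    if "w > 0" for w u :: real
    using that p by (simp add: field_simps eval_nat_numeral)
  have pq: "p * (q * (1 - q\<^sup>2)) = ((p + 1) * (p - 1)) / p\<^sup>2"
    using p by (simp add: q_def field_simps power2_eq_square)
  have "16 * (p + 1) * p / (pi\<^sup>2 * r) * sine_kernel q t s =
      16 * (p + 1) * (p * (q * (1 - q\<^sup>2))) / (pi\<^sup>2 * r) * (sin t * sin s / ?N)"
    by (simp add: sine_kernel_def)
  also have "\<dots> = 2 * (p + 1) ^ 6 * (p - 1) / (pi\<^sup>2 * p ^ 4) * (r / 2) * (sin t * sin s / ?N)"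
    unfolding pq r_eq using alg[of "p + 1" "p - 1"] p by simp
  finally have E: "16 * (p + 1) * p / (pi\<^sup>2 * r) * sine_kernel q t s =
    2 * (p + 1) ^ 6 * (p - 1) / (pi\<^sup>2 * p ^ 4) * (r / 2) * (sin t * sin s / ?N)" .
  show ?thesis
    unfolding x_def[symmetric] y_def[symmetric] r_def[symmetric] p_def[symmetric] q_def[symmetric]
      E[folded dp] b[folded dp] by (simp only: mult_ac)
qed

lemma continuous_on_beta:
  assumes "d > 2"
  shows "continuous_on S (\<lambda>(y, x). beta d x y)"
proof -
  have kap: "continuous_on S (\<lambda>p. kappa d (f p))" if "continuous_on S f" for f :: "real \<times> real \<Rightarrow> real"
    unfolding kappa_def by (intro continuous_intros that)
  have den: "continuous_on S (\<lambda>p. beta_den d (snd p) (fst p))"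
    unfolding beta_den_def A_fun_def by (intro continuous_intros kap) simp
  have "(\<lambda>(y, x). beta d x y) = (\<lambda>p. 2 * real d ^ 4 / pi\<^sup>2 * ((real d - 2) * kappa d (snd p) * kappa d (fst p) / beta_den d (snd p) (fst p)))"
    by (simp add: fun_eq_iff beta_def beta_den_def)
  moreover have "beta_den d (snd p) (fst p) \<noteq> 0" for p
    using beta_den_pos[OF assms, of "snd p" "fst p"] by simp
  ultimately show ?thesis
    using den kap[OF continuous_on_snd[OF continuous_on_id]] kap[OF continuous_on_fst[OF continuous_on_id]]
    by (simp only:) (intro continuous_on_mult continuous_on_divide continuous_on_const; simp)
qed

lemma continuous_on_beta_section:
  assumes "d > 2" "y \<in> {0..rho d}"
  shows "continuous_on {0..rho d} (\<lambda>x. beta d x y)"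
proof -
  have "continuous_on {0..rho d} (\<lambda>x. (\<lambda>(y, x). beta d x y) (y, x))"
    by (rule continuous_on_compose2[OF continuous_on_beta[OF assms(1)]])
       (use assms(2) in \<open>auto intro!: continuous_intros\<close>)
  then show ?thesis by simp
qed

text \<open>The Jacobian supplies the sine that turns \<open>F\<close> into a sine sum, and the
  kernel multiplies its \<open>l\<close>-th term by an eigenvalue. A second substitution pairs the
  result with the sines of \<open>G\<close>, and orthogonality leaves the diagonal.\<close>

lemma beta_integral_sines:
  fixes u v :: "nat \<Rightarrow> real"
  assumes d: "d > 2" and F: "continuous_on {0..rho d} F" and G: "continuous_on {0..rho d} G"
    and u: "\<And>t::real. F (cos_param d t) * sin t = (\<Sum>l\<le>N. u l * sin (l * t))" "u 0 = 0"
    and v: "\<And>t::real. G (cos_param d t) * sin t = (\<Sum>l\<le>N. v l * sin (l * t))" "v 0 = 0"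
  shows "integral {0..rho d} (\<lambda>y. integral {0..rho d} (\<lambda>x. F x * G y * beta d x y)) =
    (\<Sum>l\<le>N. 2 * real d / (real d - 1) ^ (l - 1) * (u l * v l))"
proof -
  have d2: "d \<ge> 2" using d by simp
  define q where "q = 1 / (real d - 1)"
  have q: "0 \<le> q" "q < 1" using d by (auto simp: q_def)
  define K where "K = 16 * real d * (real d - 1) / (pi\<^sup>2 * rho d)"
  define \<Phi> where "\<Phi> y = integral {0..rho d} (\<lambda>x. F x * beta d x y)" for y
  have sect: "continuous_on {0..rho d} (\<lambda>x. F x * beta d x y)" if "y \<in> {0..rho d}" for y
    by (intro continuous_on_mult F continuous_on_beta_section d that)
  have \<Phi>_cont: "continuous_on {0..rho d} \<Phi>"
  proof -
    have "continuous_on ({0..rho d} \<times> cbox 0 (rho d)) (\<lambda>(y, x). F x * beta d x y)"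
      using continuous_on_beta[OF d] unfolding case_prod_unfold cbox_interval
      by (intro continuous_on_mult continuous_on_compose2[OF F]) (auto intro!: continuous_intros)
    from integral_continuous_on_param[OF this] show ?thesis
      by (simp add: \<Phi>_def[abs_def])
  qed
  have \<Phi>_eq: "\<Phi> (cos_param d s) = K * (pi / 2) * (\<Sum>l\<le>N. u l * q ^ l * sin (l * s))" if s: "s \<in> {0..pi}" for s :: real
  proof -
    have "\<Phi> (cos_param d s) = integral {0..pi} (\<lambda>t. F (cos_param d t) * beta d (cos_param d t) (cos_param d s) * (rho d / 2 * sin t))"
      unfolding \<Phi>_def by (rule integral_cos_param(1)[OF d2 sect]) (rule integral_cos_param(2)[OF d2 F])
    also have "\<dots> = integral {0..pi} (\<lambda>t. K * (\<Sum>l\<le>N. u l * (sin (l * t) * sine_kernel q t s)))"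
    proof (rule Henstock_Kurzweil_Integration.integral_cong)
      fix t assume t: "t \<in> {0..pi}"
      have "F (cos_param d t) * beta d (cos_param d t) (cos_param d s) * (rho d / 2 * sin t)
        = (F (cos_param d t) * sin t) * (beta d (cos_param d t) (cos_param d s) * (rho d / 2))"
        by (simp only: mult_ac)
      also have "\<dots> = (\<Sum>l\<le>N. u l * sin (l * t)) * (K * sine_kernel q t s)"
        unfolding u(1) beta_cos_param[OF d t s] K_def q_def by simp
      also have "\<dots> = K * (\<Sum>l\<le>N. u l * (sin (l * t) * sine_kernel q t s))"
        by (simp add: sum_distrib_right sum_distrib_left mult_ac)
      finally show "F (cos_param d t) * beta d (cos_param d t) (cos_param d s) * (rho d / 2 * sin t) =
        K * (\<Sum>l\<le>N. u l * (sin (l * t) * sine_kernel q t s))" .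
    qed
    also have "\<dots> = K * (\<Sum>l\<le>N. u l * (pi / 2 * q ^ l * sin (l * s)))"
    proof (rule integral_unique, rule has_integral_mult_right, rule has_integral_sum, simp)
      fix l
      show "((\<lambda>t. u l * (sin (l * t) * sine_kernel q t s)) has_integral u l * (pi / 2 * q ^ l * sin (l * s))) {0..pi}"
      proof (cases "l = 0")
        case False
        then show ?thesis by (intro has_integral_mult_right sine_kernel_integral q) simp
      qed (simp add: u)
    qed
    finally show ?thesis by (simp add: sum_distrib_left mult_ac)
  qed
  have "integral {0..rho d} (\<lambda>y. integral {0..rho d} (\<lambda>x. F x * G y * beta d x y)) = integral {0..rho d} (\<lambda>y. G y * \<Phi> y)"
  proof (rule Henstock_Kurzweil_Integration.integral_cong)
    fix y
    have "(\<lambda>x. F x * G y * beta d x y) = (\<lambda>x. G y * (F x * beta d x y))"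
      by (simp add: mult_ac)
    then show "integral {0..rho d} (\<lambda>x. F x * G y * beta d x y) = G y * \<Phi> y"
      by (simp only: \<Phi>_def Henstock_Kurzweil_Integration.integral_mult_right)
  qed
  also have "\<dots> = integral {0..pi} (\<lambda>s. G (cos_param d s) * \<Phi> (cos_param d s) * (rho d / 2 * sin s))"
    by (rule integral_cos_param(1)[OF d2]) (intro continuous_intros G \<Phi>_cont)
  also have "\<dots> = integral {0..pi} (\<lambda>s. K * (pi / 2) * (rho d / 2) * (\<Sum>l\<le>N. \<Sum>m\<le>N. u l * q ^ l * v m * (sin (l * s) * sin (m * s))))"
  proof (rule Henstock_Kurzweil_Integration.integral_cong)
    fix s assume s: "s \<in> {0..pi}"
    have "G (cos_param d s) * \<Phi> (cos_param d s) * (rho d / 2 * sin s) = (rho d / 2) * (\<Phi> (cos_param d s) * (G (cos_param d s) * sin s))"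
      by (simp only: mult_ac)
    also have "\<dots> = K * (pi / 2) * (rho d / 2) * ((\<Sum>l\<le>N. u l * q ^ l * sin (l * s)) * (\<Sum>m\<le>N. v m * sin (m * s)))"
      unfolding \<Phi>_eq[OF s] v(1) by (simp only: mult_ac)
    also have "(\<Sum>l\<le>N. u l * q ^ l * sin (l * s)) * (\<Sum>m\<le>N. v m * sin (m * s)) =
      (\<Sum>l\<le>N. \<Sum>m\<le>N. u l * q ^ l * v m * (sin (l * s) * sin (m * s)))"
      unfolding sum_product by (simp add: mult_ac)
    finally show "G (cos_param d s) * \<Phi> (cos_param d s) * (rho d / 2 * sin s) =
      K * (pi / 2) * (rho d / 2) * (\<Sum>l\<le>N. \<Sum>m\<le>N. u l * q ^ l * v m * (sin (l * s) * sin (m * s)))" .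
  qed
  also have "\<dots> = K * (pi / 2) * (rho d / 2) * (\<Sum>l\<le>N. \<Sum>m\<le>N. u l * q ^ l * v m * (if l = m then pi / 2 else 0))"
  proof (rule integral_unique, rule has_integral_mult_right, rule has_integral_sum, simp, rule has_integral_sum, simp)
    fix l m
    show "((\<lambda>s. u l * q ^ l * v m * (sin (l * s) * sin (m * s))) has_integral u l * q ^ l * v m * (if l = m then pi / 2 else 0)) {0..pi}"
    proof (cases "l = 0 \<or> m = 0")
      case False
      then show ?thesis by (intro has_integral_mult_right integral_sin_sin) auto
    qed (auto simp: u v)
  qed
  also have "\<dots> = (\<Sum>l\<le>N. K * (pi / 2) * (rho d / 2) * (pi / 2) * q ^ l * (u l * v l))"
    by (simp add: sum_distrib_left mult_ac if_distrib[of "\<lambda>x. _ * x"] cong: if_cong)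
  also have "\<dots> = (\<Sum>l\<le>N. 2 * real d / (real d - 1) ^ (l - 1) * (u l * v l))"
  proof (rule sum.cong[OF refl])
    fix l
    \<comment> \<open>One factor pi / 2 is the eigenvalue, the other the square norm of a sine, and
      \<open>rho d / 2\<close> is the Jacobian in the outer variable; that of the inner variable is
      already part of \<open>K\<close>. Multiplication by \<open>q ^ l\<close> leaves 2 d / (d -
      1)^(l - 1).\<close>
    have K: "K * (pi / 2) * (rho d / 2) * (pi / 2) = 2 * real d * (real d - 1)"
      using rho_bounds[OF d2] by (simp add: K_def power2_eq_square field_simps)
    show "K * (pi / 2) * (rho d / 2) * (pi / 2) * q ^ l * (u l * v l) = 2 * real d / (real d - 1) ^ (l - 1) * (u l * v l)"
    \<comment> \<open>At l = 0 the truncated exponent \<open>l - 1\<close> breaks the formula, but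
      \<open>u 0\<close> is 0.\<close>
    proof (cases l)
      case (Suc k)
      then show ?thesis unfolding K q_def using d by (simp add: power_one_over field_simps)
    qed (simp add: u)
  qed
  finally show ?thesis .
qed

text \<open>For d = 2 the ratio q would be 1 and the kernel degenerates to the diagonal.
  Orthogonality of the sines gives the single integral, whose weight is sqrt (x (1 - x)) = sin t /
  2.\<close>

lemma semicircle_integral_sines:
  fixes u v :: "nat \<Rightarrow> real"
  assumes F: "continuous_on {0..1} F" and G: "continuous_on {0..1} G"
    and u: "\<And>t::real. F (cos_param 2 t) * sin t = (\<Sum>l\<le>N. u l * sin (l * t))" "u 0 = 0"
    and v: "\<And>t::real. G (cos_param 2 t) * sin t = (\<Sum>l\<le>N. v l * sin (l * t))" "v 0 = 0"
  shows "32 / pi * integral {0..1} (\<lambda>x. F x * G x * sqrt (x * (1 - x))) = (\<Sum>l\<le>N. 4 * (u l * v l))"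
proof -
  have r: "rho 2 = 1" by (simp add: rho_def)
  have "integral {0..rho 2} (\<lambda>x. F x * G x * sqrt (x * (1 - x))) =
    integral {0..pi} (\<lambda>t. F (cos_param 2 t) * G (cos_param 2 t) * sqrt (cos_param 2 t * (1 - cos_param 2 t)) * (1 / 2 * sin t))"
    using integral_cos_param(1)[of 2 "\<lambda>x. F x * G x * sqrt (x * (1 - x))"] F G
    by (simp add: r continuous_intros)
  also have "\<dots> = integral {0..pi} (\<lambda>t. 1 / 4 * (\<Sum>l\<le>N. \<Sum>m\<le>N. u l * v m * (sin (l * t) * sin (m * t))))"
  proof (rule Henstock_Kurzweil_Integration.integral_cong)
    fix t assume t: "t \<in> {0..pi}"
    have "sqrt (cos_param 2 t * (1 - cos_param 2 t)) = sin t / 2"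
      using kappa_cos_param[of 2 t] t by (simp add: kappa_def r)
    then have "F (cos_param 2 t) * G (cos_param 2 t) * sqrt (cos_param 2 t * (1 - cos_param 2 t)) * (1 / 2 * sin t)
      = 1 / 4 * ((F (cos_param 2 t) * sin t) * (G (cos_param 2 t) * sin t))"
      by simp
    then show "F (cos_param 2 t) * G (cos_param 2 t) * sqrt (cos_param 2 t * (1 - cos_param 2 t)) * (1 / 2 * sin t)
      = 1 / 4 * (\<Sum>l\<le>N. \<Sum>m\<le>N. u l * v m * (sin (l * t) * sin (m * t)))"
      unfolding u(1) v(1) by (simp add: sum_product mult_ac)
  qed
  also have "\<dots> = 1 / 4 * (\<Sum>l\<le>N. \<Sum>m\<le>N. u l * v m * (if l = m then pi / 2 else 0))"
  proof (rule integral_unique, rule has_integral_mult_right, rule has_integral_sum, simp, rule has_integral_sum, simp)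
    fix l m
    show "((\<lambda>s. u l * v m * (sin (l * s) * sin (m * s))) has_integral u l * v m * (if l = m then pi / 2 else 0)) {0..pi}"
    proof (cases "l = 0 \<or> m = 0")
      case False
      then show ?thesis by (intro has_integral_mult_right integral_sin_sin) auto
    qed (auto simp: u v)
  qed
  also have "\<dots> = (\<Sum>l\<le>N. pi / 8 * (u l * v l))"
    by (simp add: sum_distrib_left mult_ac if_distrib[of "\<lambda>x. _ * x"] cong: if_cong)
  finally show ?thesis by (simp add: r sum_distrib_left)
qed

section \<open>Coefficients of the limit, and the passage from polynomials to power series\<close>

definition cov_formula :: "nat \<Rightarrow> (real \<Rightarrow> real) \<Rightarrow> (real \<Rightarrow> real) \<Rightarrow> real" where
  "cov_formula d F G = (if d = 2 then 32 / pi * integral {0..1} (\<lambda>x. F x * G x * sqrt (x * (1 - x)))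
     else integral {0..rho d} (\<lambda>y. integral {0..rho d} (\<lambda>x. F x * G y * beta d x y)))"

text \<open>The coordinate of the monomial \<open>x ^ m\<close> along the \<open>l\<close>-th normal
  variable. Under the root stands 2 d (d - 1)^(l - 1), the number of vertices at distance
  \<open>l\<close> with a factor 2 for the two orders of a pair, divided by (d - 1)^(2 (l - 1)),
  which undoes the normalization of \<open>sine_coeff\<close>.\<close>

definition mono_coeff :: "nat \<Rightarrow> nat \<Rightarrow> nat \<Rightarrow> real" where
  "mono_coeff d m l = real m * sqrt (2 * real d / (real d - 1) ^ (l - 1)) * sine_coeff d (m - 1) l"

definition limit_coeff :: "nat \<Rightarrow> (nat \<Rightarrow> real) \<Rightarrow> nat \<Rightarrow> real" where
  "limit_coeff d c l = (\<Sum>m. c m * mono_coeff d m l)"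

text \<open>The coefficient vanishes for m < l, so two powers of \<open>m\<close> can be exchanged
  for l^(-2). A third moment of the Taylor coefficients then gives summability in
  \<open>l\<close>.\<close>

lemma mono_coeff_bound:
  assumes "d \<ge> 2"
  shows "\<bar>mono_coeff d m l\<bar> \<le> sqrt (2 * real d) * real m ^ 3 / (real l)\<^sup>2"
proof (cases "l = 0 \<or> m < l")
  case True
  then have "mono_coeff d m l = 0"
    by (cases "m = 0") (auto simp: mono_coeff_def sine_coeff_eq_0)
  then show ?thesis by simp
next
  case False
  then have l: "l > 0" "l \<le> m" by auto
  have s: "sqrt (2 * real d / (real d - 1) ^ (l - 1)) \<le> sqrt (2 * real d)"
    using assms by (intro real_sqrt_le_mono) (simp add: divide_le_eq mult_left_le mult_ge1_I one_le_power)
  have "\<bar>mono_coeff d m l\<bar> = real m * sqrt (2 * real d / (real d - 1) ^ (l - 1)) * \<bar>sine_coeff d (m - 1) l\<bar>"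
    using assms by (simp add: mono_coeff_def abs_mult)
  also have "\<dots> \<le> real m * sqrt (2 * real d) * 1"
    using s sine_coeff_bound[of "real d" "m - 1" l] assms by (intro mult_mono) auto
  also have "\<dots> = sqrt (2 * real d) * real m" by simp
  also have "real m \<le> real m ^ 3 / (real l)\<^sup>2"
  proof -
    have "real m * (real l)\<^sup>2 \<le> real m * (real m)\<^sup>2"
      using l by (intro mult_left_mono power_mono) auto
    then show ?thesis using l by (simp add: field_simps power3_eq_cube power2_eq_square)
  qed
  finally show ?thesis by (simp add: mult_left_mono)
qed

lemma summable_mono_coeff:
  assumes d: "d \<ge> 2" and c: "summable (\<lambda>m. real m ^ 3 * \<bar>c m\<bar>)"
  shows "summable (\<lambda>m. \<bar>c m * mono_coeff d m l\<bar>)"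
    "(\<Sum>m. \<bar>c m * mono_coeff d m l\<bar>) \<le> sqrt (2 * real d) * (\<Sum>m. real m ^ 3 * \<bar>c m\<bar>) / (real l)\<^sup>2"
proof -
  have b: "\<bar>c m * mono_coeff d m l\<bar> \<le> sqrt (2 * real d) / (real l)\<^sup>2 * (real m ^ 3 * \<bar>c m\<bar>)" for m
    using mult_left_mono[OF mono_coeff_bound[OF d, of m l], of "\<bar>c m\<bar>"] by (simp add: abs_mult mult_ac)
  have s: "summable (\<lambda>m. sqrt (2 * real d) / (real l)\<^sup>2 * (real m ^ 3 * \<bar>c m\<bar>))"
    using c by (rule summable_mult)
  show 1: "summable (\<lambda>m. \<bar>c m * mono_coeff d m l\<bar>)"
    by (rule summable_comparison_test[OF _ s]) (use b in auto)
  have "(\<Sum>m. \<bar>c m * mono_coeff d m l\<bar>) \<le> (\<Sum>m. sqrt (2 * real d) / (real l)\<^sup>2 * (real m ^ 3 * \<bar>c m\<bar>))"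
    by (rule suminf_le[OF b 1 s])
  also have "\<dots> = sqrt (2 * real d) / (real l)\<^sup>2 * (\<Sum>m. real m ^ 3 * \<bar>c m\<bar>)"
    using c by (rule suminf_mult)
  finally show "(\<Sum>m. \<bar>c m * mono_coeff d m l\<bar>) \<le> sqrt (2 * real d) * (\<Sum>m. real m ^ 3 * \<bar>c m\<bar>) / (real l)\<^sup>2"
    by simp
qed

lemma abs_limit_coeff_le:
  assumes d: "d \<ge> 2" and c: "summable (\<lambda>m. real m ^ 3 * \<bar>c m\<bar>)"
  shows "\<bar>limit_coeff d c l\<bar> \<le> sqrt (2 * real d) * (\<Sum>m. real m ^ 3 * \<bar>c m\<bar>) / (real l)\<^sup>2"
  unfolding limit_coeff_def
  using summable_rabs[OF summable_mono_coeff(1)[OF d c], of l] summable_mono_coeff(2)[OF d c, of l] by linarith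

lemma summable_limit_coeff:
  assumes "d \<ge> 2" "summable (\<lambda>m. real m ^ 3 * \<bar>c m\<bar>)"
  shows "summable (\<lambda>l. \<bar>limit_coeff d c l\<bar>)"
proof (rule summable_comparison_test)
  show "\<exists>N. \<forall>l\<ge>N. norm \<bar>limit_coeff d c l\<bar> \<le> sqrt (2 * real d) * (\<Sum>m. real m ^ 3 * \<bar>c m\<bar>) * inverse (real l ^ 2)"
    using abs_limit_coeff_le[OF assms] by (auto simp: divide_inverse)
  show "summable (\<lambda>l. sqrt (2 * real d) * (\<Sum>m. real m ^ 3 * \<bar>c m\<bar>) * inverse (real l ^ 2))"
    by (intro summable_mult inverse_power_summable) simp
qed

lemma limit_coeff_linear:
  assumes "d \<ge> 2" "finite J" "\<And>j. j \<in> J \<Longrightarrow> summable (\<lambda>m. real m ^ 3 * \<bar>c j m\<bar>)"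
  shows "limit_coeff d (\<lambda>m. \<Sum>j\<in>J. t j * c j m) l = (\<Sum>j\<in>J. t j * limit_coeff d (c j) l)"
proof -
  have s: "summable (\<lambda>m. c j m * mono_coeff d m l)" if "j \<in> J" for j
    using summable_mono_coeff(1)[OF assms(1) assms(3)[OF that]] by (rule summable_rabs_cancel)
  have "limit_coeff d (\<lambda>m. \<Sum>j\<in>J. t j * c j m) l = (\<Sum>m. \<Sum>j\<in>J. t j * (c j m * mono_coeff d m l))"
    by (simp add: limit_coeff_def sum_distrib_left mult_ac)
  also have "\<dots> = (\<Sum>j\<in>J. \<Sum>m. t j * (c j m * mono_coeff d m l))"
    by (rule suminf_sum) (intro summable_mult s)
  also have "\<dots> = (\<Sum>j\<in>J. t j * limit_coeff d (c j) l)"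
    unfolding limit_coeff_def by (intro sum.cong refl suminf_mult s)
  finally show ?thesis .
qed

definition trunc :: "nat \<Rightarrow> (nat \<Rightarrow> real) \<Rightarrow> nat \<Rightarrow> real" where
  "trunc K c m = (if m \<le> K then c m else 0)"

lemma limit_coeff_trunc: "limit_coeff d (trunc K c) l = (\<Sum>m\<le>K. c m * mono_coeff d m l)"
proof -
  have "limit_coeff d (trunc K c) l = (\<Sum>m\<le>K. trunc K c m * mono_coeff d m l)"
    unfolding limit_coeff_def by (rule suminf_finite) (auto simp: trunc_def)
  then show ?thesis by (simp add: trunc_def)
qed

lemma trunc_moment:
  assumes "summable (\<lambda>m. real m ^ 3 * \<bar>c m\<bar>)"
  shows "summable (\<lambda>m. real m ^ 3 * \<bar>trunc K c m\<bar>)"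
    "(\<Sum>m. real m ^ 3 * \<bar>trunc K c m\<bar>) \<le> (\<Sum>m. real m ^ 3 * \<bar>c m\<bar>)"
proof -
  show 1: "summable (\<lambda>m. real m ^ 3 * \<bar>trunc K c m\<bar>)"
    by (rule summable_comparison_test[OF _ assms]) (auto simp: trunc_def)
  show "(\<Sum>m. real m ^ 3 * \<bar>trunc K c m\<bar>) \<le> (\<Sum>m. real m ^ 3 * \<bar>c m\<bar>)"
    by (rule suminf_le[OF _ 1 assms]) (auto simp: trunc_def)
qed

definition dpoly :: "nat \<Rightarrow> (nat \<Rightarrow> real) \<Rightarrow> real \<Rightarrow> real" where
  "dpoly K c x = (\<Sum>m\<le>K. c m * (real m * x ^ (m - 1)))"

lemma continuous_on_dpoly [continuous_intros]: "continuous_on S (dpoly K c)"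
  unfolding dpoly_def by (intro continuous_intros)

lemma dpoly_sine_expansion:
  fixes d :: nat and t :: real
  assumes "d \<ge> 2"
  shows "dpoly K c (cos_param d t) * sin t =
    (\<Sum>l\<le>K. (\<Sum>m\<le>K. c m * (real m * sine_coeff d (m - 1) l)) * sin (l * t))"
proof -
  have "dpoly K c (cos_param d t) * sin t = (\<Sum>m\<le>K. c m * (real m * (cos_param d t ^ (m - 1) * sin t)))"
    by (simp add: dpoly_def sum_distrib_right mult.assoc)
  also have "\<dots> = (\<Sum>m\<le>K. c m * (real m * (\<Sum>l\<le>K. sine_coeff d (m - 1) l * sin (l * t))))"
  proof (rule sum.cong[OF refl])
    fix m assume "m \<in> {..K}"
    then show "c m * (real m * (cos_param d t ^ (m - 1) * sin t)) =
      c m * (real m * (\<Sum>l\<le>K. sine_coeff d (m - 1) l * sin (l * t)))"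
      using sine_expansion[of "real d" "m - 1" K t] assms by (cases "m = 0") auto
  qed
  also have "\<dots> = (\<Sum>m\<le>K. \<Sum>l\<le>K. c m * (real m * sine_coeff d (m - 1) l) * sin (l * t))"
    by (simp add: sum_distrib_left mult_ac)
  also have "\<dots> = (\<Sum>l\<le>K. \<Sum>m\<le>K. c m * (real m * sine_coeff d (m - 1) l) * sin (l * t))"
    by (rule sum.swap)
  finally show ?thesis by (simp add: sum_distrib_right)
qed

text \<open>For polynomials both sides reduce to the same finite sum of products of sine
  coefficients; the square roots in \<open>mono_coeff\<close> multiply to the weights of that
  sum.\<close>

lemma cov_formula_dpoly:
  assumes d: "d \<ge> 2"
  shows "cov_formula d (dpoly K c) (dpoly K c') =
    (\<Sum>l. limit_coeff d (trunc K c) l * limit_coeff d (trunc K c') l)"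
proof -
  define u where "u c l = (\<Sum>m\<le>K. c m * (real m * sine_coeff d (m - 1) l))" for c l
  have u0: "u c 0 = 0" for c by (simp add: u_def)
  have lim: "limit_coeff d (trunc K c) l = sqrt (2 * real d / (real d - 1) ^ (l - 1)) * u c l" for c l
    by (simp add: limit_coeff_trunc mono_coeff_def u_def sum_distrib_left mult_ac)
  have prod: "limit_coeff d (trunc K c) l * limit_coeff d (trunc K c') l = 2 * real d / (real d - 1) ^ (l - 1) * (u c l * u c' l)" for l
  proof -
    let ?X = "2 * real d / (real d - 1) ^ (l - 1)"
    have "?X \<ge> 0" using d by simp
    then have X: "sqrt ?X * sqrt ?X = ?X" by (simp only: real_sqrt_mult_self abs_of_nonneg)
    have "(sqrt ?X * u c l) * (sqrt ?X * u c' l) = (sqrt ?X * sqrt ?X) * (u c l * u c' l)"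
      by (simp only: mult_ac)
    then show ?thesis unfolding lim X .
  qed
  have "u c l = 0" if "l > K" for c l
    using that unfolding u_def
  proof (intro sum.neutral ballI)
    fix m assume "m \<in> {..K}"
    then show "c m * (real m * sine_coeff d (m - 1) l) = 0"
      using that by (cases "m = 0") (auto simp: sine_coeff_eq_0)
  qed
  then have "(\<Sum>l. limit_coeff d (trunc K c) l * limit_coeff d (trunc K c') l)
    = (\<Sum>l\<le>K. 2 * real d / (real d - 1) ^ (l - 1) * (u c l * u c' l))"
    unfolding prod by (intro suminf_finite) simp_all
  also have "\<dots> = cov_formula d (dpoly K c) (dpoly K c')"
  proof (cases "d = 2")
    case True
    have "32 / pi * integral {0..1} (\<lambda>x. dpoly K c x * dpoly K c' x * sqrt (x * (1 - x))) = (\<Sum>l\<le>K. 4 * (u c l * u c' l))"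
      using dpoly_sine_expansion[of 2] u0
      by (intro semicircle_integral_sines continuous_intros) (simp_all add: u_def True)
    then show ?thesis using True by (simp add: cov_formula_def)
  next
    case False
    then have "d > 2" using d by simp
    then show ?thesis
      using beta_integral_sines[OF _ continuous_on_dpoly continuous_on_dpoly, of d K c "u c" K K c' "u c'"]
        dpoly_sine_expansion[OF d] u0 False by (simp add: cov_formula_def u_def)
  qed
  finally show ?thesis by simp
qed

definition dseries :: "(nat \<Rightarrow> real) \<Rightarrow> real \<Rightarrow> real" where
  "dseries c x = (\<Sum>m. c m * (real m * x ^ (m - 1)))"

lemma summable_moment_1:
  assumes "summable (\<lambda>m. real m ^ 3 * \<bar>c m\<bar>)"
  shows "summable (\<lambda>m. real m * \<bar>c m\<bar>)"
proof (rule summable_comparison_test[OF _ assms], intro exI allI impI)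
  fix m :: nat
  have "real m \<le> real m ^ 3"
    by (cases "m = 0") (auto intro: self_le_power)
  then show "norm (real m * \<bar>c m\<bar>) \<le> real m ^ 3 * \<bar>c m\<bar>"
    by (simp add: mult_right_mono)
qed

lemma dpoly_uniform_limit:
  assumes c: "summable (\<lambda>m. real m ^ 3 * \<bar>c m\<bar>)" and S: "S \<subseteq> {0..1}"
  shows "uniform_limit S (\<lambda>K. dpoly K c) (dseries c) sequentially"
proof -
  have "uniform_limit {0..1} (\<lambda>K x. \<Sum>m<K. c m * (real m * x ^ (m - 1))) (\<lambda>x. \<Sum>m. c m * (real m * x ^ (m - 1))) sequentially"
  proof (rule Weierstrass_m_test[OF _ summable_moment_1[OF c]])
    fix m x assume "(x::real) \<in> {0..1}"
    then have "x ^ (m - 1) \<le> 1" "0 \<le> x ^ (m - 1)" by (auto intro: power_le_one)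
    then have "\<bar>c m\<bar> * (real m * x ^ (m - 1)) \<le> \<bar>c m\<bar> * (real m * 1)"
      by (intro mult_left_mono) auto
    then show "norm (c m * (real m * x ^ (m - 1))) \<le> real m * \<bar>c m\<bar>"
      using \<open>0 \<le> x ^ (m - 1)\<close> by (simp add: abs_mult mult_ac)
  qed
  then have "uniform_limit {0..1} (\<lambda>K x. \<Sum>m<Suc K. c m * (real m * x ^ (m - 1))) (\<lambda>x. \<Sum>m. c m * (real m * x ^ (m - 1))) sequentially"
    by (rule filterlim_compose[OF _ filterlim_Suc])
  then have "uniform_limit {0..1} (\<lambda>K. dpoly K c) (dseries c) sequentially"
    unfolding dpoly_def[abs_def] dseries_def[abs_def] lessThan_Suc_atMost .
  then show ?thesis using S by (rule uniform_limit_on_subset)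
qed

text \<open>Truncations satisfy the identity. The series side converges by dominated convergence
  with a majorant of order l^(-4), the integral side by uniform convergence on [0, 1]. The first of
  these limits is recorded as well, for the variances of truncated statistics.\<close>

theorem cov_formula_series:
  assumes d: "d \<ge> 2" and c: "summable (\<lambda>m. real m ^ 3 * \<bar>c m\<bar>)" and c': "summable (\<lambda>m. real m ^ 3 * \<bar>c' m\<bar>)"
  shows "(\<Sum>l. limit_coeff d c l * limit_coeff d c' l) = cov_formula d (dseries c) (dseries c')"
    "(\<lambda>K. \<Sum>l. limit_coeff d (trunc K c) l * limit_coeff d (trunc K c') l) \<longlonglongrightarrow> (\<Sum>l. limit_coeff d c l * limit_coeff d c' l)"
proof -
  define M where "M c = sqrt (2 * real d) * (\<Sum>m. real m ^ 3 * \<bar>c m\<bar>)" for c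
  have lim: "(\<lambda>K. limit_coeff d (trunc K c) l) \<longlonglongrightarrow> limit_coeff d c l"
    if "summable (\<lambda>m. real m ^ 3 * \<bar>c m\<bar>)" for c l
    unfolding limit_coeff_trunc unfolding limit_coeff_def
    using summable_rabs_cancel[OF summable_mono_coeff(1)[OF d that, of l]] by (rule summable_LIMSEQ')
  have bd: "\<bar>limit_coeff d (trunc K c) l\<bar> \<le> M c / (real l)\<^sup>2"
    if "summable (\<lambda>m. real m ^ 3 * \<bar>c m\<bar>)" for c l K
  proof -
    have "sqrt (2 * real d) * (\<Sum>m. real m ^ 3 * \<bar>trunc K c m\<bar>) \<le> M c"
      unfolding M_def by (intro mult_left_mono trunc_moment that) auto
    then show ?thesis
      using abs_limit_coeff_le[OF d trunc_moment(1)[OF that], of K l]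
      by (meson divide_right_mono order_trans zero_le_power2)
  qed
  have "(\<lambda>K. \<Sum>l. limit_coeff d (trunc K c) l * limit_coeff d (trunc K c') l) \<longlonglongrightarrow> (\<Sum>l. limit_coeff d c l * limit_coeff d c' l)"
  proof (rule tannerys_theorem[THEN conjunct2, THEN conjunct2])
    show "summable (\<lambda>l. M c * M c' * inverse (real l ^ 4))"
      by (intro summable_mult inverse_power_summable) simp
    have "norm (limit_coeff d (trunc K c) l * limit_coeff d (trunc K c') l) \<le> M c * M c' * inverse (real l ^ 4)" for l K
    proof -
      have "\<bar>limit_coeff d (trunc K c) l\<bar> * \<bar>limit_coeff d (trunc K c') l\<bar> \<le> (M c / (real l)\<^sup>2) * (M c' / (real l)\<^sup>2)"
        using order.trans[OF abs_ge_zero bd[OF c, of K l]] by (intro mult_mono bd c c') auto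
      then show ?thesis by (simp add: abs_mult divide_inverse power4_eq_xxxx power2_eq_square mult_ac)
    qed
    then show "\<forall>\<^sub>F (l, K) in at_top \<times>\<^sub>F sequentially. norm (limit_coeff d (trunc K c) l * limit_coeff d (trunc K c') l) \<le> M c * M c' * inverse (real l ^ 4)"
      by (intro always_eventually) auto
  qed (auto intro!: tendsto_mult lim c c')
  then show lhs: "(\<lambda>K. \<Sum>l. limit_coeff d (trunc K c) l * limit_coeff d (trunc K c') l) \<longlonglongrightarrow> (\<Sum>l. limit_coeff d c l * limit_coeff d c' l)" .
  have bdd: "bounded (dseries a ` {0..r})" "continuous_on {0..r} (dseries a)" 
    if "summable (\<lambda>m. real m ^ 3 * \<bar>a m\<bar>)" "r \<le> 1" for a r
  proof -
    show "continuous_on {0..r} (dseries a)"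
      by (rule uniform_limit_theorem[OF _ dpoly_uniform_limit[OF that(1)]]) (use that in \<open>simp_all add: continuous_on_dpoly\<close>)
    then show "bounded (dseries a ` {0..r})"
      by (intro compact_imp_bounded compact_continuous_image) auto
  qed
  have "(\<lambda>K. cov_formula d (dpoly K c) (dpoly K c')) \<longlonglongrightarrow> cov_formula d (dseries c) (dseries c')"
  proof (cases "d = 2")
    case True
    let ?w = "\<lambda>x::real. sqrt (x * (1 - x))"
    have w: "bounded (?w ` {0..1})"
      by (intro compact_imp_bounded compact_continuous_image continuous_intros) auto
    have b2: "bounded ((\<lambda>x. dseries c x * dseries c' x) ` {0..1})"
      by (intro compact_imp_bounded compact_continuous_image continuous_intros bdd c c') auto
    have "uniform_limit {0..1} (\<lambda>K x. dpoly K c x * dpoly K c' x * ?w x) (\<lambda>x. dseries c x * dseries c' x * ?w x) sequentially"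
      by (intro uniform_lim_mult uniform_limit_const dpoly_uniform_limit c c' bdd w b2) auto
    moreover have "continuous_on {0..1} (\<lambda>x. dpoly K c x * dpoly K c' x * ?w x)" for K
      by (intro continuous_intros)
    ultimately obtain I J where IJ:
      "\<And>K. ((\<lambda>x. dpoly K c x * dpoly K c' x * ?w x) has_integral I K) {0..1}"
      "((\<lambda>x. dseries c x * dseries c' x * ?w x) has_integral J) {0..1}" "I \<longlonglongrightarrow> J"
      by (rule uniform_limit_integral) auto
    have "I = (\<lambda>K. integral {0..1} (\<lambda>x. dpoly K c x * dpoly K c' x * ?w x))"
      by (rule ext) (rule integral_unique[OF IJ(1), symmetric])
    then show ?thesis
      using tendsto_mult_left[OF IJ(3), of "32 / pi"] integral_unique[OF IJ(2)] True by (simp add: cov_formula_def)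
  next
    case False
    then have d3: "d > 2" using d by simp
    have r: "0 \<le> rho d" "rho d \<le> 1" using rho_bounds[OF d] by auto
    let ?S = "{0..rho d} \<times> {0..rho d}"
    have u1: "uniform_limit ?S (\<lambda>K p. dpoly K c (snd p)) (\<lambda>p. dseries c (snd p)) sequentially"
    proof (rule uniform_limitI)
      fix e :: real assume e: "e > 0"
      have "uniform_limit {0..rho d} (\<lambda>K. dpoly K c) (dseries c) sequentially"
        using r by (intro dpoly_uniform_limit c) auto
      from uniform_limitD[OF this e]
      show "\<forall>\<^sub>F K in sequentially. \<forall>p\<in>?S. dist (dpoly K c (snd p)) (dseries c (snd p)) < e"
        by eventually_elim auto
    qed
    have u2: "uniform_limit ?S (\<lambda>K p. dpoly K c' (fst p)) (\<lambda>p. dseries c' (fst p)) sequentially"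
    proof (rule uniform_limitI)
      fix e :: real assume e: "e > 0"
      have "uniform_limit {0..rho d} (\<lambda>K. dpoly K c') (dseries c') sequentially"
        using r by (intro dpoly_uniform_limit c') auto
      from uniform_limitD[OF this e]
      show "\<forall>\<^sub>F K in sequentially. \<forall>p\<in>?S. dist (dpoly K c' (fst p)) (dseries c' (fst p)) < e"
        by eventually_elim auto
    qed
    have cont: "continuous_on ?S (\<lambda>p. dseries c (snd p))" "continuous_on ?S (\<lambda>p. dseries c' (fst p))"
      by (auto intro!: continuous_on_compose2[OF bdd(2)[OF c r(2)]] continuous_on_compose2[OF bdd(2)[OF c' r(2)]] continuous_intros)
    have B: "continuous_on ?S (\<lambda>p. beta d (snd p) (fst p))"
      using continuous_on_beta[OF d3] by (simp add: case_prod_unfold)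
    have uH: "uniform_limit ?S (\<lambda>K p. dpoly K c (snd p) * dpoly K c' (fst p) * beta d (snd p) (fst p))
      (\<lambda>p. dseries c (snd p) * dseries c' (fst p) * beta d (snd p) (fst p)) sequentially"
      by (intro uniform_lim_mult uniform_limit_const u1 u2 compact_imp_bounded compact_continuous_image continuous_intros cont B compact_Times) auto
    have cH: "continuous_on ?S (\<lambda>p. dpoly K c (snd p) * dpoly K c' (fst p) * beta d (snd p) (fst p))" for K
      by (intro continuous_intros B continuous_on_compose2[OF continuous_on_dpoly[of UNIV]]) auto
    show ?thesis
      using iterated_integral_uniform_limit[OF r(1) cH uH] False by (simp add: cov_formula_def)
  qed
  then show "(\<Sum>l. limit_coeff d c l * limit_coeff d c' l) = cov_formula d (dseries c) (dseries c')"
    using LIMSEQ_unique[OF lhs] unfolding cov_formula_dpoly[OF d] by simp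
qed

subsection \<open>Locally tree-like graphs\<close>

lemma tree_arcs: "(xs, ys) \<in> parcs (reg_tree d) \<longleftrightarrow>
   xs \<in> pverts (reg_tree d) \<and> ys \<in> pverts (reg_tree d) \<and> ((\<exists>a. ys = a # xs) \<or> (\<exists>a. xs = a # ys))"
  by (simp add: reg_tree_def Let_def)

lemma tree_verts: "xs \<in> pverts (reg_tree d) \<longleftrightarrow> set xs \<subseteq> {..<d} \<and> distinct_adj xs"
  by (simp add: reg_tree_def Let_def)

lemma tree_path: "xs \<in> pverts (reg_tree d) \<Longrightarrow> ([], xs) \<in> parcs (reg_tree d) ^^ length xs"
proof (induction xs)
  case (Cons a xs)
  then have "xs \<in> pverts (reg_tree d)" by (auto simp: tree_verts dest: distinct_adj_ConsD)
  with Cons show ?case by (auto intro!: relpow_Suc_I[of _ xs] simp: tree_arcs)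
qed simp

lemma tree_ball: "gball (reg_tree d) [] r = {xs \<in> pverts (reg_tree d). length xs \<le> r}"
proof -
  have "xs \<in> pverts (reg_tree d) \<and> length xs \<le> k" if "([], xs) \<in> parcs (reg_tree d) ^^ k" for xs k
    using that
  proof (induction k arbitrary: xs)
    case 0
    then show ?case by (simp add: tree_verts)
  next
    case (Suc k)
    then obtain ys where "([], ys) \<in> parcs (reg_tree d) ^^ k" "(ys, xs) \<in> parcs (reg_tree d)"
      by (auto elim: relpow_Suc_E)
    with Suc.IH[of ys] show ?case by (auto simp: tree_arcs)
  qed
  then show ?thesis
    unfolding gball_def using tree_path by fastforce
qed

text \<open>What the computation keeps of a tree-like ball around \<open>z\<close>: a distance
  function with one parent and d - 1 children below radius \<open>r\<close>. From level
  \<open>r\<close> on, the only demand is that level 0 occurs at no vertex but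
  \<open>z\<close>.\<close>

definition level_fun :: "'a pair_pre_digraph \<Rightarrow> nat \<Rightarrow> 'a \<Rightarrow> nat \<Rightarrow> ('a \<Rightarrow> nat) \<Rightarrow> bool" where
  "level_fun G d z r l \<longleftrightarrow> (\<forall>v\<in>pverts G. l v = 0 \<longleftrightarrow> v = z) \<and>
     (\<forall>v\<in>pverts G. l v < r \<longrightarrow> card (nbrs G v) = d \<and>
        (l v = 0 \<longrightarrow> (\<forall>w\<in>nbrs G v. l w = 1)) \<and>
        (l v > 0 \<longrightarrow> (\<exists>p\<in>nbrs G v. l p = l v - 1 \<and> (\<forall>w\<in>nbrs G v - {p}. l w = l v + 1))))"

lemma level_funD:
  assumes "level_fun G d z r l" "v \<in> pverts G"
  shows "l v = 0 \<longleftrightarrow> v = z" "l v < r \<Longrightarrow> card (nbrs G v) = d"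
    "l v < r \<Longrightarrow> l v = 0 \<Longrightarrow> w \<in> nbrs G v \<Longrightarrow> l w = 1"
    "l v < r \<Longrightarrow> 0 < l v \<Longrightarrow> \<exists>p\<in>nbrs G v. l p = l v - 1 \<and> (\<forall>w\<in>nbrs G v - {p}. l w = l v + 1)"
proof -
  note 1 = bspec[OF conjunct1[OF assms(1)[unfolded level_fun_def]] assms(2)]
  note 2 = bspec[OF conjunct2[OF assms(1)[unfolded level_fun_def]] assms(2), rule_format]
  show "l v = 0 \<longleftrightarrow> v = z" by (rule 1)
  assume lv: "l v < r"
  show "card (nbrs G v) = d" using 2[OF lv] by (rule conjunct1)
  show "l v = 0 \<Longrightarrow> w \<in> nbrs G v \<Longrightarrow> l w = 1" using 2[OF lv] by simp
  show "0 < l v \<Longrightarrow> \<exists>p\<in>nbrs G v. l p = l v - 1 \<and> (\<forall>w\<in>nbrs G v - {p}. l w = l v + 1)"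
    using 2[OF lv] by simp
qed

context pair_graph
begin

lemma nbrs_subset: "nbrs G u \<subseteq> pverts G"
  using in_arcsD2 by (auto simp: nbrs_def)

lemma nbrs_sym: "v \<in> nbrs G u \<longleftrightarrow> u \<in> nbrs G v"
  using arcs_symmetric by (auto simp: nbrs_def)

lemma finite_nbrs: "finite (nbrs G u)"
  using nbrs_subset finite_verts by (rule finite_subset)

lemma ball_iso_level:
  assumes z: "z \<in> pverts G" and iso: "ball_iso G z (reg_tree d) [] r"
  shows "\<exists>l. level_fun G d z r l"
proof -
  let ?T = "reg_tree d"
  obtain f where f: "bij_betw f (gball G z r) (gball ?T [] r)" "f z = []"
    and arc: "\<And>x y. x \<in> gball G z r \<Longrightarrow> y \<in> gball G z r \<Longrightarrow> (f x, f y) \<in> parcs ?T \<longleftrightarrow> (x, y) \<in> parcs G"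
    using iso by (auto simp: ball_iso_def)
  have inj: "inj_on f (gball G z r)" and img: "f ` gball G z r = {xs \<in> pverts ?T. length xs \<le> r}"
    using f(1) by (auto simp: bij_betw_def tree_ball)
  have zb: "z \<in> gball G z r" by (auto simp: gball_def intro: exI[of _ 0])
  have fT: "f v \<in> pverts ?T" "length (f v) \<le> r" if "v \<in> gball G z r" for v
    using img that by auto
  \<comment> \<open>Deleting first letters leads back to the root inside the ball, so a vertex of
    level below \<open>r\<close> has all its neighbours in the ball; only then can its neighbourhood
    be compared with that of a tree vertex.\<close>
  have path: "(z, v) \<in> parcs G ^^ length xs" if "v \<in> gball G z r" "f v = xs" for v xs
    using that
  proof (induction xs arbitrary: v)
    case Nil
    then have "v = z" using inj zb f(2) by (metis inj_onD)
    then show ?case by simp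
  next
    case (Cons a xs)
    have xsT: "xs \<in> pverts ?T" "length xs \<le> r"
      using fT[OF Cons.prems(1)] Cons.prems(2) by (auto simp: tree_verts dest: distinct_adj_ConsD)
    then obtain v' where v': "v' \<in> gball G z r" "f v' = xs" using img by (metis (mono_tags, lifting) imageE mem_Collect_eq)
    have "(f v', f v) \<in> parcs ?T"
      using v' Cons.prems fT[OF Cons.prems(1)] xsT by (auto simp: tree_arcs)
    then have "(v', v) \<in> parcs G" using arc v'(1) Cons.prems(1) by simp
    then show ?case using Cons.IH[OF v'] by (auto intro: relpow_Suc_I)
  qed
  \<comment> \<open>The value \<open>r + 1\<close> puts vertices outside the ball above level
    \<open>r\<close> and, even for r = 0, away from level 0.\<close>
  define l where "l v = (if v \<in> gball G z r then length (f v) else r + 1)" for v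
  have "level_fun G d z r l"
    unfolding level_fun_def
  proof (intro conjI ballI impI)
    fix v assume v: "v \<in> pverts G"
    show "l v = 0 \<longleftrightarrow> v = z"
      using inj_on_eq_iff[OF inj _ zb, of v] zb f(2) by (auto simp: l_def)
  next
    fix v assume v: "v \<in> pverts G" and lv: "l v < r"
    then have vb: "v \<in> gball G z r" and len: "length (f v) < r" by (auto simp: l_def split: if_splits)
    have nb: "w \<in> gball G z r" if "w \<in> nbrs G v" for w
    proof -
      have "(z, w) \<in> parcs G ^^ Suc (length (f v))"
        using path[OF vb refl] that by (auto simp: nbrs_def intro: relpow_Suc_I)
      then show ?thesis using len unfolding gball_def by (auto intro!: exI[of _ "Suc (length (f v))"])
    qed
    have lw: "l w = length (f w)" if "w \<in> nbrs G v" for w using nb[OF that] by (simp add: l_def)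
    have lv': "l v = length (f v)" using vb by (simp add: l_def)
    have adj: "(f v, f w) \<in> parcs ?T" if "w \<in> nbrs G v" for w
      using arc[OF vb nb[OF that]] that by (simp add: nbrs_def)
    have surj: "\<exists>w\<in>nbrs G v. f w = ys" if "ys \<in> nbrs ?T (f v)" for ys
    proof -
      have "ys \<in> pverts ?T" "length ys \<le> r"
        using that len by (auto simp: nbrs_def tree_arcs)
      then obtain w where w: "w \<in> gball G z r" "f w = ys" using img by (metis (mono_tags, lifting) imageE mem_Collect_eq)
      then show ?thesis using arc[OF vb w(1)] that by (auto simp: nbrs_def)
    qed
    have "bij_betw f (nbrs G v) (nbrs ?T (f v))"
      unfolding bij_betw_def
    proof
      show "inj_on f (nbrs G v)" using inj nb by (auto intro: inj_on_subset)
      show "f ` nbrs G v = nbrs ?T (f v)" using surj adj by (auto simp: nbrs_def)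
    qed
    then show "card (nbrs G v) = d"
      using card_nbrs_reg_tree[OF fT(1)[OF vb]] by (simp add: bij_betw_same_card)
    show "l w = 1" if "l v = 0" "w \<in> nbrs G v" for w
      using adj[OF that(2)] that lw[OF that(2)] lv' by (auto simp: tree_arcs)
    show "\<exists>p\<in>nbrs G v. l p = l v - 1 \<and> (\<forall>w\<in>nbrs G v - {p}. l w = l v + 1)" if pos: "0 < l v"
    proof -
      obtain b ys where b: "f v = b # ys" using pos lv' by (cases "f v") auto
      have "ys \<in> nbrs ?T (f v)"
        using fT(1)[OF vb] b by (auto simp: nbrs_def tree_arcs tree_verts dest: distinct_adj_ConsD)
      then obtain p where p: "p \<in> nbrs G v" "f p = ys" using surj by blast
      have "l w = l v + 1" if w: "w \<in> nbrs G v - {p}" for w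
      proof -
        have "f w \<noteq> ys" using inj nb w p by (auto dest: inj_onD)
        then have "\<exists>a. f w = a # f v" using adj[of w] w b by (auto simp: tree_arcs)
        then show ?thesis using lw[of w] w lv' by auto
      qed
      moreover have "l p = l v - 1" using lw[OF p(1)] p(2) lv' b by simp
      ultimately show ?thesis using p(1) by blast
    qed
  qed
  then show ?thesis by blast
qed

lemma aut_nbrs:
  assumes "g \<in> auts G" "v \<in> pverts G"
  shows "nbrs G (g v) = g ` nbrs G v"
proof -
  have g: "g permutes pverts G" "\<And>u v. u \<in> pverts G \<Longrightarrow> v \<in> pverts G \<Longrightarrow> (g u, g v) \<in> parcs G \<longleftrightarrow> (u, v) \<in> parcs G"
    using assms(1) by (auto simp: auts_def)
  show ?thesis
  proof (intro equalityI subsetI)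
    fix w assume w: "w \<in> nbrs G (g v)"
    then have "w \<in> pverts G" using nbrs_subset by auto
    then obtain w' where w': "w' \<in> pverts G" "w = g w'" using permutes_image[OF g(1)] by auto
    then show "w \<in> g ` nbrs G v" using w g(2)[OF assms(2) w'(1)] by (auto simp: nbrs_def)
  next
    fix w assume "w \<in> g ` nbrs G v"
    then obtain w' where w': "w' \<in> nbrs G v" "w = g w'" by auto
    then have "w' \<in> pverts G" using nbrs_subset by auto
    then show "w \<in> nbrs G (g v)" using w' g(2)[OF assms(2)] by (auto simp: nbrs_def)
  qed
qed

lemma level_fun_aut:
  assumes l: "level_fun G d z r l" and g: "g \<in> auts G" and z: "z \<in> pverts G"
  shows "level_fun G d (g z) r (l \<circ> inv_into UNIV g)"
proof -
  have p: "g permutes pverts G" using g by (auto simp: auts_def)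
  have inv_g: "inv_into UNIV g (g v) = v" for v using permutes_inverses[OF p] by simp
  have ex: "\<exists>w\<in>pverts G. v = g w" if "v \<in> pverts G" for v
  proof -
    have "v \<in> g ` pverts G" using that by (simp only: permutes_image[OF p])
    then show ?thesis by blast
  qed
  have gi: "g v = g w \<longleftrightarrow> v = w" for v w using permutes_inj[OF p] by (auto dest: injD)
  have card_g: "card (g ` S) = card S" for S
    using permutes_inj[OF p] by (intro card_image) (auto intro: inj_on_subset)
  show ?thesis
    unfolding level_fun_def
  proof (intro conjI ballI)
    fix v assume "v \<in> pverts G"
    then obtain w where w: "w \<in> pverts G" "v = g w" using ex by blast
    then show "(l \<circ> inv_into UNIV g) v = 0 \<longleftrightarrow> v = g z"
      using level_funD(1)[OF l w(1)] by (simp add: inv_g gi)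
  next
    fix v assume "v \<in> pverts G"
    then obtain w where w: "w \<in> pverts G" "v = g w" using ex by blast
    let ?l = "l \<circ> inv_into UNIV g"
    have lg: "?l (g x) = l x" for x by (simp add: inv_g)
    have nb: "nbrs G v = g ` nbrs G w" using aut_nbrs[OF g w(1)] w(2) by simp
    show "?l v < r \<longrightarrow> card (nbrs G v) = d \<and> (?l v = 0 \<longrightarrow> (\<forall>w\<in>nbrs G v. ?l w = 1)) \<and>
        (?l v > 0 \<longrightarrow> (\<exists>p\<in>nbrs G v. ?l p = ?l v - 1 \<and> (\<forall>w\<in>nbrs G v - {p}. ?l w = ?l v + 1)))"
    proof -
      have lv: "?l v = l w" using lg[of w] w(2) by simp
      have "card (nbrs G v) = d" if lw: "l w < r"
        unfolding nb card_g by (rule level_funD(2)[OF l w(1) lw])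
      moreover have "\<forall>x\<in>nbrs G v. ?l x = 1" if lw: "l w < r" and l0: "l w = 0"
        unfolding nb using level_funD(3)[OF l w(1) lw l0] by (simp add: inv_g)
      moreover have "\<exists>p\<in>nbrs G v. ?l p = l w - 1 \<and> (\<forall>x\<in>nbrs G v - {p}. ?l x = l w + 1)"
        if lw: "l w < r" and pos: "0 < l w"
      proof -
        obtain p where pp: "p \<in> nbrs G w" "l p = l w - 1" "\<forall>x\<in>nbrs G w - {p}. l x = l w + 1"
          using level_funD(4)[OF l w(1) lw pos] by blast
        have "?l x = l w + 1" if x: "x \<in> g ` nbrs G w - {g p}" for x
        proof -
          obtain y where "y \<in> nbrs G w" "x = g y" using x by blast
          then show ?thesis using x pp(3) by (auto simp: inv_g)
        qed
        then show ?thesis unfolding nb using pp(1,2) by (intro bexI[of _ "g p"]) (auto simp: inv_g)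
      qed
      ultimately show ?thesis unfolding lv by blast
    qed
  qed
qed

text \<open>Local convergence concerns one root; automorphisms carry its level function to every
  vertex.\<close>

lemma vertex_transitive_level:
  assumes "vertex_transitive G" "z0 \<in> pverts G" "ball_iso G z0 (reg_tree d) [] r" "z \<in> pverts G"
  shows "\<exists>l. level_fun G d z r l"
proof -
  obtain l where "level_fun G d z0 r l" using ball_iso_level assms by blast
  moreover obtain g where "g \<in> auts G" "g z0 = z" using assms by (auto simp: vertex_transitive_def)
  ultimately show ?thesis using level_fun_aut[of d z0 r l g] assms(2) by auto
qed

end

section \<open>Random walk on a locally tree-like graph\<close>

fun tree_walk :: "real \<Rightarrow> nat \<Rightarrow> nat \<Rightarrow> real" where
  "tree_walk d 0 l = (if l = 0 then 1 else 0)"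
| "tree_walk d (Suc b) l = (if l = 0 then tree_walk d b 1
     else (tree_walk d b (l - 1) + (d - 1) * tree_walk d b (l + 1)) / d)"

lemma tree_walk_eq_0: "b < l \<Longrightarrow> tree_walk d b l = 0"
  by (induction b arbitrary: l) auto

lemma tree_walk_diag_pos: "d > 0 \<Longrightarrow> tree_walk d b b > 0"
  by (induction b) (auto simp: tree_walk_eq_0)

text \<open>\<open>tree_walk d b l\<close> is the probability that the walk on the tree, started at
  distance \<open>l\<close>, is at the root after \<open>b\<close> steps. The special rule at the
  root turns, at l = 1, into the boundary value 0 of \<open>tree_diff\<close>.\<close>

lemma tree_diff_walk:
  assumes "d \<noteq> 0" "l > 0"
  shows "tree_diff d b l = tree_walk d b (l - 1) - tree_walk d b (l + 1)"
  using assms(2)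
proof (induction b arbitrary: l)
  case (Suc b)
  show ?case
  proof (cases "l = 1")
    case True
    have "tree_diff d b (Suc (Suc 0)) = tree_walk d b (Suc 0) - tree_walk d b (Suc (Suc (Suc 0)))"
      using Suc.IH[of "Suc (Suc 0)"] by simp
    then show ?thesis using True assms(1) by (simp add: diff_divide_distrib add_divide_distrib left_diff_distrib right_diff_distrib)
  next
    case False
    then obtain k where k: "l = Suc (Suc k)" using Suc.prems by (metis One_nat_def gr0_implies_Suc not0_implies_Suc)
    have "tree_diff d b (Suc k) = tree_walk d b k - tree_walk d b (Suc (Suc k))"
      "tree_diff d b (Suc (Suc (Suc k))) = tree_walk d b (Suc (Suc k)) - tree_walk d b (Suc (Suc (Suc (Suc k))))"
      using Suc.IH[of "Suc k"] Suc.IH[of "Suc (Suc (Suc k))"] by simp_all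
    then show ?thesis
      by (simp add: k diff_divide_distrib add_divide_distrib left_diff_distrib right_diff_distrib)
  qed
qed auto

context pair_graph
begin

abbreviation "V \<equiv> pverts G"
abbreviation "M \<equiv> walk_matrix G"

lemma walk_nonneg: "0 \<le> M u v"
  by (simp add: walk_matrix_def)

lemma mpow_nonneg: "0 \<le> mpow V M k u v"
  by (induction k arbitrary: u v) (auto simp: mm_def intro!: sum_nonneg mult_nonneg_nonneg walk_nonneg)

lemma mpow_Suc_left:
  assumes "u \<in> V" "v \<in> V"
  shows "mpow V M (Suc k) u v = mm V M (mpow V M k) u v"
proof -
  have "mpow V M (1 + k) u v = mm V (mpow V M 1) (mpow V M k) u v"
    using mpow_add[OF finite_verts assms(2), of M 1 k u] by simp
  also have "\<dots> = mm V M (mpow V M k) u v"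
    using mm_one_left[OF finite_verts assms(1)] by (intro mm_cong) auto
  finally show ?thesis by simp
qed

lemma mm_walk: "mm V M A u v = (\<Sum>w\<in>nbrs G u. A w v) / card (nbrs G u)"
proof -
  have "mm V M A u v = (\<Sum>w\<in>nbrs G u. 1 / card (nbrs G u) * A w v)"
    unfolding mm_def using nbrs_subset
    by (intro sum.mono_neutral_cong_right finite_verts) (auto simp: walk_matrix_def nbrs_def)
  then show ?thesis by (simp add: sum_divide_distrib)
qed

text \<open>Below level \<open>r\<close> the distance to \<open>z\<close> moves as on the tree; from
  level \<open>r\<close> on, \<open>z\<close> is out of reach in fewer than \<open>r\<close> steps,
  and both sides vanish. The formula thus holds at every vertex.\<close>

lemma mpow_level:
  assumes l: "level_fun G d z r l" and z: "z \<in> V" and d: "d > 0" and b: "b < r" and v: "v \<in> V"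
  shows "mpow V M b v z = tree_walk d b (l v)"
  using b v
proof (induction b arbitrary: v)
  case 0
  then show ?case using level_funD(1)[OF l] by simp
next
  case (Suc b)
  have IH: "mpow V M b w z = tree_walk d b (l w)" if "w \<in> nbrs G v" for w
    using Suc that nbrs_subset by auto
  have "mpow V M (Suc b) v z = (\<Sum>w\<in>nbrs G v. tree_walk d b (l w)) / card (nbrs G v)"
    unfolding mpow_Suc_left[OF Suc.prems(2) z] mm_walk using IH by simp
  also have "\<dots> = tree_walk d (Suc b) (l v)"
  proof (cases "l v < r")
    case True
    then have s: "card (nbrs G v) = d" "l v = 0 \<Longrightarrow> w \<in> nbrs G v \<Longrightarrow> l w = 1"
      "l v > 0 \<Longrightarrow> \<exists>p\<in>nbrs G v. l p = l v - 1 \<and> (\<forall>w\<in>nbrs G v - {p}. l w = l v + 1)" for w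
      using level_funD[OF l Suc.prems(2)] by blast+
    show ?thesis
    proof (cases "l v = 0")
      case True
      then show ?thesis using s d by simp
    next
      case False
      then obtain p where p: "p \<in> nbrs G v" "l p = l v - 1" "\<forall>w\<in>nbrs G v - {p}. l w = l v + 1"
        using s(3) by blast
      have "(\<Sum>w\<in>nbrs G v. tree_walk d b (l w)) = tree_walk d b (l p) + (\<Sum>w\<in>nbrs G v - {p}. tree_walk d b (l w))"
        using p(1) finite_nbrs by (simp add: sum.remove)
      also have "\<dots> = tree_walk d b (l v - 1) + (real d - 1) * tree_walk d b (l v + 1)"
        using p s(1) d finite_nbrs by (simp add: card_Diff_singleton of_nat_diff)
      finally show ?thesis using False s(1) by simp
    qed
  next
    case False
    \<comment> \<open>A neighbour of level at most \<open>b\<close> would itself lie in the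
      tree-like range and force the level of \<open>v\<close> to be at most \<open>b + 1\<close>,
      which is below \<open>r\<close>.\<close>
    have "tree_walk d b (l w) = 0" if w: "w \<in> nbrs G v" for w
    proof (rule tree_walk_eq_0, rule ccontr)
      assume "\<not> b < l w"
      then have lw: "l w \<le> b" by simp
      have wV: "w \<in> V" and vw: "v \<in> nbrs G w" using w nbrs_subset nbrs_sym by auto
      have "l w < r" using lw Suc.prems(1) by simp
      then have "l v \<le> l w + 1"
      proof (cases "l w = 0")
        case True
        then show ?thesis using level_funD(3)[OF l wV \<open>l w < r\<close> True vw] by simp
      next
        case False
        then obtain p where "l p = l w - 1" "\<forall>x\<in>nbrs G w - {p}. l x = l w + 1"
          using level_funD(4)[OF l wV \<open>l w < r\<close>] by blast
        then show ?thesis using vw by (cases "v = p") auto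
      qed
      then show False using False lw Suc.prems(1) by simp
    qed
    then show ?thesis using False Suc.prems(1) by (simp add: tree_walk_eq_0)
  qed
  finally show ?case .
qed

text \<open>The sets of children of distinct vertices are disjoint because a parent is unique, so
  each level beyond the first multiplies the count by d - 1.\<close>

lemma level_card:
  assumes l: "level_fun G d z r l" and z: "z \<in> V" and k: "0 < k" "k < r"
  shows "card {v\<in>V. l v = k} = d * (d - 1) ^ (k - 1)"
  using k
proof (induction k)
  case (Suc k)
  have par: "\<exists>p\<in>nbrs G w. l p = l w - 1 \<and> (\<forall>x\<in>nbrs G w - {p}. l x = l w + 1)" if "w \<in> V" "0 < l w" "l w < r" for w
    using level_funD(4)[OF l that(1)] that by blast
  show ?case
  proof (cases "k = 0")
    case True
    have "{v\<in>V. l v = 1} = nbrs G z"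
    proof (intro equalityI subsetI)
      fix v assume v: "v \<in> {v\<in>V. l v = 1}"
      then obtain p where p: "p \<in> nbrs G v" "l p = 0" using par[of v] Suc.prems True by fastforce
      then have "p = z" using level_funD(1)[OF l, of p] nbrs_subset by auto
      then show "v \<in> nbrs G z" using p nbrs_sym by simp
    next
      fix v assume v: "v \<in> nbrs G z"
      have "l z = 0" using level_funD(1)[OF l z] by simp
      then have "l v = 1" using level_funD(3)[OF l z _ _ v] Suc.prems by simp
      then show "v \<in> {v\<in>V. l v = 1}" using v nbrs_subset by auto
    qed
    moreover have "card (nbrs G z) = d"
      using level_funD(1,2)[OF l z] Suc.prems by simp
    ultimately show ?thesis using True by simp
  next
    case False
    then have k: "0 < k" "k < r" using Suc.prems by auto
    let ?up = "\<lambda>v. {w\<in>nbrs G v. l w = Suc k}"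
    have "{v\<in>V. l v = Suc k} = (\<Union>v\<in>{v\<in>V. l v = k}. ?up v)"
    proof (intro equalityI subsetI)
      fix w assume w: "w \<in> {v\<in>V. l v = Suc k}"
      then obtain p where "p \<in> nbrs G w" "l p = k" using par[of w] Suc.prems by fastforce
      moreover have "p \<in> V" using \<open>p \<in> nbrs G w\<close> nbrs_subset by auto
      moreover have "w \<in> nbrs G p" using \<open>p \<in> nbrs G w\<close> nbrs_sym by simp
      ultimately show "w \<in> (\<Union>v\<in>{v\<in>V. l v = k}. ?up v)"
        using w by auto
    qed (use nbrs_subset in auto)
    moreover have "card (\<Union>v\<in>{v\<in>V. l v = k}. ?up v) = (\<Sum>v\<in>{v\<in>V. l v = k}. card (?up v))"
    proof (rule card_UN_disjoint)
      show "\<forall>v\<in>{v\<in>V. l v = k}. \<forall>v'\<in>{v\<in>V. l v = k}. v \<noteq> v' \<longrightarrow> ?up v \<inter> ?up v' = {}"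
      proof (intro ballI impI, rule ccontr)
        fix v v' assume vv: "v \<in> {v\<in>V. l v = k}" "v' \<in> {v\<in>V. l v = k}" "v \<noteq> v'" "?up v \<inter> ?up v' \<noteq> {}"
        then obtain w where w: "w \<in> nbrs G v" "w \<in> nbrs G v'" "l w = Suc k" by auto
        then have wV: "w \<in> V" using nbrs_subset by auto
        obtain p where p: "\<forall>x\<in>nbrs G w - {p}. l x = Suc k + 1" using par[OF wV] w(3) Suc.prems by auto
        have "v \<in> nbrs G w" "v' \<in> nbrs G w" using w nbrs_sym by auto
        moreover have "l v = k" "l v' = k" using vv(1,2) by auto
        ultimately have "v = p" "v' = p" using bspec[OF p, of v] bspec[OF p, of v'] by auto
        then show False using vv(3) by simp
      qed
    qed (auto simp: finite_verts finite_nbrs)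
    moreover have "card (?up v) = d - 1" if v: "v \<in> {v\<in>V. l v = k}" for v
    proof -
      obtain p where p: "p \<in> nbrs G v" "l p = k - 1" "\<forall>x\<in>nbrs G v - {p}. l x = k + 1"
        using par[of v] v k by auto
      have "?up v = nbrs G v - {p}" using p k by auto
      moreover have "card (nbrs G v) = d" using level_funD(2)[OF l, of v] v k by simp
      ultimately show ?thesis using p(1) finite_nbrs by (simp add: card_Diff_singleton)
    qed
    ultimately have "card {v\<in>V. l v = Suc k} = card {v\<in>V. l v = k} * (d - 1)" by simp
    also have "\<dots> = d * (d - 1) ^ (Suc k - 1)"
      using Suc.IH[OF k] k by (cases k) auto
    finally show ?thesis .
  qed
qed simp

text \<open>Every level below \<open>r\<close> is attained. Hence the graphs grow, which makes the
  error of the normal approximation vanish.\<close>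

lemma level_card_verts:
  assumes l: "level_fun G d z r l" and z: "z \<in> V" and d: "d \<ge> 2"
  shows "r \<le> card V"
proof -
  have "k \<in> l ` V" if k: "k < r" for k
  proof (cases "k = 0")
    case True
    then show ?thesis using level_funD(1)[OF l z] z by (intro image_eqI[of _ _ z]) auto
  next
    case False
    then have "card {v\<in>V. l v = k} > 0" using level_card[OF l z, of k] k d by simp
    then have "{v\<in>V. l v = k} \<noteq> {}" by (metis card.empty less_numeral_extra(3))
    then show ?thesis by auto
  qed
  then have "{..<r} \<subseteq> l ` V" by auto
  then have "card {..<r} \<le> card (l ` V)" using finite_verts by (intro card_mono) auto
  also have "\<dots> \<le> card V" using finite_verts by (rule card_image_le)
  finally show ?thesis by simp
qed

lemma row_sum_mpow:
  assumes "u \<in> V"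
  shows "(\<Sum>z\<in>V. mpow V M k u z) \<le> 1"
proof -
  have "row_bound V (mpow V M k) (1 ^ k)"
    by (rule row_bound_mpow[OF finite_verts row_bound_walk_matrix]) (unfold_locales, simp)
  then show ?thesis using assms by (simp add: row_bound_def mpow_nonneg)
qed

lemma mpow_le_1: "u \<in> V \<Longrightarrow> z \<in> V \<Longrightarrow> mpow V M k u z \<le> 1"
  using row_sum_mpow[of u k] member_le_sum[of z V "mpow V M k u"] finite_verts mpow_nonneg
  by (meson order_trans)

lemma regular:
  assumes "vertex_transitive G" "u \<in> V" "v \<in> V"
  shows "card (nbrs G u) = card (nbrs G v)"
proof -
  obtain g where g: "g \<in> auts G" "g u = v" using assms by (auto simp: vertex_transitive_def)
  then have "inj g" by (auto simp: auts_def permutes_inj)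
  then show ?thesis using aut_nbrs[OF g(1) assms(2)] g(2) by (metis card_image inj_on_subset subset_UNIV)
qed

text \<open>Transitivity makes the graph regular, hence the walk matrix symmetric.\<close>

lemma mpow_sym:
  assumes t: "vertex_transitive G" and "u \<in> V" "v \<in> V"
  shows "mpow V M k u v = mpow V M k v u"
  using assms(2,3)
proof (induction k arbitrary: u v)
  case (Suc k)
  have Msym: "M u w = M w u" if "u \<in> V" "w \<in> V" for u w
    using regular[OF t that] arcs_symmetric by (auto simp: walk_matrix_def)
  have "mpow V M (Suc k) u v = (\<Sum>w\<in>V. mpow V M k u w * M w v)" by (simp add: mm_def)
  also have "\<dots> = (\<Sum>w\<in>V. M v w * mpow V M k w u)"
    using Suc Msym by (intro sum.cong) auto
  also have "\<dots> = mpow V M (Suc k) v u" using mpow_Suc_left[OF Suc.prems(2,1)] by (simp add: mm_def)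
  finally show ?case .
qed auto

lemma mpow_aut:
  assumes g: "g \<in> auts G" and "u \<in> V" "v \<in> V"
  shows "mpow V M k (g u) (g v) = mpow V M k u v"
  using assms(2,3)
proof (induction k arbitrary: u v)
  case 0
  have "inj g" using g by (auto simp: auts_def permutes_inj)
  then show ?case by (auto dest: injD)
next
  case (Suc k)
  have p: "g permutes V" using g by (auto simp: auts_def)
  have Mg: "M (g w) (g v) = M w v" if "w \<in> V" "v \<in> V" for w v
  proof -
    have "card (nbrs G (g w)) = card (nbrs G w)"
      using aut_nbrs[OF g that(1)] permutes_inj[OF p] by (metis card_image inj_on_subset subset_UNIV)
    then show ?thesis using g that by (auto simp: walk_matrix_def auts_def)
  qed
  have "mpow V M (Suc k) (g u) (g v) = (\<Sum>w\<in>V. mpow V M k (g u) (g w) * M (g w) (g v))"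
    using sum.permute[OF p, of "\<lambda>w. mpow V M k (g u) w * M w (g v)"] by (simp add: mm_def comp_def)
  also have "\<dots> = (\<Sum>w\<in>V. mpow V M k u w * M w v)"
    using Suc Mg by (intro sum.cong) auto
  finally show ?case by (simp add: mm_def)
qed

lemma card_mpow_support:
  assumes d: "\<And>v. v \<in> V \<Longrightarrow> card (nbrs G v) = d" and u: "u \<in> V"
  shows "card {z\<in>V. mpow V M k u z \<noteq> 0} \<le> d ^ k"
proof (induction k)
  case 0
  have "{z\<in>V. mpow V M 0 u z \<noteq> 0} \<subseteq> {u}" by (auto split: if_splits)
  then show ?case using card_mono[of "{u}"] by force
next
  case (Suc k)
  have "{z\<in>V. mpow V M (Suc k) u z \<noteq> 0} \<subseteq> (\<Union>w\<in>{w\<in>V. mpow V M k u w \<noteq> 0}. nbrs G w)"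
  proof
    fix z assume z: "z \<in> {z\<in>V. mpow V M (Suc k) u z \<noteq> 0}"
    then have "\<exists>w\<in>V. mpow V M k u w * M w z \<noteq> 0"
      by (auto simp: mm_def intro: ccontr dest: sum.neutral)
    then show "z \<in> (\<Union>w\<in>{w\<in>V. mpow V M k u w \<noteq> 0}. nbrs G w)"
      by (auto simp: walk_matrix_def nbrs_def split: if_splits)
  qed
  then have "card {z\<in>V. mpow V M (Suc k) u z \<noteq> 0} \<le> card (\<Union>w\<in>{w\<in>V. mpow V M k u w \<noteq> 0}. nbrs G w)"
    by (intro card_mono) (auto simp: finite_verts finite_nbrs)
  also have "\<dots> \<le> (\<Sum>w\<in>{w\<in>V. mpow V M k u w \<noteq> 0}. card (nbrs G w))"
    by (intro card_UN_le) (simp add: finite_verts)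
  also have "\<dots> = card {w\<in>V. mpow V M k u w \<noteq> 0} * d" using d by simp
  also have "\<dots> \<le> d ^ k * d" using Suc by simp
  finally show ?case by (simp add: mult.commute)
qed

end

subsection \<open>Trace statistics of a random environment\<close>

text \<open>The almost sure conditions are imposed at every point of \<open>space P\<close>, so that
  the estimates below are pointwise; \<open>random_environment_version\<close> supplies an
  environment of this kind.\<close>

locale environment = pair_graph G + prob_space P for G :: "'a pair_pre_digraph" and P :: "'w measure" +
  fixes B :: "'w \<Rightarrow> 'a \<Rightarrow> 'a \<Rightarrow> real" and c :: real
  assumes transitive: "vertex_transitive G" and nonempty: "pverts G \<noteq> {}" and c: "0 \<le> c"
    and mean_B: "\<And>u v. (u, v) \<in> parcs G \<Longrightarrow> expectation (\<lambda>\<omega>. B \<omega> u v) = 0"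
    and second_B: "\<And>u v. (u, v) \<in> parcs G \<Longrightarrow> expectation (\<lambda>\<omega>. (B \<omega> u v)\<^sup>2) = 1"
    and rows: "indep_vars (\<lambda>_. PiM (pverts G) (\<lambda>_. borel)) (\<lambda>u \<omega>. restrict (B \<omega> u) (pverts G)) (pverts G)"
    and bound_B: "\<And>\<omega> u v. \<omega> \<in> space P \<Longrightarrow> u \<in> pverts G \<Longrightarrow> v \<in> pverts G \<Longrightarrow>
      \<bar>B \<omega> u v\<bar> \<le> c * walk_matrix G u v"
    and stab_B: "\<And>\<omega> u v. \<omega> \<in> space P \<Longrightarrow> u \<in> pverts G \<Longrightarrow> v \<in> pverts G \<Longrightarrow>
      (\<Sum>g\<in>Stab G u. B \<omega> u (g v)) = 0"
begin

sublocale indep_rows P "\<lambda>_. PiM (pverts G) (\<lambda>_. borel)" "\<lambda>u \<omega>. restrict (B \<omega> u) (pverts G)" "pverts G"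
  by unfold_locales (simp_all add: rows)

text \<open>Boundedness makes all products integrable, so that expectations over disjoint sets of
  rows factor without further side conditions.\<close>

definition bdd_dep :: "'a set \<Rightarrow> ('w \<Rightarrow> real) \<Rightarrow> bool" where
  "bdd_dep S X \<longleftrightarrow> dep S X \<and> (\<exists>C. \<forall>\<omega>\<in>space P. \<bar>X \<omega>\<bar> \<le> C)"

lemma bdd_depI: "dep S X \<Longrightarrow> (\<And>\<omega>. \<omega> \<in> space P \<Longrightarrow> \<bar>X \<omega>\<bar> \<le> C) \<Longrightarrow> bdd_dep S X"
  by (auto simp: bdd_dep_def)

lemma bdd_dep_dep: "bdd_dep S X \<Longrightarrow> dep S X"
  by (simp add: bdd_dep_def)

lemma bdd_dep_mono: "bdd_dep S X \<Longrightarrow> S \<subseteq> S' \<Longrightarrow> S' \<subseteq> V \<Longrightarrow> bdd_dep S' X"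
  unfolding bdd_dep_def using dep_mono by blast

lemma bdd_dep_mult:
  assumes "bdd_dep S X" "bdd_dep S' Y"
  shows "bdd_dep (S \<union> S') (\<lambda>\<omega>. X \<omega> * Y \<omega>)"
proof -
  obtain C C' where C: "\<And>\<omega>. \<omega> \<in> space P \<Longrightarrow> \<bar>X \<omega>\<bar> \<le> C" "\<And>\<omega>. \<omega> \<in> space P \<Longrightarrow> \<bar>Y \<omega>\<bar> \<le> C'"
    using assms by (auto simp: bdd_dep_def)
  have S: "S \<union> S' \<subseteq> V" using assms by (auto simp: bdd_dep_def dest: dep_subset)
  have "dep (S \<union> S') X" "dep (S \<union> S') Y"
    using bdd_dep_mono[OF assms(1) _ S] bdd_dep_mono[OF assms(2) _ S] by (auto simp: bdd_dep_def)
  moreover have "\<bar>X \<omega> * Y \<omega>\<bar> \<le> C * C'" if "\<omega> \<in> space P" for \<omega>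
    unfolding abs_mult using C[OF that] by (intro mult_mono) auto
  ultimately show ?thesis by (auto intro: bdd_depI dep_mult)
qed

lemma bdd_dep_cmult: "bdd_dep S X \<Longrightarrow> bdd_dep S (\<lambda>\<omega>. a * X \<omega>)"
  using bdd_dep_mult[of S "\<lambda>_. a" S X] by (auto simp: bdd_dep_def intro: dep_const dest: dep_subset)

lemma bdd_dep_cmult': "bdd_dep S X \<Longrightarrow> bdd_dep S (\<lambda>\<omega>. X \<omega> * a)"
  using bdd_dep_cmult[of S X a] by (simp add: mult.commute)

lemma bdd_dep_sum:
  assumes "finite J" "\<And>j. j \<in> J \<Longrightarrow> bdd_dep S (X j)" "S \<subseteq> V"
  shows "bdd_dep S (\<lambda>\<omega>. \<Sum>j\<in>J. X j \<omega>)"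
proof -
  have "\<forall>j\<in>J. \<exists>C. \<forall>\<omega>\<in>space P. \<bar>X j \<omega>\<bar> \<le> C" using assms(2) by (auto simp: bdd_dep_def)
  then obtain C where C: "\<And>j \<omega>. j \<in> J \<Longrightarrow> \<omega> \<in> space P \<Longrightarrow> \<bar>X j \<omega>\<bar> \<le> C j" by metis
  have "\<bar>\<Sum>j\<in>J. X j \<omega>\<bar> \<le> (\<Sum>j\<in>J. C j)" if "\<omega> \<in> space P" for \<omega>
    using C that by (intro order_trans[OF sum_abs sum_mono]) auto
  then show ?thesis using assms by (intro bdd_depI dep_sum) (auto simp: bdd_dep_def)
qed

lemma bdd_dep_integrable:
  assumes "bdd_dep S X"
  shows "integrable P X"
proof -
  obtain C where "\<And>\<omega>. \<omega> \<in> space P \<Longrightarrow> norm (X \<omega>) \<le> C" using assms by (auto simp: bdd_dep_def)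
  then show ?thesis by (rule integrable_bounded[OF dep_measurable[OF bdd_dep_dep[OF assms]]])
qed

lemma bdd_dep_expectation_mult:
  assumes "bdd_dep S X" "bdd_dep S' Y" "S \<inter> S' = {}"
  shows "expectation (\<lambda>\<omega>. X \<omega> * Y \<omega>) = expectation X * expectation Y"
  by (rule expectation_dep_mult[OF bdd_dep_dep[OF assms(1)] bdd_dep_dep[OF assms(2)] assms(3)])
    (rule bdd_dep_integrable[OF assms(1)], rule bdd_dep_integrable[OF assms(2)])

lemma bdd_dep_B:
  assumes "u \<in> V" "v \<in> V"
  shows "bdd_dep {u} (\<lambda>\<omega>. B \<omega> u v)"
proof -
  have "dep {u} (\<lambda>\<omega>. (\<lambda>r. r v) (restrict (B \<omega> u) V))"
    by (rule dep_row[OF assms(1)]) (use assms(2) in measurable)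
  then show ?thesis using bound_B[OF _ assms] assms(2) by (intro bdd_depI) auto
qed

lemma B_eq_0: "\<omega> \<in> space P \<Longrightarrow> u \<in> V \<Longrightarrow> v \<in> V \<Longrightarrow> v \<notin> nbrs G u \<Longrightarrow> B \<omega> u v = 0"
  using bound_B[of \<omega> u v] by (simp add: walk_matrix_def nbrs_def)

lemma mean_B':
  assumes "u \<in> V" "v \<in> V"
  shows "expectation (\<lambda>\<omega>. B \<omega> u v) = 0"
proof (cases "(u, v) \<in> parcs G")
  case False
  then have "expectation (\<lambda>\<omega>. B \<omega> u v) = expectation (\<lambda>_. 0)"
    using B_eq_0 assms by (intro Bochner_Integration.integral_cong) (auto simp: nbrs_def)
  then show ?thesis by simp
qed (rule mean_B)

text \<open>The order of the stabilizer times the sum equals the sum averaged over the stabilizer,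
  where the condition on \<open>B\<close> applies. With \<open>h\<close> constant the rows of
  \<open>B\<close> sum to zero; with \<open>h\<close> a return probability the diagonal entries
  vanish.\<close>

lemma stab_sum:
  assumes \<omega>: "\<omega> \<in> space P" and u: "u \<in> V" and h: "\<And>g v. g \<in> Stab G u \<Longrightarrow> v \<in> V \<Longrightarrow> h (g v) = (h v :: real)"
  shows "(\<Sum>v\<in>V. B \<omega> u v * h v) = 0"
proof -
  have perm: "g permutes V" if "g \<in> Stab G u" for g using that by (simp add: Stab_def auts_def)
  have fin: "finite (Stab G u)"
    by (rule finite_subset[OF _ finite_permutations[OF finite_verts]]) (auto dest: perm)
  have "id \<in> Stab G u" by (simp add: Stab_def auts_def permutes_id)
  then have pos: "card (Stab G u) > 0" using fin card_gt_0_iff by blast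
  have "card (Stab G u) * (\<Sum>v\<in>V. B \<omega> u v * h v) = (\<Sum>g\<in>Stab G u. \<Sum>v\<in>V. B \<omega> u (g v) * h (g v))"
  proof -
    have "(\<Sum>v\<in>V. B \<omega> u (g v) * h (g v)) = (\<Sum>v\<in>V. B \<omega> u v * h v)" if "g \<in> Stab G u" for g
      using sum.permute[OF perm[OF that], of "\<lambda>v. B \<omega> u v * h v"] by (simp add: comp_def)
    then show ?thesis by simp
  qed
  also have "\<dots> = (\<Sum>g\<in>Stab G u. \<Sum>v\<in>V. B \<omega> u (g v) * h v)"
    using h by (intro sum.cong) auto
  also have "\<dots> = (\<Sum>v\<in>V. (\<Sum>g\<in>Stab G u. B \<omega> u (g v)) * h v)"
    by (subst sum.swap) (simp add: sum_distrib_right)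
  also have "\<dots> = 0" using stab_B[OF \<omega> u] by simp
  finally show ?thesis using pos by simp
qed

definition entry :: "nat \<Rightarrow> 'a \<Rightarrow> 'a \<Rightarrow> 'w \<Rightarrow> real" where
  "entry b u z \<omega> = mm V (B \<omega>) (mpow V M b) u z"

text \<open>Domination of \<open>B\<close> by \<open>c * M\<close> turns the entry into a walk
  probability of \<open>Suc b\<close> steps, which gives boundedness and finite range
  together.\<close>

lemma entry_bound:
  assumes "\<omega> \<in> space P" "u \<in> V" "z \<in> V"
  shows "\<bar>entry b u z \<omega>\<bar> \<le> c * mpow V M (Suc b) u z"
proof -
  have "\<bar>entry b u z \<omega>\<bar> \<le> (\<Sum>v\<in>V. \<bar>B \<omega> u v * mpow V M b v z\<bar>)"
    by (simp add: entry_def mm_def)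
  also have "\<dots> \<le> (\<Sum>v\<in>V. c * M u v * mpow V M b v z)"
    using bound_B[OF assms(1,2)] mpow_nonneg by (intro sum_mono) (auto simp: abs_mult intro!: mult_right_mono)
  also have "\<dots> = c * mpow V M (Suc b) u z"
    unfolding mpow_Suc_left[OF assms(2,3)] by (simp add: mm_def sum_distrib_left mult.assoc)
  finally show ?thesis .
qed

lemma bdd_dep_entry: "u \<in> V \<Longrightarrow> bdd_dep {u} (entry b u z)"
  unfolding entry_def mm_def
  by (intro bdd_dep_sum finite_verts bdd_dep_cmult' bdd_dep_B) auto

lemma mean_entry:
  assumes "u \<in> V"
  shows "expectation (entry b u z) = 0"
proof -
  have int: "integrable P (\<lambda>\<omega>. B \<omega> u v * mpow V M b v z)" if "v \<in> V" for v
    using bdd_dep_integrable[OF bdd_dep_cmult'[OF bdd_dep_B[OF assms that]]] .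
  have "expectation (entry b u z) = (\<Sum>v\<in>V. expectation (\<lambda>\<omega>. B \<omega> u v * mpow V M b v z))"
    unfolding entry_def mm_def by (intro Bochner_Integration.integral_sum int)
  also have "\<dots> = (\<Sum>v\<in>V. expectation (\<lambda>\<omega>. B \<omega> u v) * mpow V M b v z)"
    by (intro sum.cong refl Bochner_Integration.integral_mult_left_zero)
  finally show ?thesis using mean_B'[OF assms] by simp
qed

text \<open>The probability of return to \<open>u\<close> is invariant under the stabilizer of
  \<open>u\<close>. This removes the first-order trace and the diagonal of the double sums.\<close>

lemma entry_diag: "\<omega> \<in> space P \<Longrightarrow> u \<in> V \<Longrightarrow> entry b u u \<omega> = 0"
proof -
  assume a: "\<omega> \<in> space P" "u \<in> V"
  have "mpow V M b (g v) u = mpow V M b v u" if "g \<in> Stab G u" "v \<in> V" for g v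
    using mpow_aut[of g v u b] that a(2) by (simp add: Stab_def)
  with stab_sum[OF a, of "\<lambda>v. mpow V M b v u"] show ?thesis by (simp add: entry_def mm_def)
qed

lemma tr_mpow_B: "\<omega> \<in> space P \<Longrightarrow> tr V (mm V (mpow V M k) (B \<omega>)) = 0"
  unfolding tr_mm_commute[of V "mpow V M k"] using entry_diag[of \<omega> _ k] by (simp add: tr_def entry_def)

text \<open>Rotating the trace puts each \<open>B\<close> in front of its power of \<open>M\<close>,
  so that every factor depends on a single row of the environment.\<close>

lemma pair_tr_entry: "pair_tr V M (B \<omega>) a b = (\<Sum>u\<in>V. \<Sum>z\<in>V. entry a u z \<omega> * entry b z u \<omega>)"
proof -
  have "pair_tr V M (B \<omega>) a b = tr V (mm V (mm V (mm V (mpow V M b) (B \<omega>)) (mpow V M a)) (B \<omega>))"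
    unfolding pair_tr_commute[of V M "B \<omega>" a] unfolding pair_tr_def by (simp only: mm_assoc)
  also have "\<dots> = tr V (mm V (mpow V M b) (mm V (B \<omega>) (mm V (mpow V M a) (B \<omega>))))"
    by (simp only: mm_assoc)
  also have "\<dots> = tr V (mm V (mm V (B \<omega>) (mm V (mpow V M a) (B \<omega>))) (mpow V M b))"
    by (rule tr_mm_commute)
  also have "\<dots> = tr V (mm V (mm V (B \<omega>) (mpow V M a)) (mm V (B \<omega>) (mpow V M b)))"
    by (simp only: mm_assoc)
  finally show ?thesis
    by (simp only: tr_def entry_def mm_def[of V "mm V (B \<omega>) (mpow V M a)" "mm V (B \<omega>) (mpow V M b)"])
qed

text \<open>The row \<open>u'\<close> enters through one factor only, and that factor is
  centred.\<close>

lemma quad_orthogonal_aux: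
  assumes V: "u \<in> V" "z \<in> V" "u' \<in> V" "z' \<in> V" and n: "u' \<notin> {u, z, z'}"
  shows "expectation (\<lambda>\<omega>. (entry a u z \<omega> * entry b z u \<omega> * entry b' z' u' \<omega>) * entry a' u' z' \<omega>) = 0"
proof -
  have "bdd_dep ({u} \<union> {z} \<union> {z'}) (\<lambda>\<omega>. entry a u z \<omega> * entry b z u \<omega> * entry b' z' u' \<omega>)"
    using V by (intro bdd_dep_mult bdd_dep_entry)
  then have "expectation (\<lambda>\<omega>. (entry a u z \<omega> * entry b z u \<omega> * entry b' z' u' \<omega>) * entry a' u' z' \<omega>) =
    expectation (\<lambda>\<omega>. entry a u z \<omega> * entry b z u \<omega> * entry b' z' u' \<omega>) * expectation (entry a' u' z')"
    using n V by (intro bdd_dep_expectation_mult[of _ _ "{u'}"] bdd_dep_entry) auto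
  then show ?thesis using V mean_entry by simp
qed

lemma quad_orthogonal:
  assumes V: "u \<in> V" "z \<in> V" "u' \<in> V" "z' \<in> V" and n: "u' \<noteq> z'" "(u', z') \<noteq> (u, z)" "(u', z') \<noteq> (z, u)"
  shows "expectation (\<lambda>\<omega>. (entry a u z \<omega> * entry b z u \<omega>) * (entry a' u' z' \<omega> * entry b' z' u' \<omega>)) = 0"
proof -
  \<comment> \<open>If both alternatives failed, the distinct vertices \<open>u'\<close> and
    \<open>z'\<close> would both lie in {u, z}, and the pairs would agree up to order.\<close>
  consider "u' \<notin> {u, z, z'}" | "z' \<notin> {u, z, u'}" using n by auto
  then show ?thesis
  proof cases
    case 1
    show ?thesis using quad_orthogonal_aux[OF V 1, of a b b' a'] by (simp add: ac_simps)
  next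
    case 2
    show ?thesis using quad_orthogonal_aux[OF V(1,2,4,3) 2, of a b a' b'] by (simp add: ac_simps)
  qed
qed

text \<open>The index set carries all the pairs of exponents of a polynomial, so that one variance
  computation and one central limit theorem cover the whole linear combination.\<close>

definition qsum :: "'i set \<Rightarrow> ('i \<Rightarrow> real) \<Rightarrow> ('i \<Rightarrow> nat) \<Rightarrow> ('i \<Rightarrow> nat) \<Rightarrow> 'a \<Rightarrow> 'a \<Rightarrow> 'w \<Rightarrow> real" where
  "qsum I w a b u z \<omega> = (\<Sum>i\<in>I. w i * (entry (a i) u z \<omega> * entry (b i) z u \<omega>))"

lemma bdd_dep_qsum:
  assumes "finite I" "u \<in> V" "z \<in> V"
  shows "bdd_dep {u, z} (qsum I w a b u z)"
proof -
  have "bdd_dep ({u} \<union> {z}) (\<lambda>\<omega>. entry (a i) u z \<omega> * entry (b i) z u \<omega>)" for i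
    using assms by (intro bdd_dep_mult bdd_dep_entry)
  then show ?thesis
    unfolding qsum_def using assms by (intro bdd_dep_sum bdd_dep_cmult) (auto simp: insert_commute)
qed

lemma qsum_diag: "\<omega> \<in> space P \<Longrightarrow> u \<in> V \<Longrightarrow> qsum I w a b u u \<omega> = 0"
  by (simp add: qsum_def entry_diag)

lemma expectation_qsum_mult:
  assumes I: "finite I" and V: "u \<in> V" "z \<in> V" "u' \<in> V" "z' \<in> V"
  shows "expectation (\<lambda>\<omega>. qsum I w a b u z \<omega> * qsum I w a b u' z' \<omega>) =
    (\<Sum>i\<in>I. \<Sum>j\<in>I. w i * w j * expectation (\<lambda>\<omega>. (entry (a i) u z \<omega> * entry (b i) z u \<omega>) *
      (entry (a j) u' z' \<omega> * entry (b j) z' u' \<omega>)))"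
proof -
  have int: "integrable P (\<lambda>\<omega>. (entry (a i) u z \<omega> * entry (b i) z u \<omega>) * (entry (a j) u' z' \<omega> * entry (b j) z' u' \<omega>))"
    for i j
    by (rule bdd_dep_integrable[of "({u} \<union> {z}) \<union> ({u'} \<union> {z'})"]) (use V in \<open>intro bdd_dep_mult bdd_dep_entry\<close>)
  have "qsum I w a b u z \<omega> * qsum I w a b u' z' \<omega> = (\<Sum>i\<in>I. \<Sum>j\<in>I. w i * w j *
      ((entry (a i) u z \<omega> * entry (b i) z u \<omega>) * (entry (a j) u' z' \<omega> * entry (b j) z' u' \<omega>)))" for \<omega>
    unfolding qsum_def sum_product by (intro sum.cong refl) (simp add: ac_simps)
  then have "expectation (\<lambda>\<omega>. qsum I w a b u z \<omega> * qsum I w a b u' z' \<omega>) =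
    expectation (\<lambda>\<omega>. \<Sum>i\<in>I. \<Sum>j\<in>I. w i * w j *
      ((entry (a i) u z \<omega> * entry (b i) z u \<omega>) * (entry (a j) u' z' \<omega> * entry (b j) z' u' \<omega>)))"
    by simp
  also have "\<dots> = (\<Sum>i\<in>I. \<Sum>j\<in>I. w i * w j * expectation (\<lambda>\<omega>. (entry (a i) u z \<omega> * entry (b i) z u \<omega>) *
      (entry (a j) u' z' \<omega> * entry (b j) z' u' \<omega>)))"
    by (subst Bochner_Integration.integral_sum
        | intro sum.cong refl Bochner_Integration.integrable_sum Bochner_Integration.integrable_mult_right int
        | rule Bochner_Integration.integral_mult_right_zero)+
  finally show ?thesis .
qed

text \<open>By orthogonality an ordered pair correlates only with itself and with its reversal;
  diagonal pairs vanish identically.\<close>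

lemma second_moment_qsum:
  assumes I: "finite I"
  shows "expectation (\<lambda>\<omega>. (\<Sum>u\<in>V. \<Sum>z\<in>V. qsum I w a b u z \<omega>)\<^sup>2) =
    (\<Sum>u\<in>V. \<Sum>z\<in>V. expectation (\<lambda>\<omega>. qsum I w a b u z \<omega> * qsum I w a b u z \<omega>) +
       expectation (\<lambda>\<omega>. qsum I w a b u z \<omega> * qsum I w a b z u \<omega>))"
proof -
  let ?q = "qsum I w a b" and ?X = "\<lambda>p p'. (\<lambda>\<omega>. qsum I w a b (fst p) (snd p) \<omega> * qsum I w a b (fst p') (snd p') \<omega>)"
  have int: "integrable P (?X p p')" if "p \<in> V \<times> V" "p' \<in> V \<times> V" for p p'
    by (rule bdd_dep_integrable[of "{fst p, snd p} \<union> {fst p', snd p'}"])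
      (use that I in \<open>intro bdd_dep_mult bdd_dep_qsum; auto\<close>)
  have zero: "expectation (?X p p') = 0" if "p \<in> V \<times> V" "p' \<in> V \<times> V" "fst p = snd p \<or> fst p' = snd p'" for p p'
  proof -
    have "expectation (?X p p') = expectation (\<lambda>_. 0)"
      using that by (intro Bochner_Integration.integral_cong refl) (auto simp: qsum_diag)
    then show ?thesis by simp
  qed
  have inner: "(\<Sum>p'\<in>V\<times>V. expectation (?X p p')) = expectation (\<lambda>\<omega>. ?q (fst p) (snd p) \<omega> * ?q (fst p) (snd p) \<omega>) +
       expectation (\<lambda>\<omega>. ?q (fst p) (snd p) \<omega> * ?q (snd p) (fst p) \<omega>)" if p: "p \<in> V \<times> V" for p
  proof (cases "fst p = snd p")
    case True
    have "(\<Sum>p'\<in>V\<times>V. expectation (?X p p')) = 0"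
      by (intro sum.neutral ballI zero[OF p]) (simp_all only: True simp_thms)
    moreover have "expectation (?X p p) = 0" by (rule zero[OF p p]) (use True in auto)
    ultimately show ?thesis using True by simp
  next
    case False
    let ?p = "(snd p, fst p)"
    have "(\<Sum>p'\<in>V\<times>V. expectation (?X p p')) = (\<Sum>p'\<in>{p, ?p}. expectation (?X p p'))"
    proof (rule sum.mono_neutral_right)
      show "\<forall>p'\<in>V\<times>V - {p, ?p}. expectation (?X p p') = 0"
      proof
        fix p' assume p': "p' \<in> V\<times>V - {p, ?p}"
        show "expectation (?X p p') = 0"
        proof (cases "fst p' = snd p'")
          case True
          then show ?thesis by (intro zero[OF p]) (use p' in simp_all)
        next
          case False
          have V: "fst p \<in> V" "snd p \<in> V" "fst p' \<in> V" "snd p' \<in> V" using p p' by auto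
          have n: "(fst p', snd p') \<noteq> (fst p, snd p)" "(fst p', snd p') \<noteq> (snd p, fst p)" using p' by auto
          show ?thesis
            unfolding expectation_qsum_mult[OF I V] quad_orthogonal[OF V False n] by simp
        qed
      qed
    qed (use p finite_verts in auto)
    also have "\<dots> = expectation (?X p p) + expectation (?X p ?p)"
      using False by (subst sum.insert) (auto simp: prod_eq_iff)
    finally show ?thesis by simp
  qed
  have "(\<Sum>u\<in>V. \<Sum>z\<in>V. ?q u z \<omega>)\<^sup>2 = (\<Sum>p\<in>V\<times>V. \<Sum>p'\<in>V\<times>V. ?X p p' \<omega>)" for \<omega>
  proof -
    have "(\<Sum>u\<in>V. \<Sum>z\<in>V. ?q u z \<omega>) = (\<Sum>p\<in>V\<times>V. ?q (fst p) (snd p) \<omega>)"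
      unfolding sum.cartesian_product' by simp
    then show ?thesis by (simp only: power2_eq_square sum_product)
  qed
  then have "expectation (\<lambda>\<omega>. (\<Sum>u\<in>V. \<Sum>z\<in>V. ?q u z \<omega>)\<^sup>2) =
      expectation (\<lambda>\<omega>. \<Sum>p\<in>V\<times>V. \<Sum>p'\<in>V\<times>V. ?X p p' \<omega>)"
    by (intro Bochner_Integration.integral_cong refl)
  also have "\<dots> = (\<Sum>p\<in>V\<times>V. \<Sum>p'\<in>V\<times>V. expectation (?X p p'))"
  proof -
    have "expectation (\<lambda>\<omega>. \<Sum>p\<in>V\<times>V. \<Sum>p'\<in>V\<times>V. ?X p p' \<omega>) = (\<Sum>p\<in>V\<times>V. expectation (\<lambda>\<omega>. \<Sum>p'\<in>V\<times>V. ?X p p' \<omega>))"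
      by (rule Bochner_Integration.integral_sum) (intro Bochner_Integration.integrable_sum int)
    also have "\<dots> = (\<Sum>p\<in>V\<times>V. \<Sum>p'\<in>V\<times>V. expectation (?X p p'))"
      by (intro sum.cong refl Bochner_Integration.integral_sum int)
    finally show ?thesis .
  qed
  also have "\<dots> = (\<Sum>p\<in>V\<times>V. expectation (\<lambda>\<omega>. ?q (fst p) (snd p) \<omega> * ?q (fst p) (snd p) \<omega>) +
       expectation (\<lambda>\<omega>. ?q (fst p) (snd p) \<omega> * ?q (snd p) (fst p) \<omega>))"
    using inner by (intro sum.cong) auto
  finally show ?thesis unfolding sum.cartesian_product' fst_conv snd_conv .
qed

text \<open>Three of the four entries are bounded by \<open>c\<close>, and the fourth by
  \<open>c\<close> times a walk probability whose row sum is at most 1. The bound is therefore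
  linear in the size of the graph and free of the exponents, which later permits summation over all
  powers.\<close>

lemma second_moment_pair_tr: "expectation (\<lambda>\<omega>. (pair_tr V M (B \<omega>) a b)\<^sup>2) \<le> 2 * c ^ 4 * card V"
proof -
  let ?q = "qsum {()} (\<lambda>_. 1) (\<lambda>_. a) (\<lambda>_. b)"
  have eq: "pair_tr V M (B \<omega>) a b = (\<Sum>u\<in>V. \<Sum>z\<in>V. ?q u z \<omega>)" for \<omega>
    by (simp add: pair_tr_entry qsum_def)
  have b1: "\<bar>?q u z \<omega>\<bar> \<le> c\<^sup>2 * mpow V M (Suc a) u z" if "\<omega> \<in> space P" "u \<in> V" "z \<in> V" for u z \<omega>
  proof -
    have "\<bar>entry b z u \<omega>\<bar> \<le> c * mpow V M (Suc b) z u" using entry_bound that by blast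
    also have "\<dots> \<le> c * 1" by (rule mult_left_mono[OF mpow_le_1[OF that(3,2)] c])
    finally have "\<bar>entry a u z \<omega>\<bar> * \<bar>entry b z u \<omega>\<bar> \<le> (c * mpow V M (Suc a) u z) * c"
      using entry_bound[OF that, of a] by (intro mult_mono) auto
    then show ?thesis by (simp add: qsum_def abs_mult power2_eq_square ac_simps del: mpow.simps)
  qed
  have b2: "\<bar>?q u z \<omega>\<bar> \<le> c\<^sup>2" if "\<omega> \<in> space P" "u \<in> V" "z \<in> V" for u z \<omega>
  proof -
    have "c\<^sup>2 * mpow V M (Suc a) u z \<le> c\<^sup>2 * 1" by (rule mult_left_mono[OF mpow_le_1[OF that(2,3)]]) simp
    then show ?thesis using b1[OF that] by linarith
  qed
  have b3: "\<bar>expectation (\<lambda>\<omega>. ?q u z \<omega> * ?q u' z' \<omega>)\<bar> \<le> c ^ 4 * mpow V M (Suc a) u z"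
    if V: "u \<in> V" "z \<in> V" "u' \<in> V" "z' \<in> V" for u z u' z'
  proof -
    have n: "bdd_dep ({u, z} \<union> {u', z'}) (\<lambda>\<omega>. ?q u z \<omega> * ?q u' z' \<omega>)"
      using V by (intro bdd_dep_mult bdd_dep_qsum) auto
    have "norm (?q u z \<omega> * ?q u' z' \<omega>) \<le> (c\<^sup>2 * mpow V M (Suc a) u z) * c\<^sup>2" if "\<omega> \<in> space P" for \<omega>
      unfolding real_norm_def abs_mult using b1[OF that V(1,2)] b2[OF that V(3,4)] by (intro mult_mono) auto
    from expectation_norm_le[OF dep_measurable[OF bdd_dep_dep[OF n]] this] show ?thesis
      by (simp add: ac_simps power_numeral_reduce del: mpow.simps)
  qed
  have "expectation (\<lambda>\<omega>. (pair_tr V M (B \<omega>) a b)\<^sup>2) \<le> (\<Sum>u\<in>V. \<Sum>z\<in>V. 2 * c ^ 4 * mpow V M (Suc a) u z)"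
    unfolding eq second_moment_qsum[OF finite.insertI[OF finite.emptyI]]
  proof (intro sum_mono)
    fix u z assume "u \<in> V" "z \<in> V"
    then show "expectation (\<lambda>\<omega>. ?q u z \<omega> * ?q u z \<omega>) + expectation (\<lambda>\<omega>. ?q u z \<omega> * ?q z u \<omega>)
      \<le> 2 * c ^ 4 * mpow V M (Suc a) u z"
      using b3[of u z u z] b3[of u z z u] by linarith
  qed
  also have "\<dots> = (\<Sum>u\<in>V. 2 * c ^ 4 * (\<Sum>z\<in>V. mpow V M (Suc a) u z))" by (simp add: sum_distrib_left)
  also have "\<dots> \<le> (\<Sum>u\<in>V. 2 * c ^ 4 * 1)"
    using c by (intro sum_mono mult_left_mono row_sum_mpow) auto
  finally show ?thesis by (simp add: mult.commute)
qed

end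

lemma sum_by_level:
  fixes \<phi> :: "nat \<Rightarrow> real"
  assumes "finite V" "\<And>k. \<phi> k \<noteq> 0 \<Longrightarrow> 0 < k \<and> k < r"
  shows "(\<Sum>u\<in>V. \<phi> (l u)) = (\<Sum>k\<in>{1..<r}. card {u\<in>V. l u = k} * \<phi> k)"
proof -
  have "(\<Sum>u\<in>V. \<phi> (l u)) = (\<Sum>u\<in>{u\<in>V. l u \<in> {1..<r}}. \<phi> (l u))"
  proof (rule sum.mono_neutral_right)
    show "\<forall>u\<in>V - {u\<in>V. l u \<in> {1..<r}}. \<phi> (l u) = 0"
      using assms(2) by fastforce
  qed (use assms(1) in auto)
  also have "\<dots> = (\<Sum>k\<in>{1..<r}. \<Sum>u\<in>{u\<in>{u\<in>V. l u \<in> {1..<r}}. l u = k}. \<phi> (l u))"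
    using assms(1) by (intro sum.group[symmetric]) auto
  also have "\<dots> = (\<Sum>k\<in>{1..<r}. card {u\<in>V. l u = k} * \<phi> k)"
  proof (intro sum.cong refl)
    fix k assume k: "k \<in> {1..<r}"
    have "{u\<in>{u\<in>V. l u \<in> {1..<r}}. l u = k} = {u\<in>V. l u = k}" using k by auto
    then show "(\<Sum>u\<in>{u\<in>{u\<in>V. l u \<in> {1..<r}}. l u = k}. \<phi> (l u)) = card {u\<in>V. l u = k} * \<phi> k"
      by simp
  qed
  finally show ?thesis .
qed

text \<open>Level functions are given around all vertices at once, because every vertex acts as the
  target of a walk.\<close>

locale tree_like_environment = environment G P B c
  for G :: "'a pair_pre_digraph" and P :: "'w measure" and B c +
  fixes d r :: nat and lev :: "'a \<Rightarrow> 'a \<Rightarrow> nat"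
  assumes d: "d \<ge> 2" and lev: "\<And>z. z \<in> pverts G \<Longrightarrow> level_fun G d z r (lev z)"
begin

text \<open>All neighbours of \<open>u\<close> except \<open>p\<close> carry the same walk probability, and the row \<open>u\<close> of \<open>B\<close> sums to zero.\<close>

lemma entry_level:
  assumes \<omega>: "\<omega> \<in> space P" and u: "u \<in> V" and z: "z \<in> V" and p: "p \<in> nbrs G u" "lev z p = lev z u - 1"
    "\<forall>w\<in>nbrs G u - {p}. lev z w = lev z u + 1" and l: "0 < lev z u" and b: "b < r"
  shows "entry b u z \<omega> = B \<omega> u p * tree_diff d b (lev z u)"
proof -
  have row: "(\<Sum>v\<in>V. B \<omega> u v) = 0" using stab_sum[OF \<omega> u, of "\<lambda>_. 1"] by simp
  have pV: "p \<in> V" using p nbrs_subset by auto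
  let ?m = "\<lambda>v. tree_walk d b (lev z v)" and ?s = "tree_walk d b (lev z u + 1)"
  have "entry b u z \<omega> = (\<Sum>v\<in>V. B \<omega> u v * ?m v)"
    unfolding entry_def mm_def using mpow_level[OF lev[OF z] z _ b] d by (intro sum.cong) auto
  also have "\<dots> = (\<Sum>v\<in>V. B \<omega> u v * (?m v - ?s))"
    using row by (simp add: right_diff_distrib sum_subtractf flip: sum_distrib_right)
  also have "\<dots> = (\<Sum>v\<in>{p}. B \<omega> u v * (?m v - ?s))"
  proof (rule sum.mono_neutral_right)
    show "\<forall>v\<in>V - {p}. B \<omega> u v * (?m v - ?s) = 0"
    proof
      fix v assume v: "v \<in> V - {p}"
      show "B \<omega> u v * (?m v - ?s) = 0"
      proof (cases "v \<in> nbrs G u")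
        case True
        then have "lev z v = lev z u + 1" using p(3) v by blast
        then show ?thesis by simp
      next
        case False
        then show ?thesis using B_eq_0[OF \<omega> u] v by simp
      qed
    qed
  qed (use pV finite_verts in auto)
  also have "\<dots> = B \<omega> u p * tree_diff d b (lev z u)"
    using p(2) d l by (simp add: tree_diff_walk)
  finally show ?thesis .
qed

lemma entry_far:
  assumes "\<omega> \<in> space P" "u \<in> V" "z \<in> V" "r \<le> lev z u" "b + 1 < r"
  shows "entry b u z \<omega> = 0"
proof -
  have "mpow V M (Suc b) u z = tree_walk d (Suc b) (lev z u)"
    by (rule mpow_level[OF lev]) (use assms d in auto)
  then have "mpow V M (Suc b) u z = 0" using assms by (simp add: tree_walk_eq_0 del: tree_walk.simps)
  then show ?thesis using entry_bound[OF assms(1-3), of b] by simp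
qed

text \<open>Within the radius both entries are multiples of the same entry of \<open>B\<close>,
  whose second moment is 1; beyond it both sides vanish.\<close>

lemma expectation_entry_mult:
  assumes V: "u \<in> V" "z \<in> V" "u \<noteq> z" and ab: "a + 1 < r" "b + 1 < r"
  shows "expectation (\<lambda>\<omega>. entry a u z \<omega> * entry b u z \<omega>) =
    tree_diff d a (lev z u) * tree_diff d b (lev z u)"
proof (cases "lev z u < r")
  case True
  have l: "0 < lev z u" using level_funD(1)[OF lev[OF V(2)] V(1)] V(3) by simp
  then obtain p where p: "p \<in> nbrs G u" "lev z p = lev z u - 1" "\<forall>w\<in>nbrs G u - {p}. lev z w = lev z u + 1"
    using level_funD(4)[OF lev[OF V(2)] V(1) True] by blast
  have "expectation (\<lambda>\<omega>. entry a u z \<omega> * entry b u z \<omega>) =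
     expectation (\<lambda>\<omega>. tree_diff d a (lev z u) * tree_diff d b (lev z u) * (B \<omega> u p)\<^sup>2)"
  proof (intro Bochner_Integration.integral_cong refl)
    fix \<omega> assume \<omega>: "\<omega> \<in> space P"
    show "entry a u z \<omega> * entry b u z \<omega> = tree_diff d a (lev z u) * tree_diff d b (lev z u) * (B \<omega> u p)\<^sup>2"
      using entry_level[OF \<omega> V(1,2) p l, of a] entry_level[OF \<omega> V(1,2) p l, of b] ab
      by (simp add: power2_eq_square)
  qed
  also have "\<dots> = tree_diff d a (lev z u) * tree_diff d b (lev z u)"
    using second_B[of u p] p(1) by (simp add: nbrs_def)
  finally show ?thesis .
next
  case False
  have "expectation (\<lambda>\<omega>. entry a u z \<omega> * entry b u z \<omega>) = expectation (\<lambda>_. 0)"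
    using entry_far[OF _ V(1,2), of _ a] False ab by (intro Bochner_Integration.integral_cong refl) auto
  moreover have "tree_diff d a (lev z u) = 0" using False ab by (intro tree_diff_eq_0) auto
  ultimately show ?thesis by simp
qed

text \<open>The two levels come from unrelated level functions. They are compared through the
  symmetric powers of \<open>M\<close>: the walk probability is positive after as many steps as the
  level, and zero after fewer.\<close>

lemma lev_sym:
  assumes V: "u \<in> V" "z \<in> V" and l: "lev z u < r"
  shows "lev u z = lev z u"
proof -
  have le: "lev u z \<le> lev z u" if V: "u \<in> V" "z \<in> V" and l: "lev z u < r" for u z
  proof (rule ccontr)
    assume n: "\<not> lev u z \<le> lev z u"
    have "mpow V M (lev z u) z u = tree_walk d (lev z u) (lev u z)"
      by (rule mpow_level[OF lev]) (use V l d in auto)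
    also have "\<dots> = 0" using n by (intro tree_walk_eq_0) auto
    also have "mpow V M (lev z u) z u = mpow V M (lev z u) u z"
      by (rule mpow_sym[OF transitive V(2,1)])
    also have "\<dots> = tree_walk d (lev z u) (lev z u)"
      by (rule mpow_level[OF lev]) (use V l d in auto)
    finally show False using tree_walk_diag_pos[of d "lev z u"] d by simp
  qed
  then show ?thesis using le[OF V l] le[OF V(2,1)] l by fastforce
qed

lemma expectation_quad:
  assumes V: "u \<in> V" "z \<in> V" "u \<noteq> z" and ab: "a + 1 < r" "b + 1 < r" "a' + 1 < r" "b' + 1 < r"
  shows "expectation (\<lambda>\<omega>. (entry a u z \<omega> * entry a' u z \<omega>) * (entry b z u \<omega> * entry b' z u \<omega>)) =
    (tree_diff d a (lev z u) * tree_diff d a' (lev z u)) * (tree_diff d b (lev z u) * tree_diff d b' (lev z u))"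
proof -
  have n: "bdd_dep ({u} \<union> {u}) (\<lambda>\<omega>. entry a u z \<omega> * entry a' u z \<omega>)"
    "bdd_dep ({z} \<union> {z}) (\<lambda>\<omega>. entry b z u \<omega> * entry b' z u \<omega>)"
    using V by (intro bdd_dep_mult bdd_dep_entry; simp)+
  have "expectation (\<lambda>\<omega>. (entry a u z \<omega> * entry a' u z \<omega>) * (entry b z u \<omega> * entry b' z u \<omega>)) =
    expectation (\<lambda>\<omega>. entry a u z \<omega> * entry a' u z \<omega>) * expectation (\<lambda>\<omega>. entry b z u \<omega> * entry b' z u \<omega>)"
    by (rule bdd_dep_expectation_mult[OF n]) (use V in auto)
  also have "\<dots> = (tree_diff d a (lev z u) * tree_diff d a' (lev z u)) *
      (tree_diff d b (lev u z) * tree_diff d b' (lev u z))"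
    using expectation_entry_mult[OF V ab(1,3)] expectation_entry_mult[OF V(2,1) V(3)[symmetric] ab(2,4)] by simp
  also have "\<dots> = (tree_diff d a (lev z u) * tree_diff d a' (lev z u)) *
      (tree_diff d b (lev z u) * tree_diff d b' (lev z u))"
  \<comment> \<open>Symmetry of the levels is available only inside the ball; outside, the finite
    range of \<open>tree_diff\<close> makes both products zero.\<close>
  proof (cases "lev z u < r")
    case True
    then show ?thesis using lev_sym[OF V(1,2)] by simp
  next
    case False
    then have "tree_diff d a (lev z u) = 0" using ab by (intro tree_diff_eq_0) auto
    then show ?thesis by simp
  qed
  finally show ?thesis .
qed

text \<open>Both surviving correlations of a pair equal the square of \<open>\<alpha>\<close> at its
  distance, whence the factor 2; \<open>level_card\<close> counts the vertices at each
  distance.\<close>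

lemma second_moment_qsum_level:
  fixes w :: "'i \<Rightarrow> real" and \<alpha> :: "nat \<Rightarrow> real"
  assumes I: "finite I" and ab: "\<And>i. i \<in> I \<Longrightarrow> a i + 1 < r \<and> b i + 1 < r"
  defines "\<alpha> \<equiv> \<lambda>l. \<Sum>i\<in>I. w i * (tree_diff d (a i) l * tree_diff d (b i) l)"
  shows "expectation (\<lambda>\<omega>. (\<Sum>u\<in>V. \<Sum>z\<in>V. qsum I w a b u z \<omega>)\<^sup>2) =
    card V * (\<Sum>l\<in>{1..<r}. 2 * real d * (real d - 1) ^ (l - 1) * (\<alpha> l)\<^sup>2)"
proof -
  have \<alpha>2: "(\<alpha> l)\<^sup>2 = (\<Sum>i\<in>I. \<Sum>j\<in>I. w i * w j * ((tree_diff d (a i) l * tree_diff d (a j) l) *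
      (tree_diff d (b i) l * tree_diff d (b j) l)))" for l
    unfolding \<alpha>_def power2_eq_square sum_product by (intro sum.cong refl) (simp add: ac_simps)
  have 1: "expectation (\<lambda>\<omega>. qsum I w a b u z \<omega> * qsum I w a b u z \<omega>) = (\<alpha> (lev z u))\<^sup>2"
    if V: "u \<in> V" "z \<in> V" "u \<noteq> z" for u z
    unfolding expectation_qsum_mult[OF I V(1,2) V(1,2)] \<alpha>2
  proof (intro sum.cong refl)
    fix i j assume ij: "i \<in> I" "j \<in> I"
    have "expectation (\<lambda>\<omega>. (entry (a i) u z \<omega> * entry (b i) z u \<omega>) * (entry (a j) u z \<omega> * entry (b j) z u \<omega>)) =
      expectation (\<lambda>\<omega>. (entry (a i) u z \<omega> * entry (a j) u z \<omega>) * (entry (b i) z u \<omega> * entry (b j) z u \<omega>))"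
      by (simp only: ac_simps)
    then show "w i * w j * expectation (\<lambda>\<omega>. (entry (a i) u z \<omega> * entry (b i) z u \<omega>) * (entry (a j) u z \<omega> * entry (b j) z u \<omega>)) =
      w i * w j * ((tree_diff d (a i) (lev z u) * tree_diff d (a j) (lev z u)) *
      (tree_diff d (b i) (lev z u) * tree_diff d (b j) (lev z u)))"
      using expectation_quad[OF V, of "a i" "b i" "a j" "b j"] ab[OF ij(1)] ab[OF ij(2)] by simp
  qed
  \<comment> \<open>For the reversed pair the rows match \<open>a i\<close> with \<open>b j\<close>
    and \<open>b i\<close> with \<open>a j\<close>; after reordering, the product of the four walk
    differences is the same.\<close>
  have 2: "expectation (\<lambda>\<omega>. qsum I w a b u z \<omega> * qsum I w a b z u \<omega>) = (\<alpha> (lev z u))\<^sup>2"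
    if V: "u \<in> V" "z \<in> V" "u \<noteq> z" for u z
    unfolding expectation_qsum_mult[OF I V(1,2) V(2,1)] \<alpha>2
  proof (intro sum.cong refl)
    fix i j assume ij: "i \<in> I" "j \<in> I"
    have "expectation (\<lambda>\<omega>. (entry (a i) u z \<omega> * entry (b i) z u \<omega>) * (entry (a j) z u \<omega> * entry (b j) u z \<omega>)) =
      expectation (\<lambda>\<omega>. (entry (a i) u z \<omega> * entry (b j) u z \<omega>) * (entry (b i) z u \<omega> * entry (a j) z u \<omega>))"
      by (simp only: ac_simps)
    then show "w i * w j * expectation (\<lambda>\<omega>. (entry (a i) u z \<omega> * entry (b i) z u \<omega>) * (entry (a j) z u \<omega> * entry (b j) u z \<omega>)) =
      w i * w j * ((tree_diff d (a i) (lev z u) * tree_diff d (a j) (lev z u)) *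
      (tree_diff d (b i) (lev z u) * tree_diff d (b j) (lev z u)))"
      using expectation_quad[OF V, of "a i" "b i" "b j" "a j"] ab[OF ij(1)] ab[OF ij(2)] by (simp add: ac_simps)
  qed
  have diag: "expectation (\<lambda>\<omega>. qsum I w a b z z \<omega> * qsum I w a b z z \<omega>) = 0" if "z \<in> V" for z
  proof -
    have "expectation (\<lambda>\<omega>. qsum I w a b z z \<omega> * qsum I w a b z z \<omega>) = expectation (\<lambda>_. 0)"
      using that by (intro Bochner_Integration.integral_cong refl) (simp add: qsum_diag)
    then show ?thesis by simp
  qed
  have \<alpha>0: "\<alpha> 0 = 0" by (simp add: \<alpha>_def)
  have lev0: "lev z z = 0" if "z \<in> V" for z using level_funD(1)[OF lev[OF that] that] by simp
  have "expectation (\<lambda>\<omega>. (\<Sum>u\<in>V. \<Sum>z\<in>V. qsum I w a b u z \<omega>)\<^sup>2) = (\<Sum>u\<in>V. \<Sum>z\<in>V. 2 * (\<alpha> (lev z u))\<^sup>2)"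
    unfolding second_moment_qsum[OF I]
  proof (intro sum.cong refl)
    fix u z assume V: "u \<in> V" "z \<in> V"
    show "expectation (\<lambda>\<omega>. qsum I w a b u z \<omega> * qsum I w a b u z \<omega>) +
       expectation (\<lambda>\<omega>. qsum I w a b u z \<omega> * qsum I w a b z u \<omega>) = 2 * (\<alpha> (lev z u))\<^sup>2"
      using 1[OF V] 2[OF V] diag[OF V(2)] lev0[OF V(2)] \<alpha>0 by (cases "u = z") simp_all
  qed
  also have "\<dots> = (\<Sum>z\<in>V. \<Sum>u\<in>V. 2 * (\<alpha> (lev z u))\<^sup>2)" by (rule sum.swap)
  also have "\<dots> = (\<Sum>z\<in>V. \<Sum>l\<in>{1..<r}. card {u\<in>V. lev z u = l} * (2 * (\<alpha> l)\<^sup>2))"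
  proof (intro sum.cong refl sum_by_level finite_verts)
    fix k assume k: "2 * (\<alpha> k)\<^sup>2 \<noteq> 0"
    then have "\<alpha> k \<noteq> 0" by simp
    then obtain i where i: "i \<in> I" "tree_diff d (a i) k \<noteq> 0" unfolding \<alpha>_def
      by (metis (no_types, lifting) mult_zero_left mult_zero_right sum.not_neutral_contains_not_neutral)
    then have "k \<le> a i + 1" using tree_diff_eq_0 not_le by blast
    moreover have "0 < k" using i(2) by (cases k) auto
    ultimately show "0 < k \<and> k < r" using ab[OF i(1)] by simp
  qed
  also have "\<dots> = (\<Sum>z\<in>V. \<Sum>l\<in>{1..<r}. 2 * real d * (real d - 1) ^ (l - 1) * (\<alpha> l)\<^sup>2)"
  proof (intro sum.cong refl)
    fix z l assume "z \<in> V" "l \<in> {1..<r}"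
    then have "card {u\<in>V. lev z u = l} = d * (d - 1) ^ (l - 1)"
      using level_card[OF lev, of z l] by simp
    then show "card {u\<in>V. lev z u = l} * (2 * (\<alpha> l)\<^sup>2) = 2 * real d * (real d - 1) ^ (l - 1) * (\<alpha> l)\<^sup>2"
      using d by (simp add: of_nat_diff)
  qed
  finally show ?thesis by simp
qed

end

context environment
begin

text \<open>An application of \<open>local_clt\<close> with the vertices as index set: the sum
  attached to \<open>u\<close> involves only rows within \<open>L\<close> steps of \<open>u\<close>,
  since the entries vanish outside that range.\<close>

lemma qsum_char:
  fixes w :: "'i \<Rightarrow> real" and a b :: "'i \<Rightarrow> nat" and D :: nat and C :: real
  assumes I: "finite I" and L: "\<And>i. i \<in> I \<Longrightarrow> a i < L" and deg: "\<And>v. v \<in> V \<Longrightarrow> card (nbrs G v) = d"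
  defines "Y \<equiv> \<lambda>\<omega>. (\<Sum>u\<in>V. \<Sum>z\<in>V. qsum I w a b u z \<omega>) / sqrt (card V)"
    and "D \<equiv> (\<Sum>j\<le>L. d ^ j)\<^sup>2" and "C \<equiv> c\<^sup>2 * (\<Sum>i\<in>I. \<bar>w i\<bar>)"
  shows "norm (expectation (\<lambda>\<omega>. iexp (Y \<omega>)) - complex_of_real (exp (- expectation (\<lambda>\<omega>. (Y \<omega>)\<^sup>2) / 2)))
    \<le> (4 * D\<^sup>2 * C\<^sup>2 + D\<^sup>2 * C ^ 3) / sqrt (card V)"
proof -
  define nb where "nb u = {z\<in>V. \<exists>j\<le>L. mpow V M j u z \<noteq> 0}" for u
  have nbV: "nb u \<subseteq> V" for u by (auto simp: nb_def)
  have nb_refl: "u \<in> nb u" if "u \<in> V" for u using that by (auto simp: nb_def intro!: exI[of _ 0])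
  have nb_sym: "z \<in> nb u" if "u \<in> nb z" "z \<in> V" for u z
    using that mpow_sym[OF transitive] by (auto simp: nb_def)
  have card_nb: "card (nb u) \<le> (\<Sum>j\<le>L. d ^ j)" if "u \<in> V" for u
  proof -
    have "nb u = (\<Union>j\<le>L. {z\<in>V. mpow V M j u z \<noteq> 0})" by (auto simp: nb_def)
    then have "card (nb u) \<le> (\<Sum>j\<le>L. card {z\<in>V. mpow V M j u z \<noteq> 0})"
      using card_UN_le[of "{..L}" "\<lambda>j. {z\<in>V. mpow V M j u z \<noteq> 0}"] by simp
    also have "\<dots> \<le> (\<Sum>j\<le>L. d ^ j)" by (intro sum_mono card_mpow_support[OF deg that])
    finally show ?thesis .
  qed
  have entry_out: "entry (a i) u z \<omega> = 0" if "\<omega> \<in> space P" "u \<in> V" "z \<in> V" "z \<notin> nb u" "i \<in> I" for i u z \<omega>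
  proof -
    have "mpow V M (Suc (a i)) u z = 0" using that L[OF that(5)] by (auto simp: nb_def simp del: mpow.simps)
    then show ?thesis using entry_bound[OF that(1-3), of "a i"] by simp
  qed
  have out: "qsum I w a b u z \<omega> = 0" if "\<omega> \<in> space P" "u \<in> V" "z \<in> V" "z \<notin> nb u" for u z \<omega>
    unfolding qsum_def using entry_out[OF that] by (intro sum.neutral) auto
  have dep_z: "bdd_dep (nb u) (\<lambda>\<omega>. \<Sum>z\<in>nb u. qsum I w a b u z \<omega>)" if "u \<in> V" for u
  proof (rule bdd_dep_sum)
    fix z assume z: "z \<in> nb u"
    have zV: "z \<in> V" using z nbV by blast
    show "bdd_dep (nb u) (qsum I w a b u z)"
      by (rule bdd_dep_mono[OF bdd_dep_qsum[OF I that zV] _ nbV]) (use z nb_refl[OF that] in simp)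
  qed (use nbV finite_subset[OF nbV finite_verts] in auto)
  have eq: "(\<Sum>z\<in>V. qsum I w a b u z \<omega>) = (\<Sum>z\<in>nb u. qsum I w a b u z \<omega>)" if "\<omega> \<in> space P" "u \<in> V" for u \<omega>
    using out[OF that] nbV finite_verts by (intro sum.mono_neutral_right) auto
  have dep: "dep (nb u) (\<lambda>\<omega>. \<Sum>z\<in>V. qsum I w a b u z \<omega>)" if "u \<in> V" for u
    using bdd_dep_dep[OF dep_z[OF that]] eq[OF _ that] unfolding dep_def by auto
  have bound: "\<bar>\<Sum>z\<in>V. qsum I w a b u z \<omega>\<bar> \<le> C" if \<omega>: "\<omega> \<in> space P" and u: "u \<in> V" for u \<omega>
  proof -
    have "\<bar>\<Sum>z\<in>V. qsum I w a b u z \<omega>\<bar> \<le> (\<Sum>z\<in>V. \<bar>qsum I w a b u z \<omega>\<bar>)" by (rule sum_abs)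
    also have "\<dots> \<le> (\<Sum>z\<in>V. \<Sum>i\<in>I. \<bar>w i\<bar> * (c\<^sup>2 * mpow V M (Suc (a i)) u z))"
    proof (intro sum_mono)
      fix z assume z: "z \<in> V"
      have "\<bar>w i * (entry (a i) u z \<omega> * entry (b i) z u \<omega>)\<bar> \<le> \<bar>w i\<bar> * (c\<^sup>2 * mpow V M (Suc (a i)) u z)" for i
      proof -
        have "\<bar>entry (b i) z u \<omega>\<bar> \<le> c * mpow V M (Suc (b i)) z u" by (rule entry_bound[OF \<omega> z u])
        also have "\<dots> \<le> c * 1" by (rule mult_left_mono[OF mpow_le_1[OF z u] c])
        finally have "\<bar>entry (a i) u z \<omega>\<bar> * \<bar>entry (b i) z u \<omega>\<bar> \<le> (c * mpow V M (Suc (a i)) u z) * c"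
          using entry_bound[OF \<omega> u z, of "a i"] by (intro mult_mono) auto
        then show ?thesis
          unfolding abs_mult by (intro mult_left_mono) (simp_all add: power2_eq_square ac_simps del: mpow.simps)
      qed
      then show "\<bar>qsum I w a b u z \<omega>\<bar> \<le> (\<Sum>i\<in>I. \<bar>w i\<bar> * (c\<^sup>2 * mpow V M (Suc (a i)) u z))"
        unfolding qsum_def by (intro order_trans[OF sum_abs] sum_mono)
    qed
    also have "\<dots> = (\<Sum>i\<in>I. \<bar>w i\<bar> * (c\<^sup>2 * (\<Sum>z\<in>V. mpow V M (Suc (a i)) u z)))"
      by (subst sum.swap) (simp add: sum_distrib_left del: mpow.simps)
    also have "\<dots> \<le> (\<Sum>i\<in>I. \<bar>w i\<bar> * (c\<^sup>2 * 1))"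
      using u by (intro sum_mono mult_left_mono row_sum_mpow) auto
    finally show ?thesis by (simp add: C_def sum_distrib_left mult.commute)
  qed
  have mean_q: "expectation (qsum I w a b u z) = 0" if V: "u \<in> V" "z \<in> V" for u z
  proof (cases "u = z")
    case True
    have "expectation (qsum I w a b u z) = expectation (\<lambda>_. 0)"
      using V True by (intro Bochner_Integration.integral_cong refl) (simp add: qsum_diag)
    then show ?thesis by simp
  next
    case False
    have n: "bdd_dep ({u} \<union> {z}) (\<lambda>\<omega>. entry (a i) u z \<omega> * entry (b i) z u \<omega>)" for i
      by (intro bdd_dep_mult bdd_dep_entry V)
    have e: "expectation (\<lambda>\<omega>. entry (a i) u z \<omega> * entry (b i) z u \<omega>) = 0" for i
      using bdd_dep_expectation_mult[OF bdd_dep_entry[OF V(1)] bdd_dep_entry[OF V(2)], of "a i" z "b i" u] False mean_entry[OF V(1)]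
      by simp
    have "expectation (qsum I w a b u z) = (\<Sum>i\<in>I. expectation (\<lambda>\<omega>. w i * (entry (a i) u z \<omega> * entry (b i) z u \<omega>)))"
      unfolding qsum_def by (intro Bochner_Integration.integral_sum bdd_dep_integrable[OF bdd_dep_cmult[OF n]])
    then show ?thesis by (simp add: e)
  qed
  have mean: "expectation (\<lambda>\<omega>. \<Sum>z\<in>V. qsum I w a b u z \<omega>) = 0" if "u \<in> V" for u
  proof -
    have "expectation (\<lambda>\<omega>. \<Sum>z\<in>V. qsum I w a b u z \<omega>) = (\<Sum>z\<in>V. expectation (qsum I w a b u z))"
      by (intro Bochner_Integration.integral_sum bdd_dep_integrable[OF bdd_dep_qsum[OF I that]])
    then show ?thesis using mean_q[OF that] by simp
  qed
  \<comment> \<open>If the neighbourhoods of \<open>j\<close> and \<open>k\<close> meet, then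
    \<open>k\<close> lies in the neighbourhood of a point of \<open>nb j\<close>; this gives the
    square of the ball size.\<close>
  have degree: "card {k\<in>V. nb j \<inter> nb k \<noteq> {}} \<le> D" if j: "j \<in> V" for j
  proof -
    have fin: "finite (nb u)" for u using finite_subset[OF nbV finite_verts] .
    have "{k\<in>V. nb j \<inter> nb k \<noteq> {}} \<subseteq> (\<Union>z\<in>nb j. nb z)"
    proof
      fix k assume "k \<in> {k\<in>V. nb j \<inter> nb k \<noteq> {}}"
      then obtain z where "k \<in> V" "z \<in> nb j" "z \<in> nb k" by blast
      then show "k \<in> (\<Union>z\<in>nb j. nb z)" using nb_sym[of z k] by blast
    qed
    then have "card {k\<in>V. nb j \<inter> nb k \<noteq> {}} \<le> card (\<Union>z\<in>nb j. nb z)"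
      using fin by (intro card_mono) auto
    also have "\<dots> \<le> (\<Sum>z\<in>nb j. card (nb z))" by (rule card_UN_le[OF fin])
    also have "\<dots> \<le> (\<Sum>z\<in>nb j. \<Sum>j\<le>L. d ^ j)" using card_nb nbV by (intro sum_mono) blast
    also have "\<dots> = card (nb j) * (\<Sum>j\<le>L. d ^ j)" by simp
    also have "\<dots> \<le> D" unfolding D_def power2_eq_square by (rule mult_right_mono[OF card_nb[OF j]]) simp
    finally show ?thesis .
  qed
  show ?thesis
    using local_clt[OF finite_verts nonempty dep bound mean degree] unfolding Y_def by simp
qed

end

text \<open>Rows violating one of the almost sure conditions are replaced by zero. Doing this row by row keeps the
  rows independent.\<close>

lemma random_environment_version:
  fixes G :: "'a pair_pre_digraph" and P :: "'w measure" and B :: "'w \<Rightarrow> 'a \<Rightarrow> 'a \<Rightarrow> real"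
  assumes G: "pair_graph G" "vertex_transitive G" "pverts G \<noteq> {}" and P: "prob_space P"
    and env: "random_environment G c1 P B"
  obtains B' where "environment G P B' (max c1 0)"
    "AE \<omega> in P. \<forall>u\<in>pverts G. \<forall>v\<in>pverts G. B' \<omega> u v = B \<omega> u v"
proof -
  interpret pair_graph G by (rule G)
  interpret prob_space P by (rule P)
  define good where "good u row \<longleftrightarrow> (\<forall>v\<in>V. \<bar>row v\<bar> \<le> c1 * M u v) \<and> (\<forall>v\<in>V. (\<Sum>g\<in>Stab G u. row (g v)) = 0)"
    for u and row :: "'a \<Rightarrow> real"
  define F where "F u row = (if good u row then row else (\<lambda>v\<in>V. 0))" for u and row :: "'a \<Rightarrow> real"
  define B' where "B' \<omega> u v = F u (restrict (B \<omega> u) V) v" for \<omega> u v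
  have stab_V: "g v \<in> V" if "g \<in> Stab G u" "v \<in> V" for g u v
    using that permutes_in_image[of g V v] by (simp add: Stab_def auts_def)
  have F_measurable: "F u \<in> measurable (PiM V (\<lambda>_. borel)) (PiM V (\<lambda>_. borel))" for u
  proof -
    have comp: "(\<lambda>row :: 'a \<Rightarrow> real. row v) \<in> borel_measurable (PiM V (\<lambda>_. borel))" if "v \<in> V" for v :: 'a
      using that by measurable
    have s: "(\<lambda>row :: 'a \<Rightarrow> real. \<Sum>g\<in>Stab G u. row (g v)) \<in> borel_measurable (PiM V (\<lambda>_. borel))" if "v \<in> V" for v
      using stab_V[OF _ that] by (intro borel_measurable_sum comp)
    have p1: "Measurable.pred (PiM V (\<lambda>_. borel)) (\<lambda>row :: 'a \<Rightarrow> real. \<forall>v\<in>V. \<bar>row v\<bar> \<le> c1 * M u v)"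
    proof (rule pred_intros_finite[OF finite_verts])
      fix v assume v: "v \<in> V"
      note [measurable] = comp[OF v]
      show "Measurable.pred (PiM V (\<lambda>_. borel)) (\<lambda>row :: 'a \<Rightarrow> real. \<bar>row v\<bar> \<le> c1 * M u v)" by measurable
    qed
    have p2: "Measurable.pred (PiM V (\<lambda>_. borel)) (\<lambda>row :: 'a \<Rightarrow> real. \<forall>v\<in>V. (\<Sum>g\<in>Stab G u. row (g v)) = 0)"
    proof (rule pred_intros_finite[OF finite_verts])
      fix v assume v: "v \<in> V"
      note [measurable] = s[OF v]
      show "Measurable.pred (PiM V (\<lambda>_. borel)) (\<lambda>row :: 'a \<Rightarrow> real. (\<Sum>g\<in>Stab G u. row (g v)) = 0)" by measurable
    qed
    have "Measurable.pred (PiM V (\<lambda>_. borel)) (good u)"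
      unfolding good_def[abs_def] using p1 p2 by (rule pred_intros_logic)
    then show ?thesis unfolding F_def by measurable
  qed
  have rows0: "indep_vars (\<lambda>_. PiM V (\<lambda>_. borel)) (\<lambda>u \<omega>. restrict (B \<omega> u) V) V"
    using env by (simp add: random_environment_def)
  have "indep_vars (\<lambda>_. PiM V (\<lambda>_. borel)) (\<lambda>u \<omega>. F u (restrict (B \<omega> u) V)) V"
    by (rule indep_vars_compose2[OF rows0 F_measurable])
  moreover have ext: "F u (restrict (B \<omega> u) V) = restrict (B' \<omega> u) V" for u \<omega>
    by (auto simp: B'_def F_def fun_eq_iff)
  ultimately have rows: "indep_vars (\<lambda>_. PiM V (\<lambda>_. borel)) (\<lambda>u \<omega>. restrict (B' \<omega> u) V) V" by simp
  have B'_meas: "(\<lambda>\<omega>. B' \<omega> u v) \<in> borel_measurable P" if "u \<in> V" "v \<in> V" for u v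
  proof -
    have "(\<lambda>\<omega>. restrict (B' \<omega> u) V) \<in> measurable P (PiM V (\<lambda>_. borel))"
      using rows that(1) by (simp add: indep_vars_def)
    then have "(\<lambda>\<omega>. restrict (B' \<omega> u) V v) \<in> borel_measurable P"
      using measurable_component_singleton[OF that(2)] by (rule measurable_compose)
    then show ?thesis using that(2) by simp
  qed
  have B_meas: "(\<lambda>\<omega>. B \<omega> u v) \<in> borel_measurable P" if "u \<in> V" "v \<in> V" for u v
    using env that by (simp add: random_environment_def)
  have AE1: "AE \<omega> in P. \<forall>u\<in>V. \<forall>v\<in>V. \<bar>B \<omega> u v\<bar> \<le> c1 * M u v"
    and AE2: "AE \<omega> in P. \<forall>u\<in>V. \<forall>v\<in>V. (\<Sum>g\<in>Stab G u. B \<omega> u (g v)) = 0"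
    using env by (simp_all add: random_environment_def)
  have eq: "AE \<omega> in P. \<forall>u\<in>V. \<forall>v\<in>V. B' \<omega> u v = B \<omega> u v"
    using AE1 AE2
  proof eventually_elim
    case (elim \<omega>)
    have "good u (restrict (B \<omega> u) V)" if u: "u \<in> V" for u
    proof -
      have "(\<Sum>g\<in>Stab G u. restrict (B \<omega> u) V (g v)) = (\<Sum>g\<in>Stab G u. B \<omega> u (g v))" if "v \<in> V" for v
        using stab_V[OF _ that] by (intro sum.cong) auto
      then show ?thesis using elim u by (simp add: good_def)
    qed
    then show ?case by (simp add: B'_def F_def)
  qed
  have same: "expectation (\<lambda>\<omega>. h (B' \<omega> u v)) = expectation (\<lambda>\<omega>. h (B \<omega> u v))"
    if [measurable]: "h \<in> borel_measurable borel" and V: "u \<in> V" "v \<in> V" for h :: "real \<Rightarrow> real" and u v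
  proof (rule integral_cong_AE)
    show "(\<lambda>\<omega>. h (B' \<omega> u v)) \<in> borel_measurable P" "(\<lambda>\<omega>. h (B \<omega> u v)) \<in> borel_measurable P"
      by (rule measurable_compose[OF B'_meas[OF V] that(1)], rule measurable_compose[OF B_meas[OF V] that(1)])
    show "AE \<omega> in P. h (B' \<omega> u v) = h (B \<omega> u v)" using eq by eventually_elim (use V in auto)
  qed
  have "environment G P B' (max c1 0)"
  proof unfold_locales
    fix u v assume uv: "(u, v) \<in> parcs G"
    then have V: "u \<in> V" "v \<in> V" using nbrs_subset[of u] nbrs_subset[of v] nbrs_sym[of v u] by (auto simp: nbrs_def)
    have m: "expectation (\<lambda>\<omega>. B \<omega> u v) = 0" "variance (\<lambda>\<omega>. B \<omega> u v) = 1"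
      using env uv by (auto simp: random_environment_def)
    show "expectation (\<lambda>\<omega>. B' \<omega> u v) = 0" using same[of "\<lambda>x. x", OF _ V] m(1) by simp
    show "expectation (\<lambda>\<omega>. (B' \<omega> u v)\<^sup>2) = 1" using same[of "\<lambda>x. x\<^sup>2", OF _ V] m by simp
  next
    fix \<omega> u v assume \<omega>: "\<omega> \<in> space P" and V: "u \<in> V" "v \<in> V"
    \<comment> \<open>A row replaced by zero needs a nonnegative bound, hence the maximum with
      0.\<close>
    have "c1 * M u v \<le> max c1 0 * M u v" by (intro mult_right_mono walk_nonneg) simp
    moreover have "0 \<le> max c1 0 * M u v" using walk_nonneg by simp
    ultimately show "\<bar>B' \<omega> u v\<bar> \<le> max c1 0 * M u v"
      using V by (cases "good u (restrict (B \<omega> u) V)") (auto simp: B'_def F_def good_def)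
    show "(\<Sum>g\<in>Stab G u. B' \<omega> u (g v)) = 0"
    proof (cases "good u (restrict (B \<omega> u) V)")
      case True
      then have "(\<Sum>g\<in>Stab G u. B' \<omega> u (g v)) = (\<Sum>g\<in>Stab G u. restrict (B \<omega> u) V (g v))"
        by (intro sum.cong refl) (simp add: B'_def F_def)
      then show ?thesis using True V by (simp only: good_def)
    next
      case False
      then show ?thesis using stab_V[OF _ V(2)] by (intro sum.neutral) (auto simp: B'_def F_def)
    qed
  qed (use G rows in auto)
  then show ?thesis using eq that by blast
qed

section \<open>The statistic of a test function as a series in its Taylor coefficients\<close>

context environment
begin

text \<open>The exponent \<open>2 * m\<close> reflects the composition with the square, under which
  \<open>x ^ m\<close> becomes an even power.\<close>

definition moment_stat :: "nat \<Rightarrow> 'w \<Rightarrow> real" where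
  "moment_stat m \<omega> = tr V (pert2 V M (B \<omega>) (2 * m)) / sqrt (card V)"

definition linear_stat :: "(nat \<Rightarrow> real) \<Rightarrow> 'w \<Rightarrow> real" where
  "linear_stat a \<omega> = (\<Sum>m. a m * moment_stat m \<omega>)"

lemma moment_stat_pair_tr:
  "moment_stat m \<omega> = real m * (\<Sum>b<2 * m - 1. pair_tr V M (B \<omega>) (2 * m - 2 - b) b) / sqrt (card V)"
  using tr_pert2[OF finite_verts, of M "B \<omega>" "2 * m"] by (simp add: moment_stat_def)

lemma pair_tr_measurable [measurable]: "(\<lambda>\<omega>. pair_tr V M (B \<omega>) a b) \<in> borel_measurable P"
proof -
  have "bdd_dep V (entry a u z)" if "u \<in> V" for a u z
    using bdd_dep_mono[OF bdd_dep_entry[OF that]] that by simp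
  then have [measurable]: "entry a u z \<in> borel_measurable P" if "u \<in> V" for a u z
    using that bdd_dep_dep dep_measurable by blast
  show ?thesis unfolding pair_tr_entry by measurable
qed

lemma row_bound_B: "\<omega> \<in> space P \<Longrightarrow> row_bound V (B \<omega>) c"
proof (unfold row_bound_def, intro ballI)
  fix u assume \<omega>: "\<omega> \<in> space P" and u: "u \<in> V"
  have "(\<Sum>v\<in>V. \<bar>B \<omega> u v\<bar>) \<le> c * (\<Sum>v\<in>V. M u v)"
    unfolding sum_distrib_left by (intro sum_mono bound_B[OF \<omega> u])
  also have "\<dots> \<le> c * 1"
    using row_bound_walk_matrix[of G] u c walk_nonneg
    by (intro mult_left_mono) (auto simp: row_bound_def pair_graph_axioms)
  finally show "(\<Sum>v\<in>V. \<bar>B \<omega> u v\<bar>) \<le> c" by simp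
qed

text \<open>This bound grows with the graph. It serves for the pointwise convergence and
  integrability of the series on a fixed graph; the estimate uniform in the graph is
  \<open>expectation_abs_moment_stat\<close>.\<close>

lemma moment_stat_bound:
  assumes "\<omega> \<in> space P"
  shows "\<bar>moment_stat m \<omega>\<bar> \<le> 4 * c\<^sup>2 * sqrt (card V) * real m ^ 3"
proof -
  have N: "real (card V) > 0" using nonempty finite_verts by (simp add: card_gt_0_iff)
  have "\<bar>tr V (pert2 V M (B \<omega>) (2 * m))\<bar> \<le> card V * ((real (2 * m))\<^sup>2 * c\<^sup>2)"
    by (intro abs_tr_le finite_verts pert_bounds row_bound_walk_matrix row_bound_B assms c) unfold_locales
  also have "\<dots> \<le> card V * (4 * real m ^ 3 * c\<^sup>2)"
  proof -
    have "real m ^ 2 \<le> real m ^ 3" by (cases m) (auto intro!: power_increasing)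
    then have "(real (2 * m))\<^sup>2 \<le> 4 * real m ^ 3" by (simp add: power_mult_distrib)
    then show ?thesis by (intro mult_left_mono mult_right_mono) auto
  qed
  finally have "\<bar>moment_stat m \<omega>\<bar> \<le> card V * (4 * real m ^ 3 * c\<^sup>2) / sqrt (card V)"
    unfolding moment_stat_def abs_divide by (intro divide_mono) (use N in auto)
  also have "\<dots> = card V / sqrt (card V) * (4 * real m ^ 3 * c\<^sup>2)" by simp
  also have "\<dots> = 4 * c\<^sup>2 * sqrt (card V) * real m ^ 3" by (subst real_div_sqrt) auto
  finally show ?thesis .
qed

lemma moment_stat_measurable [measurable]: "moment_stat m \<in> borel_measurable P"
  unfolding moment_stat_pair_tr[abs_def] by measurable

text \<open>Each of the 2 m - 1 traces has second moment of order |V| whatever its exponents, and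
  the normalization cancels the square root of |V|. The resulting square of \<open>m\<close> is
  enlarged to a cube, so that one moment condition on the coefficients serves throughout.\<close>

lemma expectation_abs_moment_stat: "expectation (\<lambda>\<omega>. \<bar>moment_stat m \<omega>\<bar>) \<le> 4 * c\<^sup>2 * real m ^ 3"
proof -
  have N: "real (card V) > 0" using nonempty finite_verts by (simp add: card_gt_0_iff)
  have b: "\<bar>pair_tr V M (B \<omega>) a b\<bar> \<le> card V * (1 ^ a * c * (1 ^ b * c))" if "\<omega> \<in> space P" for a b \<omega>
    unfolding pair_tr_def
    by (intro abs_tr_le finite_verts row_bound_mm row_bound_mpow row_bound_walk_matrix row_bound_B that)
      (use c in \<open>auto simp: pair_graph_axioms\<close>)
  have int: "integrable P (\<lambda>\<omega>. pair_tr V M (B \<omega>) a b)" "integrable P (\<lambda>\<omega>. (pair_tr V M (B \<omega>) a b)\<^sup>2)" for a b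
  proof -
    have n: "norm (pair_tr V M (B \<omega>) a b) \<le> card V * c\<^sup>2" if "\<omega> \<in> space P" for \<omega>
      using b[OF that, of a b] by (simp add: power2_eq_square)
    then show "integrable P (\<lambda>\<omega>. pair_tr V M (B \<omega>) a b)" by (intro integrable_bounded) auto
    have "norm ((pair_tr V M (B \<omega>) a b)\<^sup>2) \<le> (card V * c\<^sup>2)\<^sup>2" if "\<omega> \<in> space P" for \<omega>
      using power_mono[OF n[OF that], of 2] by (simp add: norm_power)
    then show "integrable P (\<lambda>\<omega>. (pair_tr V M (B \<omega>) a b)\<^sup>2)" by (intro integrable_bounded) auto
  qed
  have one: "expectation (\<lambda>\<omega>. \<bar>pair_tr V M (B \<omega>) a b\<bar>) \<le> 2 * c\<^sup>2 * sqrt (card V)" for a b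
  proof -
    have "expectation (\<lambda>\<omega>. \<bar>pair_tr V M (B \<omega>) a b\<bar>) \<le> sqrt (2 * c ^ 4 * card V)"
      using abs_expectation_le_sqrt[OF int] second_moment_pair_tr
      by (meson order_trans real_sqrt_le_mono)
    also have "\<dots> \<le> sqrt ((2 * c\<^sup>2)\<^sup>2 * card V)"
      by (intro real_sqrt_le_mono mult_right_mono) (auto simp: power_mult_distrib)
    also have "\<dots> = 2 * c\<^sup>2 * sqrt (card V)" unfolding real_sqrt_mult real_sqrt_abs by simp
    finally show ?thesis .
  qed
  have "expectation (\<lambda>\<omega>. \<bar>moment_stat m \<omega>\<bar>) \<le>
      expectation (\<lambda>\<omega>. \<Sum>b<2 * m - 1. real m / sqrt (card V) * \<bar>pair_tr V M (B \<omega>) (2 * m - 2 - b) b\<bar>)"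
  proof (rule Bochner_Integration.integral_mono)
    show "integrable P (\<lambda>\<omega>. \<bar>moment_stat m \<omega>\<bar>)"
      unfolding moment_stat_pair_tr
      by (intro integrable_abs Bochner_Integration.integrable_divide Bochner_Integration.integrable_mult_right Bochner_Integration.integrable_sum int)
    show "integrable P (\<lambda>\<omega>. \<Sum>b<2 * m - 1. real m / sqrt (card V) * \<bar>pair_tr V M (B \<omega>) (2 * m - 2 - b) b\<bar>)"
      by (intro Bochner_Integration.integrable_sum Bochner_Integration.integrable_mult_right integrable_abs int)
    fix \<omega>
    have "\<bar>moment_stat m \<omega>\<bar> = real m / sqrt (card V) * \<bar>\<Sum>b<2 * m - 1. pair_tr V M (B \<omega>) (2 * m - 2 - b) b\<bar>"
      by (simp add: moment_stat_pair_tr abs_mult)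
    also have "\<dots> \<le> real m / sqrt (card V) * (\<Sum>b<2 * m - 1. \<bar>pair_tr V M (B \<omega>) (2 * m - 2 - b) b\<bar>)"
      by (intro mult_left_mono sum_abs) auto
    finally show "\<bar>moment_stat m \<omega>\<bar> \<le> (\<Sum>b<2 * m - 1. real m / sqrt (card V) * \<bar>pair_tr V M (B \<omega>) (2 * m - 2 - b) b\<bar>)"
      by (simp add: sum_distrib_left)
  qed
  also have "\<dots> = (\<Sum>b<2 * m - 1. real m / sqrt (card V) * expectation (\<lambda>\<omega>. \<bar>pair_tr V M (B \<omega>) (2 * m - 2 - b) b\<bar>))"
    by (subst Bochner_Integration.integral_sum)
      (auto intro!: Bochner_Integration.integrable_mult_right integrable_abs int simp del: integrable_abs_iff)
  also have "\<dots> \<le> (\<Sum>b<2 * m - 1. real m / sqrt (card V) * (2 * c\<^sup>2 * sqrt (card V)))"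
    by (intro sum_mono mult_left_mono one) auto
  also have "\<dots> = real (2 * m - 1) * (real m * (2 * c\<^sup>2))" using N nonempty by simp
  also have "\<dots> \<le> (2 * real m) * (real m * (2 * c\<^sup>2))" by (intro mult_right_mono) auto
  also have "\<dots> = 4 * c\<^sup>2 * real m ^ 2" by (simp add: power2_eq_square)
  also have "\<dots> \<le> 4 * c\<^sup>2 * real m ^ 3"
    by (intro mult_left_mono) (cases m, auto intro!: power_increasing)
  finally show ?thesis .
qed

lemma linear_stat_summable:
  assumes a: "summable (\<lambda>m. real m ^ 3 * \<bar>a m\<bar>)" and \<omega>: "\<omega> \<in> space P"
  shows "summable (\<lambda>m. \<bar>a m * moment_stat m \<omega>\<bar>)"
proof (rule summable_comparison_test')
  show "summable (\<lambda>m. 4 * c\<^sup>2 * sqrt (card V) * (real m ^ 3 * \<bar>a m\<bar>))" using a by (rule summable_mult)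
  show "norm \<bar>a m * moment_stat m \<omega>\<bar> \<le> 4 * c\<^sup>2 * sqrt (card V) * (real m ^ 3 * \<bar>a m\<bar>)" for m
    using mult_left_mono[OF moment_stat_bound[OF \<omega>], of "\<bar>a m\<bar>" m] by (simp add: abs_mult ac_simps)
qed

lemma linear_stat_L1:
  assumes a: "summable (\<lambda>m. real m ^ 3 * \<bar>a m\<bar>)"
  shows "integrable P (linear_stat a)" "expectation (\<lambda>\<omega>. \<bar>linear_stat a \<omega>\<bar>) \<le> 4 * c\<^sup>2 * (\<Sum>m. real m ^ 3 * \<bar>a m\<bar>)"
proof -
  have int: "integrable P (\<lambda>\<omega>. a m * moment_stat m \<omega>)" for m
    by (intro Bochner_Integration.integrable_mult_right integrable_bounded[OF moment_stat_measurable, of m])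
      (use moment_stat_bound in auto)
  have le: "expectation (\<lambda>\<omega>. \<bar>a m * moment_stat m \<omega>\<bar>) \<le> 4 * c\<^sup>2 * (real m ^ 3 * \<bar>a m\<bar>)" for m
    using mult_left_mono[OF expectation_abs_moment_stat, of "\<bar>a m\<bar>" m] by (simp add: abs_mult ac_simps)
  have s: "summable (\<lambda>m. 4 * c\<^sup>2 * (real m ^ 3 * \<bar>a m\<bar>))" using a by (rule summable_mult)
  have s2: "summable (\<lambda>m. expectation (\<lambda>\<omega>. \<bar>a m * moment_stat m \<omega>\<bar>))"
    by (rule summable_comparison_test'[OF s]) (use le in auto)
  have AE: "AE \<omega> in P. summable (\<lambda>m. \<bar>a m * moment_stat m \<omega>\<bar>)" using linear_stat_summable[OF a] by (intro AE_I2)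
  show i: "integrable P (linear_stat a)"
    unfolding linear_stat_def[abs_def] by (rule integrable_suminf[OF int]) (use AE s2 in simp_all)
  have iabs: "integrable P (\<lambda>\<omega>. \<Sum>m. \<bar>a m * moment_stat m \<omega>\<bar>)"
    and eq: "expectation (\<lambda>\<omega>. \<Sum>m. \<bar>a m * moment_stat m \<omega>\<bar>) = (\<Sum>m. expectation (\<lambda>\<omega>. \<bar>a m * moment_stat m \<omega>\<bar>))"
    by (rule integrable_suminf integral_suminf; use int AE s2 in \<open>simp del: abs_mult\<close>)+
  have "expectation (\<lambda>\<omega>. \<bar>linear_stat a \<omega>\<bar>) \<le> expectation (\<lambda>\<omega>. \<Sum>m. \<bar>a m * moment_stat m \<omega>\<bar>)"
    using i iabs summable_rabs[OF linear_stat_summable[OF a]] unfolding linear_stat_def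
    by (intro Bochner_Integration.integral_mono_AE) (auto intro!: AE_I2)
  also have "\<dots> \<le> (\<Sum>m. 4 * c\<^sup>2 * (real m ^ 3 * \<bar>a m\<bar>))"
    unfolding eq by (intro suminf_le le s2 s)
  also have "\<dots> = 4 * c\<^sup>2 * (\<Sum>m. real m ^ 3 * \<bar>a m\<bar>)" using a by (rule suminf_mult)
  finally show "expectation (\<lambda>\<omega>. \<bar>linear_stat a \<omega>\<bar>) \<le> 4 * c\<^sup>2 * (\<Sum>m. real m ^ 3 * \<bar>a m\<bar>)" .
qed

lemma linear_stat_sum:
  assumes "finite J" "\<And>j. j \<in> J \<Longrightarrow> summable (\<lambda>m. real m ^ 3 * \<bar>a j m\<bar>)" "\<omega> \<in> space P"
  shows "linear_stat (\<lambda>m. \<Sum>j\<in>J. t j * a j m) \<omega> = (\<Sum>j\<in>J. t j * linear_stat (a j) \<omega>)"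
proof -
  have s: "summable (\<lambda>m. a j m * moment_stat m \<omega>)" if "j \<in> J" for j
    using linear_stat_summable[OF assms(2)[OF that] assms(3)] by (rule summable_rabs_cancel)
  have "linear_stat (\<lambda>m. \<Sum>j\<in>J. t j * a j m) \<omega> = (\<Sum>m. \<Sum>j\<in>J. t j * (a j m * moment_stat m \<omega>))"
    by (simp add: linear_stat_def sum_distrib_right mult.assoc)
  also have "\<dots> = (\<Sum>j\<in>J. \<Sum>m. t j * (a j m * moment_stat m \<omega>))"
    using s by (intro suminf_sum summable_mult)
  also have "\<dots> = (\<Sum>j\<in>J. t j * linear_stat (a j) \<omega>)"
    using s by (intro sum.cong refl) (simp add: linear_stat_def suminf_mult)
  finally show ?thesis .
qed

lemma linear_stat_trunc_qsum:
  "linear_stat (trunc K a) \<omega> = (\<Sum>u\<in>V. \<Sum>z\<in>V. qsum (Sigma {..K} (\<lambda>m. {..<2 * m - 1})) (\<lambda>(m, b). a m * real m)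
     (\<lambda>(m, b). 2 * m - 2 - b) snd u z \<omega>) / sqrt (card V)"
proof -
  have "linear_stat (trunc K a) \<omega> = (\<Sum>m\<le>K. a m * moment_stat m \<omega>)"
    unfolding linear_stat_def by (subst suminf_finite[of "{..K}"]) (auto simp: trunc_def)
  also have "\<dots> = (\<Sum>m\<le>K. \<Sum>b<2 * m - 1. a m * real m * pair_tr V M (B \<omega>) (2 * m - 2 - b) b) / sqrt (card V)"
    by (simp add: moment_stat_pair_tr sum_distrib_left sum_divide_distrib mult.assoc)
  also have "(\<Sum>m\<le>K. \<Sum>b<2 * m - 1. a m * real m * pair_tr V M (B \<omega>) (2 * m - 2 - b) b) =
     (\<Sum>(m, b)\<in>Sigma {..K} (\<lambda>m. {..<2 * m - 1}). a m * real m * pair_tr V M (B \<omega>) (2 * m - 2 - b) b)"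
    by (rule sum.Sigma) auto
  also have "\<dots> = (\<Sum>i\<in>Sigma {..K} (\<lambda>m. {..<2 * m - 1}). \<Sum>u\<in>V. \<Sum>z\<in>V. (case i of (m, b) \<Rightarrow> a m * real m) *
     (entry (case i of (m, b) \<Rightarrow> 2 * m - 2 - b) u z \<omega> * entry (snd i) z u \<omega>))"
    by (intro sum.cong refl) (auto simp: pair_tr_entry sum_distrib_left)
  also have "\<dots> = (\<Sum>u\<in>V. \<Sum>i\<in>Sigma {..K} (\<lambda>m. {..<2 * m - 1}). \<Sum>z\<in>V. (case i of (m, b) \<Rightarrow> a m * real m) *
     (entry (case i of (m, b) \<Rightarrow> 2 * m - 2 - b) u z \<omega> * entry (snd i) z u \<omega>))"
    by (rule sum.swap)
  also have "\<dots> = (\<Sum>u\<in>V. \<Sum>z\<in>V. qsum (Sigma {..K} (\<lambda>m. {..<2 * m - 1})) (\<lambda>(m, b). a m * real m)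
     (\<lambda>(m, b). 2 * m - 2 - b) snd u z \<omega>)"
    unfolding qsum_def by (intro sum.cong refl sum.swap)
  finally show ?thesis .
qed

end

text \<open>The error constant of \<open>qsum_char\<close> for a polynomial of degree
  \<open>K\<close>, whose exponents lie below \<open>2 * K + 1\<close>. It is independent of the
  graph.\<close>

definition char_const :: "nat \<Rightarrow> real \<Rightarrow> nat \<Rightarrow> (nat \<Rightarrow> real) \<Rightarrow> real" where
  "char_const d c K a = (let D = real ((\<Sum>j\<le>2 * K + 1. d ^ j)\<^sup>2);
     C = c\<^sup>2 * (\<Sum>(m, b)\<in>Sigma {..K} (\<lambda>m. {..<2 * m - 1}). \<bar>a m * real m\<bar>) in 4 * D\<^sup>2 * C\<^sup>2 + D\<^sup>2 * C ^ 3)"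

context tree_like_environment
begin

text \<open>For each \<open>m\<close> the exponents run through all a + b = 2 m - 2, a full
  convolution; at equal distances \<open>l\<close> it collapses to the distance
  \<open>2 * l\<close>.\<close>

lemma pair_weight_sum:
  assumes l: "0 < l"
  shows "(\<Sum>i\<in>Sigma {..K} (\<lambda>m. {..<2 * m - 1}). (case i of (m, b) \<Rightarrow> a m * real m) *
      (tree_diff d (case i of (m, b) \<Rightarrow> 2 * m - 2 - b) l * tree_diff d (snd i) l)) =
    (\<Sum>m\<le>K. a m * real m * (real d * tree_diff d (2 * (m - 1) + 1) (2 * l)))"
proof -
  have "(\<Sum>i\<in>Sigma {..K} (\<lambda>m. {..<2 * m - 1}). (case i of (m, b) \<Rightarrow> a m * real m) *
      (tree_diff d (case i of (m, b) \<Rightarrow> 2 * m - 2 - b) l * tree_diff d (snd i) l)) =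
    (\<Sum>(m, b)\<in>Sigma {..K} (\<lambda>m. {..<2 * m - 1}). a m * real m * (tree_diff d (2 * m - 2 - b) l * tree_diff d b l))"
    by (intro sum.cong refl) auto
  also have "\<dots> = (\<Sum>m\<le>K. \<Sum>b<2 * m - 1. a m * real m * (tree_diff d (2 * m - 2 - b) l * tree_diff d b l))"
    by (rule sum.Sigma[symmetric]) auto
  also have "\<dots> = (\<Sum>m\<le>K. a m * real m * (real d * tree_diff d (2 * (m - 1) + 1) (2 * l)))"
  proof (intro sum.cong refl)
    fix m assume "m \<in> {..K}"
    show "(\<Sum>b<2 * m - 1. a m * real m * (tree_diff d (2 * m - 2 - b) l * tree_diff d b l)) =
      a m * real m * (real d * tree_diff d (2 * (m - 1) + 1) (2 * l))"
    proof (cases m)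
      case (Suc j)
      have "(\<Sum>b\<le>2 * j. tree_diff d b l * tree_diff d (2 * j - b) l) = real d * tree_diff d (Suc (2 * j)) (l + l)"
        using d l by (intro tree_diff_convolution) auto
      moreover have "{..<2 * m - 1} = {..2 * j}" using Suc by auto
      ultimately show ?thesis using Suc
        by (simp add: mult.commute mult_2 mult_2_right del: tree_diff.simps flip: sum_distrib_left sum_distrib_right)
    qed simp
  qed
  finally show ?thesis .
qed

text \<open>Once the radius exceeds the range of all exponents, the variance coincides with that of
  the limit, and the only error left is that of the normal approximation.\<close>

lemma trunc_char:
  assumes r: "2 * K + 1 < r"
  shows "norm (expectation (\<lambda>\<omega>. iexp (linear_stat (trunc K a) \<omega>)) -
      complex_of_real (exp (- (\<Sum>l. (limit_coeff d (trunc K a) l)\<^sup>2) / 2)))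
    \<le> char_const d c K a / sqrt (card V)"
proof -
  define I where "I = Sigma {..K} (\<lambda>m. {..<2 * m - 1})"
  define w :: "nat \<times> nat \<Rightarrow> real" where "w = (\<lambda>(m, b). a m * real m)"
  define pa :: "nat \<times> nat \<Rightarrow> nat" where "pa = (\<lambda>(m, b). 2 * m - 2 - b)"
  have N: "real (card V) > 0" using nonempty finite_verts by (simp add: card_gt_0_iff)
  have I: "finite I" by (auto simp: I_def)
  have ab: "pa i < 2 * K + 1" "pa i + 1 < r \<and> snd i + 1 < r" if "i \<in> I" for i
    using that r by (auto simp: I_def pa_def)
  have deg: "card (nbrs G v) = d" if "v \<in> V" for v
    using level_funD(1,2)[OF lev[OF that] that] r by simp
  have linear_stat: "linear_stat (trunc K a) = (\<lambda>\<omega>. (\<Sum>u\<in>V. \<Sum>z\<in>V. qsum I w pa snd u z \<omega>) / sqrt (card V))"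
    unfolding linear_stat_trunc_qsum I_def w_def pa_def ..
  define \<alpha> where "\<alpha> l = (\<Sum>i\<in>I. w i * (tree_diff d (pa i) l * tree_diff d (snd i) l))" for l
  \<comment> \<open>Here the number of vertices at level \<open>l\<close> meets the square of the
    weight \<open>p\<close> contained in \<open>sine_coeff\<close>, leaving one power of
    \<open>p\<close> in the numerator.\<close>
  have sq: "2 * real d * (real d - 1) ^ (l - 1) * (\<alpha> l)\<^sup>2 = (limit_coeff d (trunc K a) l)\<^sup>2" if l: "0 < l" for l
  proof -
    define p where "p = (real d - 1) ^ (l - 1)"
    have p: "p > 0" using d by (simp add: p_def)
    have "limit_coeff d (trunc K a) l = (\<Sum>m\<le>K. sqrt (2 * real d / p) * p * (a m * real m * (real d * tree_diff d (2 * (m - 1) + 1) (2 * l))))"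
      unfolding limit_coeff_trunc mono_coeff_def sine_coeff_def p_def by (intro sum.cong refl) (simp del: tree_diff.simps)
    also have "\<dots> = sqrt (2 * real d / p) * p * \<alpha> l"
      using pair_weight_sum[OF l, of a K] by (simp add: \<alpha>_def I_def w_def pa_def sum_distrib_left)
    finally have "(limit_coeff d (trunc K a) l)\<^sup>2 = (2 * real d / p) * p\<^sup>2 * (\<alpha> l)\<^sup>2"
      using p by (simp add: power_mult_distrib)
    then show ?thesis unfolding p_def[symmetric] using p by (simp add: power2_eq_square)
  qed
  have out: "limit_coeff d (trunc K a) l = 0" if "l \<notin> {1..<r}" for l
  proof -
    have "sine_coeff d (m - 1) l = 0" if "m \<le> K" for m
    proof (cases "l = 0")
      case False
      then have "m - 1 + 1 < l \<or> m = 0 \<and> 1 < l" using \<open>l \<notin> {1..<r}\<close> that r by auto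
      then show ?thesis using sine_coeff_eq_0[of "m - 1" l] by auto
    qed simp
    then show ?thesis by (simp add: limit_coeff_trunc mono_coeff_def)
  qed
  have "expectation (\<lambda>\<omega>. (linear_stat (trunc K a) \<omega>)\<^sup>2) =
      expectation (\<lambda>\<omega>. (\<Sum>u\<in>V. \<Sum>z\<in>V. qsum I w pa snd u z \<omega>)\<^sup>2) / card V"
    unfolding linear_stat by (simp add: power_divide)
  also have "\<dots> = (\<Sum>l\<in>{1..<r}. 2 * real d * (real d - 1) ^ (l - 1) * (\<alpha> l)\<^sup>2)"
    unfolding \<alpha>_def by (subst second_moment_qsum_level[OF I ab(2)]) (use N nonempty in simp_all)
  also have "\<dots> = (\<Sum>l\<in>{1..<r}. (limit_coeff d (trunc K a) l)\<^sup>2)"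
    using sq by (intro sum.cong) auto
  also have "\<dots> = (\<Sum>l. (limit_coeff d (trunc K a) l)\<^sup>2)"
    by (rule suminf_finite[symmetric]) (auto simp: out)
  finally have var: "expectation (\<lambda>\<omega>. (linear_stat (trunc K a) \<omega>)\<^sup>2) = (\<Sum>l. (limit_coeff d (trunc K a) l)\<^sup>2)" .
  have w: "(\<Sum>i\<in>I. \<bar>w i\<bar>) = (\<Sum>(m, b)\<in>I. \<bar>a m * real m\<bar>)" by (intro sum.cong) (auto simp: w_def)
  show ?thesis
    using qsum_char[OF I ab(1) deg, where w = w and b = snd]
    unfolding var[symmetric] unfolding linear_stat char_const_def Let_def unfolding I_def[symmetric] w by simp
qed

end

lemma iexp_lipschitz: "norm (iexp x - iexp y) \<le> \<bar>x - y\<bar>" for x y :: real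
proof -
  have "iexp x - iexp y = iexp y * (iexp (x - y) - 1)"
    by (simp add: algebra_simps flip: exp_add)
  moreover have "norm (iexp (x - y) - 1) \<le> \<bar>x - y\<bar>"
    using iexp_approx1[of "x - y" 0] by simp
  ultimately show ?thesis by (simp add: norm_mult)
qed

lemma tendsto_of_approximations:
  fixes x :: "nat \<Rightarrow> 'b::real_normed_vector" and \<delta> :: "nat \<Rightarrow> real"
  assumes X: "\<And>K. X K \<longlonglongrightarrow> Y K" and Y: "Y \<longlonglongrightarrow> y"
    and \<delta>: "\<And>K n. norm (x n - X K n) \<le> \<delta> K" "\<delta> \<longlonglongrightarrow> 0"
  shows "x \<longlonglongrightarrow> y"
proof (rule tendstoI)
  fix e :: real assume e: "e > 0"
  have "\<forall>\<^sub>F K in sequentially. dist (Y K) y < e / 3 \<and> dist (\<delta> K) 0 < e / 3"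
    using tendstoD[OF Y, of "e / 3"] tendstoD[OF \<delta>(2), of "e / 3"] e by (simp add: eventually_conj)
  then obtain K where K: "dist (Y K) y < e / 3" "dist (\<delta> K) 0 < e / 3"
    by (auto dest: eventually_happens)
  show "\<forall>\<^sub>F n in sequentially. dist (x n) y < e"
  proof (rule eventually_mono[OF tendstoD[OF X[of K], of "e / 3"]])
    fix n assume elim: "dist (X K n) (Y K) < e / 3"
    have "dist (x n) (X K n) < e / 3" using \<delta>(1)[of n K] K(2) by (simp add: dist_norm)
    then show "dist (x n) y < e"
      using elim K e dist_triangle[of "x n" y "X K n"] dist_triangle[of "X K n" y "Y K"] by simp
  qed (use e in simp)
qed

text \<open>The exponential is 1-Lipschitz, and the L1 bound controls the tail of the Taylor series
  uniformly in the graph.\<close>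

lemma (in environment) trunc_char_error:
  assumes a: "summable (\<lambda>m. real m ^ 3 * \<bar>a m\<bar>)"
  shows "norm (expectation (\<lambda>\<omega>. iexp (linear_stat a \<omega>)) - expectation (\<lambda>\<omega>. iexp (linear_stat (trunc K a) \<omega>)))
    \<le> 4 * c\<^sup>2 * ((\<Sum>m. real m ^ 3 * \<bar>a m\<bar>) - (\<Sum>m\<le>K. real m ^ 3 * \<bar>a m\<bar>))"
proof -
  have t: "summable (\<lambda>m. real m ^ 3 * \<bar>trunc K a m\<bar>)" using trunc_moment(1)[OF a] .
  let ?D = "\<lambda>m. a m - trunc K a m"
  have Deq: "real m ^ 3 * \<bar>?D m\<bar> = real m ^ 3 * \<bar>a m\<bar> - real m ^ 3 * \<bar>trunc K a m\<bar>" for m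
    by (simp add: trunc_def)
  have D: "summable (\<lambda>m. real m ^ 3 * \<bar>?D m\<bar>)"
    unfolding Deq by (rule summable_diff[OF a t])
  have diff: "linear_stat a \<omega> - linear_stat (trunc K a) \<omega> = linear_stat ?D \<omega>" if "\<omega> \<in> space P" for \<omega>
    unfolding linear_stat_def
    using suminf_diff[OF summable_rabs_cancel[OF linear_stat_summable[OF a that]] summable_rabs_cancel[OF linear_stat_summable[OF t that]]]
    by (simp add: left_diff_distrib)
  have [measurable]: "linear_stat a \<in> borel_measurable P" "linear_stat (trunc K a) \<in> borel_measurable P"
    using linear_stat_L1(1)[OF a] linear_stat_L1(1)[OF t] by auto
  have [measurable]: "(\<lambda>x. iexp x) \<in> borel_measurable borel"
    by (intro borel_measurable_continuous_onI continuous_intros)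
  have int: "integrable P (\<lambda>\<omega>. iexp (linear_stat b \<omega>))" if b: "linear_stat b \<in> borel_measurable P" for b
  proof (rule integrable_bounded[of _ 1])
    show "(\<lambda>\<omega>. iexp (linear_stat b \<omega>)) \<in> borel_measurable P"
      by (rule measurable_compose[OF b]) measurable
  qed simp
  have "expectation (\<lambda>\<omega>. iexp (linear_stat a \<omega>)) - expectation (\<lambda>\<omega>. iexp (linear_stat (trunc K a) \<omega>)) =
      expectation (\<lambda>\<omega>. iexp (linear_stat a \<omega>) - iexp (linear_stat (trunc K a) \<omega>))"
    by (rule Bochner_Integration.integral_diff[symmetric]) (intro int; measurable)+
  also have "norm \<dots> \<le> expectation (\<lambda>\<omega>. norm (iexp (linear_stat a \<omega>) - iexp (linear_stat (trunc K a) \<omega>)))"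
    by (rule integral_norm_bound)
  also have "\<dots> \<le> expectation (\<lambda>\<omega>. \<bar>linear_stat ?D \<omega>\<bar>)"
  proof (rule Bochner_Integration.integral_mono)
    show "integrable P (\<lambda>\<omega>. norm (iexp (linear_stat a \<omega>) - iexp (linear_stat (trunc K a) \<omega>)))"
      by (intro integrable_norm Bochner_Integration.integrable_diff int) measurable
    show "integrable P (\<lambda>\<omega>. \<bar>linear_stat ?D \<omega>\<bar>)" using linear_stat_L1(1)[OF D] by (rule integrable_abs)
    show "norm (iexp (linear_stat a \<omega>) - iexp (linear_stat (trunc K a) \<omega>)) \<le> \<bar>linear_stat ?D \<omega>\<bar>" if "\<omega> \<in> space P" for \<omega>
      using iexp_lipschitz[of "linear_stat a \<omega>" "linear_stat (trunc K a) \<omega>"] unfolding diff[OF that] .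
  qed
  also have "\<dots> \<le> 4 * c\<^sup>2 * (\<Sum>m. real m ^ 3 * \<bar>?D m\<bar>)" by (rule linear_stat_L1(2)[OF D])
  also have "(\<Sum>m. real m ^ 3 * \<bar>?D m\<bar>) = (\<Sum>m. real m ^ 3 * \<bar>a m\<bar>) - (\<Sum>m. real m ^ 3 * \<bar>trunc K a m\<bar>)"
    unfolding Deq by (rule suminf_diff[OF a t, symmetric])
  also have "(\<Sum>m. real m ^ 3 * \<bar>trunc K a m\<bar>) = (\<Sum>m\<le>K. real m ^ 3 * \<bar>a m\<bar>)"
    by (subst suminf_finite[of "{..K}"]) (auto simp: trunc_def)
  finally show ?thesis .
qed

text \<open>For fixed \<open>K\<close> the graphs grow and the truncated statistic becomes normal;
  the truncation error is uniform in \<open>n\<close>, so the two limits can be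
  interchanged.\<close>

theorem linear_stat_char_limit:
  fixes G :: "nat \<Rightarrow> 'a pair_pre_digraph" and P :: "nat \<Rightarrow> 'w measure" and a :: "nat \<Rightarrow> real"
  assumes d: "d \<ge> 2" and env: "\<And>n. environment (G n) (P n) (B n) c"
    and level: "\<And>r. \<forall>\<^sub>F n in sequentially. \<forall>z\<in>pverts (G n). \<exists>l. level_fun (G n) d z r l"
    and a: "summable (\<lambda>m. real m ^ 3 * \<bar>a m\<bar>)"
  shows "(\<lambda>n. \<integral>\<omega>. iexp (environment.linear_stat (G n) (B n) a \<omega>) \<partial>P n)
    \<longlonglongrightarrow> complex_of_real (exp (- (\<Sum>l. (limit_coeff d a l)\<^sup>2) / 2))"
proof (rule tendsto_of_approximations)
  fix K
  let ?x = "complex_of_real (exp (- (\<Sum>l. (limit_coeff d (trunc K a) l)\<^sup>2) / 2))"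
  show "(\<lambda>n. \<integral>\<omega>. iexp (environment.linear_stat (G n) (B n) (trunc K a) \<omega>) \<partial>P n) \<longlonglongrightarrow> ?x"
  proof (rule tendstoI)
    fix e :: real assume e: "e > 0"
    \<comment> \<open>The radius has to cover the exponents and, as a lower bound for the number of
      vertices, to push the error below \<open>e\<close>.\<close>
    obtain r where r: "2 * K + 1 < r" "(char_const d c K a / e)\<^sup>2 < real r"
    proof -
      obtain k where "(char_const d c K a / e)\<^sup>2 < real k" using reals_Archimedean2 by blast
      then show ?thesis using that[of "max k (2 * K + 2)"] by auto
    qed
    show "\<forall>\<^sub>F n in sequentially. dist (\<integral>\<omega>. iexp (environment.linear_stat (G n) (B n) (trunc K a) \<omega>) \<partial>P n) ?x < e"
      using level[of r]
    proof eventually_elim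
      case (elim n)
      then obtain lev where lev: "\<And>z. z \<in> pverts (G n) \<Longrightarrow> level_fun (G n) d z r (lev z)" by metis
      interpret environment "G n" "P n" "B n" c by (rule env)
      interpret tree_like_environment "G n" "P n" "B n" c d r lev
        by unfold_locales (fact d, fact lev)
      obtain z where z: "z \<in> V" using nonempty by auto
      have N: "real r \<le> real (card V)" using level_card_verts[OF lev[OF z] z d] by simp
      have "(char_const d c K a / e)\<^sup>2 < real (card V)" using r(2) N by simp
      then have "char_const d c K a / e < sqrt (card V)" by (rule real_less_rsqrt)
      then have "char_const d c K a / sqrt (card V) < e"
        using e N r by (simp add: divide_less_eq mult.commute)
      then show ?case using trunc_char[OF r(1), of a] by (simp add: dist_norm)
    qed
  qed
next
  show "(\<lambda>K. complex_of_real (exp (- (\<Sum>l. (limit_coeff d (trunc K a) l)\<^sup>2) / 2)))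
    \<longlonglongrightarrow> complex_of_real (exp (- (\<Sum>l. (limit_coeff d a l)\<^sup>2) / 2))"
    using cov_formula_series(2)[OF d a a] by (intro tendsto_intros) (simp_all add: power2_eq_square)
next
  fix K n
  interpret environment "G n" "P n" "B n" c by (rule env)
  show "norm ((\<integral>\<omega>. iexp (linear_stat a \<omega>) \<partial>P n) - (\<integral>\<omega>. iexp (linear_stat (trunc K a) \<omega>) \<partial>P n))
    \<le> 4 * c\<^sup>2 * ((\<Sum>m. real m ^ 3 * \<bar>a m\<bar>) - (\<Sum>m\<le>K. real m ^ 3 * \<bar>a m\<bar>))"
    by (rule trunc_char_error[OF a])
next
  show "(\<lambda>K. 4 * c\<^sup>2 * ((\<Sum>m. real m ^ 3 * \<bar>a m\<bar>) - (\<Sum>m\<le>K. real m ^ 3 * \<bar>a m\<bar>))) \<longlonglongrightarrow> 0"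
    using tendsto_mult_right_zero[OF tendsto_diff[OF tendsto_const summable_LIMSEQ'[OF a], of "\<Sum>m. real m ^ 3 * \<bar>a m\<bar>", simplified]]
    by (simp add: mult.commute)
qed

subsection \<open>Test functions and the limit theorem\<close>

definition taylor_coeff :: "(complex \<Rightarrow> complex) \<Rightarrow> nat \<Rightarrow> real" where
  "taylor_coeff f m = Re ((deriv ^^ m) f 0 / fact m)"

text \<open>By compactness, a neighbourhood of the closed unit disc contains a concentric disc of
  radius larger than 1, on which the Taylor series converges.\<close>

lemma taylor_series:
  assumes f: "f \<in> real_test_functions"
  obtains R where "R > 1" "\<forall>z. norm z < R \<longrightarrow> (\<lambda>m. complex_of_real (taylor_coeff f m) * z ^ m) sums f z"
proof -
  obtain S where S: "open S" "cball 0 1 \<subseteq> S" "f holomorphic_on S"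
    using f by (auto simp: real_test_functions_def test_functions_def analytic_on_holomorphic)
  then obtain e where e: "e > 0" "(\<Union>x\<in>cball 0 1. ball x e) \<subseteq> S"
    using compact_subset_open_imp_ball_epsilon_subset[of "cball 0 1" S] by (metis compact_cball)
  have "ball 0 (1 + e) \<subseteq> S"
  proof
    fix z :: complex assume z: "z \<in> ball 0 (1 + e)"
    show "z \<in> S"
    proof (cases "norm z \<le> 1")
      case False
      then have z0: "z \<noteq> 0" by auto
      \<comment> \<open>The radial projection to the unit circle lies at distance |z| - 1, hence
        within \<open>e\<close> of \<open>z\<close>.\<close>
      have "dist (z / of_real (norm z)) z = norm z - 1"
      proof -
        have "z / of_real (norm z) - z = of_real (1 / norm z - 1) * z" by (simp add: algebra_simps)
        then have "dist (z / of_real (norm z)) z = \<bar>1 / norm z - 1\<bar> * norm z"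
          by (simp add: dist_norm norm_mult del: of_real_diff of_real_divide)
        also have "\<dots> = norm z - 1" using False z0 by (simp add: abs_if field_simps)
        finally show ?thesis .
      qed
      then have "z \<in> ball (z / of_real (norm z)) e" using z False by simp
      moreover have "z / of_real (norm z) \<in> cball 0 1" using z0 by (simp add: norm_divide)
      ultimately show ?thesis using e(2) by blast
    qed (use S in auto)
  qed
  then have hol: "f holomorphic_on ball 0 (1 + e)" using S(3) holomorphic_on_subset by blast
  have "complex_of_real (taylor_coeff f m) = (deriv ^^ m) f 0 / fact m" for m
    using f by (simp add: real_test_functions_def taylor_coeff_def)
  then have "(\<lambda>m. complex_of_real (taylor_coeff f m) * z ^ m) sums f z" if "norm z < 1 + e" for z
    using holomorphic_power_series[OF hol, of z] that by simp
  then show ?thesis using that[of "1 + e"] e(1) by simp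
qed

lemma taylor_coeff_summable:
  assumes f: "f \<in> real_test_functions"
  obtains s where "s > 1" "summable (\<lambda>m. \<bar>taylor_coeff f m\<bar> * s ^ m)"
    "\<forall>z. norm z \<le> s \<longrightarrow> (\<lambda>m. complex_of_real (taylor_coeff f m) * z ^ m) sums f z"
proof -
  obtain R where R0: "R > 1" "\<forall>z. norm z < R \<longrightarrow> (\<lambda>m. complex_of_real (taylor_coeff f m) * z ^ m) sums f z"
    by (rule taylor_series[OF f])
  note R = R0(1) R0(2)[rule_format]
  obtain s where s: "1 < s" "s < R" using R(1) dense by blast
  obtain s' where s': "s < s'" "s' < R" using s(2) dense by blast
  have "norm (complex_of_real s') < R" using s s' by simp
  from sums_summable[OF R(2)[OF this]]
  have "summable (\<lambda>m. norm (complex_of_real (taylor_coeff f m) * complex_of_real s ^ m))"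
    by (rule powser_insidea) (use s s' in simp)
  then have "summable (\<lambda>m. \<bar>taylor_coeff f m\<bar> * s ^ m)"
    using s by (simp add: norm_mult norm_power)
  moreover have "(\<lambda>m. complex_of_real (taylor_coeff f m) * z ^ m) sums f z" if "norm z \<le> s" for z
    by (rule R(2)) (use that s in simp)
  ultimately show ?thesis using that[OF s(1)] by blast
qed

text \<open>Geometric decay of the coefficients beats any power of \<open>m\<close>; the cube is the
  power that \<open>expectation_abs_moment_stat\<close> and \<open>mono_coeff_bound\<close> ask
  for.\<close>

lemma taylor_coeff_moment:
  assumes f: "f \<in> real_test_functions"
  shows "summable (\<lambda>m. real m ^ 3 * \<bar>taylor_coeff f m\<bar>)"
proof -
  obtain s where s0: "s > 1" "summable (\<lambda>m. \<bar>taylor_coeff f m\<bar> * s ^ m)"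
    "\<forall>z. norm z \<le> s \<longrightarrow> (\<lambda>m. complex_of_real (taylor_coeff f m) * z ^ m) sums f z"
    by (rule taylor_coeff_summable[OF f])
  note s = s0(1,2) s0(3)[rule_format]
  define q where "q = root 3 (1 / s)"
  have q: "0 \<le> q" "q < 1" "q ^ 3 = 1 / s" using s(1) by (simp_all add: q_def)
  have "(\<lambda>m. (real m * q ^ m) ^ 3) \<longlonglongrightarrow> 0 ^ 3"
    using q by (intro tendsto_power powser_times_n_limit_0) auto
  then have "Bseq (\<lambda>m. (real m * q ^ m) ^ 3)" by (intro convergent_imp_Bseq convergentI)
  then obtain C where "\<forall>m. norm ((real m * q ^ m) ^ 3) \<le> C" unfolding Bseq_def by blast
  note C = this[rule_format]
  show ?thesis
  proof (rule summable_comparison_test')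
    show "summable (\<lambda>m. C * (\<bar>taylor_coeff f m\<bar> * s ^ m))" using s(2) by (rule summable_mult)
    fix m :: nat
    have "(real m * q ^ m) ^ 3 = real m ^ 3 * (q ^ 3) ^ m"
      by (simp add: power_mult_distrib mult.commute flip: power_mult)
    then have "real m ^ 3 = (real m * q ^ m) ^ 3 * s ^ m"
      using s(1) by (simp add: q(3) power_one_over)
    also have "\<dots> \<le> C * s ^ m" using C[of m] s(1) by (intro mult_right_mono) auto
    finally show "norm (real m ^ 3 * \<bar>taylor_coeff f m\<bar>) \<le> C * (\<bar>taylor_coeff f m\<bar> * s ^ m)"
      using mult_right_mono[of "real m ^ 3" "C * s ^ m" "\<bar>taylor_coeff f m\<bar>"] by (simp add: ac_simps)
  qed
qed

lemma real_deriv_eq_dseries: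
  assumes f: "f \<in> real_test_functions" and x: "x \<in> {0..1}"
  shows "real_deriv f x = dseries (taylor_coeff f) x"
proof -
  obtain R where R0: "R > 1" "\<forall>z. norm z < R \<longrightarrow> (\<lambda>m. complex_of_real (taylor_coeff f m) * z ^ m) sums f z"
    by (rule taylor_series[OF f])
  note R = R0(1) R0(2)[rule_format]
  let ?c = "\<lambda>m. complex_of_real (taylor_coeff f m)"
  have xR: "norm (complex_of_real x) < R" using x R(1) by simp
  have "((\<lambda>z. \<Sum>n. ?c n * z ^ n) has_field_derivative (\<Sum>n. diffs ?c n * of_real x ^ n)) (at (of_real x))"
    by (rule termdiffs_strong'[OF sums_summable[OF R(2)] xR])
  then have "(f has_field_derivative (\<Sum>n. diffs ?c n * of_real x ^ n)) (at (of_real x))"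
  proof (rule has_field_derivative_transform_within_open)
    show "(\<Sum>n. ?c n * z ^ n) = f z" if "z \<in> ball 0 R" for z using R(2)[of z] that by (simp add: sums_iff)
  qed (use xR in auto)
  then have "deriv f (of_real x) = (\<Sum>n. diffs ?c n * of_real x ^ n)" by (rule DERIV_imp_deriv)
  also have "\<dots> = (\<Sum>n. complex_of_real (taylor_coeff f (Suc n) * (real (Suc n) * x ^ n)))"
    by (intro suminf_cong) (simp add: diffs_def)
  also have "\<dots> = complex_of_real (\<Sum>n. taylor_coeff f (Suc n) * (real (Suc n) * x ^ n))"
  proof (rule suminf_of_real[symmetric])
    have s: "summable (\<lambda>m. real m * \<bar>taylor_coeff f m\<bar>)" by (rule summable_moment_1[OF taylor_coeff_moment[OF f]])
    show "summable (\<lambda>n. taylor_coeff f (Suc n) * (real (Suc n) * x ^ n))"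
    proof (rule summable_comparison_test'[of "\<lambda>n. real (Suc n) * \<bar>taylor_coeff f (Suc n)\<bar>"])
      show "summable (\<lambda>n. real (Suc n) * \<bar>taylor_coeff f (Suc n)\<bar>)" using s by (subst summable_Suc_iff)
      fix n
      have "\<bar>x ^ n\<bar> \<le> 1" using x by (auto simp: power_abs intro: power_le_one)
      then show "norm (taylor_coeff f (Suc n) * (real (Suc n) * x ^ n)) \<le> real (Suc n) * \<bar>taylor_coeff f (Suc n)\<bar>"
        using mult_left_mono[of "\<bar>x ^ n\<bar>" 1 "real (Suc n) * \<bar>taylor_coeff f (Suc n)\<bar>"]
        by (simp add: abs_mult ac_simps)
    qed
  qed
  finally have "real_deriv f x = (\<Sum>n. taylor_coeff f (Suc n) * (real (Suc n) * x ^ n))"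
    by (simp add: real_deriv_def)
  also have "\<dots> = dseries (taylor_coeff f) x"
  proof -
    have "summable (\<lambda>m. taylor_coeff f m * (real m * x ^ (m - 1)))"
    proof (rule summable_comparison_test'[OF summable_moment_1[OF taylor_coeff_moment[OF f]]])
      fix n :: nat
      have "\<bar>x ^ (n - 1)\<bar> \<le> 1" using x by (auto simp: power_abs intro: power_le_one)
      then show "norm (taylor_coeff f n * (real n * x ^ (n - 1))) \<le> real n * \<bar>taylor_coeff f n\<bar>"
        using mult_left_mono[of "\<bar>x ^ (n - 1)\<bar>" 1 "real n * \<bar>taylor_coeff f n\<bar>"]
        by (simp add: abs_mult ac_simps)
    qed
    from suminf_split_head[OF this] show ?thesis by (simp add: dseries_def)
  qed
  finally show ?thesis .
qed

text \<open>Both series have the same \<open>sums\<close> relation, so the identity holds regardless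
  of convergence and can be used as a rewrite rule for an arbitrary \<open>B\<close>.\<close>

lemma suminf_even:
  fixes X :: "nat \<Rightarrow> real"
  shows "(\<Sum>k. (if even k then c (k div 2) else 0) * X k) = (\<Sum>m. c m * X (2 * m))"
proof -
  have "(\<lambda>m. c m * X (2 * m)) sums s \<longleftrightarrow> (\<lambda>k. (if even k then c (k div 2) else 0) * X k) sums s" for s
  proof -
    have zero: "(if even n then c (n div 2) else 0) * X n = 0" if "n \<notin> range (\<lambda>m. 2 * m)" for n
    proof -
      have "odd n"
      proof
        assume "even n"
        then obtain m where "n = 2 * m" by (rule evenE)
        then show False using that by blast
      qed
      then show ?thesis by simp
    qed
    have "strict_mono (\<lambda>m :: nat. 2 * m)" by (simp add: strict_mono_def)
    have "(\<lambda>m. (if even (2 * m) then c (2 * m div 2) else 0) * X (2 * m)) sums s \<longleftrightarrow>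
        (\<lambda>k. (if even k then c (k div 2) else 0) * X k) sums s"
      by (rule sums_mono_reindex[OF \<open>strict_mono _\<close>, where f = "\<lambda>k. (if even k then c (k div 2) else 0) * X k"])
        (rule zero)
    then show ?thesis by simp
  qed
  then show ?thesis by (simp add: suminf_def)
qed

lemma T_tilde_eq:
  assumes G: "pair_graph G" "pverts G \<noteq> {}" and f: "f \<in> real_test_functions"
  shows "T_tilde G B f =
    (if (\<Sum>m. taylor_coeff f m * tr (pverts G) (pert1 (pverts G) (walk_matrix G) B (2 * m))) = 0
     then complex_of_real ((\<Sum>m. taylor_coeff f m * tr (pverts G) (pert2 (pverts G) (walk_matrix G) B (2 * m))) /
       sqrt (card (pverts G)))
     else (THE l. False))"
proof -
  obtain s where s0: "s > 1" "summable (\<lambda>m. \<bar>taylor_coeff f m\<bar> * s ^ m)"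
    "\<forall>z. norm z \<le> s \<longrightarrow> (\<lambda>m. complex_of_real (taylor_coeff f m) * z ^ m) sums f z"
    by (rule taylor_coeff_summable[OF f])
  note s = s0(1,2) s0(3)[rule_format]
  \<comment> \<open>If the series of \<open>f\<close> converges up to \<open>s\<close>, that of the
    composition with the square converges up to the square root of \<open>s\<close>, which still
    exceeds 1.\<close>
  define r where "r = sqrt s"
  define a where "a k = (if even k then taylor_coeff f (k div 2) else 0)" for k :: nat
  have r: "r > 1" "r\<^sup>2 = s" using s(1) by (simp_all add: r_def)
  have mono: "strict_mono (\<lambda>m :: nat. 2 * m)" by (simp add: strict_mono_def)
  have odd: "a k = 0" if "k \<notin> range (\<lambda>m :: nat. 2 * m)" for k
    using that by (auto simp: a_def elim!: evenE)
  have 1: "summable (\<lambda>k. \<bar>a k\<bar> * r ^ k)"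
  proof -
    have "(\<lambda>m. \<bar>a (2 * m)\<bar> * r ^ (2 * m)) sums (\<Sum>m. \<bar>taylor_coeff f m\<bar> * s ^ m)"
      using summable_sums[OF s(2)] by (simp add: a_def power_mult r(2))
    then have "(\<lambda>k. \<bar>a k\<bar> * r ^ k) sums (\<Sum>m. \<bar>taylor_coeff f m\<bar> * s ^ m)"
      by (subst (asm) sums_mono_reindex[OF mono, of "\<lambda>k. \<bar>a k\<bar> * r ^ k"]) (auto simp: odd)
    then show ?thesis by (rule sums_summable)
  qed
  have 2: "(\<lambda>k. complex_of_real (a k) * z ^ k) sums (f \<circ> (\<lambda>z. z\<^sup>2)) z" if z: "norm z \<le> r" for z
  proof -
    have "norm (z\<^sup>2) \<le> s" using power_mono[OF z, of 2] by (simp add: norm_power r(2))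
    then have "(\<lambda>m. complex_of_real (a (2 * m)) * z ^ (2 * m)) sums f (z\<^sup>2)"
      using s(3)[of "z\<^sup>2"] by (simp add: a_def power_mult)
    then show ?thesis
      by (subst (asm) sums_mono_reindex[OF mono, of "\<lambda>k. complex_of_real (a k) * z ^ k"]) (auto simp: odd)
  qed
  have eq: "T_stat G B (f \<circ> (\<lambda>z. z\<^sup>2)) =
    (if (\<Sum>k. a k * tr (pverts G) (pert1 (pverts G) (walk_matrix G) B k)) = 0
     then complex_of_real ((\<Sum>k. a k * tr (pverts G) (pert2 (pverts G) (walk_matrix G) B k)) / sqrt (card (pverts G)))
     else (THE l. False))"
    by (rule T_stat_eq[OF G r(1) 1], rule 2)
  show ?thesis
    using eq unfolding T_tilde_def a_def
      suminf_even[where X = "\<lambda>k. tr (pverts G) (pert1 (pverts G) (walk_matrix G) B k)"]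
      suminf_even[where X = "\<lambda>k. tr (pverts G) (pert2 (pverts G) (walk_matrix G) B k)"] .
qed

lemma pert_measurable:
  fixes M :: "'a \<Rightarrow> 'a \<Rightarrow> real"
  assumes B: "\<And>u v. u \<in> V \<Longrightarrow> v \<in> V \<Longrightarrow> (\<lambda>\<omega>. B \<omega> u v) \<in> borel_measurable P"
  shows "u \<in> V \<Longrightarrow> v \<in> V \<Longrightarrow> (\<lambda>\<omega>. pert1 V M (B \<omega>) k u v) \<in> borel_measurable P"
    "u \<in> V \<Longrightarrow> v \<in> V \<Longrightarrow> (\<lambda>\<omega>. pert2 V M (B \<omega>) k u v) \<in> borel_measurable P"
proof -
  show 1: "(\<lambda>\<omega>. pert1 V M (B \<omega>) k u v) \<in> borel_measurable P" if "u \<in> V" "v \<in> V" for k u v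
    using that
  proof (induction k arbitrary: u v)
    case (Suc k)
    then show ?case using B unfolding pert1.simps mm_def
      by (intro borel_measurable_add borel_measurable_sum borel_measurable_times borel_measurable_const) auto
  qed simp
  show "u \<in> V \<Longrightarrow> v \<in> V \<Longrightarrow> (\<lambda>\<omega>. pert2 V M (B \<omega>) k u v) \<in> borel_measurable P"
  proof (induction k arbitrary: u v)
    case (Suc k)
    then show ?case using B 1 unfolding pert2.simps mm_def
      by (intro borel_measurable_add borel_measurable_sum borel_measurable_times borel_measurable_const) auto
  qed simp
qed

text \<open>Off an event of full measure the first-order trace may be nonzero and the limit may not
  exist. The explicit value of \<open>Lim\<close> in that case, given by \<open>T_tilde_eq\<close>,
  makes the statistic measurable on the whole space.\<close>

lemma T_tilde_measurable:
  assumes G: "pair_graph G" "pverts G \<noteq> {}" and f: "f \<in> real_test_functions"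
    and B: "\<And>u v. u \<in> pverts G \<Longrightarrow> v \<in> pverts G \<Longrightarrow> (\<lambda>\<omega>. B \<omega> u v) \<in> borel_measurable P"
  shows "(\<lambda>\<omega>. T_tilde G (B \<omega>) f) \<in> borel_measurable P"
proof -
  have [measurable]: "(\<lambda>\<omega>. tr (pverts G) (pert1 (pverts G) (walk_matrix G) (B \<omega>) k)) \<in> borel_measurable P"
    "(\<lambda>\<omega>. tr (pverts G) (pert2 (pverts G) (walk_matrix G) (B \<omega>) k)) \<in> borel_measurable P" for k
    unfolding tr_def
    by (rule borel_measurable_sum, rule pert_measurable[of "pverts G" B P, OF B]; assumption)+
  show ?thesis unfolding T_tilde_eq[OF G f] by measurable
qed

text \<open>This permits replacing the environment by its pointwise version on the event where the
  two agree on the vertices.\<close>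

lemma T_tilde_cong:
  assumes V: "finite (pverts G)" and B: "\<And>u v. u \<in> pverts G \<Longrightarrow> v \<in> pverts G \<Longrightarrow> B u v = B' u v"
  shows "T_tilde G B f = T_tilde G B' f"
proof -
  have e: "vertex_enum (pverts G) i \<in> pverts G" if "i < card (pverts G)" for i
    using bij_betwE[OF vertex_enum_bij[OF V]] that by simp
  have "mat_of (pverts G) (\<lambda>u v. walk_matrix G u v + \<epsilon> * B u v) =
      mat_of (pverts G) (\<lambda>u v. walk_matrix G u v + \<epsilon> * B' u v)" for \<epsilon>
    unfolding mat_of_def using B e by (intro cong_mat) auto
  then have "eig_measure G B \<epsilon> = eig_measure G B' \<epsilon>" for \<epsilon>
    by (simp add: eig_measure_def empirical_eigs_def)
  then show ?thesis by (simp add: T_tilde_def T_stat_def m_integral_def)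
qed

text \<open>The stabilizer condition makes the first-order trace vanish, so the limit exists and is
  the second-order coefficient.\<close>

lemma (in environment) T_tilde_linear_stat:
  assumes f: "f \<in> real_test_functions" and \<omega>: "\<omega> \<in> space P"
  shows "T_tilde G (B \<omega>) f = complex_of_real (linear_stat (taylor_coeff f) \<omega>)"
proof -
  have z: "tr V (pert1 V M (B \<omega>) k) = 0" for k
    unfolding tr_pert1[OF finite_verts] using tr_mpow_B[OF \<omega>] by simp
  have "summable (\<lambda>m. taylor_coeff f m * moment_stat m \<omega>)"
    using linear_stat_summable[OF taylor_coeff_moment[OF f] \<omega>] by (rule summable_rabs_cancel)
  then have "linear_stat (taylor_coeff f) \<omega> * sqrt (card V) = (\<Sum>m. taylor_coeff f m * moment_stat m \<omega> * sqrt (card V))"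
    unfolding linear_stat_def by (rule suminf_mult2)
  also have "\<dots> = (\<Sum>m. taylor_coeff f m * tr V (pert2 V M (B \<omega>) (2 * m)))"
    using nonempty by (simp add: moment_stat_def card_gt_0_iff finite_verts)
  finally have "(\<Sum>m. taylor_coeff f m * tr V (pert2 V M (B \<omega>) (2 * m))) / sqrt (card V) = linear_stat (taylor_coeff f) \<omega>"
    using nonempty by (simp add: divide_eq_eq finite_verts)
  then show ?thesis
    unfolding T_tilde_eq[OF pair_graph_axioms nonempty f] z by simp
qed

text \<open>Translates the Lebesgue integrals of the final statement into the gauge integrals of
  \<open>cov_formula\<close>; the integrands are continuous on compact intervals.\<close>

lemma set_integral_cov:
  assumes d: "d \<ge> 2" and f: "f \<in> real_test_functions" and g: "g \<in> real_test_functions"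
  shows "d > 2 \<Longrightarrow> (LBINT y:{0..rho d}. (LBINT x:{0..rho d}. real_deriv f x * real_deriv g y * beta d x y)) =
      cov_formula d (dseries (taylor_coeff f)) (dseries (taylor_coeff g))"
    "32 / pi * (LBINT x:{0..1}. real_deriv f x * real_deriv g x * sqrt (x * (1 - x))) =
      cov_formula 2 (dseries (taylor_coeff f)) (dseries (taylor_coeff g))"
proof -
  have cont: "continuous_on {0..1} (dseries (taylor_coeff h))" if h: "h \<in> real_test_functions" for h
    by (rule uniform_limit_theorem[OF always_eventually dpoly_uniform_limit[OF taylor_coeff_moment[OF h] order.refl]])
      (simp_all add: continuous_on_dpoly)
  note F = cont[OF f] and F' = cont[OF g]
  let ?F = "dseries (taylor_coeff f)" and ?G = "dseries (taylor_coeff g)"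
  have rho: "{0..rho d} \<subseteq> {0..1}" using rho_bounds[OF d] by auto
  show "32 / pi * (LBINT x:{0..1}. real_deriv f x * real_deriv g x * sqrt (x * (1 - x))) = cov_formula 2 ?F ?G"
  proof -
    have "(LBINT x:{0..1}. real_deriv f x * real_deriv g x * sqrt (x * (1 - x))) =
        (LBINT x:{0..1}. ?F x * ?G x * sqrt (x * (1 - x)))"
      using real_deriv_eq_dseries f g by (intro set_lebesgue_integral_cong) auto
    also have "\<dots> = integral {0..1} (\<lambda>x. ?F x * ?G x * sqrt (x * (1 - x)))"
      by (intro set_lebesgue_eq_integral continuous_intros F F')
    finally show ?thesis by (simp add: cov_formula_def)
  qed
  assume d2: "d > 2"
  have Fr: "continuous_on {0..rho d} ?F" and Gr: "continuous_on {0..rho d} ?G"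
    using F F' rho continuous_on_subset by blast+
  have inner: "(LBINT x:{0..rho d}. real_deriv f x * real_deriv g y * beta d x y) =
      integral {0..rho d} (\<lambda>x. ?F x * ?G y * beta d x y)" if y: "y \<in> {0..rho d}" for y
  proof -
    have "(LBINT x:{0..rho d}. real_deriv f x * real_deriv g y * beta d x y) =
        (LBINT x:{0..rho d}. ?F x * ?G y * beta d x y)"
      using real_deriv_eq_dseries[OF f] real_deriv_eq_dseries[OF g] rho y by (intro set_lebesgue_integral_cong) auto
    also have "\<dots> = integral {0..rho d} (\<lambda>x. ?F x * ?G y * beta d x y)"
      by (intro set_lebesgue_eq_integral continuous_intros Fr continuous_on_beta_section[OF d2 y])
    finally show ?thesis .
  qed
  have "(LBINT y:{0..rho d}. (LBINT x:{0..rho d}. real_deriv f x * real_deriv g y * beta d x y)) =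
      (LBINT y:{0..rho d}. integral {0..rho d} (\<lambda>x. ?F x * ?G y * beta d x y))"
    using inner by (intro set_lebesgue_integral_cong) auto
  also have "\<dots> = integral {0..rho d} (\<lambda>y. integral {0..rho d} (\<lambda>x. ?F x * ?G y * beta d x y))"
  proof (rule set_lebesgue_eq_integral)
    have b: "continuous_on ({0..rho d} \<times> {0..rho d}) (\<lambda>(y, x). ?F x * ?G y * beta d x y)"
      unfolding case_prod_beta
      by (intro continuous_intros continuous_on_compose2[OF Fr] continuous_on_compose2[OF Gr]
          continuous_on_beta[OF d2, unfolded case_prod_beta]) auto
    then show "continuous_on {0..rho d} (\<lambda>y. integral {0..rho d} (\<lambda>x. ?F x * ?G y * beta d x y))"
      using integral_continuous_on_param[of "{0..rho d}" 0 "rho d" "\<lambda>y x. ?F x * ?G y * beta d x y"] by simp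
  qed
  finally show "(LBINT y:{0..rho d}. (LBINT x:{0..rho d}. real_deriv f x * real_deriv g y * beta d x y)) =
      cov_formula d ?F ?G"
    using d2 by (simp add: cov_formula_def)
qed

lemma moment_linear_combination:
  fixes a :: "nat \<Rightarrow> nat \<Rightarrow> real"
  assumes "\<And>i. i < k \<Longrightarrow> summable (\<lambda>m. real m ^ 3 * \<bar>a i m\<bar>)"
  shows "summable (\<lambda>m. real m ^ 3 * \<bar>\<Sum>i<k. s i * a i m\<bar>)"
proof (rule summable_comparison_test')
  show "summable (\<lambda>m. \<Sum>i<k. \<bar>s i\<bar> * (real m ^ 3 * \<bar>a i m\<bar>))"
    using assms by (intro summable_sum summable_mult) auto
  fix m :: nat
  have "real m ^ 3 * \<bar>\<Sum>i<k. s i * a i m\<bar> \<le> real m ^ 3 * (\<Sum>i<k. \<bar>s i * a i m\<bar>)"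
    by (intro mult_left_mono sum_abs) simp
  then show "norm (real m ^ 3 * \<bar>\<Sum>i<k. s i * a i m\<bar>) \<le> (\<Sum>i<k. \<bar>s i\<bar> * (real m ^ 3 * \<bar>a i m\<bar>))"
    by (simp add: sum_distrib_left abs_mult ac_simps)
qed

text \<open>A linear combination of statistics is the statistic of the combined coefficients, and
  the same holds almost surely for Gaussian series. The joint characteristic function thus reduces
  to \<open>linear_stat_char_limit\<close>.\<close>

lemma linear_stat_joint_limit:
  fixes G :: "nat \<Rightarrow> 'a pair_pre_digraph" and P :: "nat \<Rightarrow> 'w measure" and h :: "(nat \<Rightarrow> real) \<Rightarrow> real"
  assumes d: "d \<ge> 2" and env: "\<And>n. environment (G n) (P n) (B n) c"
    and level: "\<And>r. \<forall>\<^sub>F n in sequentially. \<forall>z\<in>pverts (G n). \<exists>l. level_fun (G n) d z r l"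
    and a: "\<And>i. i < k \<Longrightarrow> summable (\<lambda>m. real m ^ 3 * \<bar>a i m\<bar>)"
    and h: "continuous_on UNIV h" "bounded (range h)"
  shows "(\<lambda>n. \<integral>\<omega>. h (pad k (\<lambda>i. environment.linear_stat (G n) (B n) (a i) \<omega>)) \<partial>P n)
    \<longlonglongrightarrow> (\<integral>\<omega>. h (pad k (\<lambda>i. gauss_series (limit_coeff d (a i)) \<omega>)) \<partial>std_normal_seq)"
proof -
  let ?b = "\<lambda>i. limit_coeff d (a i)"
  have b: "summable (\<lambda>l. \<bar>?b i l\<bar>)" if "i < k" for i by (rule summable_limit_coeff[OF d a[OF that]])
  define C1 where "C1 i = 4 * c\<^sup>2 * (\<Sum>m. real m ^ 3 * \<bar>a i m\<bar>)" for i
  define C2 where "C2 i = (\<integral>\<omega>. \<bar>gauss_series (?b i) \<omega>\<bar> \<partial>std_normal_seq)" for i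
  define C where "C = (\<Sum>i<k. C1 i + C2 i)"
  have pos: "0 \<le> C1 i" "0 \<le> C2 i" if "i < k" for i
    unfolding C1_def C2_def using a[OF that] by (auto intro!: mult_nonneg_nonneg suminf_nonneg)
  have C: "C1 i \<le> C" "C2 i \<le> C" if i: "i < k" for i
  proof -
    have "C1 i + C2 i \<le> C" unfolding C_def using pos i by (intro member_le_sum) auto
    then show "C1 i \<le> C" "C2 i \<le> C" using pos[OF i] by auto
  qed
  show ?thesis
  proof (rule tendsto_integral_pad_of_char[where C = C])
    show "prob_space (P n)" for n using env environment.axioms(2) by blast
    show "prob_space std_normal_seq" by (intro prob_space_PiM prob_space_std_normal)
    fix i assume i: "i < k"
    show "gauss_series (?b i) \<in> borel_measurable std_normal_seq" by measurable
    show "integrable std_normal_seq (\<lambda>\<omega>. \<bar>gauss_series (?b i) \<omega>\<bar>)"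
      by (intro integrable_abs gauss_series_moments(1) b i)
    show "(\<integral>\<omega>. \<bar>gauss_series (?b i) \<omega>\<bar> \<partial>std_normal_seq) \<le> C" using C(2)[OF i] by (simp add: C2_def)
    fix n
    interpret environment "G n" "P n" "B n" c by (rule env)
    show "linear_stat (a i) \<in> borel_measurable (P n)" using linear_stat_L1(1)[OF a[OF i]] by simp
    show "integrable (P n) (\<lambda>\<omega>. \<bar>linear_stat (a i) \<omega>\<bar>)" by (intro integrable_abs linear_stat_L1(1) a i)
    show "(\<integral>\<omega>. \<bar>linear_stat (a i) \<omega>\<bar> \<partial>P n) \<le> C"
      using linear_stat_L1(2)[OF a[OF i]] C(1)[OF i] by (simp add: C1_def)
  next
    fix s :: "nat \<Rightarrow> real"
    let ?a = "\<lambda>m. \<Sum>i<k. s i * a i m"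
    have sa: "summable (\<lambda>m. real m ^ 3 * \<bar>?a m\<bar>)" by (rule moment_linear_combination[OF a])
    have lhs: "(\<integral>\<omega>. iexp (\<Sum>i<k. s i * environment.linear_stat (G n) (B n) (a i) \<omega>) \<partial>P n) =
        (\<integral>\<omega>. iexp (environment.linear_stat (G n) (B n) ?a \<omega>) \<partial>P n)" for n
    proof (intro Bochner_Integration.integral_cong refl)
      fix \<omega> assume \<omega>: "\<omega> \<in> space (P n)"
      interpret environment "G n" "P n" "B n" c by (rule env)
      have "linear_stat ?a \<omega> = (\<Sum>i<k. s i * linear_stat (a i) \<omega>)"
        by (rule linear_stat_sum) (use a \<omega> in auto)
      then show "iexp (\<Sum>i<k. s i * linear_stat (a i) \<omega>) = iexp (linear_stat ?a \<omega>)" by simp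
    qed
    have lc: "limit_coeff d ?a l = (\<Sum>i<k. s i * ?b i l)" for l
      by (rule limit_coeff_linear[OF d]) (use a in auto)
    have J: "finite {..<k}" by simp
    have bJ: "summable (\<lambda>l. \<bar>?b j l\<bar>)" if "j \<in> {..<k}" for j using b that by simp
    have sums: "AE \<omega> in std_normal_seq. gauss_series (\<lambda>l. \<Sum>j<k. s j * ?b j l) \<omega> = (\<Sum>j<k. s j * gauss_series (?b j) \<omega>)"
      by (rule AE_gauss_series_sum(2)[OF J]) (rule bJ)
    have m: "(\<lambda>\<omega>. iexp (X \<omega>)) \<in> borel_measurable std_normal_seq" if X: "X \<in> borel_measurable std_normal_seq" for X
    proof (rule measurable_compose[OF X])
      show "(\<lambda>x. iexp x) \<in> borel_measurable borel"
        by (intro borel_measurable_continuous_onI continuous_intros)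
    qed
    have "(\<integral>\<omega>. iexp (\<Sum>i<k. s i * gauss_series (?b i) \<omega>) \<partial>std_normal_seq) =
        (\<integral>\<omega>. iexp (gauss_series (limit_coeff d ?a) \<omega>) \<partial>std_normal_seq)"
    proof (rule integral_cong_AE)
      show "AE \<omega> in std_normal_seq. iexp (\<Sum>i<k. s i * gauss_series (?b i) \<omega>) = iexp (gauss_series (limit_coeff d ?a) \<omega>)"
        unfolding lc[abs_def] using sums by eventually_elim simp
      show "(\<lambda>\<omega>. iexp (\<Sum>i<k. s i * gauss_series (?b i) \<omega>)) \<in> borel_measurable std_normal_seq"
        by (rule m) measurable
      show "(\<lambda>\<omega>. iexp (gauss_series (limit_coeff d ?a) \<omega>)) \<in> borel_measurable std_normal_seq"
        by (rule m) measurable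
    qed
    also have "\<dots> = complex_of_real (exp (- (\<Sum>l. (limit_coeff d ?a l)\<^sup>2) / 2))"
      by (rule char_gauss_series[OF summable_limit_coeff[OF d sa]])
    finally have rhs: "(\<integral>\<omega>. iexp (\<Sum>i<k. s i * gauss_series (?b i) \<omega>) \<partial>std_normal_seq) =
      complex_of_real (exp (- (\<Sum>l. (limit_coeff d ?a l)\<^sup>2) / 2))" .
    show "(\<lambda>n. \<integral>\<omega>. iexp (\<Sum>i<k. s i * environment.linear_stat (G n) (B n) (a i) \<omega>) \<partial>P n)
      \<longlonglongrightarrow> (\<integral>\<omega>. iexp (\<Sum>i<k. s i * gauss_series (?b i) \<omega>) \<partial>std_normal_seq)"
      unfolding lhs rhs by (rule linear_stat_char_limit[OF d env level sa])
  qed (rule h)+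
qed

lemma T_tilde_converges_in_distribution:
  fixes G :: "nat \<Rightarrow> 'a pair_pre_digraph" and P :: "nat \<Rightarrow> 'w measure"
  assumes d: "d \<ge> 2" and env: "\<And>n. environment (G n) (P n) (B' n) c"
    and level: "\<And>r. \<forall>\<^sub>F n in sequentially. \<forall>z\<in>pverts (G n). \<exists>l. level_fun (G n) d z r l"
    and B: "\<And>n u v. u \<in> pverts (G n) \<Longrightarrow> v \<in> pverts (G n) \<Longrightarrow> (\<lambda>\<omega>. B n \<omega> u v) \<in> borel_measurable (P n)"
    and eq: "\<And>n. AE \<omega> in P n. \<forall>u\<in>pverts (G n). \<forall>v\<in>pverts (G n). B' n \<omega> u v = B n \<omega> u v"
    and t: "\<And>i. i < k \<Longrightarrow> t i \<in> real_test_functions"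
  shows "converges_in_distribution P (\<lambda>n \<omega>. pad k (\<lambda>i. T_tilde (G n) (B n \<omega>) (t i))) std_normal_seq
    (\<lambda>\<omega>. pad k (\<lambda>i. complex_of_real (gauss_series (limit_coeff d (taylor_coeff (t i))) \<omega>)))"
  unfolding converges_in_distribution_def
proof (intro conjI allI impI)
  let ?a = "\<lambda>i. taylor_coeff (t i)"
  have G: "pair_graph (G n)" "pverts (G n) \<noteq> {}" for n
    using env[of n] environment.axioms(1) environment.nonempty by blast+
  show X: "(\<lambda>\<omega>. pad k (\<lambda>i. T_tilde (G n) (B n \<omega>) (t i))) \<in> borel_measurable (P n)" for n
    by (rule pad_measurable) (intro T_tilde_measurable G t B)
  show "(\<lambda>\<omega>. pad k (\<lambda>i. complex_of_real (gauss_series (limit_coeff d (?a i)) \<omega>))) \<in> borel_measurable std_normal_seq"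
    by (rule pad_measurable) measurable
  fix h :: "(nat \<Rightarrow> complex) \<Rightarrow> real"
  assume h: "continuous_on UNIV h" "bounded (range h)"
  \<comment> \<open>The statistics are complex-valued but almost surely real, so a test function
    matters only through its restriction to real sequences.\<close>
  define h' where "h' x = h (\<lambda>i. complex_of_real (x i))" for x
  have h': "continuous_on UNIV h'" "bounded (range h')"
  proof -
    have "continuous_on UNIV (\<lambda>x :: nat \<Rightarrow> real. (\<lambda>i. complex_of_real (x i)))"
      by (intro continuous_on_coordinatewise_then_product continuous_on_of_real continuous_on_product_coordinates)
    then show "continuous_on UNIV h'"
      unfolding h'_def[abs_def] by (rule continuous_on_compose2[OF h(1)]) simp
    show "bounded (range h')" using h(2) by (rule bounded_subset) (auto simp: h'_def)
  qed
  have pad_h: "h (pad k (\<lambda>i. complex_of_real (x i))) = h' (pad k x)" for x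
    unfolding h'_def by (rule arg_cong[where f = h]) (simp add: pad_def fun_eq_iff)
  have pre: "(\<integral>\<omega>. h (pad k (\<lambda>i. T_tilde (G n) (B n \<omega>) (t i))) \<partial>P n) =
      (\<integral>\<omega>. h' (pad k (\<lambda>i. environment.linear_stat (G n) (B' n) (?a i) \<omega>)) \<partial>P n)" for n
  proof -
    interpret environment "G n" "P n" "B' n" c by (rule env)
    show ?thesis
    proof (rule integral_cong_AE)
      show "(\<lambda>\<omega>. h (pad k (\<lambda>i. T_tilde (G n) (B n \<omega>) (t i)))) \<in> borel_measurable (P n)"
        by (rule measurable_compose[OF X borel_measurable_continuous_onI[OF h(1)]])
      have "(\<lambda>\<omega>. pad k (\<lambda>i. linear_stat (?a i) \<omega>)) \<in> borel_measurable (P n)"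
      proof (rule pad_measurable)
        fix i assume "i < k"
        then show "linear_stat (?a i) \<in> borel_measurable (P n)"
          using linear_stat_L1(1)[OF taylor_coeff_moment[OF t]] by simp
      qed
      from measurable_compose[OF this borel_measurable_continuous_onI[OF h'(1)]]
      show "(\<lambda>\<omega>. h' (pad k (\<lambda>i. linear_stat (?a i) \<omega>))) \<in> borel_measurable (P n)" .
      show "AE \<omega> in P n. h (pad k (\<lambda>i. T_tilde (G n) (B n \<omega>) (t i))) = h' (pad k (\<lambda>i. linear_stat (?a i) \<omega>))"
        using eq[of n] AE_space
      proof eventually_elim
        case (elim \<omega>)
        have "T_tilde (G n) (B n \<omega>) (t i) = complex_of_real (linear_stat (?a i) \<omega>)" if "i < k" for i
        proof -
          have "T_tilde (G n) (B n \<omega>) (t i) = T_tilde (G n) (B' n \<omega>) (t i)"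
            by (rule T_tilde_cong[OF finite_verts]) (use elim(1) in simp)
          then show ?thesis using T_tilde_linear_stat[OF t[OF that] elim(2)] by simp
        qed
        then have "pad k (\<lambda>i. T_tilde (G n) (B n \<omega>) (t i)) = pad k (\<lambda>i. complex_of_real (linear_stat (?a i) \<omega>))"
          by (simp add: pad_def fun_eq_iff)
        then show ?case by (simp only: pad_h)
      qed
    qed
  qed
  show "(\<lambda>n. \<integral>\<omega>. h (pad k (\<lambda>i. T_tilde (G n) (B n \<omega>) (t i))) \<partial>P n)
    \<longlonglongrightarrow> (\<integral>\<omega>. h (pad k (\<lambda>i. complex_of_real (gauss_series (limit_coeff d (?a i)) \<omega>))) \<partial>std_normal_seq)"
    unfolding pre pad_h by (rule linear_stat_joint_limit[OF d env level taylor_coeff_moment[OF t] h'])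
qed

theorem theorem3:
  fixes d :: nat
    and G :: "nat \<Rightarrow> 'a pair_pre_digraph"
    and P :: "nat \<Rightarrow> 'w measure"
    and B :: "nat \<Rightarrow> 'w \<Rightarrow> 'a \<Rightarrow> 'a \<Rightarrow> real"
    and c1 :: real
  assumes "d \<ge> 2"
    and "\<And>n. pair_graph (G n)"
    and "\<And>n. vertex_transitive (G n)"
    and "converges_locally_to_tree G d"
    and "\<And>n. prob_space (P n)"
    and "\<And>n. random_environment (G n) c1 (P n) (B n)"
  shows "\<exists>(Q :: (nat \<Rightarrow> real) measure) (T :: (complex \<Rightarrow> complex) \<Rightarrow> (nat \<Rightarrow> real) \<Rightarrow> real).
    prob_space Q \<and>
    converges_fdd P (\<lambda>n f \<omega>. T_tilde (G n) (B n \<omega>) f) Q (\<lambda>f \<omega>. complex_of_real (T f \<omega>))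
      real_test_functions \<and>
    jointly_normal Q real_test_functions T \<and>
    (\<forall>f\<in>real_test_functions. prob_space.expectation Q (T f) = 0) \<and>
    (\<forall>f\<in>real_test_functions. \<forall>g\<in>real_test_functions.
       (d > 2 \<longrightarrow> prob_space.expectation Q (\<lambda>\<omega>. T f \<omega> * T g \<omega>) =
          (LBINT y:{0..rho d}. (LBINT x:{0..rho d}.
             real_deriv f x * real_deriv g y * beta d x y))) \<and>
       (d = 2 \<longrightarrow> prob_space.expectation Q (\<lambda>\<omega>. T f \<omega> * T g \<omega>) =
          32 / pi * (LBINT x:{0..1}. real_deriv f x * real_deriv g x * sqrt (x * (1 - x)))))"
proof -
  note d = assms(1)
  obtain root where root: "\<And>n. root n \<in> pverts (G n)"
    "\<And>r. \<forall>\<^sub>F n in sequentially. ball_iso (G n) (root n) (reg_tree d) [] r"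
    using assms(4) unfolding converges_locally_to_tree_def by metis
  \<comment> \<open>The root provided by local convergence shows that every graph is nonempty, which
    the construction of the pointwise version asks for.\<close>
  have "\<exists>B'. environment (G n) (P n) B' (max c1 0) \<and>
      (AE \<omega> in P n. \<forall>u\<in>pverts (G n). \<forall>v\<in>pverts (G n). B' \<omega> u v = B n \<omega> u v)" for n
  proof -
    have "pverts (G n) \<noteq> {}" using root(1)[of n] by blast
    show ?thesis
      by (rule random_environment_version[OF assms(2,3) \<open>pverts (G n) \<noteq> {}\<close> assms(5,6)]) blast
  qed
  then have "\<forall>n. \<exists>B'. environment (G n) (P n) B' (max c1 0) \<and>
      (AE \<omega> in P n. \<forall>u\<in>pverts (G n). \<forall>v\<in>pverts (G n). B' \<omega> u v = B n \<omega> u v)" ..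
  from choice[OF this] obtain B' where env: "\<And>n. environment (G n) (P n) (B' n) (max c1 0)"
    and eq: "\<And>n. AE \<omega> in P n. \<forall>u\<in>pverts (G n). \<forall>v\<in>pverts (G n). B' n \<omega> u v = B n \<omega> u v"
    by blast
  have level: "\<forall>\<^sub>F n in sequentially. \<forall>z\<in>pverts (G n). \<exists>l. level_fun (G n) d z r l" for r
    using root(2)[of r]
    by eventually_elim (use pair_graph.vertex_transitive_level[OF assms(2,3) root(1)] in blast)
  have B: "(\<lambda>\<omega>. B n \<omega> u v) \<in> borel_measurable (P n)" if "u \<in> pverts (G n)" "v \<in> pverts (G n)" for n u v
    using assms(6)[of n] that by (simp add: random_environment_def)
  let ?b = "\<lambda>f. limit_coeff d (taylor_coeff f)"
  have sb: "summable (\<lambda>l. \<bar>?b f l\<bar>)" if "f \<in> real_test_functions" for f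
    by (rule summable_limit_coeff[OF d taylor_coeff_moment[OF that]])
  have prob: "prob_space std_normal_seq" by (intro prob_space_PiM prob_space_std_normal)
  have fdd: "converges_fdd P (\<lambda>n f \<omega>. T_tilde (G n) (B n \<omega>) f) std_normal_seq
      (\<lambda>f \<omega>. complex_of_real (gauss_series (?b f) \<omega>)) real_test_functions"
    unfolding converges_fdd_def
    by (intro allI impI T_tilde_converges_in_distribution[OF d env level B eq]) auto
  have normal: "jointly_normal std_normal_seq real_test_functions (\<lambda>f. gauss_series (?b f))"
    unfolding jointly_normal_def
  proof (intro allI impI)
    fix J :: "(complex \<Rightarrow> complex) set" and a :: "(complex \<Rightarrow> complex) \<Rightarrow> real"
    assume J: "finite J" "J \<subseteq> real_test_functions"
    have bJ: "summable (\<lambda>l. \<bar>?b j l\<bar>)" if "j \<in> J" for j using sb J(2) that by blast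
    have sums: "summable (\<lambda>l. \<bar>\<Sum>j\<in>J. a j * ?b j l\<bar>)"
      "AE \<omega> in std_normal_seq. gauss_series (\<lambda>l. \<Sum>j\<in>J. a j * ?b j l) \<omega> = (\<Sum>j\<in>J. a j * gauss_series (?b j) \<omega>)"
      by (rule AE_gauss_series_sum[OF J(1)], rule bJ, assumption)+
    show "normal_rv std_normal_seq (\<lambda>\<omega>. \<Sum>j\<in>J. a j * gauss_series (?b j) \<omega>)"
    proof (rule normal_rv_gauss_series[OF sums(1)])
      show "AE \<omega> in std_normal_seq. (\<Sum>j\<in>J. a j * gauss_series (?b j) \<omega>) =
          gauss_series (\<lambda>l. \<Sum>j\<in>J. a j * ?b j l) \<omega>"
        using sums(2) by eventually_elim simp
    qed measurable
  qed
  have cov: "prob_space.expectation std_normal_seq (\<lambda>\<omega>. gauss_series (?b f) \<omega> * gauss_series (?b g) \<omega>) =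
      cov_formula d (dseries (taylor_coeff f)) (dseries (taylor_coeff g))"
    if "f \<in> real_test_functions" "g \<in> real_test_functions" for f g
    using gauss_series_covariance[OF sb[OF that(1)] sb[OF that(2)]]
      cov_formula_series(1)[OF d taylor_coeff_moment[OF that(1)] taylor_coeff_moment[OF that(2)]] by simp
  show ?thesis
  proof (intro exI[of _ std_normal_seq] exI[of _ "\<lambda>f. gauss_series (?b f)"] conjI ballI impI)
    fix f g assume fg: "f \<in> real_test_functions" "g \<in> real_test_functions"
    show "prob_space.expectation std_normal_seq (\<lambda>\<omega>. gauss_series (?b f) \<omega> * gauss_series (?b g) \<omega>) =
        (LBINT y:{0..rho d}. (LBINT x:{0..rho d}. real_deriv f x * real_deriv g y * beta d x y))" if "d > 2"
      unfolding cov[OF fg] by (rule set_integral_cov(1)[OF d fg that, symmetric])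
    show "prob_space.expectation std_normal_seq (\<lambda>\<omega>. gauss_series (?b f) \<omega> * gauss_series (?b g) \<omega>) =
        32 / pi * (LBINT x:{0..1}. real_deriv f x * real_deriv g x * sqrt (x * (1 - x)))" if "d = 2"
      unfolding cov[OF fg] set_integral_cov(2)[OF d fg] using that by simp
  qed (use prob fdd normal gauss_series_moments(3)[OF sb] in auto)
qed

end
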